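(* Let $\mathcal{U}$, $\mathcal{V}$, $\mathcal{B}$ be the Hilbert spaces and the bilinear form of the ultra-weak (DPG) variational formulation of the clamped Reissner-Mindlin plate bending problem on a mesh $\Omega_h$, as defined in the context. Then the variational problem: find $u\in\mathcal{U}$ such that $$\mathcal{B}(u,v)=\mathcal{L}(v)\qquad\forall v\in\mathcal{V}$$ is well-posed, that is, there is a constant $\alpha>0$ such that for every continuous linear functional $\mathcal{L}$ on $\mathcal{V}$ (in particular for $\mathcal{L}(v)=(p,z)_{\Omega_h}$ with load $p\in L_2(\Omega)$, where $z$ is the third component of $v$) there exists a unique solution $u\in\mathcal{U}$, and it satisfies $\|u\|_{\mathcal{U}}\le \alpha^{-1}\|\mathcal{L}\|_{\mathcal{V}'}$.
   Context: Setting. $\Omega\subset\mathbb{R}^2$ is a convex polygonal domain with $\mathrm{diam}(\Omega)=1$ (length unit), $0<t\le 1$ is the plate thickness, $\kappa>0$ the shear correction factor, $\nu$ the Poisson ratio ($-1<\nu<1/2$). For $2\times2$ tensors $\tau$, $\mathcal{C}^{-1}\tau=6\left(\tau-\frac{\nu}{1+\nu}\mathrm{tr}(\tau)I\right)$, and $J=\begin{bmatrix}0&1\\-1&0\end{bmatrix}$. $\Omega_h$ is a partition of $\Omega$ into convex quadrilaterals $K$, from a non-degenerate (shape-regular) family, with skeleton $\partial\Omega_h$ (the union of the boundaries $\partial K$); $n$ is the outward unit normal on $\partial K$. Notation. Boldface denotes vector- or tensor-valued analogues of scalar spaces. $H(\mathrm{div},X)$ is the space of $L_2$ vector fields with divergence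 in $L_2(X)$; $\mathbf{H}(\mathbf{div},X)$ is the space of $2\times2$ tensor fields (not necessarily symmetric) with rows in $H(\mathrm{div},X)$; gradients of vector fields and divergences of tensor fields are taken row-wise. Broken spaces: $H^1(\Omega_h)=\{v\in L_2(\Omega): v|_K\in H^1(K)\ \forall K\in\Omega_h\}$, and similarly $\mathbf{H}^1(\Omega_h)$, $H(\mathrm{div},\Omega_h)$, $\mathbf{H}(\mathbf{div},\Omega_h)$. Trace spaces: $H^{1/2}_0(\partial\Omega_h)=\{v|_{\partial\Omega_h}: v\in H^1_0(\Omega)\}$ and $H^{-1/2}(\partial\Omega_h)=\{\eta\cdot n|_{\partial\Omega_h}:\eta\in H(\mathrm{div},\Omega)\}$ (traces, respectively normal traces, on every $\partial K$), with the quotient norms $\|\hat u\|=\inf\{\|v\|_{H^1(\Omega)}: v\in H_0^1(\Omega),\ v|_{\partial\Omega_h}=\hat u\}$ and $\|\hat\eta_n\|=\inf\{\|\eta\|_{H(\mathrm{div},\Omega)}:\eta\in H(\mathrm{div},\Omega),\ \eta\cdot n|_{\partial\Omega_h}=\hat\eta_n\}$; bold versions are the vector-valued analogues. $(\cdot,\cdot)_{\Omega_h}=\sum_{K\in\Omega_h}(\cdot,\cdot)_{L_2(K)}$ with derivatives taken elementwise, and $\langle\cdot,\cdot\rangle_{\partial\Omega_h}=\sum_{K\in\Omega_h}\langle\cdot,\cdot\rangle_{1/2,\partial K}$, where $\langle\cdot,\cdot\rangle_{1/2,\partial K}$ is the duality pairing between $H^{1/2}(\partial K)$ and $H^{-1/2}(\partial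 K)$. Spaces. $\mathcal{U}=\mathbf{L}_2(\Omega)\times\mathbf{L}_2(\Omega)\times L_2(\Omega)\times\mathbf{L}_2(\Omega)\times L_2(\Omega)\times H^{1/2}_0(\partial\Omega_h)\times\mathbf{H}^{1/2}_0(\partial\Omega_h)\times H^{-1/2}(\partial\Omega_h)\times\mathbf{H}^{-1/2}(\partial\Omega_h)$, with elements $u=(V,M,w,\psi,r,\hat w,\hat\psi,\hat V_n,\hat M_n)$ ($V,\psi$ vectors, $M$ a $2\times 2$ tensor, $w,r$ scalars), and $\mathcal{V}=H(\mathrm{div},\Omega_h)\times\mathbf{H}(\mathbf{div},\Omega_h)\times H^1(\Omega_h)\times\mathbf{H}^1(\Omega_h)\times L_2(\Omega)$, with elements $v=(q,\tau,z,\varphi,s)$. Both carry the product Hilbert norms (broken norms on $\mathcal{V}$). Bilinear form. $$\begin{aligned}\mathcal{B}(u,v)&=(V,\kappa^{-1}t^2q+\nabla z-\varphi)_{\Omega_h}+(M,\mathcal{C}^{-1}\tau+\nabla\varphi+sJ)_{\Omega_h}+(w,\nabla\cdot q)_{\Omega_h}+(\psi,q+\nabla\cdot\tau)_{\Omega_h}+(rJ,\tau)_{\Omega_h}\\&\quad-\langle\hat w,q\cdot n\rangle_{\partial\Omega_h}-\langle\hat\psi,\tau n\rangle_{\partial\Omega_h}-\langle z,\hat V_n\rangle_{\partial\Omega_h}-\langle\varphi,\hat M_n\rangle_{\partial\Omega_h}.\end{aligned}$$ *)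

theory Defs
  imports "HOL-Analysis.Analysis"
begin

type_synonym point = "real ^ 2"
type_synonym tensor = "real ^ 2 ^ 2"  \<comment> \<open>\<open>M $ i\<close> is the \<open>i\<close>-th row, and the inner product is \<open>M : N\<close>\<close>


section \<open>Lebesgue spaces\<close>

text \<open>
  Elements of the function spaces are represented by functions on the whole space, of which only the
  values on \<open>X\<close> matter, and those up to null sets. Equality of elements is stated separately
  where it is needed (\<open>trial_eq\<close> below).
\<close>

definition L2 :: "'d::euclidean_space set \<Rightarrow> ('d \<Rightarrow> 'a::euclidean_space) set" where
  "L2 X = {f \<in> borel_measurable (lebesgue_on X). integrable (lebesgue_on X) (\<lambda>x. (norm (f x))\<^sup>2)}"

definition ip :: "'d::euclidean_space set \<Rightarrow> ('d \<Rightarrow> 'a::euclidean_space) \<Rightarrow> ('d \<Rightarrow> 'a) \<Rightarrow> real" where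
  "ip X f g = (LINT x|lebesgue_on X. f x \<bullet> g x)"

definition L2_norm_on :: "'d::euclidean_space set \<Rightarrow> ('d \<Rightarrow> 'a::euclidean_space) \<Rightarrow> real" where
  "L2_norm_on X f = sqrt (LINT x|lebesgue_on X. (norm (f x))\<^sup>2)"


section \<open>Smooth functions and weak derivatives\<close>

definition grad :: "(point \<Rightarrow> real) \<Rightarrow> point \<Rightarrow> point" where
  "grad f x = (\<chi> i. frechet_derivative f (at x) (axis i 1))"

primrec Ck :: "nat \<Rightarrow> (point \<Rightarrow> real) \<Rightarrow> bool" where
  "Ck 0 f \<longleftrightarrow> continuous_on UNIV f"
| "Ck (Suc k) f \<longleftrightarrow> (\<forall>x. f differentiable (at x)) \<and> (\<forall>i. Ck k (\<lambda>x. grad f x $ i))"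

definition smooth :: "(point \<Rightarrow> real) \<Rightarrow> bool" where
  "smooth f \<longleftrightarrow> (\<forall>k. Ck k f)"

definition test_functions :: "point set \<Rightarrow> (point \<Rightarrow> real) set" where
  "test_functions X =
     {f. smooth f \<and> compact (closure {x. f x \<noteq> 0}) \<and> closure {x. f x \<noteq> 0} \<subseteq> X}"

definition is_weak_grad :: "point set \<Rightarrow> (point \<Rightarrow> real) \<Rightarrow> (point \<Rightarrow> point) \<Rightarrow> bool" where
  "is_weak_grad X f g \<longleftrightarrow> g \<in> L2 X \<and>
     (\<forall>\<phi> \<in> test_functions X.
        (LINT x|lebesgue_on X. f x *\<^sub>R grad \<phi> x) = - (LINT x|lebesgue_on X. \<phi> x *\<^sub>R g x))"

definition is_weak_div :: "point set \<Rightarrow> (point \<Rightarrow> point) \<Rightarrow> (point \<Rightarrow> real) \<Rightarrow> bool" where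
  "is_weak_div X q d \<longleftrightarrow> d \<in> L2 X \<and>
     (\<forall>\<phi> \<in> test_functions X.
        (LINT x|lebesgue_on X. q x \<bullet> grad \<phi> x) = - (LINT x|lebesgue_on X. \<phi> x * d x))"

text \<open>Weak derivatives are unique up to null sets; the choice operator picks a representative.\<close>

definition wgrad :: "point set \<Rightarrow> (point \<Rightarrow> real) \<Rightarrow> point \<Rightarrow> point" where
  "wgrad X f = (SOME g. is_weak_grad X f g)"

definition wdiv :: "point set \<Rightarrow> (point \<Rightarrow> point) \<Rightarrow> point \<Rightarrow> real" where
  "wdiv X q = (SOME d. is_weak_div X q d)"

definition wgrad_vec :: "point set \<Rightarrow> (point \<Rightarrow> point) \<Rightarrow> point \<Rightarrow> tensor" where
  "wgrad_vec X \<phi> x = (\<chi> i. wgrad X (\<lambda>y. \<phi> y $ i) x)"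

definition wdiv_ten :: "point set \<Rightarrow> (point \<Rightarrow> tensor) \<Rightarrow> point \<Rightarrow> point" where
  "wdiv_ten X \<tau> x = (\<chi> i. wdiv X (\<lambda>y. \<tau> y $ i) x)"


section \<open>Sobolev spaces on an open set\<close>

definition H1 :: "point set \<Rightarrow> (point \<Rightarrow> real) set" where
  "H1 X = {f \<in> L2 X. \<exists>g. is_weak_grad X f g}"

definition H1_vec :: "point set \<Rightarrow> (point \<Rightarrow> point) set" where
  "H1_vec X = {\<phi>. \<forall>i. (\<lambda>x. \<phi> x $ i) \<in> H1 X}"

definition Hdiv :: "point set \<Rightarrow> (point \<Rightarrow> point) set" where
  "Hdiv X = {q \<in> L2 X. \<exists>d. is_weak_div X q d}"

definition Hdiv_ten :: "point set \<Rightarrow> (point \<Rightarrow> tensor) set" where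
  "Hdiv_ten X = {\<tau>. \<forall>i. (\<lambda>x. \<tau> x $ i) \<in> Hdiv X}"

definition H1_norm :: "point set \<Rightarrow> (point \<Rightarrow> real) \<Rightarrow> real" where
  "H1_norm X f = sqrt ((L2_norm_on X f)\<^sup>2 + (L2_norm_on X (wgrad X f))\<^sup>2)"

definition H1_vec_norm :: "point set \<Rightarrow> (point \<Rightarrow> point) \<Rightarrow> real" where
  "H1_vec_norm X \<phi> = sqrt ((L2_norm_on X \<phi>)\<^sup>2 + (L2_norm_on X (wgrad_vec X \<phi>))\<^sup>2)"

definition Hdiv_norm :: "point set \<Rightarrow> (point \<Rightarrow> point) \<Rightarrow> real" where
  "Hdiv_norm X q = sqrt ((L2_norm_on X q)\<^sup>2 + (L2_norm_on X (wdiv X q))\<^sup>2)"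

definition Hdiv_ten_norm :: "point set \<Rightarrow> (point \<Rightarrow> tensor) \<Rightarrow> real" where
  "Hdiv_ten_norm X \<tau> = sqrt ((L2_norm_on X \<tau>)\<^sup>2 + (L2_norm_on X (wdiv_ten X \<tau>))\<^sup>2)"

definition H10 :: "point set \<Rightarrow> (point \<Rightarrow> real) set" where
  "H10 X = {v \<in> H1 X. \<exists>\<phi>. (\<forall>n. \<phi> n \<in> test_functions X) \<and>
              (\<lambda>n. H1_norm X (\<lambda>x. \<phi> n x - v x)) \<longlonglongrightarrow> 0}"

definition H10_vec :: "point set \<Rightarrow> (point \<Rightarrow> point) set" where
  "H10_vec X = {\<phi>. \<forall>i. (\<lambda>x. \<phi> x $ i) \<in> H10 X}"


section \<open>Polygonal domain and quadrilateral meshes\<close>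

definition convex_polygonal_domain :: "point set \<Rightarrow> bool" where
  "convex_polygonal_domain \<Omega> \<longleftrightarrow>
     \<Omega> \<noteq> {} \<and> (\<exists>S. finite S \<and> \<Omega> = interior (convex hull S))"

text \<open>A quadrilateral is given by its vertices in cyclic order.\<close>

type_synonym quad = "point \<times> point \<times> point \<times> point"

fun vertices :: "quad \<Rightarrow> point set" where
  "vertices (a, b, c, d) = {a, b, c, d}"

fun edges :: "quad \<Rightarrow> (point \<times> point) set" where
  "edges (a, b, c, d) = {(a, b), (b, c), (c, d), (d, a)}"

definition cell :: "quad \<Rightarrow> point set" where
  "cell K = interior (convex hull (vertices K))"

definition cross2 :: "point \<Rightarrow> point \<Rightarrow> real" where
  "cross2 x y = x $ 1 * y $ 2 - x $ 2 * y $ 1"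

text \<open>
  Every turn along \<open>a, b, c, d, a\<close> is strictly to the left: the polygon is convex and
  non-degenerate, with its vertices listed counterclockwise. (The turning angles lie between
  \<open>0\<close> and \<open>\<pi>\<close>, so that four of them can only add up to one full turn.)
\<close>

fun convex_quad :: "quad \<Rightarrow> bool" where
  "convex_quad (a, b, c, d) \<longleftrightarrow>
     cross2 (b - a) (c - b) > 0 \<and> cross2 (c - b) (d - c) > 0 \<and>
     cross2 (d - c) (a - d) > 0 \<and> cross2 (a - d) (b - a) > 0"

definition quad_mesh :: "point set \<Rightarrow> quad set \<Rightarrow> bool" where
  "quad_mesh \<Omega> T \<longleftrightarrow> finite T \<and> (\<forall>K \<in> T. convex_quad K) \<and>
     (\<forall>K \<in> T. \<forall>K' \<in> T. K \<noteq> K' \<longrightarrow> cell K \<inter> cell K' = {}) \<and>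
     closure \<Omega> = (\<Union>K \<in> T. closure (cell K))"

definition inscribed_diameter :: "point set \<Rightarrow> real" where
  "inscribed_diameter S = 2 * Sup {r. 0 \<le> r \<and> (\<exists>x. ball x r \<subseteq> S)}"

text \<open>
  Shape regularity of quadrilaterals: uniform bound of the diameter by the inscribed-circle
  diameters of the four triangles spanned by three of the vertices.
\<close>

definition nondegenerate :: "quad set set \<Rightarrow> bool" where
  "nondegenerate F \<longleftrightarrow> (\<exists>\<sigma>>0. \<forall>T \<in> F. \<forall>K \<in> T. \<forall>p \<in> vertices K.
     diameter (cell K) \<le> \<sigma> * inscribed_diameter (convex hull (vertices K - {p})))"


section \<open>Traces on the element boundaries\<close>

text \<open>\<open>L\<^sub>2(\<partial>K)\<close> with respect to arc length, each edge being parametrized over the unit interval.\<close>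

definition edge_pt :: "point \<times> point \<Rightarrow> real \<Rightarrow> point" where
  "edge_pt e s = fst e + s *\<^sub>R (snd e - fst e)"

definition bdry_L2 :: "quad \<Rightarrow> (point \<Rightarrow> real) set" where
  "bdry_L2 K = {g. \<forall>e \<in> edges K. (\<lambda>s. g (edge_pt e s)) \<in> L2 {0..1}}"

definition bdry_L2_norm :: "quad \<Rightarrow> (point \<Rightarrow> real) \<Rightarrow> real" where
  "bdry_L2_norm K g =
     sqrt (\<Sum>e \<in> edges K. dist (fst e) (snd e) * (L2_norm_on {0..1} (\<lambda>s. g (edge_pt e s)))\<^sup>2)"

text \<open>The trace is the continuous extension of the restriction of smooth functions to \<open>\<partial>K\<close>.\<close>

definition has_trace :: "quad \<Rightarrow> (point \<Rightarrow> real) \<Rightarrow> (point \<Rightarrow> real) \<Rightarrow> bool" where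
  "has_trace K v g \<longleftrightarrow> v \<in> H1 (cell K) \<and> g \<in> bdry_L2 K \<and>
     (\<exists>\<phi>. (\<forall>n. smooth (\<phi> n)) \<and>
        (\<lambda>n. H1_norm (cell K) (\<lambda>x. \<phi> n x - v x)) \<longlonglongrightarrow> 0 \<and>
        (\<lambda>n. bdry_L2_norm K (\<lambda>x. \<phi> n x - g x)) \<longlonglongrightarrow> 0)"

definition trace_on :: "quad \<Rightarrow> (point \<Rightarrow> real) \<Rightarrow> point \<Rightarrow> real" where
  "trace_on K v = (SOME g. has_trace K v g)"

definition H_half :: "quad \<Rightarrow> (point \<Rightarrow> real) set" where
  "H_half K = {g. \<exists>v. has_trace K v g}"

text \<open>
  Elements of \<open>H\<^sup>-\<^sup>1\<^sup>/\<^sup>2(\<partial>K)\<close> are functionals on \<open>H_half K\<close>, set to zero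
  elsewhere, and the duality pairing is application. The normal trace of \<open>q\<close> is the functional
  given by Green's formula, \<open>\<langle>g, q \<bullet> n\<rangle> = (\<nabla>v, q)\<^sub>K + (v, \<nabla> \<bullet> q)\<^sub>K\<close>, where \<open>v\<close> is any extension
  of \<open>g\<close> to \<open>H\<^sup>1(K)\<close>; the right-hand side does not depend on the extension.
\<close>

definition normal_trace :: "quad \<Rightarrow> (point \<Rightarrow> point) \<Rightarrow> (point \<Rightarrow> real) \<Rightarrow> real" where
  "normal_trace K q g =
     (if g \<in> H_half K
      then let v = (SOME v. has_trace K v g)
           in ip (cell K) (wgrad (cell K) v) q + ip (cell K) v (wdiv (cell K) q)
      else 0)"

text \<open>Row-wise version; the pairing with \<open>g :: point \<Rightarrow> point\<close> is \<open>\<Sum>i. normal_trace_ten K \<tau> (g\<^sub>i) $ i\<close>.\<close>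

definition normal_trace_ten :: "quad \<Rightarrow> (point \<Rightarrow> tensor) \<Rightarrow> (point \<Rightarrow> real) \<Rightarrow> point" where
  "normal_trace_ten K \<tau> g = (\<chi> i. normal_trace K (\<lambda>x. \<tau> x $ i) g)"


section \<open>Trace spaces on the skeleton\<close>

text \<open>
  \<open>\<hat>w\<close> is a function on the skeleton; \<open>is_skel_trace T v \<hat>w\<close> says that it is the trace of
  \<open>v\<close> on every \<open>\<partial>K\<close>. An element of \<open>H\<^sup>-\<^sup>1\<^sup>/\<^sup>2(\<partial>\<Omega>\<^sub>h)\<close> is a family of functionals indexed by the
  elements \<open>K\<close> (and zero for other indices).
\<close>

definition is_skel_trace :: "quad set \<Rightarrow> (point \<Rightarrow> real) \<Rightarrow> (point \<Rightarrow> real) \<Rightarrow> bool" where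
  "is_skel_trace T v g \<longleftrightarrow> (\<forall>K \<in> T. has_trace K v g)"

definition is_skel_trace_vec :: "quad set \<Rightarrow> (point \<Rightarrow> point) \<Rightarrow> (point \<Rightarrow> point) \<Rightarrow> bool" where
  "is_skel_trace_vec T v g \<longleftrightarrow> (\<forall>i. is_skel_trace T (\<lambda>x. v x $ i) (\<lambda>x. g x $ i))"

definition skel_normal_trace ::
  "quad set \<Rightarrow> (point \<Rightarrow> point) \<Rightarrow> quad \<Rightarrow> (point \<Rightarrow> real) \<Rightarrow> real" where
  "skel_normal_trace T \<eta> K = (if K \<in> T then normal_trace K \<eta> else (\<lambda>_. 0))"

definition skel_normal_trace_ten ::
  "quad set \<Rightarrow> (point \<Rightarrow> tensor) \<Rightarrow> quad \<Rightarrow> (point \<Rightarrow> real) \<Rightarrow> point" where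
  "skel_normal_trace_ten T \<eta> K = (if K \<in> T then normal_trace_ten K \<eta> else (\<lambda>_. 0))"

definition H_half0_skel :: "point set \<Rightarrow> quad set \<Rightarrow> (point \<Rightarrow> real) set" where
  "H_half0_skel \<Omega> T = {g. \<exists>v \<in> H10 \<Omega>. is_skel_trace T v g}"

definition H_half0_skel_vec :: "point set \<Rightarrow> quad set \<Rightarrow> (point \<Rightarrow> point) set" where
  "H_half0_skel_vec \<Omega> T = {g. \<exists>v \<in> H10_vec \<Omega>. is_skel_trace_vec T v g}"

definition H_mhalf_skel :: "point set \<Rightarrow> quad set \<Rightarrow> (quad \<Rightarrow> (point \<Rightarrow> real) \<Rightarrow> real) set" where
  "H_mhalf_skel \<Omega> T = skel_normal_trace T ` Hdiv \<Omega>"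

definition H_mhalf_skel_ten :: "point set \<Rightarrow> quad set \<Rightarrow> (quad \<Rightarrow> (point \<Rightarrow> real) \<Rightarrow> point) set" where
  "H_mhalf_skel_ten \<Omega> T = skel_normal_trace_ten T ` Hdiv_ten \<Omega>"

definition half_norm :: "point set \<Rightarrow> quad set \<Rightarrow> (point \<Rightarrow> real) \<Rightarrow> real" where
  "half_norm \<Omega> T g = Inf {H1_norm \<Omega> v | v. v \<in> H10 \<Omega> \<and> is_skel_trace T v g}"

definition half_norm_vec :: "point set \<Rightarrow> quad set \<Rightarrow> (point \<Rightarrow> point) \<Rightarrow> real" where
  "half_norm_vec \<Omega> T g = Inf {H1_vec_norm \<Omega> v | v. v \<in> H10_vec \<Omega> \<and> is_skel_trace_vec T v g}"

definition mhalf_norm ::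
  "point set \<Rightarrow> quad set \<Rightarrow> (quad \<Rightarrow> (point \<Rightarrow> real) \<Rightarrow> real) \<Rightarrow> real" where
  "mhalf_norm \<Omega> T l = Inf {Hdiv_norm \<Omega> \<eta> | \<eta>. \<eta> \<in> Hdiv \<Omega> \<and> skel_normal_trace T \<eta> = l}"

definition mhalf_norm_ten ::
  "point set \<Rightarrow> quad set \<Rightarrow> (quad \<Rightarrow> (point \<Rightarrow> real) \<Rightarrow> point) \<Rightarrow> real" where
  "mhalf_norm_ten \<Omega> T l =
     Inf {Hdiv_ten_norm \<Omega> \<eta> | \<eta>. \<eta> \<in> Hdiv_ten \<Omega> \<and> skel_normal_trace_ten T \<eta> = l}"


section \<open>Trial space\<close>

text \<open>The components of \<open>u = (V, M, w, \<psi>, r, \<hat>w, \<hat>\<psi>, \<hat>V\<^sub>n, \<hat>M\<^sub>n)\<close>; the suffix \<open>h\<close> marks a hat.\<close>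

record trial =
  uV :: "point \<Rightarrow> point"
  uM :: "point \<Rightarrow> tensor"
  uw :: "point \<Rightarrow> real"
  upsi :: "point \<Rightarrow> point"
  ur :: "point \<Rightarrow> real"
  uwh :: "point \<Rightarrow> real"
  upsih :: "point \<Rightarrow> point"
  uVnh :: "quad \<Rightarrow> (point \<Rightarrow> real) \<Rightarrow> real"
  uMnh :: "quad \<Rightarrow> (point \<Rightarrow> real) \<Rightarrow> point"

definition trial_space :: "point set \<Rightarrow> quad set \<Rightarrow> trial set" where
  "trial_space \<Omega> T =
     {u. uV u \<in> L2 \<Omega> \<and> uM u \<in> L2 \<Omega> \<and> uw u \<in> L2 \<Omega> \<and> upsi u \<in> L2 \<Omega> \<and> ur u \<in> L2 \<Omega> \<and>
         uwh u \<in> H_half0_skel \<Omega> T \<and> upsih u \<in> H_half0_skel_vec \<Omega> T \<and>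
         uVnh u \<in> H_mhalf_skel \<Omega> T \<and> uMnh u \<in> H_mhalf_skel_ten \<Omega> T}"

definition trial_norm :: "point set \<Rightarrow> quad set \<Rightarrow> trial \<Rightarrow> real" where
  "trial_norm \<Omega> T u =
     sqrt ((L2_norm_on \<Omega> (uV u))\<^sup>2 + (L2_norm_on \<Omega> (uM u))\<^sup>2 + (L2_norm_on \<Omega> (uw u))\<^sup>2 +
           (L2_norm_on \<Omega> (upsi u))\<^sup>2 + (L2_norm_on \<Omega> (ur u))\<^sup>2 +
           (half_norm \<Omega> T (uwh u))\<^sup>2 + (half_norm_vec \<Omega> T (upsih u))\<^sup>2 +
           (mhalf_norm \<Omega> T (uVnh u))\<^sup>2 + (mhalf_norm_ten \<Omega> T (uMnh u))\<^sup>2)"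

definition trial_eq :: "point set \<Rightarrow> quad set \<Rightarrow> trial \<Rightarrow> trial \<Rightarrow> bool" where
  "trial_eq \<Omega> T u u' \<longleftrightarrow>
     (AE x in lebesgue_on \<Omega>. uV u x = uV u' x \<and> uM u x = uM u' x \<and> uw u x = uw u' x \<and>
        upsi u x = upsi u' x \<and> ur u x = ur u' x) \<and>
     (\<forall>K \<in> T. \<forall>e \<in> edges K. AE s in lebesgue_on {0..1}.
        uwh u (edge_pt e s) = uwh u' (edge_pt e s) \<and>
        upsih u (edge_pt e s) = upsih u' (edge_pt e s)) \<and>
     uVnh u = uVnh u' \<and> uMnh u = uMnh u'"


section \<open>Test space and its dual\<close>

record testv =
  vq :: "point \<Rightarrow> point"
  vtau :: "point \<Rightarrow> tensor"
  vz :: "point \<Rightarrow> real"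
  vphi :: "point \<Rightarrow> point"
  vs :: "point \<Rightarrow> real"

definition test_space :: "point set \<Rightarrow> quad set \<Rightarrow> testv set" where
  "test_space \<Omega> T =
     {v. vq v \<in> L2 \<Omega> \<and> (\<forall>K \<in> T. vq v \<in> Hdiv (cell K)) \<and>
         vtau v \<in> L2 \<Omega> \<and> (\<forall>K \<in> T. vtau v \<in> Hdiv_ten (cell K)) \<and>
         vz v \<in> L2 \<Omega> \<and> (\<forall>K \<in> T. vz v \<in> H1 (cell K)) \<and>
         vphi v \<in> L2 \<Omega> \<and> (\<forall>K \<in> T. vphi v \<in> H1_vec (cell K)) \<and>
         vs v \<in> L2 \<Omega>}"

definition test_norm :: "point set \<Rightarrow> quad set \<Rightarrow> testv \<Rightarrow> real" where
  "test_norm \<Omega> T v =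
     sqrt ((\<Sum>K \<in> T. (Hdiv_norm (cell K) (vq v))\<^sup>2) + (\<Sum>K \<in> T. (Hdiv_ten_norm (cell K) (vtau v))\<^sup>2) +
           (\<Sum>K \<in> T. (H1_norm (cell K) (vz v))\<^sup>2) + (\<Sum>K \<in> T. (H1_vec_norm (cell K) (vphi v))\<^sup>2) +
           (L2_norm_on \<Omega> (vs v))\<^sup>2)"

definition test_lincomb :: "real \<Rightarrow> testv \<Rightarrow> real \<Rightarrow> testv \<Rightarrow> testv" where
  "test_lincomb a v b v' =
     \<lparr>vq = \<lambda>x. a *\<^sub>R vq v x + b *\<^sub>R vq v' x,
      vtau = \<lambda>x. a *\<^sub>R vtau v x + b *\<^sub>R vtau v' x,
      vz = \<lambda>x. a * vz v x + b * vz v' x,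
      vphi = \<lambda>x. a *\<^sub>R vphi v x + b *\<^sub>R vphi v' x,
      vs = \<lambda>x. a * vs v x + b * vs v' x\<rparr>"

text \<open>
  Boundedness forces a functional to agree on representatives of the same element of the test space.
\<close>

definition test_dual :: "point set \<Rightarrow> quad set \<Rightarrow> (testv \<Rightarrow> real) set" where
  "test_dual \<Omega> T =
     {L. (\<forall>v \<in> test_space \<Omega> T. \<forall>v' \<in> test_space \<Omega> T. \<forall>a b.
            L (test_lincomb a v b v') = a * L v + b * L v') \<and>
         (\<exists>C. \<forall>v \<in> test_space \<Omega> T. \<bar>L v\<bar> \<le> C * test_norm \<Omega> T v)}"

definition dual_norm :: "point set \<Rightarrow> quad set \<Rightarrow> (testv \<Rightarrow> real) \<Rightarrow> real" where
  "dual_norm \<Omega> T L = Sup {\<bar>L v\<bar> | v. v \<in> test_space \<Omega> T \<and> test_norm \<Omega> T v \<le> 1}"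

definition load_functional :: "quad set \<Rightarrow> (point \<Rightarrow> real) \<Rightarrow> testv \<Rightarrow> real" where
  "load_functional T p v = (\<Sum>K \<in> T. ip (cell K) p (vz v))"


section \<open>Bilinear form\<close>

definition Cinv :: "real \<Rightarrow> tensor \<Rightarrow> tensor" where
  "Cinv \<nu> \<tau> = 6 *\<^sub>R (\<tau> - (\<nu> / (1 + \<nu>) * trace \<tau>) *\<^sub>R mat 1)"

definition Jmat :: tensor where
  "Jmat = vector [vector [0, 1], vector [-1, 0]]"

definition RM_form :: "real \<Rightarrow> real \<Rightarrow> real \<Rightarrow> quad set \<Rightarrow> trial \<Rightarrow> testv \<Rightarrow> real" where
  "RM_form \<kappa> t \<nu> T u v =
     (\<Sum>K \<in> T. ip (cell K) (uV u) (\<lambda>x. (inverse \<kappa> * t\<^sup>2) *\<^sub>R vq v x + wgrad (cell K) (vz v) x - vphi v x))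
   + (\<Sum>K \<in> T. ip (cell K) (uM u)
        (\<lambda>x. Cinv \<nu> (vtau v x) + wgrad_vec (cell K) (vphi v) x + vs v x *\<^sub>R Jmat))
   + (\<Sum>K \<in> T. ip (cell K) (uw u) (wdiv (cell K) (vq v)))
   + (\<Sum>K \<in> T. ip (cell K) (upsi u) (\<lambda>x. vq v x + wdiv_ten (cell K) (vtau v) x))
   + (\<Sum>K \<in> T. ip (cell K) (\<lambda>x. ur u x *\<^sub>R Jmat) (vtau v))
   - (\<Sum>K \<in> T. normal_trace K (vq v) (uwh u))
   - (\<Sum>K \<in> T. \<Sum>i \<in> UNIV. normal_trace_ten K (vtau v) (\<lambda>x. upsih u x $ i) $ i)
   - (\<Sum>K \<in> T. uVnh u K (trace_on K (vz v)))
   - (\<Sum>K \<in> T. \<Sum>i \<in> UNIV. uMnh u K (trace_on K (\<lambda>x. vphi v x $ i)) $ i)"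

end

theory Submission
  imports Defs
begin

text \<open>
  Choosing extensions of the four skeleton unknowns to the whole domain and integrating by parts on each
  element turns \<open>\<B>(u, v)\<close> into an \<open>L\<^sub>2\<close> inner product of a residual with the jet
  \<open>(q, \<nabla> \<bullet> q, \<tau>, \<nabla> \<bullet> \<tau>, z, \<nabla>z, \<phi>, \<nabla>\<phi>, s)\<close> of the test function, whose norm is the norm of
  \<open>v\<close>. By the Riesz theorem the functional is represented by some \<open>f\<close> in \<open>L\<^sub>2\<close>, and a solution is
  obtained by making the residual equal to \<open>f\<close>: this is a Reissner-Mindlin system on \<open>\<Omega>\<close> with general
  right-hand sides, which reduces to the minimization of the plate energy on \<open>H\<^sub>0\<^sup>1\<close>, coercive by the
  inequalities of Poincare and Korn. The bound does not involve the mesh.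

  For uniqueness, conforming test functions do not see the skeleton unknowns, and the same plate system,
  which is self-adjoint up to signs, shows that the five fields vanish. Test functions supported on
  a single element then show that the traces and normal traces vanish.
\<close>

section \<open>Square integrable functions\<close>

text \<open>Four of the nine components of the residual only compare a field with the extension next
  to it: \<open>uw - lw\<close>, \<open>upsi - lpsi\<close>, \<open>uV - lV\<close>,
  \<open>uM - lM\<close>. No regularity ties the ultra-weak fields to their traces, so shifting
  fields and extensions against each other gives these components any value in L2. What remains is
  the plate system: \<open>- ldV\<close> and \<open>- uV - ldM\<close> express equilibrium, and the
  pairing of the moments with \<open>Jmat\<close> fixes their skew part. The rotation
  \<open>r\<close> is the multiplier of this last condition and is read off from the constitutive
  law, so that only the symmetric gradient enters the energy. The trial norm is controlled because a
  quotient norm never exceeds the norm of the extension used, and the extensions are solved for on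
  \<Omega> without reference to elements. Elements of the spaces are representatives and weak
  derivatives are chosen by \<open>SOME\<close>, hence most identities hold only almost everywhere,
  while a trace has to be one function serving all elements. This explains the amount of
  approximation: density of smooth functions without extension operators, and boundary limits along
  common subsequences.\<close>

lemma L2_measurable [measurable_dest]: "f \<in> L2 X \<Longrightarrow> f \<in> borel_measurable (lebesgue_on X)"
  by (simp add: L2_def)

lemma L2_integrable_sq: "f \<in> L2 X \<Longrightarrow> integrable (lebesgue_on X) (\<lambda>x. (norm (f x))\<^sup>2)"
  by (simp add: L2_def)

lemma L2_bound:
  fixes f :: "'d::euclidean_space \<Rightarrow> 'a::euclidean_space" and g :: "'d \<Rightarrow> 'b::euclidean_space"
  assumes "f \<in> borel_measurable (lebesgue_on X)" "g \<in> L2 X"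
    and le: "AE x in lebesgue_on X. norm (f x) \<le> c * norm (g x)"
  shows "f \<in> L2 X"
proof -
  have "integrable (lebesgue_on X) (\<lambda>x. (norm (f x))\<^sup>2)"
  proof (rule Bochner_Integration.integrable_bound)
    show "integrable (lebesgue_on X) (\<lambda>x. c\<^sup>2 * (norm (g x))\<^sup>2)"
      using L2_integrable_sq[OF assms(2)] by simp
    show "AE x in lebesgue_on X. norm ((norm (f x))\<^sup>2) \<le> norm (c\<^sup>2 * (norm (g x))\<^sup>2)"
      using le
    proof eventually_elim
      case (elim x)
      then have "(norm (f x))\<^sup>2 \<le> (c * norm (g x))\<^sup>2" by (intro power_mono) auto
      then show ?case by (simp add: power_mult_distrib)
    qed
  qed (use assms(1) in measurable)
  with assms(1) show ?thesis by (simp add: L2_def)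
qed

lemma L2_add [intro]:
  assumes "f \<in> L2 X" "g \<in> L2 X" shows "(\<lambda>x. f x + g x) \<in> L2 X"
proof -
  have "integrable (lebesgue_on X) (\<lambda>x. (norm (f x + g x))\<^sup>2)"
  proof (rule Bochner_Integration.integrable_bound)
    show "integrable (lebesgue_on X) (\<lambda>x. 2 * (norm (f x))\<^sup>2 + 2 * (norm (g x))\<^sup>2)"
      using L2_integrable_sq[OF assms(1)] L2_integrable_sq[OF assms(2)] by simp
    have "(norm (f x + g x))\<^sup>2 \<le> 2 * (norm (f x))\<^sup>2 + 2 * (norm (g x))\<^sup>2" for x
    proof -
      have "(norm (f x + g x))\<^sup>2 \<le> (norm (f x) + norm (g x))\<^sup>2"
        by (intro power_mono norm_triangle_ineq) auto
      also have "\<dots> \<le> 2 * (norm (f x))\<^sup>2 + 2 * (norm (g x))\<^sup>2"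
        using sum_squares_bound[of "norm (f x)" "norm (g x)"] by (simp add: power2_sum)
      finally show ?thesis .
    qed
    then show "AE x in lebesgue_on X. norm ((norm (f x + g x))\<^sup>2) \<le> norm (2 * (norm (f x))\<^sup>2 + 2 * (norm (g x))\<^sup>2)"
      by (simp add: add_nonneg_nonneg)
  qed (use assms L2_measurable in measurable)
  moreover have "(\<lambda>x. f x + g x) \<in> borel_measurable (lebesgue_on X)"
    using assms L2_measurable by (intro borel_measurable_add) auto
  ultimately show ?thesis by (simp add: L2_def)
qed

lemma L2_bounded_linear:
  fixes f :: "'d::euclidean_space \<Rightarrow> 'a::euclidean_space" and h :: "'a \<Rightarrow> 'b::euclidean_space"
  assumes "bounded_linear h" "f \<in> L2 X" shows "(\<lambda>x. h (f x)) \<in> L2 X"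
proof -
  obtain K where K: "\<And>x. norm (h x) \<le> norm x * K"
    using bounded_linear.bounded[OF assms(1)] by blast
  have m: "h \<in> borel_measurable borel"
    using assms(1) by (intro borel_measurable_continuous_onI linear_continuous_on)
  show ?thesis
  proof (rule L2_bound[OF _ assms(2)])
    show "(\<lambda>x. h (f x)) \<in> borel_measurable (lebesgue_on X)"
      using m L2_measurable[OF assms(2)] by measurable
    show "AE x in lebesgue_on X. norm (h (f x)) \<le> K * norm (f x)"
      using K by (simp add: mult.commute)
  qed
qed

lemma L2_zero [simp, intro]: "(\<lambda>x. 0) \<in> L2 X"
  by (simp add: L2_def)

lemma L2_scaleR [intro]: "f \<in> L2 X \<Longrightarrow> (\<lambda>x. c *\<^sub>R f x) \<in> L2 X"
  by (rule L2_bounded_linear[OF bounded_linear_scaleR_right])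

lemma L2_mult [intro]: fixes f :: "'d::euclidean_space \<Rightarrow> real"
  shows "f \<in> L2 X \<Longrightarrow> (\<lambda>x. c * f x) \<in> L2 X"
  using L2_scaleR[of f X c] by simp

lemma L2_scaleR_const [intro]: fixes f :: "'d::euclidean_space \<Rightarrow> real" and a :: "'a::euclidean_space"
  shows "f \<in> L2 X \<Longrightarrow> (\<lambda>x. f x *\<^sub>R a) \<in> L2 X"
  by (rule L2_bounded_linear[OF bounded_linear_scaleR_left])

lemma L2_minus [intro]: "f \<in> L2 X \<Longrightarrow> (\<lambda>x. - f x) \<in> L2 X"
  using L2_scaleR[of f X "-1"] by simp

lemma L2_diff [intro]: "f \<in> L2 X \<Longrightarrow> g \<in> L2 X \<Longrightarrow> (\<lambda>x. f x - g x) \<in> L2 X"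
  using L2_add[of f X "\<lambda>x. - g x"] L2_minus[of g X] by simp

lemma L2_inner_const [intro]: "f \<in> L2 X \<Longrightarrow> (\<lambda>x. f x \<bullet> a) \<in> L2 X"
  by (rule L2_bounded_linear[OF bounded_linear_inner_left])

lemma L2_sum: "(\<And>i. i \<in> I \<Longrightarrow> f i \<in> L2 X) \<Longrightarrow> (\<lambda>x. \<Sum>i\<in>I. f i x) \<in> L2 X"
  by (induction I rule: infinite_finite_induct) auto

lemma L2_nth [intro]:
  fixes f :: "'d::euclidean_space \<Rightarrow> ('a::euclidean_space)^'n"
  shows "f \<in> L2 X \<Longrightarrow> (\<lambda>x. f x $ i) \<in> L2 X"
  by (rule L2_bounded_linear[OF bounded_linear_vec_nth])

lemma L2_vecI:
  fixes f :: "'d::euclidean_space \<Rightarrow> ('a::euclidean_space)^'n"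
  assumes "\<And>i. (\<lambda>x. f x $ i) \<in> L2 X" shows "f \<in> L2 X"
proof -
  have "(\<lambda>x. \<Sum>i\<in>UNIV. axis i (f x $ i)) \<in> L2 X"
  proof (rule L2_sum)
    fix i :: 'n
    have "linear (axis i :: 'a \<Rightarrow> 'a^'n)"
      by (auto intro!: linearI simp: axis_def vec_eq_iff)
    then show "(\<lambda>x. axis i (f x $ i)) \<in> L2 X"
      using L2_bounded_linear[OF _ assms] linear_conv_bounded_linear by blast
  qed
  moreover have "(\<Sum>i\<in>UNIV. axis i (f x $ i)) = f x" for x
    by (simp add: vec_eq_iff axis_def)
  ultimately show ?thesis by simp
qed

lemma L2_fst [intro]: "f \<in> L2 X \<Longrightarrow> (\<lambda>x. fst (f x)) \<in> L2 X"
  by (rule L2_bounded_linear[OF bounded_linear_fst])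

lemma L2_snd [intro]: "f \<in> L2 X \<Longrightarrow> (\<lambda>x. snd (f x)) \<in> L2 X"
  by (rule L2_bounded_linear[OF bounded_linear_snd])

lemma L2_Pair [intro]:
  assumes "f \<in> L2 X" "g \<in> L2 X" shows "(\<lambda>x. (f x, g x)) \<in> L2 X"
proof -
  have "(\<lambda>x. (f x, 0) + (0, g x)) \<in> L2 X"
    using assms by (intro L2_add L2_bounded_linear[of "\<lambda>x. (x, 0)"] L2_bounded_linear[of "\<lambda>x. (0, x)"])
      (auto intro!: bounded_linear_Pair bounded_linear_ident bounded_linear_zero)
  then show ?thesis by simp
qed

section \<open>The inner product of L2 and its norm\<close>

lemma ip_integrable:
  assumes "f \<in> L2 X" "g \<in> L2 X" shows "integrable (lebesgue_on X) (\<lambda>x. f x \<bullet> g x)"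
proof (rule Bochner_Integration.integrable_bound)
  show "integrable (lebesgue_on X) (\<lambda>x. (norm (f x))\<^sup>2 + (norm (g x))\<^sup>2)"
    using L2_integrable_sq[OF assms(1)] L2_integrable_sq[OF assms(2)] by simp
  have "\<bar>f x \<bullet> g x\<bar> \<le> (norm (f x))\<^sup>2 + (norm (g x))\<^sup>2" for x
  proof -
    have "\<bar>f x \<bullet> g x\<bar> \<le> norm (f x) * norm (g x)" by (rule Cauchy_Schwarz_ineq2)
    also have "\<dots> \<le> (norm (f x))\<^sup>2 + (norm (g x))\<^sup>2"
      using sum_squares_bound[of "norm (f x)" "norm (g x)"]
        mult_nonneg_nonneg[OF norm_ge_zero norm_ge_zero, of "f x" "g x"] by linarith
    finally show ?thesis .
  qed
  then show "AE x in lebesgue_on X. norm (f x \<bullet> g x) \<le> norm ((norm (f x))\<^sup>2 + (norm (g x))\<^sup>2)"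
    by (simp add: add_nonneg_nonneg)
qed (use assms L2_measurable in measurable)

lemma ip_add_left: "f \<in> L2 X \<Longrightarrow> g \<in> L2 X \<Longrightarrow> h \<in> L2 X \<Longrightarrow> ip X (\<lambda>x. f x + g x) h = ip X f h + ip X g h"
  unfolding ip_def by (simp add: inner_add_left Bochner_Integration.integral_add ip_integrable)

lemma ip_commute: "ip X f g = ip X g f"
  unfolding ip_def by (simp add: inner_commute)

lemma ip_add_right: "f \<in> L2 X \<Longrightarrow> g \<in> L2 X \<Longrightarrow> h \<in> L2 X \<Longrightarrow> ip X h (\<lambda>x. f x + g x) = ip X h f + ip X h g"
  using ip_add_left[of f X g h] by (simp add: ip_commute)

lemma ip_scaleR_left: "ip X (\<lambda>x. c *\<^sub>R f x) h = c * ip X f h"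
  unfolding ip_def by simp

lemma ip_scaleR_right: "ip X h (\<lambda>x. c *\<^sub>R f x) = c * ip X h f"
  unfolding ip_def by simp

lemma ip_diff_left: "f \<in> L2 X \<Longrightarrow> g \<in> L2 X \<Longrightarrow> h \<in> L2 X \<Longrightarrow> ip X (\<lambda>x. f x - g x) h = ip X f h - ip X g h"
  unfolding ip_def by (simp add: inner_diff_left Bochner_Integration.integral_diff ip_integrable)

lemma ip_diff_right: "f \<in> L2 X \<Longrightarrow> g \<in> L2 X \<Longrightarrow> h \<in> L2 X \<Longrightarrow> ip X h (\<lambda>x. f x - g x) = ip X h f - ip X h g"
  using ip_diff_left[of f X g h] by (simp add: ip_commute)

lemma ip_minus_left: "ip X (\<lambda>x. - f x) h = - ip X f h"
  unfolding ip_def by simp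

lemma ip_minus_right: "ip X h (\<lambda>x. - f x) = - ip X h f"
  unfolding ip_def by simp

lemma ip_zero [simp]: "ip X (\<lambda>x. 0) h = 0" "ip X h (\<lambda>x. 0) = 0"
  unfolding ip_def by auto

lemmas ip_linear = ip_add_left ip_add_right ip_diff_left ip_diff_right
  ip_scaleR_left ip_scaleR_right ip_minus_left ip_minus_right

lemma ip_cong_AE:
  assumes "f \<in> borel_measurable (lebesgue_on X)" "g \<in> borel_measurable (lebesgue_on X)"
    "f' \<in> borel_measurable (lebesgue_on X)" "g' \<in> borel_measurable (lebesgue_on X)"
    "AE x in lebesgue_on X. f x = f' x" "AE x in lebesgue_on X. g x = g' x"
  shows "ip X f g = ip X f' g'"
  unfolding ip_def
proof (rule integral_cong_AE)
  show "AE x in lebesgue_on X. f x \<bullet> g x = f' x \<bullet> g' x"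
    using assms(5,6) by eventually_elim simp
qed (use assms(1-4) in measurable)

lemma ip_Pair:
  assumes "f \<in> L2 X" "g \<in> L2 X" "f' \<in> L2 X" "g' \<in> L2 X"
  shows "ip X (\<lambda>x. (f x, g x)) (\<lambda>x. (f' x, g' x)) = ip X f f' + ip X g g'"
  using assms unfolding ip_def by (simp add: inner_prod_def Bochner_Integration.integral_add ip_integrable)

lemma ip_vec:
  fixes f g :: "'d::euclidean_space \<Rightarrow> ('a::euclidean_space)^'n"
  assumes "f \<in> L2 X" "g \<in> L2 X"
  shows "ip X f g = (\<Sum>i\<in>UNIV. ip X (\<lambda>x. f x $ i) (\<lambda>x. g x $ i))"
  unfolding ip_def inner_vec_def
  by (rule Bochner_Integration.integral_sum) (use assms in \<open>auto intro!: ip_integrable\<close>)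

lemma L2_norm_sq: "(L2_norm_on X f)\<^sup>2 = ip X f f"
  unfolding L2_norm_on_def ip_def by (simp add: power2_norm_eq_inner)

lemma L2_norm_nonneg [simp]: "0 \<le> L2_norm_on X f"
  unfolding L2_norm_on_def by simp

lemma L2_norm_eq_sqrt: "L2_norm_on X f = sqrt (ip X f f)"
  by (metis L2_norm_nonneg L2_norm_sq real_sqrt_unique)

text \<open>On representatives \<open>ip\<close> is only a positive semidefinite form, so the
  discriminant argument is carried out by hand, with a separate case for vanishing
  \<open>ip X g g\<close>.\<close>

lemma ip_Cauchy_Schwarz:
  assumes f: "f \<in> L2 X" and g: "g \<in> L2 X"
  shows "\<bar>ip X f g\<bar> \<le> L2_norm_on X f * L2_norm_on X g"
proof -
  let ?a = "ip X f f" and ?b = "ip X f g" and ?c = "ip X g g"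
  have c0: "0 \<le> ?c" and a0: "0 \<le> ?a" by (simp_all add: L2_norm_sq[symmetric])
  have q: "0 \<le> ?a + 2 * t * ?b + t\<^sup>2 * ?c" for t
  proof -
    have "0 \<le> ip X (\<lambda>x. f x + t *\<^sub>R g x) (\<lambda>x. f x + t *\<^sub>R g x)" by (simp add: L2_norm_sq[symmetric])
    also have "\<dots> = ?a + 2 * t * ?b + t\<^sup>2 * ?c"
      using f g by (simp add: ip_linear L2_add L2_scaleR ip_commute[of X g f] power2_eq_square algebra_simps)
    finally show ?thesis .
  qed
  have "?b\<^sup>2 \<le> ?a * ?c"
  proof (cases "?c = 0")
    case True
    have "?b = 0"
    proof (rule ccontr)
      assume "?b \<noteq> 0"
      \<comment> \<open>This value of the parameter makes \<open>?a + 2 * t * ?b\<close> equal to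
        -1.\<close>
      then show False using q[of "- (?a + 1) / (2 * ?b)"] True by (simp add: field_simps)
    qed
    then show ?thesis using True by simp
  next
    case False
    then have "0 < ?c" using c0 by simp
    \<comment> \<open>The minimizer of the quadratic polynomial.\<close>
    with q[of "- ?b / ?c"] show ?thesis by (simp add: power2_eq_square field_simps)
  qed
  then have "?b\<^sup>2 \<le> (L2_norm_on X f * L2_norm_on X g)\<^sup>2"
    by (simp add: power_mult_distrib L2_norm_sq)
  then show ?thesis
    by (metis abs_le_square_iff abs_of_nonneg L2_norm_nonneg mult_nonneg_nonneg)
qed

lemma L2_norm_triangle:
  assumes f: "f \<in> L2 X" and g: "g \<in> L2 X"
  shows "L2_norm_on X (\<lambda>x. f x + g x) \<le> L2_norm_on X f + L2_norm_on X g"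
proof (rule power2_le_imp_le)
  have "(L2_norm_on X (\<lambda>x. f x + g x))\<^sup>2 = (L2_norm_on X f)\<^sup>2 + 2 * ip X f g + (L2_norm_on X g)\<^sup>2"
    using f g by (simp add: L2_norm_sq ip_linear L2_add ip_commute[of X g f])
  also have "\<dots> \<le> (L2_norm_on X f + L2_norm_on X g)\<^sup>2"
    using ip_Cauchy_Schwarz[OF f g] by (simp add: power2_sum)
  finally show "(L2_norm_on X (\<lambda>x. f x + g x))\<^sup>2 \<le> (L2_norm_on X f + L2_norm_on X g)\<^sup>2" .
qed (simp add: add_nonneg_nonneg)

lemma L2_norm_scaleR: "L2_norm_on X (\<lambda>x. c *\<^sub>R f x) = \<bar>c\<bar> * L2_norm_on X f"
proof -
  have "ip X (\<lambda>x. c *\<^sub>R f x) (\<lambda>x. c *\<^sub>R f x) = c\<^sup>2 * ip X f f"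
    by (simp add: ip_linear power2_eq_square)
  then show ?thesis by (simp add: L2_norm_eq_sqrt real_sqrt_mult)
qed

lemma L2_norm_mult: fixes f :: "'d::euclidean_space \<Rightarrow> real"
  shows "L2_norm_on X (\<lambda>x. c * f x) = \<bar>c\<bar> * L2_norm_on X f"
  using L2_norm_scaleR[of X c f] by simp

lemma L2_norm_minus: "L2_norm_on X (\<lambda>x. - f x) = L2_norm_on X f"
  by (simp add: L2_norm_on_def)

lemma L2_norm_diff_commute: "L2_norm_on X (\<lambda>x. f x - g x) = L2_norm_on X (\<lambda>x. g x - f x)"
  by (simp add: L2_norm_on_def norm_minus_commute)

lemma L2_norm_triangle_diff:
  assumes "f \<in> L2 X" "g \<in> L2 X"
  shows "L2_norm_on X (\<lambda>x. f x - g x) \<le> L2_norm_on X f + L2_norm_on X g"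
  using L2_norm_triangle[of f X "\<lambda>x. - g x"] assms by (auto simp: L2_norm_minus)

lemma L2_norm_triangle3:
  assumes "f \<in> L2 X" "g \<in> L2 X" "h \<in> L2 X"
  shows "L2_norm_on X (\<lambda>x. f x - h x) \<le> L2_norm_on X (\<lambda>x. f x - g x) + L2_norm_on X (\<lambda>x. g x - h x)"
  using L2_norm_triangle[of "\<lambda>x. f x - g x" X "\<lambda>x. g x - h x"] assms by (auto intro: L2_diff)

lemma L2_norm_cong_AE:
  assumes "f \<in> borel_measurable (lebesgue_on X)" "g \<in> borel_measurable (lebesgue_on X)"
    "AE x in lebesgue_on X. f x = g x"
  shows "L2_norm_on X f = L2_norm_on X g"
  unfolding L2_norm_eq_sqrt using ip_cong_AE[of f X f g g] assms by simp

lemma L2_norm_mono: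
  fixes f :: "'d::euclidean_space \<Rightarrow> 'a::euclidean_space" and g :: "'d \<Rightarrow> 'b::euclidean_space"
  assumes f: "f \<in> borel_measurable (lebesgue_on X)" and g: "g \<in> L2 X" and c: "0 \<le> c"
    and le: "AE x in lebesgue_on X. norm (f x) \<le> c * norm (g x)"
  shows "L2_norm_on X f \<le> c * L2_norm_on X g"
proof -
  have "f \<in> L2 X" by (rule L2_bound[OF f g le])
  have "(LINT x|lebesgue_on X. (norm (f x))\<^sup>2) \<le> (LINT x|lebesgue_on X. c\<^sup>2 * (norm (g x))\<^sup>2)"
  proof (rule integral_mono_AE)
    show "AE x in lebesgue_on X. (norm (f x))\<^sup>2 \<le> c\<^sup>2 * (norm (g x))\<^sup>2"
      using le
    proof eventually_elim
      case (elim x)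
      then have "(norm (f x))\<^sup>2 \<le> (c * norm (g x))\<^sup>2" by (intro power_mono) auto
      then show ?case by (simp add: power_mult_distrib)
    qed
  qed (use \<open>f \<in> L2 X\<close> g L2_integrable_sq in auto)
  also have "\<dots> = c\<^sup>2 * (LINT x|lebesgue_on X. (norm (g x))\<^sup>2)" by simp
  finally have "L2_norm_on X f \<le> sqrt (c\<^sup>2 * (LINT x|lebesgue_on X. (norm (g x))\<^sup>2))"
    unfolding L2_norm_on_def by (rule real_sqrt_le_mono)
  then show ?thesis using c by (simp add: real_sqrt_mult L2_norm_on_def)
qed

lemma L2_norm_zero_AE:
  assumes "f \<in> L2 X" "L2_norm_on X f = 0" shows "AE x in lebesgue_on X. f x = 0"
proof -
  have "(LINT x|lebesgue_on X. (norm (f x))\<^sup>2) = 0"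
    using assms(2) by (simp add: L2_norm_on_def)
  then have "AE x in lebesgue_on X. (norm (f x))\<^sup>2 = 0"
    using integral_nonneg_eq_0_iff_AE[OF L2_integrable_sq[OF assms(1)]] by simp
  then show ?thesis by simp
qed

lemma L2_norm_Pair:
  assumes "f \<in> L2 X" "g \<in> L2 X"
  shows "(L2_norm_on X (\<lambda>x. (f x, g x)))\<^sup>2 = (L2_norm_on X f)\<^sup>2 + (L2_norm_on X g)\<^sup>2"
  using assms by (simp add: L2_norm_sq ip_Pair)

lemma L2_norm_vec:
  fixes f :: "'d::euclidean_space \<Rightarrow> ('a::euclidean_space)^'n"
  assumes "f \<in> L2 X"
  shows "(L2_norm_on X f)\<^sup>2 = (\<Sum>i\<in>UNIV. (L2_norm_on X (\<lambda>x. f x $ i))\<^sup>2)"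
  using assms by (simp add: L2_norm_sq ip_vec)

lemma L2_norm_nth_le:
  fixes f :: "'d::euclidean_space \<Rightarrow> ('a::euclidean_space)^'n"
  assumes "f \<in> L2 X" shows "L2_norm_on X (\<lambda>x. f x $ i) \<le> L2_norm_on X f"
  using L2_norm_mono[of "\<lambda>x. f x $ i" X f 1] assms L2_measurable[OF L2_nth[OF assms]]
  by (simp add: Finite_Cartesian_Product.norm_nth_le)

section \<open>Almost everywhere convergence, completeness, and the Riesz theorem\<close>

text \<open>The squared distances tend to zero in L1, and L1 convergence gives convergence almost
  everywhere along a subsequence.\<close>

lemma L2_AE_subseq:
  assumes "\<And>n. f n \<in> L2 X" "g \<in> L2 X" "(\<lambda>n. L2_norm_on X (\<lambda>x. f n x - g x)) \<longlonglongrightarrow> 0"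
  obtains r :: "nat \<Rightarrow> nat" where "strict_mono r" "AE x in lebesgue_on X. (\<lambda>n. f (r n) x) \<longlonglongrightarrow> g x"
proof -
  let ?u = "\<lambda>n x. (norm (f n x - g x))\<^sup>2"
  have i: "integrable (lebesgue_on X) (?u n)" for n
    using L2_integrable_sq[OF L2_diff[OF assms(1,2)]] .
  have "(\<lambda>n. (L2_norm_on X (\<lambda>x. f n x - g x))\<^sup>2) \<longlonglongrightarrow> 0\<^sup>2"
    by (intro tendsto_power assms(3))
  then have "(\<lambda>n. LINT x|lebesgue_on X. norm (?u n x)) \<longlonglongrightarrow> 0"
    by (simp add: L2_norm_sq ip_def power2_norm_eq_inner)
  from tendsto_L1_AE_subseq[OF i this] obtain r
    where r: "strict_mono r" "AE x in lebesgue_on X. (\<lambda>n. ?u (r n) x) \<longlonglongrightarrow> 0" by blast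
  have "AE x in lebesgue_on X. (\<lambda>n. f (r n) x) \<longlonglongrightarrow> g x"
    using r(2)
  proof eventually_elim
    case (elim x)
    then have "(\<lambda>n. sqrt (?u (r n) x)) \<longlonglongrightarrow> sqrt 0" by (rule tendsto_real_sqrt)
    then show ?case by (simp add: tendsto_norm_zero_iff LIM_zero_iff)
  qed
  with r(1) show ?thesis by (rule that)
qed

lemma fast_subsequence:
  assumes "\<And>e. e > 0 \<Longrightarrow> \<exists>N. \<forall>m\<ge>N. \<forall>n\<ge>N. d m n < (e::real)" "\<And>n. \<epsilon> n > 0"
  obtains r :: "nat \<Rightarrow> nat" where "strict_mono r" "\<And>n m k. m \<ge> r n \<Longrightarrow> k \<ge> r n \<Longrightarrow> d m k < \<epsilon> n"
proof -
  obtain N where N: "\<And>n m k. m \<ge> N n \<Longrightarrow> k \<ge> N n \<Longrightarrow> d m k < \<epsilon> n"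
  proof -
    have "\<forall>n. \<exists>N. \<forall>m\<ge>N. \<forall>k\<ge>N. d m k < \<epsilon> n" using assms by blast
    then show ?thesis using that by metis
  qed
  \<comment> \<open>Partial sums stay above each \<open>N n\<close>, and the added 1 makes the
    sequence strictly increasing.\<close>
  define r where "r n = (\<Sum>i\<le>n. N i + 1)" for n
  have "strict_mono r" by (auto simp: strict_mono_Suc_iff r_def)
  moreover have "N n \<le> r n" for n
  proof -
    have "N n + 1 \<le> r n" unfolding r_def by (rule member_le_sum) auto
    then show ?thesis by simp
  qed
  ultimately show ?thesis using that N order_trans by metis
qed

text \<open>The terms of a summable sequence are bounded, so the weight \<open>4 ^ n\<close> forces
  increments of order \<open>2 ^ - n\<close>, and the telescoping series converges
  absolutely.\<close>

lemma convergent_of_fast_differences: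
  fixes s :: "nat \<Rightarrow> 'a::banach"
  assumes "summable (\<lambda>n. 4 ^ n * (norm (s (Suc n) - s n))\<^sup>2)"
  shows "convergent s"
proof -
  let ?h = "\<lambda>n. norm (s (Suc n) - s n)"
  have "Bseq (\<lambda>n. 4 ^ n * (?h n)\<^sup>2)"
    using summable_LIMSEQ_zero[OF assms] by (intro convergent_imp_Bseq convergentI)
  then obtain B where B: "B > 0" "\<And>n. norm (4 ^ n * (?h n)\<^sup>2) \<le> B" by (auto elim: BseqE)
  have "?h n \<le> sqrt B * (1/2) ^ n" for n
  proof -
    have "(2 ^ n * ?h n)\<^sup>2 \<le> B"
      using B(2)[of n] by (simp add: power_mult_distrib power_mult[symmetric] mult.commute[of n] power_mult[of 2 2 n])
    then have "2 ^ n * ?h n \<le> sqrt B" by (rule real_le_rsqrt)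
    then show ?thesis by (simp add: field_simps power_divide)
  qed
  then have le: "norm (?h n) \<le> sqrt B * (1/2) ^ n" if "n \<ge> 0" for n by simp
  have "summable (\<lambda>n. sqrt B * (1/2::real) ^ n)" by (intro summable_mult summable_geometric) simp
  then have "summable ?h" using le by (rule summable_comparison_test')
  then have "summable (\<lambda>n. s (Suc n) - s n)" by (rule summable_norm_cancel)
  then have "convergent (\<lambda>n. \<Sum>k<n. s (Suc k) - s k)" by (simp add: summable_iff_convergent)
  then have "convergent (\<lambda>n. s n - s 0)" unfolding sum_lessThan_telescope .
  then show ?thesis using convergent_add[OF _ convergent_const, of "\<lambda>n. s n - s 0" "s 0"] by simp
qed

text \<open>Riesz-Fischer. Along a fast subsequence the weighted squared increments have an
  integrable sum, so the subsequence converges almost everywhere; Fatou's lemma turns this pointwise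
  limit into a limit in L2 of the whole sequence.\<close>

lemma L2_complete:
  fixes f :: "nat \<Rightarrow> 'd::euclidean_space \<Rightarrow> 'a::euclidean_space"
  assumes f: "\<And>n. f n \<in> L2 X"
    and Cauchy: "\<And>e. e > 0 \<Longrightarrow> \<exists>N. \<forall>m\<ge>N. \<forall>n\<ge>N. L2_norm_on X (\<lambda>x. f m x - f n x) < e"
  obtains g where "g \<in> L2 X" "(\<lambda>n. L2_norm_on X (\<lambda>x. f n x - g x)) \<longlonglongrightarrow> 0"
proof -
  let ?M = "lebesgue_on X"
  have [measurable]: "f n \<in> borel_measurable ?M" for n using f L2_measurable by blast
  have nn: "(\<integral>\<^sup>+x. ennreal ((norm (f m x - f n x))\<^sup>2) \<partial>?M) = ennreal ((L2_norm_on X (\<lambda>x. f m x - f n x))\<^sup>2)" for m n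
    using nn_integral_eq_integral[OF L2_integrable_sq[OF L2_diff[OF f f]], of m n]
    by (simp add: L2_norm_on_def)
  \<comment> \<open>The rate is chosen against the weight in \<open>h\<close>: squared it is
    \<open>16 ^ - n\<close>, which leaves the summable bound \<open>4 ^ - n\<close> after
    multiplication by \<open>4 ^ n\<close>.\<close>
  obtain r :: "nat \<Rightarrow> nat" where r: "strict_mono r"
    "\<And>n m k. m \<ge> r n \<Longrightarrow> k \<ge> r n \<Longrightarrow> L2_norm_on X (\<lambda>x. f m x - f k x) < (1/4) ^ n"
    using fast_subsequence[of "\<lambda>m n. L2_norm_on X (\<lambda>x. f m x - f n x)" "\<lambda>n. (1/4) ^ n"] Cauchy by auto
  define h where "h n x = 4 ^ n * (norm (f (r (Suc n)) x - f (r n) x))\<^sup>2" for n x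
  have [measurable]: "h n \<in> borel_measurable ?M" for n unfolding h_def by measurable
  have "(\<integral>\<^sup>+x. (\<Sum>n. ennreal (h n x)) \<partial>?M) = (\<Sum>n. \<integral>\<^sup>+x. ennreal (h n x) \<partial>?M)"
    by (rule nn_integral_suminf) measurable
  also have "\<dots> \<le> (\<Sum>n. ennreal ((1/4) ^ n))"
  proof (intro suminf_le allI)
    fix n
    have "(\<integral>\<^sup>+x. ennreal (h n x) \<partial>?M) = ennreal (4 ^ n) * ennreal ((L2_norm_on X (\<lambda>x. f (r (Suc n)) x - f (r n) x))\<^sup>2)"
      unfolding h_def nn[symmetric] by (simp add: ennreal_mult nn_integral_cmult)
    also have "\<dots> \<le> ennreal (4 ^ n) * ennreal (((1/4) ^ n)\<^sup>2)"
      using r(2)[of n "r (Suc n)" "r n"] strict_monoD[OF r(1), of n "Suc n"]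
      by (intro mult_left_mono ennreal_leI power_mono) (auto intro: less_imp_le)
    also have "\<dots> = ennreal ((1/4) ^ n)"
      by (simp add: ennreal_mult[symmetric] power2_eq_square power_divide)
    finally show "(\<integral>\<^sup>+x. ennreal (h n x) \<partial>?M) \<le> ennreal ((1/4) ^ n)" .
  qed auto
  also have "\<dots> = ennreal (\<Sum>n. (1/4) ^ n)"
    by (rule suminf_ennreal2) (auto intro: summable_geometric)
  also have "\<dots> < top" by simp
  finally have "(\<integral>\<^sup>+x. (\<Sum>n. ennreal (h n x)) \<partial>?M) \<noteq> \<infinity>" by simp
  then have "AE x in ?M. (\<Sum>n. ennreal (h n x)) \<noteq> \<infinity>"
    by (intro nn_integral_PInf_AE) measurable
  then have conv: "AE x in ?M. convergent (\<lambda>n. f (r n) x)"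
  proof eventually_elim
    case (elim x)
    have "summable (\<lambda>n. h n x)"
      by (rule summable_suminf_not_top) (use elim in \<open>auto simp: h_def\<close>)
    then show ?case unfolding h_def by (rule convergent_of_fast_differences)
  qed
  \<comment> \<open>\<open>lim\<close> is a total function, so \<open>g\<close> is measurable
    everywhere although it is the limit only outside a null set.\<close>
  define g where "g x = lim (\<lambda>n. f (r n) x)" for x
  have [measurable]: "g \<in> borel_measurable ?M" unfolding g_def by measurable
  have lim: "AE x in ?M. (\<lambda>n. f (r n) x) \<longlonglongrightarrow> g x"
    using conv by eventually_elim (simp add: g_def convergent_LIMSEQ_iff)
  \<comment> \<open>Fatou's lemma: the distance from \<open>f n\<close> to \<open>g\<close> is at
    most the lower limit of its distances to the members of the subsequence, all of which lie below
    \<open>e\<close> eventually.\<close>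
  have key: "(\<lambda>x. f n x - g x) \<in> L2 X \<and> L2_norm_on X (\<lambda>x. f n x - g x) \<le> e"
    if "e > 0" "\<forall>m\<ge>N. \<forall>n\<ge>N. L2_norm_on X (\<lambda>x. f m x - f n x) < e" "n \<ge> N" for e N n
  proof -
    have "(\<integral>\<^sup>+x. ennreal ((norm (f n x - g x))\<^sup>2) \<partial>?M) = (\<integral>\<^sup>+x. liminf (\<lambda>k. ennreal ((norm (f n x - f (r k) x))\<^sup>2)) \<partial>?M)"
    proof (rule nn_integral_cong_AE)
      show "AE x in ?M. ennreal ((norm (f n x - g x))\<^sup>2) = liminf (\<lambda>k. ennreal ((norm (f n x - f (r k) x))\<^sup>2))"
        using lim
      proof eventually_elim
        case (elim x)
        then have "(\<lambda>k. ennreal ((norm (f n x - f (r k) x))\<^sup>2)) \<longlonglongrightarrow> ennreal ((norm (f n x - g x))\<^sup>2)"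
          by (intro tendsto_ennrealI tendsto_intros)
        then show ?case by (rule lim_imp_Liminf[OF sequentially_bot, symmetric])
      qed
    qed
    also have "\<dots> \<le> liminf (\<lambda>k. \<integral>\<^sup>+x. ennreal ((norm (f n x - f (r k) x))\<^sup>2) \<partial>?M)"
      by (rule nn_integral_liminf) measurable
    also have "\<dots> \<le> ennreal (e\<^sup>2)"
    proof -
      have "\<forall>\<^sub>F k in sequentially. (\<integral>\<^sup>+x. ennreal ((norm (f n x - f (r k) x))\<^sup>2) \<partial>?M) \<le> ennreal (e\<^sup>2)"
        unfolding eventually_sequentially nn
      proof (intro exI[of _ N] allI impI ennreal_leI power_mono)
        fix k assume "k \<ge> N"
        then have "r k \<ge> N" using strict_mono_imp_increasing[OF r(1), of k] by simp
        then show "L2_norm_on X (\<lambda>x. f n x - f (r k) x) \<le> e" using that by (simp add: less_imp_le)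
      qed auto
      then have "liminf (\<lambda>k. \<integral>\<^sup>+x. ennreal ((norm (f n x - f (r k) x))\<^sup>2) \<partial>?M) \<le> liminf (\<lambda>k::nat. ennreal (e\<^sup>2))"
        by (rule Liminf_mono)
      then show ?thesis by (simp add: Liminf_const)
    qed
    finally have le: "(\<integral>\<^sup>+x. ennreal ((norm (f n x - g x))\<^sup>2) \<partial>?M) \<le> ennreal (e\<^sup>2)" .
    then have int: "integrable ?M (\<lambda>x. (norm (f n x - g x))\<^sup>2)"
      by (intro integrableI_bounded) (auto simp: order_le_less_trans)
    then have "ennreal (LINT x|?M. (norm (f n x - g x))\<^sup>2) \<le> ennreal (e\<^sup>2)"
      using le nn_integral_eq_integral[OF int] by simp
    then have "(LINT x|?M. (norm (f n x - g x))\<^sup>2) \<le> e\<^sup>2" by (subst (asm) ennreal_le_iff) auto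
    then have "L2_norm_on X (\<lambda>x. f n x - g x) \<le> sqrt (e\<^sup>2)"
      unfolding L2_norm_on_def by (rule real_sqrt_le_mono)
    with int \<open>e > 0\<close> show ?thesis by (simp add: L2_def)
  qed
  have "g \<in> L2 X"
  proof -
    obtain N where "\<forall>m\<ge>N. \<forall>n\<ge>N. L2_norm_on X (\<lambda>x. f m x - f n x) < 1" using Cauchy[of 1] by auto
    then have "(\<lambda>x. f N x - g x) \<in> L2 X" using key[of 1 N N] by auto
    from L2_diff[OF f[of N] this] show ?thesis by simp
  qed
  moreover have "(\<lambda>n. L2_norm_on X (\<lambda>x. f n x - g x)) \<longlonglongrightarrow> 0"
  proof (rule LIMSEQ_I)
    fix e :: real assume "e > 0"
    then obtain N where N: "\<forall>m\<ge>N. \<forall>n\<ge>N. L2_norm_on X (\<lambda>x. f m x - f n x) < e/2" using Cauchy[of "e/2"] by auto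
    have "\<forall>n\<ge>N. norm (L2_norm_on X (\<lambda>x. f n x - g x) - 0) < e"
      using key[OF _ N] \<open>e > 0\<close> by fastforce
    then show "\<exists>N. \<forall>n\<ge>N. norm (L2_norm_on X (\<lambda>x. f n x - g x) - 0) < e" by blast
  qed
  ultimately show ?thesis by (rule that)
qed

lemma null_sequence_comparison:
  fixes a :: "nat \<Rightarrow> real"
  assumes "\<And>n. \<bar>a n\<bar> \<le> b n" "b \<longlonglongrightarrow> 0" shows "a \<longlonglongrightarrow> 0"
  using Lim_null_comparison[OF always_eventually assms(2), of a] assms(1) by simp

lemma ip_tendsto:
  assumes "\<And>n. f n \<in> L2 X" "g \<in> L2 X" "(\<lambda>n. L2_norm_on X (\<lambda>x. f n x - g x)) \<longlonglongrightarrow> 0" "h \<in> L2 X"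
  shows "(\<lambda>n. ip X (f n) h) \<longlonglongrightarrow> ip X g h"
proof -
  have "(\<lambda>n. L2_norm_on X (\<lambda>x. f n x - g x) * L2_norm_on X h) \<longlonglongrightarrow> 0"
    using tendsto_mult_left_zero[OF assms(3)] by simp
  moreover have "\<bar>ip X (f n) h - ip X g h\<bar> \<le> L2_norm_on X (\<lambda>x. f n x - g x) * L2_norm_on X h" for n
    using ip_Cauchy_Schwarz[OF L2_diff[OF assms(1,2)] assms(4)] assms by (simp add: ip_linear)
  ultimately have "(\<lambda>n. ip X (f n) h - ip X g h) \<longlonglongrightarrow> 0"
    by (intro null_sequence_comparison[of "\<lambda>n. ip X (f n) h - ip X g h"])
  then show ?thesis by (simp add: LIM_zero_iff)
qed

lemma L2_norm_tendsto:
  assumes "\<And>n. f n \<in> L2 X" "g \<in> L2 X" "(\<lambda>n. L2_norm_on X (\<lambda>x. f n x - g x)) \<longlonglongrightarrow> 0"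
  shows "(\<lambda>n. L2_norm_on X (f n)) \<longlonglongrightarrow> L2_norm_on X g"
proof -
  have "\<bar>L2_norm_on X (f n) - L2_norm_on X g\<bar> \<le> L2_norm_on X (\<lambda>x. f n x - g x)" for n
    using L2_norm_triangle[OF L2_diff[OF assms(1,2)] assms(2), of n]
      L2_norm_triangle[OF L2_diff[OF assms(2,1)] assms(1), of n n] L2_norm_diff_commute[of X "f n" g]
    by (auto simp: abs_le_iff)
  then have "(\<lambda>n. L2_norm_on X (f n) - L2_norm_on X g) \<longlonglongrightarrow> 0"
    using assms(3) by (rule null_sequence_comparison)
  then show ?thesis by (simp add: LIM_zero_iff)
qed

lemma L2_limit_unique:
  assumes "\<And>n. f n \<in> L2 X" "g \<in> L2 X" "h \<in> L2 X"
    "(\<lambda>n. L2_norm_on X (\<lambda>x. f n x - g x)) \<longlonglongrightarrow> 0" "(\<lambda>n. L2_norm_on X (\<lambda>x. f n x - h x)) \<longlonglongrightarrow> 0"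
  shows "AE x in lebesgue_on X. g x = h x"
proof -
  have "L2_norm_on X (\<lambda>x. g x - h x) \<le> L2_norm_on X (\<lambda>x. f n x - g x) + L2_norm_on X (\<lambda>x. f n x - h x)" for n
    using L2_norm_triangle3[OF assms(2) assms(1) assms(3), of n] L2_norm_diff_commute[of X "f n" g] by simp
  then have "L2_norm_on X (\<lambda>x. g x - h x) \<le> 0"
    using tendsto_add[OF assms(4,5)] by (intro LIMSEQ_le_const[of _ "0"]) auto
  then have "AE x in lebesgue_on X. g x - h x = 0"
    by (intro L2_norm_zero_AE L2_diff assms) (simp add: antisym)
  then show ?thesis by simp
qed

text \<open>The first-order optimality condition: \<open>e\<close> is the step along a test
  direction at a minimizer, \<open>b\<close> the derivative and \<open>c\<close> the
  curvature.\<close>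

lemma linear_term_zero:
  fixes b c :: real assumes "\<And>e. 0 \<le> e * b + e\<^sup>2 * c" "0 \<le> c" shows "b = 0"
proof (rule ccontr)
  assume b: "b \<noteq> 0"
  \<comment> \<open>A step against the sign of \<open>b\<close>; the denominator
    \<open>c + 1\<close> also covers vanishing curvature.\<close>
  have "0 \<le> (- b / (c + 1)) * b + (- b / (c + 1))\<^sup>2 * c" by (rule assms(1))
  also have "\<dots> = - (b\<^sup>2 / (c + 1)\<^sup>2)"
  proof -
    have c: "c + 1 \<noteq> 0" using assms(2) by simp
    have "(- b / (c + 1)) * b + (- b / (c + 1))\<^sup>2 * c = (b\<^sup>2 / (c + 1)\<^sup>2) * (c - (c + 1))"
      using c by (simp add: divide_simps) (simp add: power2_eq_square algebra_simps)
    then show ?thesis by simp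
  qed
  also have "\<dots> < 0" using b assms(2) by (simp add: add_nonneg_pos)
  finally show False by simp
qed

text \<open>
  The range of \<open>D\<close> need not be closed, hence \<open>f\<close> is only a limit of elements of the range. It is
  the limit of a sequence minimizing \<open>\<parallel>D v\<parallel>\<^sup>2 / 2 - l v\<close>.
\<close>

lemma riesz_L2:
  fixes D :: "'v \<Rightarrow> 'd::euclidean_space \<Rightarrow> 'a::euclidean_space" and l :: "'v \<Rightarrow> real"
  assumes comb: "\<And>u v a b. u \<in> S \<Longrightarrow> v \<in> S \<Longrightarrow>
      \<exists>w\<in>S. (AE x in lebesgue_on X. D w x = a *\<^sub>R D u x + b *\<^sub>R D v x) \<and> l w = a * l u + b * l v"
    and D: "\<And>v. v \<in> S \<Longrightarrow> D v \<in> L2 X"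
    and bnd: "\<And>v. v \<in> S \<Longrightarrow> \<bar>l v\<bar> \<le> C * L2_norm_on X (D v)" and "S \<noteq> {}" and C: "C \<ge> 0"
  obtains f u where "f \<in> L2 X" "\<And>n::nat. u n \<in> S"
    "(\<lambda>n. L2_norm_on X (\<lambda>x. D (u n) x - f x)) \<longlonglongrightarrow> 0"
    "\<And>v. v \<in> S \<Longrightarrow> l v = ip X f (D v)" "L2_norm_on X f \<le> C"
proof -
  define J where "J v = ip X (D v) (D v) / 2 - l v" for v
  have comb': "\<exists>w\<in>S. l w = a * l u + b * l v \<and>
     ip X (D w) (D w) = a\<^sup>2 * ip X (D u) (D u) + 2 * a * b * ip X (D u) (D v) + b\<^sup>2 * ip X (D v) (D v)"
    if uv: "u \<in> S" "v \<in> S" for u v a b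
  proof -
    obtain w where w: "w \<in> S" "AE x in lebesgue_on X. D w x = a *\<^sub>R D u x + b *\<^sub>R D v x" "l w = a * l u + b * l v"
      using comb[OF uv] by blast
    have "ip X (D w) (D w) = ip X (\<lambda>x. a *\<^sub>R D u x + b *\<^sub>R D v x) (\<lambda>x. a *\<^sub>R D u x + b *\<^sub>R D v x)"
      using w uv D by (intro ip_cong_AE L2_measurable L2_add L2_scaleR) auto
    also have "\<dots> = a\<^sup>2 * ip X (D u) (D u) + 2 * a * b * ip X (D u) (D v) + b\<^sup>2 * ip X (D v) (D v)"
      using uv D by (simp add: ip_linear L2_add L2_scaleR ip_commute[of X "D v" "D u"] power2_eq_square algebra_simps)
    finally show ?thesis using w by blast
  qed
  \<comment> \<open>Completing the square: the energy is bounded below because the linear term is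
    dominated by \<open>C\<close> times the norm of \<open>D v\<close>.\<close>
  have Jlow: "J v \<ge> - (C\<^sup>2 / 2)" if "v \<in> S" for v
  proof -
    have "0 \<le> (L2_norm_on X (D v) - C)\<^sup>2 / 2" by simp
    then show ?thesis using bnd[OF that]
      by (simp add: J_def L2_norm_sq[symmetric] power2_diff abs_le_iff mult.commute)
  qed
  define m where "m = Inf (J ` S)"
  have bdd: "bdd_below (J ` S)" using Jlow by (auto intro!: bdd_belowI)
  have mle: "m \<le> J v" if "v \<in> S" for v unfolding m_def using bdd that by (auto intro: cInf_lower)
  have "\<exists>u\<in>S. J u < m + 1 / real (Suc n)" for n
    using cInf_less_iff[of "J ` S" "m + 1 / real (Suc n)"] bdd \<open>S \<noteq> {}\<close> by (auto simp: m_def)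
  then obtain u where u: "\<And>n. u n \<in> S" "\<And>n. J (u n) < m + 1 / real (Suc n)" by metis
  let ?d = "\<lambda>i j. L2_norm_on X (\<lambda>x. D (u i) x - D (u j) x)"
  \<comment> \<open>The parallelogram identity with the midpoint \<open>w\<close>. Since the energy
    of \<open>w\<close> is at least the infimum, two nearly minimizing elements must have images
    close to each other.\<close>
  have par: "(?d i j)\<^sup>2 \<le> 4 * (1 / real (Suc i) + 1 / real (Suc j))" for i j
  proof -
    obtain w where w: "w \<in> S" "l w = 1/2 * l (u i) + 1/2 * l (u j)"
      "ip X (D w) (D w) = (1/2)\<^sup>2 * ip X (D (u i)) (D (u i)) + 2 * (1/2) * (1/2) * ip X (D (u i)) (D (u j)) + (1/2)\<^sup>2 * ip X (D (u j)) (D (u j))"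
      using comb'[OF u(1) u(1)] by blast
    have "(?d i j)\<^sup>2 = ip X (D (u i)) (D (u i)) - 2 * ip X (D (u i)) (D (u j)) + ip X (D (u j)) (D (u j))"
      using u D by (simp add: L2_norm_sq ip_linear L2_diff ip_commute[of X "D (u j)" "D (u i)"])
    then have "(?d i j)\<^sup>2 = 4 * J (u i) + 4 * J (u j) - 8 * J w"
      unfolding J_def w by (simp add: field_simps power2_eq_square)
    with mle[OF w(1)] u(2)[of i] u(2)[of j] show ?thesis by (simp add: algebra_simps)
  qed
  have Cauchy: "\<exists>N. \<forall>i\<ge>N. \<forall>j\<ge>N. ?d i j < e" if "e > 0" for e
  proof -
    obtain N where N: "1 / real (Suc N) < e\<^sup>2 / 8"
      using reals_Archimedean[of "e\<^sup>2 / 8"] \<open>e > 0\<close> by (auto simp: inverse_eq_divide)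
    have "?d i j < e" if "i \<ge> N" "j \<ge> N" for i j
    proof -
      have "1 / real (Suc i) \<le> 1 / real (Suc N)" "1 / real (Suc j) \<le> 1 / real (Suc N)"
        using that by (auto intro!: divide_left_mono)
      then have "4 * (1 / real (Suc i) + 1 / real (Suc j)) \<le> 4 * (1 / real (Suc N) + 1 / real (Suc N))"
        by (intro mult_left_mono add_mono) auto
      also have "\<dots> < e\<^sup>2" using N by (simp add: field_simps)
      finally have "(?d i j)\<^sup>2 < e\<^sup>2" using par[of i j] by (rule order_le_less_trans[rotated])
      then show ?thesis using \<open>e > 0\<close> by (simp add: power2_less_imp_less)
    qed
    then show ?thesis by blast
  qed
  obtain f where f: "f \<in> L2 X" "(\<lambda>n. L2_norm_on X (\<lambda>x. D (u n) x - f x)) \<longlonglongrightarrow> 0"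
    using L2_complete[of "\<lambda>n. D (u n)" X] D u Cauchy by blast
  have rep: "l v = ip X f (D v)" if v: "v \<in> S" for v
  proof -
    \<comment> \<open>Each \<open>u n\<close> minimizes only up to \<open>1 / (n + 1)\<close>, so
      the variational inequality holds with this slack, which disappears in the limit.\<close>
    have "0 \<le> e * (ip X f (D v) - l v) + e\<^sup>2 * (ip X (D v) (D v) / 2)" for e
    proof -
      have "- (1 / real (Suc n)) \<le> e * (ip X (D (u n)) (D v) - l v) + e\<^sup>2 * (ip X (D v) (D v) / 2)" for n
      proof -
        obtain w where w: "w \<in> S" "l w = 1 * l (u n) + e * l v"
          "ip X (D w) (D w) = 1\<^sup>2 * ip X (D (u n)) (D (u n)) + 2 * 1 * e * ip X (D (u n)) (D v) + e\<^sup>2 * ip X (D v) (D v)"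
          using comb'[OF u(1) v] by blast
        have "J w = J (u n) + e * (ip X (D (u n)) (D v) - l v) + e\<^sup>2 * (ip X (D v) (D v) / 2)"
          unfolding J_def w by (simp add: field_simps)
        with mle[OF w(1)] u(2)[of n] show ?thesis by linarith
      qed
      moreover have "(\<lambda>n. e * (ip X (D (u n)) (D v) - l v) + e\<^sup>2 * (ip X (D v) (D v) / 2))
          \<longlonglongrightarrow> e * (ip X f (D v) - l v) + e\<^sup>2 * (ip X (D v) (D v) / 2)"
        by (intro tendsto_intros ip_tendsto f D u v)
      moreover have "(\<lambda>n. - (1 / real (Suc n))) \<longlonglongrightarrow> - 0"
        by (intro tendsto_minus lim_1_over_real_power[of 1, simplified] LIMSEQ_Suc[OF lim_const_over_n[of 1]])
      ultimately show ?thesis using LIMSEQ_le by fastforce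
    qed
    then have "ip X f (D v) - l v = 0"
      by (rule linear_term_zero) (simp add: L2_norm_sq[symmetric])
    then show ?thesis by simp
  qed
  \<comment> \<open>The limit \<open>f\<close> need not have the form \<open>D v\<close>, so the
    bound of the functional is applied to \<open>u n\<close> and passed to the limit.\<close>
  have "(L2_norm_on X f)\<^sup>2 \<le> C * L2_norm_on X f"
  proof (rule LIMSEQ_le)
    show "(\<lambda>n. ip X (D (u n)) f) \<longlonglongrightarrow> (L2_norm_on X f)\<^sup>2"
      using ip_tendsto[of "\<lambda>n. D (u n)" X f f] f D u by (simp add: L2_norm_sq)
    show "(\<lambda>n. C * L2_norm_on X (D (u n))) \<longlonglongrightarrow> C * L2_norm_on X f"
      using L2_norm_tendsto[of "\<lambda>n. D (u n)" X f] f D u by (intro tendsto_intros) auto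
    show "\<exists>N. \<forall>n\<ge>N. ip X (D (u n)) f \<le> C * L2_norm_on X (D (u n))"
      using bnd u rep by (metis abs_le_iff ip_commute)
  qed
  then have "L2_norm_on X f \<le> C"
    using C by (cases "L2_norm_on X f = 0") (auto simp: power2_eq_square mult_le_cancel_right less_le)
  with f u rep that show ?thesis by blast
qed

section \<open>Smooth functions\<close>

lemma UNIV_2_pt: "(UNIV :: 2 set) = {1, 2}" and sum_2_pt: "sum f (UNIV::2 set) = f 1 + f 2"
  by (rule UNIV_2) (simp add: sum_2)

lemma inner_2: "x \<bullet> y = x $ 1 * y $ 1 + x $ 2 * y $ (2::2)" for x y :: point
  by (simp add: inner_vec_def sum_2)

lemma grad_eqI: "(f has_derivative f') (at x) \<Longrightarrow> grad f x = (\<chi> i. f' (axis i 1))"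
  by (simp add: grad_def frechet_derivative_at[symmetric])

lemma grad_eqI_inner: "(f has_derivative (\<lambda>h. v \<bullet> h)) (at x) \<Longrightarrow> grad f x = v"
  by (simp add: grad_eqI vec_eq_iff inner_axis)

lemma has_derivative_grad:
  assumes "f differentiable (at x)"
  shows "(f has_derivative (\<lambda>h. grad f x \<bullet> h)) (at x)"
proof -
  obtain f' where f': "(f has_derivative f') (at x)" using assms by (auto simp: differentiable_def)
  then have l: "linear f'" by (rule has_derivative_linear)
  have "f' = (\<lambda>h. grad f x \<bullet> h)"
  proof (rule ext)
    fix h
    have "f' h = f' (\<Sum>i\<in>UNIV. (h $ i) *\<^sub>R axis i 1)"
      by (rule arg_cong[of _ _ f']) (simp add: vec_eq_iff axis_def if_distrib cong: if_cong)
    also have "\<dots> = grad f x \<bullet> h"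
      by (simp add: linear_sum[OF l] linear_scale[OF l] grad_eqI[OF f'] inner_vec_def mult.commute)
    finally show "f' h = grad f x \<bullet> h" .
  qed
  with f' show ?thesis by simp
qed

lemma grad_const [simp]: "grad (\<lambda>x. c) x = 0"
  by (rule grad_eqI_inner) simp

lemma grad_nth [simp]: "grad (\<lambda>x. x $ i) x = axis i 1"
  by (rule grad_eqI_inner) (simp add: inner_axis' bounded_linear_imp_has_derivative bounded_linear_vec_nth)

lemma grad_add:
  assumes "f differentiable (at x)" "g differentiable (at x)"
  shows "grad (\<lambda>x. f x + g x) x = grad f x + grad g x"
  by (rule grad_eqI_inner)
    (use has_derivative_add[OF assms[THEN has_derivative_grad]] in \<open>simp add: inner_add_left\<close>)

lemma grad_mult:
  assumes "f differentiable (at x)" "g differentiable (at x)"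
  shows "grad (\<lambda>x. f x * g x) x = f x *\<^sub>R grad g x + g x *\<^sub>R grad f x"
  by (rule grad_eqI_inner)
    (use has_derivative_mult[OF assms[THEN has_derivative_grad]] in \<open>simp add: inner_add_left mult.commute\<close>)

lemma grad_cmult:
  assumes "f differentiable (at x)" shows "grad (\<lambda>x. c * f x) x = c *\<^sub>R grad f x"
  using grad_mult[of "\<lambda>_. c" x f] assms by simp

lemma grad_compose_real:
  assumes "(h has_real_derivative h') (at (f x))" "f differentiable (at x)"
  shows "(\<lambda>x. h (f x)) differentiable (at x)" "grad (\<lambda>x. h (f x)) x = h' *\<^sub>R grad f x"
proof -
  have "((\<lambda>x. h (f x)) has_derivative (\<lambda>v. h' * (grad f x \<bullet> v))) (at x)"
    using has_derivative_compose[OF has_derivative_grad[OF assms(2)], of h "\<lambda>t. h' * t"] assms(1)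
    by (simp add: has_field_derivative_def)
  then show "(\<lambda>x. h (f x)) differentiable (at x)" "grad (\<lambda>x. h (f x)) x = h' *\<^sub>R grad f x"
    by (auto simp: differentiable_def intro!: grad_eqI_inner)
qed

lemma grad_compose_affine:
  fixes A :: "point \<Rightarrow> point"
  assumes "linear A" "f differentiable (at (A x + b))"
  shows "(\<lambda>x. f (A x + b)) differentiable (at x)"
    and "grad (\<lambda>x. f (A x + b)) x $ i = grad f (A x + b) \<bullet> A (axis i 1)"
proof -
  have "((\<lambda>x. A x + b) has_derivative A) (at x)"
    using linear_imp_has_derivative[OF assms(1)] by (simp add: has_derivative_add_const)
  from has_derivative_compose[OF this has_derivative_grad[OF assms(2)]]
  have "((\<lambda>x. f (A x + b)) has_derivative (\<lambda>h. grad f (A x + b) \<bullet> A h)) (at x)" .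
  then show "(\<lambda>x. f (A x + b)) differentiable (at x)"
    "grad (\<lambda>x. f (A x + b)) x $ i = grad f (A x + b) \<bullet> A (axis i 1)"
    by (auto simp: differentiable_def grad_eqI)
qed

text \<open>\<open>Ck (Suc k)\<close> does not contain \<open>Ck k\<close> by definition; at the
  bottom of the induction differentiability supplies the continuity.\<close>

lemma Ck_pred: "Ck (Suc k) f \<Longrightarrow> Ck k f"
proof (induction k arbitrary: f)
  case 0
  then show ?case
    by (auto simp: continuous_on_eq_continuous_at differentiable_imp_continuous_within)
qed auto

lemma Ck_mono: "Ck k f \<Longrightarrow> j \<le> k \<Longrightarrow> Ck j f"
proof (induction k)
  case (Suc k) then show ?case using Ck_pred le_Suc_eq by blast
qed simp

lemma Ck_continuous: "Ck k f \<Longrightarrow> continuous_on UNIV f"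
  using Ck_mono[of k f 0] by simp

lemma Ck_const: "Ck k (\<lambda>x. c)"
  by (induction k arbitrary: c) auto

lemma Ck_nth: "Ck k (\<lambda>x. x $ i)"
  by (cases k) (auto intro!: continuous_intros simp: Ck_const bounded_linear_imp_differentiable bounded_linear_vec_nth)

lemma Ck_add: "Ck k f \<Longrightarrow> Ck k g \<Longrightarrow> Ck k (\<lambda>x. f x + g x)"
  by (induction k arbitrary: f g) (auto intro!: continuous_on_add simp: grad_add)

lemma Ck_mult: "Ck k f \<Longrightarrow> Ck k g \<Longrightarrow> Ck k (\<lambda>x. f x * g x)"
proof (induction k arbitrary: f g)
  case 0 then show ?case by (auto intro!: continuous_on_mult)
next
  case (Suc k)
  then show ?case
    using Ck_pred[OF Suc.prems(1)] Ck_pred[OF Suc.prems(2)]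
    by (auto simp: grad_mult intro!: Ck_add)
qed

lemma Ck_sum: "(\<And>i. i \<in> I \<Longrightarrow> Ck k (f i)) \<Longrightarrow> Ck k (\<lambda>x. \<Sum>i\<in>I. f i x)"
  by (induction I rule: infinite_finite_induct) (auto intro: Ck_const Ck_add)

lemma Ck_affine:
  fixes A :: "point \<Rightarrow> point"
  assumes "linear A" shows "Ck k f \<Longrightarrow> Ck k (\<lambda>x. f (A x + b))"
proof (induction k arbitrary: f)
  case 0
  have "continuous_on UNIV (\<lambda>x. A x + b)"
    using linear_continuous_on[of A UNIV] assms linear_conv_bounded_linear by (auto intro!: continuous_intros)
  then show ?case using 0 by (auto intro: continuous_on_compose2)
next
  case (Suc k)
  then show ?case
    by (auto simp: grad_compose_affine[OF assms] inner_vec_def intro!: Ck_sum Ck_mult Ck_const)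
qed

lemma smooth_Ck: "smooth f \<Longrightarrow> Ck k f"
  by (simp add: smooth_def)

lemma smooth_const [intro]: "smooth (\<lambda>x. c)" by (simp add: smooth_def Ck_const)
lemma smooth_nth [intro]: "smooth (\<lambda>x. x $ i)" by (simp add: smooth_def Ck_nth)
lemma smooth_add [intro]: "smooth f \<Longrightarrow> smooth g \<Longrightarrow> smooth (\<lambda>x. f x + g x)" by (simp add: smooth_def Ck_add)
lemma smooth_mult [intro]: "smooth f \<Longrightarrow> smooth g \<Longrightarrow> smooth (\<lambda>x. f x * g x)" by (simp add: smooth_def Ck_mult)
lemma smooth_diff [intro]: "smooth f \<Longrightarrow> smooth g \<Longrightarrow> smooth (\<lambda>x. f x - g x)"
  using smooth_add[of f "\<lambda>x. -1 * g x"] smooth_mult[of "\<lambda>x. -1" g] by auto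
lemma smooth_affine: "linear A \<Longrightarrow> smooth f \<Longrightarrow> smooth (\<lambda>x. f (A x + b))" by (simp add: smooth_def Ck_affine)
lemma smooth_grad: "smooth f \<Longrightarrow> smooth (\<lambda>x. grad f x $ i)"
  unfolding smooth_def by (metis Ck.simps(2))
lemma smooth_differentiable: "smooth f \<Longrightarrow> f differentiable (at x)"
  using smooth_Ck[of f "Suc 0"] by simp
lemma smooth_continuous: "smooth f \<Longrightarrow> continuous_on A f"
  using smooth_Ck[of f 0] continuous_on_subset by auto
lemma smooth_continuous_grad: "smooth f \<Longrightarrow> continuous_on A (grad f)"
  using smooth_continuous[OF smooth_grad] by (auto simp: continuous_on_componentwise[of A "grad f"] Basis_vec_def inner_axis)

section \<open>A smooth bump function\<close>

text \<open>The classical function \<open>exp (- (1 / t))\<close>, extended by zero, together with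
  its products with negative powers of \<open>t\<close>. The family is closed under differentiation
  up to linear combinations, which makes smoothness a single induction.\<close>

definition bump :: "nat \<Rightarrow> real \<Rightarrow> real" where
  "bump n t = (if t > 0 then (1 / t) ^ n * exp (- (1 / t)) else 0)"

text \<open>With \<open>u = 1 / t\<close> this is the decay of \<open>u ^ n / exp u\<close> at
  infinity.\<close>

lemma bump_tendsto_0: "(bump n \<longlongrightarrow> 0) (at_right 0)"
proof -
  have "((\<lambda>u. u ^ n / exp u) \<longlongrightarrow> (0::real)) at_top" by (rule tendsto_power_div_exp_0)
  from filterlim_compose[OF this filterlim_inverse_at_top_right]
  have "((\<lambda>t::real. inverse t ^ n / exp (inverse t)) \<longlongrightarrow> 0) (at_right 0)" .
  then show ?thesis
    by (rule Lim_transform_eventually)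
      (auto simp: eventually_at_right_field bump_def divide_simps exp_minus intro!: exI[of _ 1])
qed

lemma bump_derivative:
  "(bump n has_real_derivative (- real n * bump (Suc n) t + bump (Suc (Suc n)) t)) (at t)"
proof -
  consider "t > 0" | "t < 0" | "t = 0" by linarith
  then show ?thesis
  proof cases
    case 1
    have d1: "((\<lambda>t. 1 / t) has_real_derivative - (1 / t\<^sup>2)) (at t)"
      using 1 by (auto intro!: derivative_eq_intros simp: power2_eq_square)
    have "((\<lambda>t. (1 / t) ^ n * exp (- (1 / t))) has_real_derivative
        real n * (- (1 / t\<^sup>2) * (1 / t) ^ (n - Suc 0)) * exp (- (1 / t)) + exp (- (1 / t)) * (- (- (1 / t\<^sup>2))) * (1 / t) ^ n) (at t)"
      by (rule DERIV_mult[OF DERIV_power[OF d1] DERIV_fun_exp[OF DERIV_minus[OF d1]]])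
    also have "real n * (- (1 / t\<^sup>2) * (1 / t) ^ (n - Suc 0)) * exp (- (1 / t)) + exp (- (1 / t)) * (- (- (1 / t\<^sup>2))) * (1 / t) ^ n
        = - real n * bump (Suc n) t + bump (Suc (Suc n)) t"
      using 1 by (cases n) (auto simp: bump_def power2_eq_square diff_divide_distrib add_divide_distrib algebra_simps)
    finally show ?thesis
      by (rule has_field_derivative_transform_within_open[of _ _ _ "{0<..}"]) (use 1 in \<open>auto simp: bump_def\<close>)
  next
    case 2
    have "((\<lambda>t. 0) has_real_derivative 0) (at t)" by simp
    then have "(bump n has_real_derivative 0) (at t)"
      by (rule has_field_derivative_transform_within_open[of _ _ _ "{..<0}"]) (use 2 in \<open>auto simp: bump_def\<close>)
    then show ?thesis using 2 by (simp add: bump_def)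
  next
    case 3
    \<comment> \<open>To the right of zero the difference quotient is \<open>bump (Suc n) h\<close>,
      which is known to vanish in the limit.\<close>
    have "((\<lambda>h. bump n h / h) \<longlongrightarrow> 0) (at_right 0)"
      by (rule Lim_transform_eventually[OF bump_tendsto_0[of "Suc n"]])
        (auto simp: eventually_at_right_field bump_def divide_simps intro!: exI[of _ 1])
    moreover have "((\<lambda>h. bump n h / h) \<longlongrightarrow> 0) (at_left 0)"
      by (rule Lim_transform_eventually[OF tendsto_const[of 0]])
        (auto simp: eventually_at_left_field bump_def intro!: exI[of _ "-1"])
    ultimately have "((\<lambda>h. bump n h / h) \<longlongrightarrow> 0) (at 0)" by (simp add: filterlim_split_at)
    then have "(bump n has_real_derivative 0) (at 0)" by (simp add: DERIV_def bump_def)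
    then show ?thesis using 3 by (simp add: bump_def)
  qed
qed

text \<open>The induction runs over all \<open>n\<close> at once, because differentiation raises the
  index of \<open>bump\<close>.\<close>

lemma Ck_bump: assumes "smooth p" shows "Ck k (\<lambda>x. bump n (p x))"
proof (induction k arbitrary: n)
  case 0
  have "continuous_on UNIV (bump n)"
    using DERIV_isCont[OF bump_derivative] by (simp add: continuous_on_eq_continuous_at)
  then show ?case using smooth_continuous[OF assms] by (auto intro: continuous_on_compose2)
next
  case (Suc k)
  have d: "p differentiable (at x)" for x using assms by (rule smooth_differentiable)
  have "grad (\<lambda>x. bump n (p x)) x $ i = (- real n * bump (Suc n) (p x) + bump (Suc (Suc n)) (p x)) * (grad p x $ i)" for x i
    by (simp add: grad_compose_real(2)[OF bump_derivative d])
  moreover have "Ck k (\<lambda>x. (- real n * bump (Suc n) (p x) + bump (Suc (Suc n)) (p x)) * (grad p x $ i))" for i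
    by (intro Ck_mult Ck_add Ck_const Suc smooth_Ck[OF smooth_grad[OF assms]])
  ultimately show ?case using grad_compose_real(1)[OF bump_derivative d] by simp
qed

lemma smooth_bump: "smooth p \<Longrightarrow> smooth (\<lambda>x. bump n (p x))"
  by (simp add: smooth_def Ck_bump)

section \<open>Continuous functions on bounded sets\<close>

lemma bounded_lebesgue_lmeasurable:
  "bounded X \<Longrightarrow> X \<in> sets lebesgue \<Longrightarrow> X \<in> lmeasurable"
  using bounded_set_imp_lmeasurable by blast

lemma continuous_measurable_lebesgue_on:
  fixes f :: "'a::euclidean_space \<Rightarrow> 'b::euclidean_space"
  assumes "continuous_on UNIV f" shows "f \<in> borel_measurable (lebesgue_on X)"
proof -
  have "f \<in> borel_measurable lebesgue"
    using continuous_imp_measurable_on_sets_lebesgue[OF assms] by (simp add: lebesgue_on_UNIV_eq)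
  then show ?thesis by (rule measurable_restrict_space1)
qed

lemma continuous_bounded_on_bounded:
  fixes f :: "'a::euclidean_space \<Rightarrow> 'b::euclidean_space"
  assumes "continuous_on UNIV f" "bounded X"
  obtains B where "\<And>x. x \<in> X \<Longrightarrow> norm (f x) \<le> B"
proof -
  have "compact (f ` closure X)"
    using assms by (intro compact_continuous_image continuous_on_subset[OF assms(1)]) (auto simp: compact_closure)
  then have "bounded (f ` closure X)" by (rule compact_imp_bounded)
  then obtain B where "\<forall>y\<in>f ` closure X. norm y \<le> B" by (auto simp: bounded_iff)
  then show ?thesis using that closure_subset[of X] by blast
qed

lemma bounded_measurable_L2:
  fixes f :: "'a::euclidean_space \<Rightarrow> 'b::euclidean_space"
  assumes "f \<in> borel_measurable (lebesgue_on X)" "\<And>x. x \<in> X \<Longrightarrow> norm (f x) \<le> B" "bounded X" "X \<in> sets lebesgue"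
  shows "f \<in> L2 X"
proof -
  have fm: "finite_measure (lebesgue_on X)"
    using bounded_lebesgue_lmeasurable[OF assms(3,4)] by (rule finite_measure_lebesgue_on)
  have "integrable (lebesgue_on X) (\<lambda>x. (norm (f x))\<^sup>2)"
  proof (rule finite_measure.integrable_const_bound[OF fm])
    show "AE x in lebesgue_on X. norm ((norm (f x))\<^sup>2) \<le> B\<^sup>2"
      using assms(2) by (intro AE_I2) (auto simp: power_mono)
  qed (use assms(1) in measurable)
  then show ?thesis using assms by (simp add: L2_def)
qed

lemma continuous_L2:
  fixes f :: "'a::euclidean_space \<Rightarrow> 'b::euclidean_space"
  assumes "continuous_on UNIV f" "bounded X" "X \<in> sets lebesgue"
  shows "f \<in> L2 X"
  by (rule continuous_bounded_on_bounded[OF assms(1,2)])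
    (rule bounded_measurable_L2[OF continuous_measurable_lebesgue_on[OF assms(1)] _ assms(2,3)])

lemma L2_restrict:
  fixes f :: "'d::euclidean_space \<Rightarrow> 'a::euclidean_space"
  assumes "f \<in> L2 X" "Y \<subseteq> X" "Y \<in> sets lebesgue" "X \<in> sets lebesgue"
  shows "f \<in> L2 Y"
proof -
  have r: "restrict_space (lebesgue_on X) Y = lebesgue_on Y"
    using assms by (simp add: restrict_restrict_space inf.absorb2)
  have "f \<in> borel_measurable (lebesgue_on Y)"
    using measurable_restrict_space1[OF L2_measurable[OF assms(1)], of Y] r by simp
  moreover have "integrable (lebesgue_on Y) (\<lambda>x. (norm (f x))\<^sup>2)"
    using set_integrable_subset[of lebesgue X "\<lambda>x. (norm (f x))\<^sup>2" Y] L2_integrable_sq[OF assms(1)] assms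
    by (simp add: integrable_restrict_space set_integrable_def)
  ultimately show ?thesis by (simp add: L2_def)
qed

lemma L2_mult_bounded:
  fixes f :: "'d::euclidean_space \<Rightarrow> 'a::euclidean_space"
  assumes "f \<in> L2 X" "c \<in> borel_measurable (lebesgue_on X)" "\<And>x. x \<in> X \<Longrightarrow> \<bar>c x\<bar> \<le> B"
  shows "(\<lambda>x. c x *\<^sub>R f x) \<in> L2 X"
proof (rule L2_bound[OF _ assms(1)])
  show "(\<lambda>x. c x *\<^sub>R f x) \<in> borel_measurable (lebesgue_on X)"
    using assms(2) L2_measurable[OF assms(1)] by measurable
  show "AE x in lebesgue_on X. norm (c x *\<^sub>R f x) \<le> B * norm (f x)"
    using assms(3) by (intro AE_I2) (auto intro: mult_right_mono)
qed

lemma L2_bounded_integrable: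
  fixes f :: "'d::euclidean_space \<Rightarrow> 'a::euclidean_space"
  assumes "f \<in> L2 X" "c \<in> borel_measurable (lebesgue_on X)" "\<And>x. x \<in> X \<Longrightarrow> \<bar>c x\<bar> \<le> B" "bounded X" "X \<in> sets lebesgue"
  shows "integrable (lebesgue_on X) (\<lambda>x. c x *\<^sub>R f x)"
proof -
  have c: "c \<in> L2 X" by (rule bounded_measurable_L2) (use assms in auto)
  have "(\<lambda>x. norm (f x)) \<in> L2 X"
    by (rule L2_bound[of _ _ f 1]) (use assms(1) L2_measurable[OF assms(1)] in auto)
  from ip_integrable[OF c this] have "integrable (lebesgue_on X) (\<lambda>x. c x * norm (f x))" by simp
  then have "integrable (lebesgue_on X) (\<lambda>x. norm (c x * norm (f x)))" by (rule integrable_norm)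
  then show ?thesis
  proof (rule Bochner_Integration.integrable_bound)
    show "(\<lambda>x. c x *\<^sub>R f x) \<in> borel_measurable (lebesgue_on X)"
      using assms(2) L2_measurable[OF assms(1)] by measurable
  qed (simp add: abs_mult)
qed

section \<open>The divergence theorem on convex quadrilaterals\<close>

lemma lebesgue_on_integral_eq_set_integral:
  fixes f :: "'a::euclidean_space \<Rightarrow> 'b::euclidean_space"
  shows "S \<in> sets lebesgue \<Longrightarrow> (LINT x|lebesgue_on S. f x) = (LINT x:S|lebesgue. f x)"
  by (simp add: integral_restrict_space set_lebesgue_integral_def)

lemma lebesgue_on_integrable_iff_set_integrable:
  fixes f :: "'a::euclidean_space \<Rightarrow> 'b::euclidean_space"
  shows "S \<in> sets lebesgue \<Longrightarrow> integrable (lebesgue_on S) f \<longleftrightarrow> set_integrable lebesgue S f"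
  by (simp add: integrable_restrict_space set_integrable_def)

lemma lebesgue_on_integral_lborel:
  fixes f :: "'a::euclidean_space \<Rightarrow> 'b::euclidean_space"
  assumes "S \<in> sets borel" "f \<in> borel_measurable borel"
  shows "(LINT x|lebesgue_on S. f x) = (LINT x|lborel. indicator S x *\<^sub>R f x)"
  using assms by (simp add: integral_restrict_space integral_completion)

lemma continuous_integrable_bounded:
  fixes f :: "'a::euclidean_space \<Rightarrow> 'b::euclidean_space"
  assumes "continuous_on UNIV f" "bounded S" "S \<in> sets lebesgue"
  shows "integrable (lebesgue_on S) f"
proof -
  obtain B where B: "\<And>x. x \<in> S \<Longrightarrow> norm (f x) \<le> B"
    using continuous_bounded_on_bounded[OF assms(1,2)] by blast
  have "finite_measure (lebesgue_on S)"
    using bounded_lebesgue_lmeasurable[OF assms(2,3)] by (rule finite_measure_lebesgue_on)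
  then show ?thesis
    using B continuous_measurable_lebesgue_on[OF assms(1)]
    by (intro finite_measure.integrable_const_bound[of _ _ B] AE_I2) auto
qed

lemma lebesgue_on_integral_spike_set:
  fixes f :: "'a::euclidean_space \<Rightarrow> 'b::euclidean_space"
  assumes "S \<in> sets lebesgue" "S' \<in> sets lebesgue" "integrable (lebesgue_on S) f" "integrable (lebesgue_on S') f"
    "negligible (S - S')" "negligible (S' - S)"
  shows "(LINT x|lebesgue_on S. f x) = (LINT x|lebesgue_on S'. f x)"
proof -
  have "integral S f = integral S' f"
    using assms(5,6) by (intro integral_spike_set) (auto elim: negligible_subset)
  then show ?thesis using assms by (simp add: lebesgue_integral_eq_integral)
qed

section \<open>The Gauss formula on triangles\<close>

definition ref_triangle :: "point set" where
  "ref_triangle = {x. 0 \<le> x $ 1 \<and> 0 \<le> x $ 2 \<and> x $ 1 + x $ 2 \<le> 1}"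

text \<open>Identifies \<open>real \<times> real\<close> with \<open>point\<close>, so that Fubini's
  theorem for product measures becomes available for integrals over the plane.\<close>

definition pt :: "real \<times> real \<Rightarrow> point" where
  "pt p = fst p *\<^sub>R axis 1 1 + snd p *\<^sub>R axis 2 1"

lemma pt_nth [simp]: "pt (x, y) $ 1 = x" "pt (x, y) $ 2 = y"
  by (auto simp: pt_def axis_def)

lemma point_eq_iff: "x = y \<longleftrightarrow> x $ 1 = y $ 1 \<and> x $ 2 = y $ 2" for x y :: point
  by (simp add: vec_eq_iff forall_2)

lemma continuous_pt: "continuous_on UNIV pt"
  unfolding pt_def by (intro continuous_intros)

lemma measurable_pt [measurable]: "pt \<in> borel_measurable borel"
  by (rule borel_measurable_continuous_onI[OF continuous_pt])

lemma Basis_point: "(Basis :: point set) = {axis 1 1, axis 2 1}"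
  by (auto simp: Basis_vec_def UNIV_2_pt)

text \<open>The preimage of a box is a box with the same side lengths, and the values on boxes
  determine the Lebesgue measure.\<close>

lemma distr_lborel_pt: "distr lborel borel pt = lborel"
proof (rule lborel_eqI[symmetric])
  fix l u :: point assume le: "\<And>b. b \<in> Basis \<Longrightarrow> l \<bullet> b \<le> u \<bullet> b"
  then have le': "l $ 1 \<le> u $ 1" "l $ 2 \<le> u $ 2"
    using le[of "axis 1 1"] le[of "axis 2 1"] by (auto simp: Basis_point inner_axis)
  have pre: "pt -` box l u = box (l $ 1, l $ 2) (u $ 1, u $ 2)"
    by (auto simp: mem_box Basis_point inner_axis Basis_prod_def)
  have ne: "axis 1 1 \<noteq> (axis 2 1 :: point)" by (simp add: axis_eq_axis)
  have "emeasure (distr lborel borel pt) (box l u) = emeasure lborel (pt -` box l u)"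
    by (subst emeasure_distr) auto
  also have "\<dots> = (\<Prod>b\<in>Basis. (u - l) \<bullet> b)"
    unfolding pre emeasure_lborel_box_eq using le' ne
    by (auto simp: Basis_prod_def Basis_point inner_axis inner_diff_left prod.union_disjoint)
  finally show "emeasure (distr lborel borel pt) (box l u) = (\<Prod>b\<in>Basis. (u - l) \<bullet> b)" .
qed simp

lemma closed_ref_triangle: "closed ref_triangle"
proof -
  have "ref_triangle = {x. 0 \<le> x $ 1} \<inter> {x. 0 \<le> x $ 2} \<inter> {x. x $ 1 + x $ 2 \<le> 1}"
    by (auto simp: ref_triangle_def)
  also have "closed \<dots>" by (intro closed_Int closed_Collect_le continuous_intros)
  finally show ?thesis .
qed

lemma bounded_ref_triangle: "bounded ref_triangle"
proof -
  have "norm x \<le> 2" if "x \<in> ref_triangle" for x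
  proof -
    have "norm x \<le> (\<Sum>i\<in>UNIV. \<bar>x $ i\<bar>)" by (rule norm_le_l1_cart)
    also have "\<dots> \<le> 2" using that by (auto simp: sum_2 ref_triangle_def)
    finally show ?thesis .
  qed
  then show ?thesis by (auto simp: bounded_iff)
qed

lemma compact_ref_triangle: "compact ref_triangle"
  using closed_ref_triangle bounded_ref_triangle by (simp add: compact_eq_bounded_closed)

lemma compact_lebesgue: "compact S \<Longrightarrow> S \<in> sets lebesgue" for S :: "'a::euclidean_space set"
  using lmeasurable_compact fmeasurableD by blast

text \<open>Fubini's theorem and the fundamental theorem of calculus on the horizontal slices
  \<open>{0..1 - y}\<close>; their end points run through the hypotenuse and the left leg, both
  parametrized by the height.\<close>

lemma ref_triangle_partial:
  assumes f: "Ck (Suc 0) f"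
  shows "(LINT x|lebesgue_on ref_triangle. grad f x $ 1)
    = (LINT s|lebesgue_on {0..1}. f (pt (1 - s, s))) - (LINT s|lebesgue_on {0..1}. f (pt (0, s)))"
proof -
  have cg: "continuous_on UNIV (\<lambda>x. grad f x $ 1)" and d: "f differentiable (at x)" for x using f by auto
  have cf: "continuous_on UNIV f" using f by (rule Ck_continuous)
  have [measurable]: "(\<lambda>x. grad f x $ 1) \<in> borel_measurable borel" using cg by (rule borel_measurable_continuous_onI)
  have [measurable]: "ref_triangle \<in> sets borel" using closed_ref_triangle by (rule borel_closed)
  let ?h = "\<lambda>x. indicator ref_triangle x *\<^sub>R (grad f x $ 1)"
  have int: "integrable lborel ?h"
  proof -
    have "integrable (lebesgue_on ref_triangle) (\<lambda>x. grad f x $ 1)"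
      by (rule continuous_integrable_bounded[OF cg bounded_ref_triangle compact_lebesgue[OF compact_ref_triangle]])
    then have "integrable lebesgue ?h"
      using compact_lebesgue[OF compact_ref_triangle] by (simp add: integrable_restrict_space)
    then show ?thesis by (simp add: integrable_completion)
  qed
  have int2: "integrable (lborel \<Otimes>\<^sub>M lborel) (\<lambda>(x, y). ?h (pt (x, y)))"
  proof -
    have "integrable (distr lborel borel pt) ?h" using int by (simp add: distr_lborel_pt)
    then have "integrable lborel (\<lambda>p. ?h (pt p))" by (subst (asm) integrable_distr_eq) auto
    then show ?thesis by (simp add: lborel_prod case_prod_unfold)
  qed
  have inner: "(LINT x|lborel. ?h (pt (x, y))) = indicator {0..1} y *\<^sub>R (f (pt (1 - y, y)) - f (pt (0, y)))" for y
  proof (cases "y \<in> {0..1}")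
    case True
    have der: "((\<lambda>x. f (pt (x, y))) has_real_derivative grad f (pt (x, y)) $ 1) (at x)" for x
    proof -
      have "((\<lambda>x. pt (x, y)) has_derivative (\<lambda>h. h *\<^sub>R axis 1 1)) (at x)"
        unfolding pt_def by (auto intro!: derivative_eq_intros)
      from has_derivative_compose[OF this has_derivative_grad[OF d]]
      have "((\<lambda>x. f (pt (x, y))) has_derivative (\<lambda>h. grad f (pt (x, y)) \<bullet> (h *\<^sub>R axis 1 1))) (at x)" .
      moreover have "(\<lambda>h. grad f (pt (x, y)) \<bullet> (h *\<^sub>R axis 1 1)) = (*) (grad f (pt (x, y)) $ 1)"
        by (auto simp: inner_axis mult.commute)
      ultimately show ?thesis by (simp add: has_field_derivative_def)
    qed
    have cp: "continuous_on UNIV (\<lambda>x. pt (x, y))" unfolding pt_def by (intro continuous_intros)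
    have cgp: "continuous_on UNIV (\<lambda>x. grad f (pt (x, y)) $ 1)"
      using continuous_on_compose2[OF cg cp] by simp
    have "(LINT x|lborel. ?h (pt (x, y))) = (LINT x|lborel. (grad f (pt (x, y)) $ 1) * indicator {0..1 - y} x)"
      using True by (intro Bochner_Integration.integral_cong) (auto simp: ref_triangle_def indicator_def)
    also have "\<dots> = f (pt (1 - y, y)) - f (pt (0, y))"
      using True der cgp by (intro integral_FTC_Icc_real)
        (auto simp: continuous_on_eq_continuous_at)
    finally show ?thesis using True by simp
  next
    case False
    then have "(\<lambda>x. ?h (pt (x, y))) = (\<lambda>x. 0)"
      by (intro ext) (auto simp: ref_triangle_def indicator_def)
    then show ?thesis using False by simp
  qed
  have c1: "continuous_on UNIV (\<lambda>s. f (pt (1 - s, s)))" "continuous_on UNIV (\<lambda>s. f (pt (0, s)))"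
    unfolding pt_def by (intro continuous_on_compose2[OF cf] continuous_intros; simp)+
  have "(LINT x|lebesgue_on ref_triangle. grad f x $ 1) = (LINT x|lborel. ?h x)"
    by (rule lebesgue_on_integral_lborel) auto
  also have "\<dots> = (LINT x|distr lborel borel pt. ?h x)" by (simp add: distr_lborel_pt)
  also have "\<dots> = (LINT p|lborel. ?h (pt p))" by (rule integral_distr) auto
  also have "\<dots> = (LINT p|(lborel \<Otimes>\<^sub>M lborel). (\<lambda>(x, y). ?h (pt (x, y))) p)"
    by (simp add: lborel_prod case_prod_unfold)
  also have "\<dots> = (LINT y|lborel. LINT x|lborel. ?h (pt (x, y)))"
    by (rule lborel_pair.integral_snd[symmetric, OF int2])
  also have "\<dots> = (LINT y|lborel. indicator {0..1} y *\<^sub>R (f (pt (1 - y, y)) - f (pt (0, y))))"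
    by (simp only: inner)
  also have "\<dots> = (LINT s|lebesgue_on {0..1}. f (pt (1 - s, s)) - f (pt (0, s)))"
    using c1 by (intro lebesgue_on_integral_lborel[symmetric])
      (auto intro!: borel_measurable_continuous_onI continuous_on_diff)
  also have "\<dots> = (LINT s|lebesgue_on {0..1}. f (pt (1 - s, s))) - (LINT s|lebesgue_on {0..1}. f (pt (0, s)))"
    using c1 by (intro Bochner_Integration.integral_diff continuous_integrable_bounded) auto
  finally show ?thesis .
qed

lemma cross2_simps:
  "cross2 (x + y) z = cross2 x z + cross2 y z" "cross2 z (x + y) = cross2 z x + cross2 z y"
  "cross2 (x - y) z = cross2 x z - cross2 y z" "cross2 z (x - y) = cross2 z x - cross2 z y"
  "cross2 (c *\<^sub>R x) y = c * cross2 x y" "cross2 x (c *\<^sub>R y) = c * cross2 x y"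
  "cross2 x x = 0" "cross2 0 x = 0" "cross2 x 0 = 0"
  by (auto simp: cross2_def algebra_simps)

lemma cross2_commute: "cross2 x y = - cross2 y x"
  by (simp add: cross2_def)

text \<open>The mean value over the edge. The length of the edge is not included because it is
  carried by the factor \<open>cross2 w (snd e - fst e)\<close> in the Gauss formula, which for
  counterclockwise edges is the product of the edge length with the outward normal component of
  \<open>w\<close>.\<close>

definition edge_integral :: "(point \<Rightarrow> real) \<Rightarrow> point \<times> point \<Rightarrow> real" where
  "edge_integral g e = (LINT s|lebesgue_on {0..1}. g (edge_pt e s))"

lemma continuous_edge_pt: "continuous_on A (edge_pt e)"
  unfolding edge_pt_def by (intro continuous_intros)

lemma continuous_on_edge:
  "continuous_on UNIV g \<Longrightarrow> continuous_on UNIV (\<lambda>s. g (edge_pt e s))"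
  using continuous_on_compose2[OF _ continuous_edge_pt] by blast

lemma edge_integral_reverse:
  assumes g: "continuous_on UNIV g" shows "edge_integral g (b, a) = edge_integral g (a, b)"
proof -
  have c: "continuous_on UNIV (\<lambda>s. g (edge_pt e s))" for e using g by (rule continuous_on_edge)
  have i: "integral {0..1} (\<lambda>s. g (edge_pt e s)) = edge_integral g e" for e
    using continuous_integrable_bounded[OF c, of "{0..1}"] by (simp add: edge_integral_def lebesgue_integral_eq_integral)
  have "integral {0..1} (\<lambda>s. g (edge_pt (a, b) s)) = integral {0..1} (\<lambda>s. g (edge_pt (a, b) (1 - s)))"
  proof -
    have "((\<lambda>s. g (edge_pt (a, b) s)) has_integral edge_integral g (a, b)) (cbox 0 1)"
      using continuous_on_subset[OF c] integrable_continuous_interval[of 0 1] i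
      by (metis box_real(2) has_integral_integral subset_UNIV)
    from has_integral_affinity[OF this, of "-1" 1]
    have "((\<lambda>s. g (edge_pt (a, b) (1 - s))) has_integral edge_integral g (a, b)) {0..1}"
      by (simp add: image_diff_atLeastAtMost)
    then show ?thesis using i by (simp add: integral_unique)
  qed
  also have "(\<lambda>s. g (edge_pt (a, b) (1 - s))) = (\<lambda>s. g (edge_pt (b, a) s))"
    by (intro ext arg_cong[of _ _ g]) (simp add: edge_pt_def algebra_simps)
  finally show ?thesis using i by simp
qed

text \<open>An affine change of variables with columns \<open>u\<close> and \<open>v\<close> turns
  the derivative in direction \<open>u\<close> into the first partial derivative on the reference
  triangle; the hypotenuse becomes the edge from \<open>p + u\<close> to \<open>p + v\<close>, the
  left leg the edge from \<open>p\<close> to \<open>p + v\<close>.\<close>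

lemma triangle_integral_directional:
  fixes p u v :: point
  defines "\<Phi> \<equiv> \<lambda>x::point. x $ 1 *\<^sub>R u + x $ 2 *\<^sub>R v + p"
  assumes f: "Ck (Suc 0) f" and D: "cross2 u v \<noteq> 0"
  shows "u \<bullet> (LINT x|lebesgue_on (\<Phi> ` ref_triangle). grad f x)
    = \<bar>cross2 u v\<bar> * (edge_integral f (p + u, p + v) - edge_integral f (p, p + v))"
proof -
  define A where "A x = x $ 1 *\<^sub>R u + x $ 2 *\<^sub>R v" for x :: point
  have A: "linear A" by (rule linearI) (auto simp: A_def algebra_simps scaleR_add_left)
  have \<Phi>: "\<Phi> x = A x + p" for x by (simp add: \<Phi>_def A_def)
  have A1: "A (axis 1 1) = u" "A (axis 2 1) = v" by (auto simp: A_def axis_def)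
  have det: "det (matrix A) = cross2 u v"
    by (simp add: det_2 matrix_def A1 cross2_def)
  have inj: "inj_on \<Phi> S" for S
  proof -
    have "inj A" using det D A det_nz_iff_inj by metis
    then show ?thesis by (auto simp: inj_on_def \<Phi>)
  qed
  have der: "(\<Phi> has_derivative A) (at x within S)" for x S
    unfolding \<Phi>[abs_def] using linear_imp_has_derivative[OF A] by (simp add: has_derivative_add_const)
  have c\<Phi>: "continuous_on UNIV \<Phi>" unfolding \<Phi>_def by (intro continuous_intros)
  have cg: "continuous_on UNIV (grad f)"
    using f by (auto simp: continuous_on_componentwise[of UNIV "grad f"] Basis_vec_def inner_axis)
  have cg\<Phi>: "continuous_on UNIV (\<lambda>x. grad f (\<Phi> x))" using continuous_on_compose2[OF cg c\<Phi>] by simp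
  have cpt: "compact (\<Phi> ` ref_triangle)"
    using compact_continuous_image[OF continuous_on_subset[OF c\<Phi>] compact_ref_triangle] by simp
  note leb = compact_lebesgue[OF compact_ref_triangle] compact_lebesgue[OF cpt]
  have int1: "integrable (lebesgue_on ref_triangle) (\<lambda>x. \<bar>cross2 u v\<bar> *\<^sub>R grad f (\<Phi> x))"
    using continuous_integrable_bounded[OF cg\<Phi> bounded_ref_triangle leb(1)] by (rule integrable_scaleR_right)
  have int2: "integrable (lebesgue_on (\<Phi> ` ref_triangle)) (grad f)"
    using continuous_integrable_bounded[OF cg compact_imp_bounded[OF cpt] leb(2)] .
  have "integral (\<Phi> ` ref_triangle) (grad f) = integral ref_triangle (\<lambda>x. \<bar>det (matrix A)\<bar> *\<^sub>R grad f (\<Phi> x))"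
  proof (rule integral_change_of_variables[OF leb(1) der inj])
    show "grad f absolutely_integrable_on \<Phi> ` ref_triangle \<or> (\<lambda>x. \<bar>det (matrix A)\<bar> *\<^sub>R grad f (\<Phi> x)) absolutely_integrable_on ref_triangle"
      using int2 leb by (simp add: lebesgue_on_integrable_iff_set_integrable)
  qed
  then have "(LINT x|lebesgue_on (\<Phi> ` ref_triangle). grad f x) = (LINT x|lebesgue_on ref_triangle. \<bar>cross2 u v\<bar> *\<^sub>R grad f (\<Phi> x))"
    unfolding lebesgue_integral_eq_integral[OF int1 leb(1)] lebesgue_integral_eq_integral[OF int2 leb(2)]
    by (simp add: det)
  also have "u \<bullet> \<dots> = \<bar>cross2 u v\<bar> * (LINT x|lebesgue_on ref_triangle. u \<bullet> grad f (\<Phi> x))"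
    using int1 continuous_integrable_bounded[OF cg\<Phi> bounded_ref_triangle leb(1)] by simp
  also have "(\<lambda>x. u \<bullet> grad f (\<Phi> x)) = (\<lambda>x. grad (\<lambda>x. f (A x + p)) x $ 1)"
    using f by (simp add: grad_compose_affine[OF A] A1 \<Phi> inner_commute)
  also have "(LINT x|lebesgue_on ref_triangle. grad (\<lambda>x. f (A x + p)) x $ 1) =
      (LINT s|lebesgue_on {0..1}. f (A (pt (1 - s, s)) + p)) - (LINT s|lebesgue_on {0..1}. f (A (pt (0, s)) + p))"
    by (rule ref_triangle_partial[OF Ck_affine[OF A f]])
  also have "(\<lambda>s. f (A (pt (1 - s, s)) + p)) = (\<lambda>s. f (edge_pt (p + u, p + v) s))"
    by (intro ext arg_cong[of _ _ f]) (simp add: A_def edge_pt_def algebra_simps)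
  also have "(\<lambda>s. f (A (pt (0, s)) + p)) = (\<lambda>s. f (edge_pt (p, p + v) s))"
    by (intro ext arg_cong[of _ _ f]) (simp add: A_def edge_pt_def algebra_simps)
  finally show ?thesis by (simp add: edge_integral_def)
qed

text \<open>The directional formula gives the two directions of the edges at \<open>a\<close>, the
  second one after exchanging the roles of the edges; these directions span the plane.\<close>

lemma gauss_triangle:
  fixes a b c w :: point
  assumes f: "Ck (Suc 0) f" and D: "cross2 (b - a) (c - a) > 0"
  shows "w \<bullet> (LINT x|lebesgue_on (convex hull {a, b, c}). grad f x)
    = cross2 w (b - a) * edge_integral f (a, b) + cross2 w (c - b) * edge_integral f (b, c)
      + cross2 w (a - c) * edge_integral f (c, a)"
proof -
  let ?u = "b - a" and ?v = "c - a"
  let ?I = "LINT x|lebesgue_on (convex hull {a, b, c}). grad f x"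
  have hull: "(\<lambda>x::point. x $ 1 *\<^sub>R ?u + x $ 2 *\<^sub>R ?v + a) ` ref_triangle = convex hull {a, b, c}"
    "(\<lambda>x::point. x $ 1 *\<^sub>R ?v + x $ 2 *\<^sub>R ?u + a) ` ref_triangle = convex hull {a, b, c}"
  proof -
    have "x \<in> convex hull {a, b, c} \<longleftrightarrow> (\<exists>y\<in>ref_triangle. x = y $ 1 *\<^sub>R ?u + y $ 2 *\<^sub>R ?v + a)" for x
    proof
      assume "x \<in> convex hull {a, b, c}"
      then obtain s t where "x = a + s *\<^sub>R ?u + t *\<^sub>R ?v" "0 \<le> s" "0 \<le> t" "s + t \<le> 1"
        by (auto simp: convex_hull_3_alt)
      then show "\<exists>y\<in>ref_triangle. x = y $ 1 *\<^sub>R ?u + y $ 2 *\<^sub>R ?v + a"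
        by (intro bexI[of _ "pt (s, t)"]) (auto simp: ref_triangle_def)
    next
      assume "\<exists>y\<in>ref_triangle. x = y $ 1 *\<^sub>R ?u + y $ 2 *\<^sub>R ?v + a"
      then obtain y where y: "y \<in> ref_triangle" "x = a + y $ 1 *\<^sub>R ?u + y $ 2 *\<^sub>R ?v"
        by (auto simp: add.commute)
      then show "x \<in> convex hull {a, b, c}"
        unfolding convex_hull_3_alt ref_triangle_def by blast
    qed
    then show 1: "(\<lambda>x::point. x $ 1 *\<^sub>R ?u + x $ 2 *\<^sub>R ?v + a) ` ref_triangle = convex hull {a, b, c}" by blast
    \<comment> \<open>The reference triangle is symmetric under exchange of coordinates, so both
      parametrizations have the same image.\<close>
    have "ref_triangle = (\<lambda>x. pt (x $ 2, x $ 1)) ` ref_triangle"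
    proof safe
      fix x assume "x \<in> ref_triangle"
      then show "x \<in> (\<lambda>x. pt (x $ 2, x $ 1)) ` ref_triangle"
        by (intro image_eqI[of _ _ "pt (x $ 2, x $ 1)"]) (auto simp: ref_triangle_def point_eq_iff)
    qed (auto simp: ref_triangle_def)
    then have "(\<lambda>x::point. x $ 1 *\<^sub>R ?v + x $ 2 *\<^sub>R ?u + a) ` ref_triangle =
       (\<lambda>x::point. x $ 1 *\<^sub>R ?v + x $ 2 *\<^sub>R ?u + a) ` (\<lambda>x. pt (x $ 2, x $ 1)) ` ref_triangle" by simp
    also have "\<dots> = (\<lambda>x::point. x $ 1 *\<^sub>R ?u + x $ 2 *\<^sub>R ?v + a) ` ref_triangle"
      unfolding image_image by (simp add: add.commute)
    finally show "(\<lambda>x::point. x $ 1 *\<^sub>R ?v + x $ 2 *\<^sub>R ?u + a) ` ref_triangle = convex hull {a, b, c}" using 1 by simp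
  qed
  have cf: "continuous_on UNIV f" using f by (rule Ck_continuous)
  let ?D = "cross2 ?u ?v"
  have 1: "?u \<bullet> ?I = ?D * (edge_integral f (b, c) - edge_integral f (c, a))"
    using triangle_integral_directional[OF f, of ?u ?v a] D edge_integral_reverse[OF cf, of a c] unfolding hull by simp
  have 2: "?v \<bullet> ?I = ?D * (edge_integral f (b, c) - edge_integral f (a, b))"
    using triangle_integral_directional[OF f, of ?v ?u a] D edge_integral_reverse[OF cf, of b c] cross2_commute[of ?v ?u]
    unfolding hull by simp
  \<comment> \<open>Cramer's rule for the expansion of \<open>w\<close> in the two edge
    directions.\<close>
  have w: "?D *\<^sub>R w = cross2 w ?v *\<^sub>R ?u + cross2 ?u w *\<^sub>R ?v"
    by (simp add: point_eq_iff cross2_def algebra_simps)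
  have "?D * (w \<bullet> ?I) = (?D *\<^sub>R w) \<bullet> ?I" by simp
  also have "\<dots> = cross2 w ?v * (?u \<bullet> ?I) + cross2 ?u w * (?v \<bullet> ?I)"
    unfolding w by (simp add: inner_add_left)
  also have "\<dots> = ?D * (cross2 w ?v * (edge_integral f (b, c) - edge_integral f (c, a))
      + cross2 ?u w * (edge_integral f (b, c) - edge_integral f (a, b)))"
    unfolding 1 2 by (simp add: algebra_simps)
  finally have "w \<bullet> ?I = cross2 w ?v * (edge_integral f (b, c) - edge_integral f (c, a))
      + cross2 ?u w * (edge_integral f (b, c) - edge_integral f (a, b))" using D by simp
  then show ?thesis by (simp add: cross2_simps cross2_commute[of _ w] algebra_simps)
qed

section \<open>Convex quadrilaterals as intersections of half planes\<close>

text \<open>Barycentric coordinates are quotients of signed areas, and the three conditions say that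
  these areas are nonnegative.\<close>

lemma triangle_halfplanes:
  fixes a b c x :: point
  assumes D: "cross2 (b - a) (c - a) > 0"
    and "cross2 (b - a) (x - a) \<ge> 0" "cross2 (c - b) (x - b) \<ge> 0" "cross2 (a - c) (x - c) \<ge> 0"
  shows "x \<in> convex hull {a, b, c}"
proof -
  let ?D = "cross2 (b - a) (c - a)"
  define \<beta> where "\<beta> = cross2 (a - c) (x - c) / ?D"
  define \<gamma> where "\<gamma> = cross2 (b - a) (x - a) / ?D"
  have "0 \<le> \<beta>" "0 \<le> \<gamma>" using assms by (auto simp: \<beta>_def \<gamma>_def)
  moreover have "\<beta> + \<gamma> = 1 - cross2 (c - b) (x - b) / ?D"
  proof -
    have "cross2 (a - c) (x - c) + cross2 (b - a) (x - a) = ?D - cross2 (c - b) (x - b)"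
      by (simp add: cross2_def algebra_simps)
    then have "\<beta> + \<gamma> = (?D - cross2 (c - b) (x - b)) / ?D"
      by (simp add: \<beta>_def \<gamma>_def add_divide_distrib[symmetric])
    then show ?thesis using D by (simp add: diff_divide_distrib)
  qed
  then have "\<beta> + \<gamma> \<le> 1" using assms by simp
  moreover have "x = a + \<beta> *\<^sub>R (b - a) + \<gamma> *\<^sub>R (c - a)"
  proof -
    have "?D *\<^sub>R (x - a) = cross2 (a - c) (x - c) *\<^sub>R (b - a) + cross2 (b - a) (x - a) *\<^sub>R (c - a)"
      by (simp add: point_eq_iff cross2_def algebra_simps)
    also have "\<dots> = ?D *\<^sub>R (\<beta> *\<^sub>R (b - a) + \<gamma> *\<^sub>R (c - a))"
      using D by (simp add: \<beta>_def \<gamma>_def scaleR_add_right)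
    finally have "x - a = \<beta> *\<^sub>R (b - a) + \<gamma> *\<^sub>R (c - a)" using D by (simp add: scaleR_left_imp_eq)
    then show ?thesis by (simp add: algebra_simps)
  qed
  ultimately show ?thesis unfolding convex_hull_3_alt by blast
qed

lemma convex_quad_rotate: "convex_quad (a, b, c, d) \<Longrightarrow> convex_quad (b, c, d, a)"
  by simp

text \<open>Only the edge from \<open>a\<close> to \<open>b\<close> is treated here; the remaining
  edges follow through \<open>convex_quad_rotate\<close>.\<close>

lemma quad_vertex_side:
  assumes "convex_quad (a, b, c, d)"
  shows "cross2 (b - a) (c - a) > 0" "cross2 (b - a) (d - a) > 0"
  using assms by (auto simp: cross2_def algebra_simps)

text \<open>Writes the side of a line as an inner product, which gives access to the facts on half
  spaces and hyperplanes.\<close>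

lemma cross2_inner: "cross2 e y = pt (- (e $ 2), e $ 1) \<bullet> y"
  by (simp add: cross2_def inner_2)

lemma quad_hull_halfplane:
  assumes "convex_quad (a, b, c, d)"
  shows "x \<in> convex hull {a, b, c, d} \<Longrightarrow> cross2 (b - a) (x - a) \<ge> 0"
    and "x \<in> interior (convex hull {a, b, c, d}) \<Longrightarrow> cross2 (b - a) (x - a) > 0"
proof -
  let ?n = "pt (- ((b - a) $ 2), (b - a) $ 1)"
  have sub: "convex hull {a, b, c, d} \<subseteq> {x. ?n \<bullet> x \<ge> ?n \<bullet> a}"
  proof (rule hull_minimal)
    show "{a, b, c, d} \<subseteq> {x. ?n \<bullet> x \<ge> ?n \<bullet> a}"
      using quad_vertex_side[OF assms] by (auto simp: cross2_inner cross2_def inner_2 algebra_simps)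
  qed (rule convex_halfspace_ge)
  then show "x \<in> convex hull {a, b, c, d} \<Longrightarrow> cross2 (b - a) (x - a) \<ge> 0"
    by (auto simp: cross2_inner inner_diff_right)
  have "?n \<noteq> 0"
  proof
    assume "?n = 0"
    then have "cross2 (b - a) (c - a) = 0" by (simp add: cross2_inner)
    then show False using quad_vertex_side[OF assms] by simp
  qed
  then show "x \<in> interior (convex hull {a, b, c, d}) \<Longrightarrow> cross2 (b - a) (x - a) > 0"
    using interior_mono[OF sub] by (auto simp: cross2_inner inner_diff_right interior_halfspace_ge)
qed

lemma quad_hull_edge:
  assumes "convex_quad K" "e \<in> edges K"
  shows "x \<in> convex hull (vertices K) \<Longrightarrow> cross2 (snd e - fst e) (x - fst e) \<ge> 0"
    and "x \<in> cell K \<Longrightarrow> cross2 (snd e - fst e) (x - fst e) > 0"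
proof -
  obtain a b c d where K: "K = (a, b, c, d)" by (cases K) auto
  have 1: "convex_quad (a, b, c, d)" using assms K by simp
  note 2 = convex_quad_rotate[OF 1] note 3 = convex_quad_rotate[OF 2] note 4 = convex_quad_rotate[OF 3]
  note h = quad_hull_halfplane[OF 1] quad_hull_halfplane[OF 2] quad_hull_halfplane[OF 3] quad_hull_halfplane[OF 4]
  have r: "{b, c, d, a} = {a, b, c, d}" "{c, d, a, b} = {a, b, c, d}" "{d, a, b, c} = {a, b, c, d}" by auto
  show "x \<in> convex hull (vertices K) \<Longrightarrow> cross2 (snd e - fst e) (x - fst e) \<ge> 0"
    "x \<in> cell K \<Longrightarrow> cross2 (snd e - fst e) (x - fst e) > 0"
    using assms(2) h unfolding K cell_def r by auto
qed

text \<open>The side of the diagonal from \<open>a\<close> to \<open>c\<close> on which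
  \<open>x\<close> lies decides which of the two triangles contains it.\<close>

lemma quad_hull_split:
  assumes "convex_quad (a, b, c, d)"
    and "cross2 (b - a) (x - a) \<ge> 0" "cross2 (c - b) (x - b) \<ge> 0"
      "cross2 (d - c) (x - c) \<ge> 0" "cross2 (a - d) (x - d) \<ge> 0"
  shows "x \<in> convex hull {a, b, c} \<union> convex hull {a, c, d}"
proof (cases "cross2 (a - c) (x - c) \<ge> 0")
  case True
  then show ?thesis using assms quad_vertex_side[OF assms(1)] by (auto intro: triangle_halfplanes)
next
  case False
  have "cross2 (c - a) (d - a) > 0" using assms(1) by (auto simp: cross2_def algebra_simps)
  moreover have "cross2 (c - a) (x - a) \<ge> 0" using False by (simp add: cross2_def algebra_simps)
  ultimately show ?thesis using assms by (auto intro: triangle_halfplanes)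
qed

lemma quad_hull_Un:
  assumes "convex_quad (a, b, c, d)"
  shows "convex hull {a, b, c, d} = convex hull {a, b, c} \<union> convex hull {a, c, d}"
proof
  show "convex hull {a, b, c, d} \<subseteq> convex hull {a, b, c} \<union> convex hull {a, c, d}"
  proof
    fix x assume "x \<in> convex hull {a, b, c, d}"
    then have "\<forall>e\<in>edges (a, b, c, d). cross2 (snd e - fst e) (x - fst e) \<ge> 0"
      using quad_hull_edge(1)[OF assms] by auto
    then show "x \<in> convex hull {a, b, c} \<union> convex hull {a, c, d}"
      by (intro quad_hull_split[OF assms]) auto
  qed
  show "convex hull {a, b, c} \<union> convex hull {a, c, d} \<subseteq> convex hull {a, b, c, d}"
    by (intro Un_least hull_mono) auto
qed

text \<open>The intersection of the four open half planes is an open subset of the hull, hence lies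
  in its interior; conversely the interior of a closed half plane is the open one.\<close>

lemma in_cell_iff:
  assumes "convex_quad K"
  shows "x \<in> cell K \<longleftrightarrow> (\<forall>e\<in>edges K. cross2 (snd e - fst e) (x - fst e) > 0)"
proof
  assume "x \<in> cell K" then show "\<forall>e\<in>edges K. cross2 (snd e - fst e) (x - fst e) > 0"
    using quad_hull_edge(2)[OF assms] by blast
next
  assume x: "\<forall>e\<in>edges K. cross2 (snd e - fst e) (x - fst e) > 0"
  obtain a b c d where K: "K = (a, b, c, d)" by (cases K) auto
  let ?S = "\<Inter>e\<in>edges K. {x. 0 < cross2 (snd e - fst e) (x - fst e)}"
  have "open ?S" unfolding K
    by (auto intro!: open_Int open_Collect_less continuous_intros simp: cross2_inner)
  moreover have "?S \<subseteq> convex hull (vertices K)"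
  proof
    fix y assume "y \<in> ?S"
    then have "y \<in> convex hull {a, b, c} \<union> convex hull {a, c, d}"
      unfolding K by (intro quad_hull_split[OF assms[unfolded K]]) (auto intro: less_imp_le)
    then show "y \<in> convex hull (vertices K)" using quad_hull_Un[OF assms[unfolded K]] K by simp
  qed
  ultimately show "x \<in> cell K" unfolding cell_def using x by (intro interiorI[of ?S]) auto
qed

lemma open_cell: "open (cell K)" and convex_cell: "convex (cell K)" and bounded_cell: "bounded (cell K)"
proof -
  obtain a b c d where K: "K = (a, b, c, d)" by (cases K) auto
  show "open (cell K)" "convex (cell K)" by (auto simp: cell_def convex_interior)
  have "bounded (convex hull (vertices K))" unfolding K by (intro bounded_convex_hull) auto
  then show "bounded (cell K)" unfolding cell_def using bounded_subset interior_subset by blast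
qed

lemma cell_lebesgue [simp]: "cell K \<in> sets lebesgue"
  using open_cell by (simp add: lborelD)

lemma cell_nonempty:
  assumes "convex_quad K" shows "cell K \<noteq> {}"
proof -
  obtain a b c d where K: "K = (a, b, c, d)" by (cases K) auto
  let ?S = "{x. cross2 (b - a) (x - a) > 0 \<and> cross2 (c - b) (x - b) > 0 \<and> cross2 (a - c) (x - c) > 0}"
  have D: "cross2 (b - a) (c - a) > 0" using assms quad_vertex_side unfolding K by blast
  have "open ?S"
    by (intro open_Collect_conj open_Collect_less continuous_intros) (auto simp: cross2_inner intro!: continuous_intros)
  moreover have "?S \<subseteq> convex hull (vertices K)"
    using triangle_halfplanes[OF D] quad_hull_Un[OF assms[unfolded K]] unfolding K by auto
  \<comment> \<open>The centroid of the triangle \<open>a, b, c\<close> serves as an interior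
    point.\<close>
  moreover have "(1/3) *\<^sub>R (a + b + c) \<in> ?S"
    using D by (auto simp: cross2_def field_simps)
  ultimately show ?thesis unfolding cell_def using interiorI by blast
qed

lemma finite_edges [simp]: "finite (edges K)"
  by (cases K) auto

text \<open>\<open>edges\<close> is a set, so the four edges have to be distinct for the sum to have
  four terms.\<close>

lemma sum_edges:
  assumes "convex_quad (a, b, c, d)"
  shows "(\<Sum>e\<in>edges (a, b, c, d). f e) = f (a, b) + f (b, c) + f (c, d) + f (d, a)"
proof -
  have "a \<noteq> b" "b \<noteq> c" "c \<noteq> d" "d \<noteq> a" "a \<noteq> c" "b \<noteq> d"
    using assms by (auto simp: cross2_def algebra_simps)
  then show ?thesis by (auto simp: add.assoc)
qed

text \<open>The frontier of the hull and the common diagonal of the two triangles are null sets, so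
  the formula is the sum of the two triangle formulas.\<close>

theorem gauss_quad:
  assumes K: "convex_quad K" and f: "Ck (Suc 0) f"
  shows "w \<bullet> (LINT x|lebesgue_on (cell K). grad f x)
    = (\<Sum>e\<in>edges K. cross2 w (snd e - fst e) * edge_integral f e)"
proof -
  obtain a b c d where Ke: "K = (a, b, c, d)" by (cases K) auto
  note q = K[unfolded Ke]
  let ?H = "convex hull {a, b, c, d}" and ?S = "convex hull {a, b, c}" and ?T = "convex hull {a, c, d}"
  have cpt: "compact ?H" "compact ?S" "compact ?T" by (auto intro!: finite_imp_compact_convex_hull)
  note leb = cpt[THEN compact_lebesgue] note bnd = cpt[THEN compact_imp_bounded]
  have cg: "continuous_on UNIV (grad f)"
    using f by (auto simp: continuous_on_componentwise[of UNIV "grad f"] Basis_vec_def inner_axis)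
  have cf: "continuous_on UNIV f" using f by (rule Ck_continuous)
  have D1: "cross2 (b - a) (c - a) > 0" using quad_vertex_side[OF q] by simp
  have D2: "cross2 (c - a) (d - a) > 0" using q by (auto simp: cross2_def algebra_simps)
  have "(LINT x|lebesgue_on (cell K). grad f x) = (LINT x|lebesgue_on ?H. grad f x)"
  proof (rule lebesgue_on_integral_spike_set)
    have "?H - cell K \<subseteq> frontier ?H" "cell K - ?H = {}"
      using interior_subset closure_subset[of ?H] by (auto simp: Ke cell_def frontier_def)
    moreover have "negligible (frontier ?H)" by (rule negligible_convex_frontier) simp
    ultimately show "negligible (?H - cell K)" "negligible (cell K - ?H)"
      by (auto elim: negligible_subset)
  qed (use leb bnd continuous_integrable_bounded[OF cg] bounded_cell in auto)
  also have "\<dots> = (LINT x|lebesgue_on ?S. grad f x) + (LINT x|lebesgue_on ?T. grad f x)"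
  proof -
    have S: "cross2 (c - a) (x - a) \<le> 0" if "x \<in> ?S" for x
    proof -
      obtain s t where x: "x = a + s *\<^sub>R (b - a) + t *\<^sub>R (c - a)" "0 \<le> s" using \<open>x \<in> ?S\<close> by (auto simp: convex_hull_3_alt)
      have "cross2 (c - a) (x - a) = - (s * cross2 (b - a) (c - a))" by (simp add: x cross2_def algebra_simps)
      then show ?thesis using D1 x(2) by simp
    qed
    have T: "cross2 (c - a) (x - a) \<ge> 0" if "x \<in> ?T" for x
    proof -
      obtain s t where x: "x = a + s *\<^sub>R (c - a) + t *\<^sub>R (d - a)" "0 \<le> t" using \<open>x \<in> ?T\<close> by (auto simp: convex_hull_3_alt)
      have "cross2 (c - a) (x - a) = t * cross2 (c - a) (d - a)" by (simp add: x cross2_def algebra_simps)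
      then show ?thesis using D2 x(2) by simp
    qed
    let ?n = "pt (- ((c - a) $ 2), (c - a) $ 1)"
    have "?S \<inter> ?T \<subseteq> {x. ?n \<bullet> x = ?n \<bullet> a}" using S T by (force simp: cross2_inner inner_diff_right)
    moreover have "?n \<noteq> 0"
    proof
      assume "?n = 0" then have "cross2 (c - a) (d - a) = 0" by (simp add: cross2_inner)
      then show False using D2 by simp
    qed
    ultimately have neg: "negligible (?S \<inter> ?T)"
      using negligible_hyperplane[of ?n "?n \<bullet> a"] negligible_subset by blast
    have "integral ?H (grad f) = integral ?S (grad f) + integral ?T (grad f)"
      unfolding quad_hull_Un[OF q]
      by (rule Henstock_Kurzweil_Integration.integral_Un[OF _ _ neg])
        (use leb bnd continuous_integrable_bounded[OF cg] in \<open>auto intro!: integrable_on_lebesgue_on\<close>)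
    then show ?thesis
      using continuous_integrable_bounded[OF cg] leb bnd by (simp add: lebesgue_integral_eq_integral)
  qed
  finally have "w \<bullet> (LINT x|lebesgue_on (cell K). grad f x) =
     w \<bullet> (LINT x|lebesgue_on ?S. grad f x) + w \<bullet> (LINT x|lebesgue_on ?T. grad f x)"
    by (simp add: inner_add_right)
  \<comment> \<open>The two triangles run through the diagonal in opposite directions, and its
    contributions cancel.\<close>
  also have "\<dots> = (\<Sum>e\<in>edges K. cross2 w (snd e - fst e) * edge_integral f e)"
    unfolding gauss_triangle[OF f D1] gauss_triangle[OF f D2] Ke sum_edges[OF q]
    using edge_integral_reverse[OF cf, of a c] by (simp add: cross2_simps algebra_simps)
  finally show ?thesis .
qed

lemma test_functions_grad_zero:
  assumes "f \<in> test_functions X" "x \<notin> closure {x. f x \<noteq> 0}" shows "f x = 0" "grad f x = 0"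
proof -
  have z: "f y = 0" if "y \<notin> closure {x. f x \<noteq> 0}" for y
    using that closure_subset[of "{x. f x \<noteq> 0}"] by auto
  then show "f x = 0" using assms(2) .
  have "((\<lambda>x. 0) has_derivative (\<lambda>h. 0)) (at x)" by simp
  then have "(f has_derivative (\<lambda>h. 0)) (at x)"
  proof (rule has_derivative_transform_within_open)
    show "open (- closure {x. f x \<noteq> 0})" by (intro open_Compl closed_closure)
    show "x \<in> - closure {x. f x \<noteq> 0}" using assms(2) by simp
    show "0 = f y" if "y \<in> - closure {x. f x \<noteq> 0}" for y by (rule z[OF ComplD[OF that], symmetric])
  qed
  then show "grad f x = 0" using grad_eqI_inner[of f 0 x] by simp
qed

text \<open>The support is enclosed in a large square, a convex quadrilateral on whose edges the
  function vanishes, so the Gauss formula has no boundary terms.\<close>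

lemma test_functions_integral_grad:
  assumes f: "f \<in> test_functions X" and X: "X \<in> sets lebesgue"
  shows "(LINT x|lebesgue_on X. grad f x) = 0"
proof -
  let ?Z = "closure {x. f x \<noteq> 0}"
  have sm: "smooth f" and cpt: "compact ?Z" and sub: "?Z \<subseteq> X" using f by (auto simp: test_functions_def)
  obtain B where B: "B > 0" "\<And>x. x \<in> ?Z \<Longrightarrow> norm x \<le> B"
    using compact_imp_bounded[OF cpt] by (auto simp: bounded_pos)
  \<comment> \<open>The margin keeps the support away from the boundary of the square.\<close>
  define r where "r = B + 1"
  have r: "r > 0" using B by (simp add: r_def)
  define Q where "Q = (pt (-r, -r), pt (r, -r), pt (r, r), pt (-r, r))"
  have q: "convex_quad Q" using r by (simp add: Q_def cross2_def)
  have out: "\<bar>x $ i\<bar> \<le> B" if "x \<in> ?Z" for x i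
    using B(2)[OF that] component_le_norm_cart[of x i] by linarith
  have "?Z \<subseteq> cell Q"
  proof
    fix x assume "x \<in> ?Z"
    then have "\<bar>x $ 1\<bar> < r" "\<bar>x $ 2\<bar> < r" using out[of x 1] out[of x 2] by (auto simp: r_def)
    then show "x \<in> cell Q" unfolding in_cell_iff[OF q] using r
      by (auto simp: Q_def cross2_def abs_less_iff mult_less_0_iff zero_less_mult_iff)
  qed
  then have "(LINT x|lebesgue_on X. grad f x) = (LINT x|lebesgue_on (cell Q). grad f x)"
    unfolding lebesgue_on_integral_eq_set_integral[OF X] lebesgue_on_integral_eq_set_integral[OF cell_lebesgue]
      set_lebesgue_integral_def
    using sub test_functions_grad_zero(2)[OF f]
    by (intro Bochner_Integration.integral_cong refl) (auto simp: indicator_def)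
  also have "\<dots> = 0"
  proof -
    have "edge_integral f e = 0" if "e \<in> edges Q" for e
    proof -
      have "f (edge_pt e s) = 0" for s
      proof (rule test_functions_grad_zero(1)[OF f])
        have "\<bar>edge_pt e s $ 1\<bar> = r \<or> \<bar>edge_pt e s $ 2\<bar> = r"
          using that r by (auto simp: Q_def edge_pt_def)
        then show "edge_pt e s \<notin> ?Z" using out[of "edge_pt e s" 1] out[of "edge_pt e s" 2] by (auto simp: r_def)
      qed
      then show ?thesis by (simp add: edge_integral_def)
    qed
    then have "w \<bullet> (LINT x|lebesgue_on (cell Q). grad f x) = 0" for w
      using gauss_quad[OF q smooth_Ck[OF sm], of w] by simp
    then show ?thesis using inner_eq_zero_iff by blast
  qed
  finally show ?thesis .
qed

section \<open>Approximation by smooth functions\<close>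

lemma L2_dominated_convergence:
  fixes f :: "'d::euclidean_space \<Rightarrow> 'a::euclidean_space" and w :: "'d \<Rightarrow> real"
  assumes f: "f \<in> borel_measurable (lebesgue_on X)" and s: "\<And>n. s n \<in> borel_measurable (lebesgue_on X)"
    and w: "w \<in> L2 X" and lim: "AE x in lebesgue_on X. (\<lambda>n. s n x) \<longlonglongrightarrow> f x"
    and le: "\<And>n. AE x in lebesgue_on X. norm (s n x) \<le> w x"
  shows "(\<lambda>n. L2_norm_on X (\<lambda>x. s n x - f x)) \<longlonglongrightarrow> 0"
proof -
  have le': "AE x in lebesgue_on X. \<forall>n. norm (s n x) \<le> w x"
    using le by (simp add: AE_all_countable)
  have fle: "AE x in lebesgue_on X. norm (f x) \<le> w x"
    using lim le'
  proof eventually_elim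
    case (elim x)
    then show ?case by (intro LIMSEQ_le_const2[OF tendsto_norm[OF elim(1)]]) auto
  qed
  have "(\<lambda>n. LINT x|lebesgue_on X. (norm (s n x - f x))\<^sup>2) \<longlonglongrightarrow> (LINT x|lebesgue_on X. 0)"
  proof (rule integral_dominated_convergence)
    show "integrable (lebesgue_on X) (\<lambda>x. 4 * (norm (w x))\<^sup>2)"
      using L2_integrable_sq[OF w] by simp
    show "AE x in lebesgue_on X. (\<lambda>n. (norm (s n x - f x))\<^sup>2) \<longlonglongrightarrow> 0"
      using lim
    proof eventually_elim
      case (elim x)
      have "(\<lambda>n. (norm (s n x - f x))\<^sup>2) \<longlonglongrightarrow> (norm (f x - f x))\<^sup>2"
        by (intro tendsto_intros elim)
      then show ?case by simp
    qed
    show "AE x in lebesgue_on X. norm ((norm (s n x - f x))\<^sup>2) \<le> 4 * (norm (w x))\<^sup>2" for n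
      using fle le[of n]
    proof eventually_elim
      case (elim x)
      have "norm (s n x - f x) \<le> 2 * w x" using elim norm_triangle_ineq4[of "s n x" "f x"] by linarith
      then have "(norm (s n x - f x))\<^sup>2 \<le> (2 * w x)\<^sup>2" by (intro power_mono) auto
      then show ?case by (simp add: power_mult_distrib)
    qed
  qed (use f s in measurable)
  then have "(\<lambda>n. sqrt (LINT x|lebesgue_on X. (norm (s n x - f x))\<^sup>2)) \<longlonglongrightarrow> sqrt 0"
    by (intro tendsto_real_sqrt) simp
  then show ?thesis by (simp add: L2_norm_on_def)
qed

text \<open>Measurable functions are almost everywhere limits of continuous ones, but without a
  common majorant. Truncation of both the function and its approximants at a level \<open>m\<close>
  supplies a constant majorant on the bounded set.\<close>

lemma L2_continuous_dense:
  fixes f :: "'d::euclidean_space \<Rightarrow> real"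
  assumes f: "f \<in> L2 X" and X: "bounded X" "X \<in> sets lebesgue" and e: "e > 0"
  obtains c B where "continuous_on UNIV c" "\<And>x. \<bar>c x\<bar> \<le> B" "L2_norm_on X (\<lambda>x. f x - c x) < e"
proof -
  have fm: "f \<in> borel_measurable (lebesgue_on X)" using f by (rule L2_measurable)
  define cl where "cl m t = max (- real m) (min (real m) t)" for m :: nat and t :: real
  have cl: "\<bar>cl m t\<bar> \<le> real m" "\<bar>cl m t\<bar> \<le> \<bar>t\<bar>" for m t by (auto simp: cl_def)
  have ccl: "continuous_on A (cl m)" for m A unfolding cl_def by (intro continuous_intros)
  have [measurable]: "cl m \<in> borel_measurable borel" for m using ccl by (rule borel_measurable_continuous_onI)
  have fcl: "(\<lambda>x. cl m (f x)) \<in> borel_measurable (lebesgue_on X)" for m using fm by measurable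
  have "(\<lambda>m. L2_norm_on X (\<lambda>x. cl m (f x) - f x)) \<longlonglongrightarrow> 0"
  proof (rule L2_dominated_convergence[OF fm fcl])
    show "(\<lambda>x. \<bar>f x\<bar>) \<in> L2 X" by (rule L2_bound[of _ _ f 1]) (use f fm in auto)
    show "AE x in lebesgue_on X. (\<lambda>m. cl m (f x)) \<longlonglongrightarrow> f x"
    proof (rule AE_I2)
      fix x
      obtain N :: nat where "\<bar>f x\<bar> \<le> real N" using real_arch_simple by blast
      then have "\<forall>\<^sub>F m in sequentially. cl m (f x) = f x"
        by (intro eventually_sequentiallyI[of N]) (auto simp: cl_def)
      then show "(\<lambda>m. cl m (f x)) \<longlonglongrightarrow> f x" by (rule tendsto_eventually)
    qed
  qed (use cl in auto)
  then have "\<forall>\<^sub>F m in sequentially. L2_norm_on X (\<lambda>x. cl m (f x) - f x) < e / 2"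
    using e by (intro order_tendstoD) auto
  then obtain m where m: "L2_norm_on X (\<lambda>x. cl m (f x) - f x) < e / 2"
    by (auto simp: eventually_sequentially)
  have "(\<lambda>x. if x \<in> X then f x else 0) \<in> borel_measurable lebesgue"
    by (rule borel_measurable_if_I[OF fm X(2)])
  then have "(\<lambda>x. if x \<in> X then f x else 0) measurable_on UNIV"
    by (intro lebesgue_measurable_imp_measurable_on) auto
  then obtain N g where g: "negligible N" "\<And>n. continuous_on UNIV (g n)"
    "\<And>x. x \<notin> N \<Longrightarrow> (\<lambda>n. g n x) \<longlonglongrightarrow> (if x \<in> X then f x else 0)"
    unfolding measurable_on_def by auto
  have cg: "continuous_on UNIV (\<lambda>x. cl m (g n x))" for n
    by (rule continuous_on_compose2[OF ccl[of UNIV] g(2)]) simp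
  have "(\<lambda>n. L2_norm_on X (\<lambda>x. cl m (g n x) - cl m (f x))) \<longlonglongrightarrow> 0"
  proof (rule L2_dominated_convergence[OF fcl continuous_measurable_lebesgue_on[OF cg]])
    show "(\<lambda>x. real m) \<in> L2 X" by (rule continuous_L2) (use X in auto)
    have "AE x in lebesgue. x \<notin> N" using g(1) by (simp add: negligible_iff_null_sets AE_not_in)
    then have "AE x in lebesgue. x \<in> X \<longrightarrow> (\<lambda>n. cl m (g n x)) \<longlonglongrightarrow> cl m (f x)"
    proof eventually_elim
      case (elim x)
      have "isCont (cl m) t" for t using ccl[of UNIV m] by (simp add: continuous_on_eq_continuous_at)
      then show ?case using g(3)[OF elim] by (auto intro: isCont_tendsto_compose)
    qed
    then show "AE x in lebesgue_on X. (\<lambda>n. cl m (g n x)) \<longlonglongrightarrow> cl m (f x)"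
      using X(2) by (subst AE_restrict_space_iff) auto
  qed (use cl in auto)
  then have "\<forall>\<^sub>F n in sequentially. L2_norm_on X (\<lambda>x. cl m (g n x) - cl m (f x)) < e / 2"
    using e by (intro order_tendstoD) auto
  then obtain n where n: "L2_norm_on X (\<lambda>x. cl m (g n x) - cl m (f x)) < e / 2"
    by (auto simp: eventually_sequentially)
  have L: "(\<lambda>x. cl m (f x)) \<in> L2 X" by (rule L2_bound[OF fcl f, where c = 1]) (use cl in auto)
  have "L2_norm_on X (\<lambda>x. f x - cl m (g n x)) < e"
    using L2_norm_triangle3[OF f L continuous_L2[OF cg X], of n] m n
      L2_norm_diff_commute[of X f "\<lambda>x. cl m (f x)"] L2_norm_diff_commute[of X "\<lambda>x. cl m (f x)" "\<lambda>x. cl m (g n x)"]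
    by linarith
  with cg[of n] cl(1) show ?thesis by (rule that)
qed

text \<open>Fubini's theorem is applied to the product of \<open>lborel\<close> with itself and
  needs Borel measurable integrands, whereas elements of \<open>L2 X\<close> are only Lebesgue
  measurable.\<close>

lemma L2_borel_representative:
  fixes g :: "'d::euclidean_space \<Rightarrow> real"
  assumes "g \<in> L2 X" "X \<in> sets lebesgue"
  obtains g' where "g' \<in> borel_measurable borel" "AE x in lebesgue. g' x = indicator X x *\<^sub>R g x"
proof -
  have "(\<lambda>x. if x \<in> X then g x else 0) \<in> borel_measurable lebesgue"
    by (rule borel_measurable_if_I[OF L2_measurable[OF assms(1)] assms(2)])
  then obtain g' where g': "g' \<in> borel_measurable lborel" "AE x in lborel. (if x \<in> X then g x else 0) = g' x"
    using completion_ex_borel_measurable_real by blast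
  have "AE x in lebesgue. (if x \<in> X then g x else 0) = g' x" by (rule AE_completion[OF g'(2)])
  then have "AE x in lebesgue. g' x = indicator X x *\<^sub>R g x"
    by eventually_elim (auto simp: indicator_def)
  then show ?thesis using g'(1) by (intro that) auto
qed

section \<open>Convolution with smooth kernels\<close>

text \<open>The convolution of \<open>k\<close> with the extension of \<open>g\<close> by
  zero.\<close>

definition conv :: "point set \<Rightarrow> (point \<Rightarrow> real) \<Rightarrow> (point \<Rightarrow> real) \<Rightarrow> point \<Rightarrow> real" where
  "conv X k g z = (LINT y|lebesgue_on X. k (z - y) * g y)"

lemma conv_integrable:
  fixes k g :: "point \<Rightarrow> real"
  assumes "continuous_on UNIV k" "bounded X" "X \<in> sets lebesgue" "g \<in> L2 X"
  shows "integrable (lebesgue_on X) (\<lambda>y. k (z - y) * g y)"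
proof -
  have "continuous_on UNIV (\<lambda>y. k (z - y))"
    by (rule continuous_on_compose2[OF assms(1)]) (auto intro!: continuous_intros)
  from ip_integrable[OF continuous_L2[OF this assms(2,3)] assms(4)] show ?thesis by simp
qed

text \<open>Differentiation under the integral. For \<open>y\<close> in the bounded set
  \<open>X\<close> all shifts \<open>z - y\<close> stay in a compact ball, where
  \<open>grad k\<close> is uniformly continuous; the Taylor remainder is therefore small uniformly
  in \<open>y\<close> and is integrated against \<open>g\<close>.\<close>

lemma conv_has_derivative:
  fixes g :: "point \<Rightarrow> real"
  assumes k: "smooth k" and X: "bounded X" "X \<in> sets lebesgue" and g: "g \<in> L2 X"
  shows "(conv X k g has_derivative (\<lambda>h. (\<chi> i. conv X (\<lambda>z. grad k z $ i) g z) \<bullet> h)) (at z)"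
  unfolding has_derivative_at_alt
proof (intro conjI allI impI bounded_linear_inner_right)
  fix e :: real assume e: "e > 0"
  have ck: "continuous_on UNIV k" "continuous_on UNIV (\<lambda>z. grad k z $ i)" for i
    using smooth_continuous[OF k] smooth_continuous[OF smooth_grad[OF k]] by auto
  have kd: "(k has_derivative (\<lambda>h. grad k u \<bullet> h)) (at u)" for u
    by (rule has_derivative_grad[OF smooth_differentiable[OF k]])
  have gi: "integrable (lebesgue_on X) (\<lambda>y. \<bar>g y\<bar>)"
    using conv_integrable[OF continuous_on_const[of UNIV 1] X g] by (simp add: integrable_abs)
  define G where "G = (LINT y|lebesgue_on X. \<bar>g y\<bar>)"
  have G: "G \<ge> 0" by (simp add: G_def)
  \<comment> \<open>The remainder is multiplied by the L1 norm \<open>G\<close>; adding 1 avoids a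
    zero denominator.\<close>
  define e' where "e' = e / (G + 1)"
  have e': "e' > 0" using e G by (simp add: e'_def)
  obtain R where R: "R > 0" "\<And>y. y \<in> X \<Longrightarrow> norm y \<le> R" using X(1) by (auto simp: bounded_pos)
  \<comment> \<open>The extra 1 leaves room for the increments, whose length is restricted to less
    than \<open>min d 1\<close>.\<close>
  define B where "B = cball (0::point) (norm z + R + 1)"
  have "uniformly_continuous_on B (grad k)"
    by (rule compact_uniformly_continuous[OF smooth_continuous_grad[OF k]]) (simp add: B_def)
  then obtain d where d: "d > 0" "\<And>a b. a \<in> B \<Longrightarrow> b \<in> B \<Longrightarrow> dist b a < d \<Longrightarrow> dist (grad k b) (grad k a) < e'"
    using e' unfolding uniformly_continuous_on_def by blast
  show "\<exists>d>0. \<forall>z'. norm (z' - z) < d \<longrightarrow>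
      norm (conv X k g z' - conv X k g z - (\<chi> i. conv X (\<lambda>z. grad k z $ i) g z) \<bullet> (z' - z)) \<le> e * norm (z' - z)"
  proof (intro exI[of _ "min d 1"] conjI allI impI)
    fix z' assume z': "norm (z' - z) < min d 1"
    let ?r = "\<lambda>y. k (z' - y) - k (z - y) - grad k (z - y) \<bullet> (z' - z)"
    have r: "\<bar>?r y\<bar> \<le> e' * norm (z' - z)" if "y \<in> X" for y
    proof -
      let ?a = "z - y" and ?S = "ball (z - y) (min d 1)"
      have S: "?S \<subseteq> B"
      proof
        fix u assume "u \<in> ?S"
        then have "norm (?a - u) < 1" by (simp add: dist_norm)
        moreover have "norm u \<le> norm ?a + norm (?a - u)" using norm_triangle_ineq4[of ?a "?a - u"] by simp
        moreover have "norm ?a \<le> norm z + R" using norm_triangle_ineq4[of z y] R(2)[OF that] by linarith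
        ultimately show "u \<in> B" by (simp add: B_def)
      qed
      have aS: "?a \<in> ?S" using d by simp
      \<comment> \<open>The mean value inequality for \<open>k\<close> minus its linear part at
        \<open>z - y\<close>, whose gradient is small near this point.\<close>
      have "norm ((k (z' - y) - grad k ?a \<bullet> (z' - y)) - (k ?a - grad k ?a \<bullet> ?a)) \<le> e' * norm ((z' - y) - ?a)"
      proof (rule differentiable_bound[where f = "\<lambda>u. k u - grad k ?a \<bullet> u" and f' = "\<lambda>u h. (grad k u - grad k ?a) \<bullet> h" and S = ?S])
        show "((\<lambda>u. k u - grad k ?a \<bullet> u) has_derivative (\<lambda>h. (grad k u - grad k ?a) \<bullet> h)) (at u within ?S)" for u
          unfolding inner_diff_left
          by (intro has_derivative_diff has_derivative_at_withinI[OF kd] bounded_linear_imp_has_derivative bounded_linear_inner_right)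
        show "onorm (\<lambda>h. (grad k u - grad k ?a) \<bullet> h) \<le> e'" if u: "u \<in> ?S" for u
        proof (rule onorm_bound)
          have "dist u ?a < d" using u by (simp add: dist_commute)
          then have "norm (grad k u - grad k ?a) < e'"
            using d(2)[OF subsetD[OF S aS] subsetD[OF S u]] by (simp add: dist_norm)
          then show "norm ((grad k u - grad k ?a) \<bullet> h) \<le> e' * norm h" for h
            using Cauchy_Schwarz_ineq2[of "grad k u - grad k ?a" h]
            by (smt (verit) mult_right_mono norm_ge_zero real_norm_def)
        qed (use e' in simp)
        show "z' - y \<in> ?S" using z' by (simp add: dist_norm norm_minus_commute)
      qed (use aS in auto)
      then show ?thesis by (simp add: inner_diff_right algebra_simps)
    qed
    have ri: "integrable (lebesgue_on X) (\<lambda>y. ?r y * g y)"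
    proof -
      have "integrable (lebesgue_on X) (\<lambda>y. k (z' - y) * g y - k (z - y) * g y -
          (\<Sum>i\<in>UNIV. (grad k (z - y) $ i * g y) * (z' - z) $ i))"
        using conv_integrable[OF ck(1) X g] conv_integrable[OF ck(2) X g]
        by (intro Bochner_Integration.integrable_diff Bochner_Integration.integrable_sum integrable_mult_left) auto
      then show ?thesis by (simp add: inner_vec_def algebra_simps sum_distrib_left sum_distrib_right)
    qed
    have "conv X k g z' - conv X k g z - (\<chi> i. conv X (\<lambda>z. grad k z $ i) g z) \<bullet> (z' - z)
      = (LINT y|lebesgue_on X. k (z' - y) * g y - k (z - y) * g y - (\<Sum>i\<in>UNIV. (grad k (z - y) $ i * g y) * (z' - z) $ i))"
      using conv_integrable[OF ck(1) X g] conv_integrable[OF ck(2) X g]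
      by (simp add: conv_def inner_vec_def Bochner_Integration.integral_diff Bochner_Integration.integral_sum integrable_mult_left
          Bochner_Integration.integrable_sum)
    also have "\<dots> = (LINT y|lebesgue_on X. ?r y * g y)"
      by (rule Bochner_Integration.integral_cong) (auto simp: inner_vec_def algebra_simps sum_distrib_left sum_distrib_right)
    finally have eq: "conv X k g z' - conv X k g z - (\<chi> i. conv X (\<lambda>z. grad k z $ i) g z) \<bullet> (z' - z) = (LINT y|lebesgue_on X. ?r y * g y)" .
    have "\<bar>LINT y|lebesgue_on X. ?r y * g y\<bar> \<le> (LINT y|lebesgue_on X. e' * norm (z' - z) * \<bar>g y\<bar>)"
    proof (rule order_trans[OF integral_abs_bound integral_mono])
      show "integrable (lebesgue_on X) (\<lambda>y. e' * norm (z' - z) * \<bar>g y\<bar>)" using gi by simp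
      show "integrable (lebesgue_on X) (\<lambda>y. \<bar>?r y * g y\<bar>)" using ri by (rule integrable_abs)
      show "\<bar>?r y * g y\<bar> \<le> e' * norm (z' - z) * \<bar>g y\<bar>" if "y \<in> space (lebesgue_on X)" for y
        using r[of y] that by (simp add: abs_mult mult_right_mono)
    qed
    also have "\<dots> = e' * norm (z' - z) * G" by (simp add: G_def)
    also have "\<dots> \<le> e * norm (z' - z)"
    proof -
      have "e' * G \<le> e" using e G by (simp add: e'_def field_simps)
      then have "(e' * G) * norm (z' - z) \<le> e * norm (z' - z)" by (rule mult_right_mono) simp
      then show ?thesis by (simp add: mult.commute mult.left_commute)
    qed
    finally show "norm (conv X k g z' - conv X k g z - (\<chi> i. conv X (\<lambda>z. grad k z $ i) g z) \<bullet> (z' - z)) \<le> e * norm (z' - z)"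
      unfolding eq by simp
  qed (use d in simp)
qed

text \<open>Each partial derivative is again a convolution with a smooth kernel, so the induction
  over the order of differentiation ranges over all kernels.\<close>

lemma conv_smooth:
  fixes g :: "point \<Rightarrow> real"
  assumes k: "smooth k" and X: "bounded X" "X \<in> sets lebesgue" and g: "g \<in> L2 X"
  shows "smooth (conv X k g)" and "grad (conv X k g) z $ i = conv X (\<lambda>z. grad k z $ i) g z"
proof -
  have gr: "grad (conv X k g) z $ i = conv X (\<lambda>z. grad k z $ i) g z" if "smooth k" for k z i
    using grad_eqI_inner[OF conv_has_derivative[OF that X g]] by simp
  have d: "conv X k g differentiable (at z)" if "smooth k" for k z
    using conv_has_derivative[OF that X g] by (auto simp: differentiable_def)
  have "Ck j (conv X k g)" if "smooth k" for j k
    using that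
  proof (induction j arbitrary: k)
    case 0
    then show ?case using d by (simp add: continuous_on_eq_continuous_at differentiable_imp_continuous_within)
  next
    case (Suc j)
    then show ?case using d smooth_grad by (simp add: gr)
  qed
  then show "smooth (conv X k g)" using k by (simp add: smooth_def)
  show "grad (conv X k g) z $ i = conv X (\<lambda>z. grad k z $ i) g z" using gr k .
qed

section \<open>The mollifier\<close>

definition moll_mass :: "real \<Rightarrow> real" where
  "moll_mass \<epsilon> = (LINT z|lborel. bump 0 (\<epsilon>\<^sup>2 - (z::point) \<bullet> z))"

definition moll :: "real \<Rightarrow> point \<Rightarrow> real" where
  "moll \<epsilon> z = inverse (moll_mass \<epsilon>) * bump 0 (\<epsilon>\<^sup>2 - z \<bullet> z)"

lemma smooth_bump_ball: "smooth (\<lambda>z::point. bump 0 (\<epsilon>\<^sup>2 - z \<bullet> z))"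
  unfolding inner_2 by (rule smooth_bump) (intro smooth_diff smooth_const smooth_add smooth_mult smooth_nth)

lemma bump_0_bounds: "0 \<le> bump 0 t" "bump 0 t \<le> 1"
  by (auto simp: bump_def)

lemma bump_ball_nonzero:
  assumes "\<epsilon> > 0" shows "bump 0 (\<epsilon>\<^sup>2 - z \<bullet> z) \<noteq> 0 \<longleftrightarrow> norm z < \<epsilon>"
proof -
  have "bump 0 (\<epsilon>\<^sup>2 - z \<bullet> z) \<noteq> 0 \<longleftrightarrow> (norm z)\<^sup>2 < \<epsilon>\<^sup>2" by (simp add: bump_def power2_norm_eq_inner)
  also have "\<dots> \<longleftrightarrow> norm z < \<epsilon>"
    using assms power2_less_imp_less[of "norm z" \<epsilon>] power_strict_mono[of "norm z" \<epsilon> 2] by auto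
  finally show ?thesis .
qed

lemma bump_ball_integrable:
  assumes "\<epsilon> > 0" shows "integrable lborel (\<lambda>z::point. bump 0 (\<epsilon>\<^sup>2 - z \<bullet> z))"
proof (rule Bochner_Integration.integrable_bound)
  show "integrable lborel (indicator (ball 0 \<epsilon>) :: point \<Rightarrow> real)"
    using emeasure_lborel_ball_finite[of "0::point" \<epsilon>] by (intro integrable_real_indicator) (auto simp: less_top)
  show "(\<lambda>z::point. bump 0 (\<epsilon>\<^sup>2 - z \<bullet> z)) \<in> borel_measurable lborel"
    using smooth_continuous[OF smooth_bump_ball] by (simp add: borel_measurable_continuous_onI)
  have "norm (bump 0 (\<epsilon>\<^sup>2 - z \<bullet> z)) \<le> norm (indicator (ball 0 \<epsilon>) z :: real)" for z :: point
    using bump_ball_nonzero[OF assms, of z] bump_0_bounds by (auto simp: indicator_def)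
  then show "AE z in lborel. norm (bump 0 (\<epsilon>\<^sup>2 - (z::point) \<bullet> z)) \<le> norm (indicator (ball 0 \<epsilon>) z :: real)" by simp
qed

text \<open>A nonnegative function with vanishing integral vanishes almost everywhere, but the bump
  is nonzero on a ball, which is not a null set.\<close>

lemma moll_mass_pos:
  assumes "\<epsilon> > 0" shows "moll_mass \<epsilon> > 0"
proof -
  have "moll_mass \<epsilon> \<noteq> 0"
  proof
    assume "moll_mass \<epsilon> = 0"
    then have "AE z in lborel. bump 0 (\<epsilon>\<^sup>2 - (z::point) \<bullet> z) = 0"
      using integral_nonneg_eq_0_iff_AE[OF bump_ball_integrable[OF assms]] bump_0_bounds by (simp add: moll_mass_def)
    then have "AE z::point in lborel. z \<notin> ball 0 \<epsilon>"
      by eventually_elim (use bump_ball_nonzero[OF assms] in auto)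
    then have "ball (0::point) \<epsilon> \<in> null_sets lborel"
      by (subst (asm) AE_iff_null) (auto simp: ball_def)
    then have "negligible (ball (0::point) \<epsilon>)" by (simp add: negligible_iff_null_sets null_sets_completionI)
    then show False using open_not_negligible[of "ball (0::point) \<epsilon>"] assms by simp
  qed
  moreover have "moll_mass \<epsilon> \<ge> 0" unfolding moll_mass_def by (rule Bochner_Integration.integral_nonneg) (simp add: bump_0_bounds)
  ultimately show ?thesis by simp
qed

lemma smooth_moll: "smooth (moll \<epsilon>)"
  unfolding moll_def[abs_def] by (intro smooth_mult smooth_const smooth_bump_ball)

lemma moll_nonneg: "\<epsilon> > 0 \<Longrightarrow> 0 \<le> moll \<epsilon> z"
  using moll_mass_pos bump_0_bounds by (simp add: moll_def less_imp_le)

lemma moll_nonzero: "\<epsilon> > 0 \<Longrightarrow> moll \<epsilon> z \<noteq> 0 \<longleftrightarrow> norm z < \<epsilon>"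
  using moll_mass_pos[of \<epsilon>] bump_ball_nonzero[of \<epsilon> z] by (simp add: moll_def)

lemma moll_zero: "\<epsilon> > 0 \<Longrightarrow> \<epsilon> \<le> norm z \<Longrightarrow> moll \<epsilon> z = 0"
  using moll_nonzero[of \<epsilon> z] by linarith

lemma moll_measurable [measurable]: "moll \<epsilon> \<in> borel_measurable borel"
  using smooth_continuous[OF smooth_moll] by (rule borel_measurable_continuous_onI)

lemma moll_integrable: "\<epsilon> > 0 \<Longrightarrow> integrable lborel (moll \<epsilon>)"
  unfolding moll_def[abs_def] by (intro integrable_mult_right bump_ball_integrable)

lemma moll_integral: "\<epsilon> > 0 \<Longrightarrow> (LINT z|lborel. moll \<epsilon> z) = 1"
  using moll_mass_pos[of \<epsilon>] by (simp add: moll_def moll_mass_def)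

lemma moll_bounded: "\<epsilon> > 0 \<Longrightarrow> \<bar>moll \<epsilon> z\<bar> \<le> inverse (moll_mass \<epsilon>)"
  using moll_mass_pos[of \<epsilon>] bump_0_bounds[of "\<epsilon>\<^sup>2 - z \<bullet> z"]
  by (simp add: moll_def abs_mult mult_left_le)

lemma moll_shift:
  assumes "\<epsilon> > 0"
  shows "integrable lborel (\<lambda>y. moll \<epsilon> (z - y))" "(LINT y|lborel. moll \<epsilon> (z - y)) = 1"
proof -
  have 1: "integrable (distr lborel borel (\<lambda>y. z + (-1) *\<^sub>R y)) (moll \<epsilon>)" "(LINT y|distr lborel borel (\<lambda>y. z + (-1) *\<^sub>R y). moll \<epsilon> y) = 1"
    using lborel_affine[of "-1" z] moll_integrable[OF assms] moll_integral[OF assms] by (simp_all add: density_1)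
  show "integrable lborel (\<lambda>y. moll \<epsilon> (z - y))" using 1(1) by (subst (asm) integrable_distr_eq) auto
  show "(LINT y|lborel. moll \<epsilon> (z - y)) = 1" using 1(2) by (subst (asm) integral_distr) auto
qed

text \<open>Scaling the plane by \<open>c\<close> contributes the factor \<open>1 / c ^ 2\<close>,
  at most 4 for \<open>c\<close> not below one half. The nonnegative integral is used so that no
  integrability is required in the Fubini argument.\<close>

lemma moll_affine_nn_integral:
  fixes t :: point
  assumes "\<epsilon> > 0" "1 / 2 \<le> c"
  shows "(\<integral>\<^sup>+x. ennreal (moll \<epsilon> (t + c *\<^sub>R x)) \<partial>lborel) \<le> 4"
proof -
  let ?I = "\<integral>\<^sup>+x. ennreal (moll \<epsilon> (t + c *\<^sub>R x)) \<partial>lborel"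
  have "1 = (\<integral>\<^sup>+z. ennreal (moll \<epsilon> z) \<partial>lborel)"
    using nn_integral_eq_integral[OF moll_integrable[OF assms(1)]] moll_nonneg[OF assms(1)] moll_integral[OF assms(1)] by simp
  also have "\<dots> = (\<integral>\<^sup>+z. ennreal (moll \<epsilon> z) \<partial>(density (distr lborel borel (\<lambda>x. t + c *\<^sub>R x)) (\<lambda>_. \<bar>c\<bar>^DIM(point))))"
    using lborel_affine[of c t] assms by simp
  also have "\<dots> = (\<integral>\<^sup>+x. ennreal (c\<^sup>2) * ennreal (moll \<epsilon> (t + c *\<^sub>R x)) \<partial>lborel)"
    using assms by (simp add: nn_integral_density nn_integral_distr power2_eq_square)
  also have "\<dots> = ennreal (c\<^sup>2) * ?I" by (rule nn_integral_cmult) measurable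
  finally have 1: "ennreal (c\<^sup>2) * ?I = 1" by simp
  have "1 / 4 \<le> c\<^sup>2" using power_mono[OF assms(2), of 2] by (simp add: power2_eq_square)
  then have "ennreal (1 / 4) * ?I \<le> ennreal (c\<^sup>2) * ?I" by (intro mult_right_mono ennreal_leI) auto
  then have "ennreal 4 * (ennreal (1 / 4) * ?I) \<le> ennreal 4 * 1" unfolding 1 by (rule mult_left_mono) simp
  moreover have "4 * ennreal (1 / 4) = 1" using ennreal_mult[of 4 "1 / 4"] by simp
  ultimately show ?thesis by (simp add: mult.assoc[symmetric])
qed

text \<open>
  Contracting towards \<open>x\<^sub>0\<close> before mollifying keeps the support of the kernel inside the convex
  set \<open>X\<close>, so that weak derivatives of functions on \<open>X\<close> commute with the smoothing up to the
  contraction factor, without any extension operator.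
\<close>

locale smoothing =
  fixes X :: "point set" and x0 :: point and r :: real
  assumes open_X: "open X" and convex_X: "convex X" and bounded_X: "bounded X"
    and ball_X: "ball x0 r \<subseteq> X" and r: "r > 0"
begin

definition lam :: "nat \<Rightarrow> real" where "lam n = 1 - 1 / (real n + 2)"
text \<open>By convexity a ball of radius \<open>(1 - lam n) * r\<close> about the contracted point
  fits into \<open>X\<close>; half of this radius also accommodates the closed ball.\<close>

definition eps :: "nat \<Rightarrow> real" where "eps n = (1 - lam n) * (r / 2)"
definition contract :: "nat \<Rightarrow> point \<Rightarrow> point" where "contract n x = lam n *\<^sub>R x + (1 - lam n) *\<^sub>R x0"
definition smoothen :: "nat \<Rightarrow> (point \<Rightarrow> real) \<Rightarrow> point \<Rightarrow> real" where
  "smoothen n g x = conv X (moll (eps n)) g (contract n x)"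

lemma X_lebesgue: "X \<in> sets lebesgue" using open_X by (simp add: lborelD)

lemma lam: "1 / 2 \<le> lam n" "lam n < 1" by (auto simp: lam_def field_simps)
lemma eps: "eps n > 0" using r lam[of n] by (simp add: eps_def)

lemma cball_contract:
  assumes "x \<in> X" shows "cball (contract n x) (eps n) \<subseteq> X"
proof
  fix y assume "y \<in> cball (contract n x) (eps n)"
  then have y: "norm (y - contract n x) \<le> eps n" by (simp add: dist_norm norm_minus_commute)
  let ?l = "1 - lam n"
  have l: "?l > 0" "?l < 1" using lam[of n] by auto
  \<comment> \<open>The point for which \<open>y\<close> is the convex combination of
    \<open>x\<close> and \<open>?w\<close> with weights \<open>lam n\<close> and
    \<open>1 - lam n\<close>; it lies in the ball about \<open>x0\<close>.\<close>
  let ?w = "x0 + (1 / ?l) *\<^sub>R (y - contract n x)"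
  have "norm ((1 / ?l) *\<^sub>R (y - contract n x)) \<le> (1 / ?l) * eps n" using y l by (simp add: divide_right_mono)
  also have "\<dots> = r / 2" using l by (simp add: eps_def)
  also have "\<dots> < r" using r by simp
  finally have "?w \<in> ball x0 r" by (simp add: dist_norm)
  then have "?w \<in> X" using ball_X by blast
  moreover have "y = lam n *\<^sub>R x + ?l *\<^sub>R ?w"
    using l by (simp add: contract_def scaleR_add_right)
  ultimately show "y \<in> X" using convexD[OF convex_X assms, of ?w "lam n" ?l] lam[of n] l by auto
qed

lemma contract_eq: "contract n x = (lam n *\<^sub>R x) + (1 - lam n) *\<^sub>R x0" by (simp add: contract_def)

lemma linear_contract: "linear (\<lambda>x::point. lam n *\<^sub>R x)" by (rule linearI) (auto simp: algebra_simps)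

lemma smoothen_smooth:
  assumes g: "g \<in> L2 X" shows "smooth (smoothen n g)"
    and "grad (smoothen n g) x $ i = lam n * conv X (\<lambda>z. grad (moll (eps n)) z $ i) g (contract n x)"
proof -
  note c = conv_smooth[OF smooth_moll bounded_X X_lebesgue g, of "eps n"]
  show "smooth (smoothen n g)"
    unfolding smoothen_def contract_eq by (rule smooth_affine[OF linear_contract c(1)])
  have "grad (smoothen n g) x $ i = grad (conv X (moll (eps n)) g) (contract n x) \<bullet> (lam n *\<^sub>R axis i 1)"
    unfolding smoothen_def contract_eq
    by (rule grad_compose_affine(2)[OF linear_contract smooth_differentiable[OF c(1)]])
  then show "grad (smoothen n g) x $ i = lam n * conv X (\<lambda>z. grad (moll (eps n)) z $ i) g (contract n x)"
    by (simp add: inner_axis c(2))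
qed

lemma smoothen_diff:
  assumes "f \<in> L2 X" "g \<in> L2 X" shows "smoothen n (\<lambda>x. f x - g x) = (\<lambda>x. smoothen n f x - smoothen n g x)"
  using conv_integrable[OF smooth_continuous[OF smooth_moll] bounded_X X_lebesgue assms(1)]
    conv_integrable[OF smooth_continuous[OF smooth_moll] bounded_X X_lebesgue assms(2)]
  by (simp add: fun_eq_iff smoothen_def conv_def right_diff_distrib Bochner_Integration.integral_diff)

lemma smoothen_L2: "g \<in> L2 X \<Longrightarrow> smoothen n g \<in> L2 X"
  using continuous_L2[OF smooth_continuous[OF smoothen_smooth(1)] bounded_X X_lebesgue] .

text \<open>Jensen's inequality for the probability density \<open>moll (eps n)\<close> bounds the
  square of an average by the average of squares. Exchanging the order of integration then costs the
  factor 4 of \<open>moll_affine_nn_integral\<close>, whose root is the constant here.\<close>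

lemma smoothen_norm:
  assumes g: "g \<in> L2 X" shows "L2_norm_on X (smoothen n g) \<le> 2 * L2_norm_on X g"
proof -
  obtain g' where g' [measurable]: "g' \<in> borel_measurable borel" and ae: "AE x in lebesgue. g' x = indicator X x *\<^sub>R g x"
    using L2_borel_representative[OF g X_lebesgue] .
  let ?m = "moll (eps n)"
  have S: "smoothen n g x = (LINT y|lborel. ?m (contract n x - y) * g' y)" for x
  proof -
    have "smoothen n g x = (LINT y|lebesgue. indicator X y *\<^sub>R (?m (contract n x - y) * g y))"
      using X_lebesgue by (simp add: smoothen_def conv_def integral_restrict_space)
    also have "\<dots> = (LINT y|lebesgue. ?m (contract n x - y) * g' y)"
    proof (rule integral_cong_AE)
      show "AE y in lebesgue. indicator X y *\<^sub>R (?m (contract n x - y) * g y) = ?m (contract n x - y) * g' y"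
        using ae by eventually_elim simp
      show "(\<lambda>y. ?m (contract n x - y) * g' y) \<in> borel_measurable lebesgue"
        by (rule measurable_completion) measurable
      have "integrable lebesgue (\<lambda>y. indicator X y *\<^sub>R (?m (contract n x - y) * g y))"
        using conv_integrable[OF smooth_continuous[OF smooth_moll] bounded_X X_lebesgue g] X_lebesgue
        by (simp add: integrable_restrict_space)
      then show "(\<lambda>y. indicator X y *\<^sub>R (?m (contract n x - y) * g y)) \<in> borel_measurable lebesgue" by simp
    qed
    also have "\<dots> = (LINT y|lborel. ?m (contract n x - y) * g' y)"
      by (rule integral_completion) measurable
    finally show ?thesis .
  qed
  have sq: "integrable lborel (\<lambda>y. (g' y)\<^sup>2)" "(\<integral>\<^sup>+y. ennreal ((g' y)\<^sup>2) \<partial>lborel) = ennreal ((L2_norm_on X g)\<^sup>2)"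
  proof -
    have i: "integrable lebesgue (\<lambda>y. indicator X y *\<^sub>R (g y)\<^sup>2)"
      using L2_integrable_sq[OF g] X_lebesgue by (simp add: integrable_restrict_space)
    have a: "AE y in lebesgue. (g' y)\<^sup>2 = indicator X y *\<^sub>R (g y)\<^sup>2"
      using ae by eventually_elim (simp add: power_mult_distrib indicator_def)
    have m: "(\<lambda>y. (g' y)\<^sup>2) \<in> borel_measurable lebesgue" by (rule measurable_completion) measurable
    have "integrable lebesgue (\<lambda>y. (g' y)\<^sup>2)"
      using integrable_cong_AE[OF m _ a] i by auto
    then show 1: "integrable lborel (\<lambda>y. (g' y)\<^sup>2)" by (simp add: integrable_completion)
    have "(LINT y|lborel. (g' y)\<^sup>2) = (LINT y|lebesgue. (g' y)\<^sup>2)" by (rule integral_completion[symmetric]) measurable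
    also have "\<dots> = (LINT y|lebesgue. indicator X y *\<^sub>R (g y)\<^sup>2)"
      by (rule integral_cong_AE[OF m _ a]) (use i in auto)
    also have "\<dots> = ip X g g"
      using X_lebesgue by (simp add: ip_def integral_restrict_space power2_eq_square)
    also have "\<dots> = (L2_norm_on X g)\<^sup>2" by (simp add: L2_norm_sq)
    finally show "(\<integral>\<^sup>+y. ennreal ((g' y)\<^sup>2) \<partial>lborel) = ennreal ((L2_norm_on X g)\<^sup>2)"
      using nn_integral_eq_integral[OF 1] by simp
  qed
  have pt: "ennreal ((smoothen n g x)\<^sup>2) \<le> (\<integral>\<^sup>+y. ennreal (?m (contract n x - y)) * ennreal ((g' y)\<^sup>2) \<partial>lborel)" for x
  proof -
    let ?k = "\<lambda>y. ?m (contract n x - y)"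
    have k0: "0 \<le> ?k y" for y using moll_nonneg[OF eps] .
    note k = moll_shift[OF eps, of n "contract n x"]
    have kg2: "integrable lborel (\<lambda>y. ?k y * (g' y)\<^sup>2)"
    proof (rule Bochner_Integration.integrable_bound)
      show "integrable lborel (\<lambda>y. inverse (moll_mass (eps n)) * (g' y)\<^sup>2)" using sq(1) by simp
      show "AE y in lborel. norm (?k y * (g' y)\<^sup>2) \<le> norm (inverse (moll_mass (eps n)) * (g' y)\<^sup>2)"
        using moll_bounded[OF eps, of n] moll_mass_pos[OF eps, of n]
        by (intro AE_I2) (auto simp: abs_mult intro!: mult_right_mono)
    qed measurable
    have kg: "integrable lborel (\<lambda>y. ?k y * g' y)"
    proof (rule Bochner_Integration.integrable_bound)
      show "integrable lborel (\<lambda>y. ?k y + ?k y * (g' y)\<^sup>2)" using k(1) kg2 by simp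
      have "\<bar>t\<bar> \<le> 1 + t\<^sup>2" for t :: real
        using sum_squares_bound[of "\<bar>t\<bar>" 1] by (simp add: power2_eq_square)
      then have "\<bar>?k y * g' y\<bar> \<le> ?k y * (1 + (g' y)\<^sup>2)" for y using k0[of y] by (simp add: abs_mult mult_left_mono)
      then show "AE y in lborel. norm (?k y * g' y) \<le> norm (?k y + ?k y * (g' y)\<^sup>2)"
        using k0 by (intro AE_I2) (simp add: distrib_left)
    qed measurable
    let ?a = "smoothen n g x"
    \<comment> \<open>Jensen's inequality as nonnegativity of the variance about the mean value
      \<open>?a\<close>.\<close>
    have "0 \<le> (LINT y|lborel. ?k y * (g' y - ?a)\<^sup>2)" using k0 by (intro Bochner_Integration.integral_nonneg) auto
    also have "\<dots> = (LINT y|lborel. ?k y * (g' y)\<^sup>2 - 2 * ?a * (?k y * g' y) + ?a\<^sup>2 * ?k y)"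
      by (simp add: power2_diff algebra_simps)
    also have "\<dots> = (LINT y|lborel. ?k y * (g' y)\<^sup>2) - 2 * ?a * (LINT y|lborel. ?k y * g' y) + ?a\<^sup>2 * (LINT y|lborel. ?k y)"
      using k(1) kg kg2 by simp
    also have "\<dots> = (LINT y|lborel. ?k y * (g' y)\<^sup>2) - ?a\<^sup>2"
      unfolding k(2) S[symmetric] by (simp add: power2_eq_square)
    finally have "ennreal (?a\<^sup>2) \<le> ennreal (LINT y|lborel. ?k y * (g' y)\<^sup>2)" by (intro ennreal_leI) simp
    also have "\<dots> = (\<integral>\<^sup>+y. ennreal (?k y * (g' y)\<^sup>2) \<partial>lborel)"
      using nn_integral_eq_integral[OF kg2] k0 by simp
    finally show ?thesis using k0 by (simp add: ennreal_mult)
  qed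
  have [measurable]: "contract n \<in> borel_measurable borel"
    unfolding contract_def[abs_def] by (intro borel_measurable_continuous_onI continuous_intros)
  have "(\<integral>\<^sup>+x. ennreal ((smoothen n g x)\<^sup>2) \<partial>lebesgue_on X) \<le> (\<integral>\<^sup>+x. ennreal ((smoothen n g x)\<^sup>2) \<partial>lebesgue)"
    using X_lebesgue by (subst nn_integral_restrict_space) (auto intro!: nn_integral_mono simp: indicator_def)
  also have "\<dots> = (\<integral>\<^sup>+x. ennreal ((smoothen n g x)\<^sup>2) \<partial>lborel)" by (rule nn_integral_completion)
  also have "\<dots> \<le> (\<integral>\<^sup>+x. (\<integral>\<^sup>+y. ennreal (?m (contract n x - y)) * ennreal ((g' y)\<^sup>2) \<partial>lborel) \<partial>lborel)"
    by (intro nn_integral_mono pt)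
  also have "\<dots> = (\<integral>\<^sup>+y. (\<integral>\<^sup>+x. ennreal (?m (contract n x - y)) * ennreal ((g' y)\<^sup>2) \<partial>lborel) \<partial>lborel)"
    by (rule lborel_pair.Fubini'[symmetric]) measurable
  also have "\<dots> = (\<integral>\<^sup>+y. (\<integral>\<^sup>+x. ennreal (?m (contract n x - y)) \<partial>lborel) * ennreal ((g' y)\<^sup>2) \<partial>lborel)"
    by (intro nn_integral_cong nn_integral_multc) measurable
  also have "\<dots> \<le> (\<integral>\<^sup>+y. 4 * ennreal ((g' y)\<^sup>2) \<partial>lborel)"
  proof (intro nn_integral_mono mult_right_mono)
    fix y
    have "(\<integral>\<^sup>+x. ennreal (?m (contract n x - y)) \<partial>lborel) = (\<integral>\<^sup>+x. ennreal (?m (((1 - lam n) *\<^sub>R x0 - y) + lam n *\<^sub>R x)) \<partial>lborel)"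
      by (simp add: contract_def algebra_simps)
    also have "\<dots> \<le> 4" by (rule moll_affine_nn_integral[OF eps lam(1)])
    finally show "(\<integral>\<^sup>+x. ennreal (?m (contract n x - y)) \<partial>lborel) \<le> 4" .
  qed simp
  also have "\<dots> = ennreal ((2 * L2_norm_on X g)\<^sup>2)"
    by (simp add: nn_integral_cmult sq(2) power_mult_distrib ennreal_mult)
  finally have "ennreal (LINT x|lebesgue_on X. (norm (smoothen n g x))\<^sup>2) \<le> ennreal ((2 * L2_norm_on X g)\<^sup>2)"
    using nn_integral_eq_integral[OF L2_integrable_sq[OF smoothen_L2[OF g]]] by simp
  then have "(LINT x|lebesgue_on X. (norm (smoothen n g x))\<^sup>2) \<le> (2 * L2_norm_on X g)\<^sup>2"
    by (subst (asm) ennreal_le_iff) auto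
  then have "sqrt (LINT x|lebesgue_on X. (norm (smoothen n g x))\<^sup>2) \<le> sqrt ((2 * L2_norm_on X g)\<^sup>2)"
    by (rule real_sqrt_le_mono)
  also have "\<dots> = 2 * L2_norm_on X g" by (rule real_sqrt_unique) auto
  finally show ?thesis unfolding L2_norm_on_def[of X "smoothen n g"] .
qed

text \<open>The kernel carries no mass outside \<open>X\<close>, so restricting the integral to
  \<open>X\<close> loses nothing.\<close>

lemma moll_X_integral:
  assumes x: "x \<in> X"
  shows "(LINT y|lebesgue_on X. moll (eps n) (contract n x - y)) = 1"
proof -
  have "(LINT y|lebesgue_on X. moll (eps n) (contract n x - y)) = (LINT y|lborel. indicator X y *\<^sub>R moll (eps n) (contract n x - y))"
    using open_X by (intro lebesgue_on_integral_lborel) auto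
  also have "\<dots> = (LINT y|lborel. moll (eps n) (contract n x - y))"
  proof (rule Bochner_Integration.integral_cong)
    fix y
    show "indicator X y *\<^sub>R moll (eps n) (contract n x - y) = moll (eps n) (contract n x - y)"
    proof (cases "y \<in> X")
      case False
      then have "y \<notin> cball (contract n x) (eps n)" using cball_contract[OF x] by blast
      then show ?thesis using moll_zero[OF eps, of n "contract n x - y"] by (simp add: dist_norm)
    qed simp
  qed simp
  finally show ?thesis using moll_shift[OF eps] by simp
qed

lemma lam_tendsto: "lam \<longlonglongrightarrow> 1"
proof -
  have "(\<lambda>n. 1 / real (n + 2)) \<longlonglongrightarrow> 0" by (rule LIMSEQ_ignore_initial_segment[OF lim_1_over_n])
  then have "(\<lambda>n. 1 - 1 / real (n + 2)) \<longlonglongrightarrow> 1 - 0" by (intro tendsto_intros)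
  then show ?thesis by (simp add: lam_def[abs_def] add.commute)
qed

lemma contract_tendsto: "(\<lambda>n. contract n x) \<longlonglongrightarrow> x" and eps_tendsto: "eps \<longlonglongrightarrow> 0"
proof -
  have "(\<lambda>n. contract n x) \<longlonglongrightarrow> 1 *\<^sub>R x + (1 - 1) *\<^sub>R x0"
    unfolding contract_def by (intro tendsto_intros lam_tendsto)
  then show "(\<lambda>n. contract n x) \<longlonglongrightarrow> x" by simp
  have "(\<lambda>n. (1 - lam n) * (r / 2)) \<longlonglongrightarrow> (1 - 1) * (r / 2)" by (intro tendsto_intros lam_tendsto)
  then show "eps \<longlonglongrightarrow> 0" by (simp add: eps_def[abs_def])
qed

lemma smoothen_continuous:
  assumes c: "continuous_on UNIV c" "\<And>x. \<bar>c x\<bar> \<le> B"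
  shows "(\<lambda>n. L2_norm_on X (\<lambda>x. smoothen n c x - c x)) \<longlonglongrightarrow> 0"
proof (rule L2_dominated_convergence)
  have cL: "c \<in> L2 X" by (rule continuous_L2[OF c(1) bounded_X X_lebesgue])
  show "c \<in> borel_measurable (lebesgue_on X)" "smoothen n c \<in> borel_measurable (lebesgue_on X)" for n
    using cL smoothen_L2[OF cL] L2_measurable by auto
  show "(\<lambda>x. B) \<in> L2 X" by (rule continuous_L2) (use bounded_X X_lebesgue in auto)
  note ci = conv_integrable[OF smooth_continuous[OF smooth_moll] bounded_X X_lebesgue]
  \<comment> \<open>An average is as close to \<open>a\<close> as the averaged values are. With
    \<open>a = 0\<close> this gives the majorant, and with \<open>a = c x\<close> the pointwise
    convergence.\<close>
  have est: "\<bar>smoothen n c x - a\<bar> \<le> b" if x: "x \<in> X" and b: "\<And>y. dist y (contract n x) < eps n \<Longrightarrow> \<bar>c y - a\<bar> \<le> b" for n x a b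
  proof -
    let ?k = "\<lambda>y. moll (eps n) (contract n x - y)"
    have k0: "0 \<le> ?k y" for y using moll_nonneg[OF eps] .
    have aL: "(\<lambda>x. a) \<in> L2 X" "(\<lambda>x. b) \<in> L2 X" by (rule continuous_L2; use bounded_X X_lebesgue in auto)+
    have "smoothen n c x - a = smoothen n c x - a * (LINT y|lebesgue_on X. ?k y)" by (simp add: moll_X_integral[OF x])
    also have "\<dots> = (LINT y|lebesgue_on X. ?k y * c y - ?k y * a)"
      using ci[OF cL] ci[OF aL(1)] by (simp add: smoothen_def conv_def Bochner_Integration.integral_diff)
    also have "\<bar>\<dots>\<bar> \<le> (LINT y|lebesgue_on X. ?k y * b)"
    proof (rule order_trans[OF integral_abs_bound integral_mono])
      show "integrable (lebesgue_on X) (\<lambda>y. \<bar>?k y * c y - ?k y * a\<bar>)"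
        using ci[OF cL] ci[OF aL(1)] by (intro integrable_abs Bochner_Integration.integrable_diff)
      show "\<bar>?k y * c y - ?k y * a\<bar> \<le> ?k y * b" for y
      proof (cases "norm (contract n x - y) < eps n")
        case True
        then have "\<bar>c y - a\<bar> \<le> b" by (intro b) (simp add: dist_norm norm_minus_commute)
        then show ?thesis using k0[of y] by (simp add: right_diff_distrib[symmetric] abs_mult mult_left_mono)
      next
        case False
        then show ?thesis using moll_zero[OF eps, of n "contract n x - y"] by simp
      qed
    qed (rule ci[OF aL(2)])
    also have "\<dots> = b" by (simp add: moll_X_integral[OF x])
    finally show ?thesis .
  qed
  show "AE x in lebesgue_on X. norm (smoothen n c x) \<le> B" for n
    using est[of _ n 0 B] c(2) by (intro AE_I2) auto
  show "AE x in lebesgue_on X. (\<lambda>n. smoothen n c x) \<longlonglongrightarrow> c x"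
  proof (rule AE_I2)
    fix x assume "x \<in> space (lebesgue_on X)"
    then have x: "x \<in> X" by simp
    show "(\<lambda>n. smoothen n c x) \<longlonglongrightarrow> c x"
    proof (rule LIMSEQ_I)
      fix e :: real assume e: "e > 0"
      have "isCont c x" using c(1) by (simp add: continuous_on_eq_continuous_at)
      then obtain d where d: "d > 0" "\<And>y. dist y x < d \<Longrightarrow> dist (c y) (c x) < e / 2"
        using e unfolding continuous_at_eps_delta by (metis half_gt_zero)
      have "\<forall>\<^sub>F n in sequentially. dist (contract n x) x < d / 2"
        using tendstoD[OF contract_tendsto[of x], of "d / 2"] d(1) by simp
      moreover have "\<forall>\<^sub>F n in sequentially. eps n < d / 2"
        using order_tendstoD(2)[OF eps_tendsto, of "d / 2"] d(1) by simp
      ultimately have "\<forall>\<^sub>F n in sequentially. norm (smoothen n c x - c x) < e"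
      proof eventually_elim
        case (elim n)
        have "\<bar>smoothen n c x - c x\<bar> \<le> e / 2"
        proof (rule est[OF x])
          fix y assume "dist y (contract n x) < eps n"
          then have "dist y x < d" using elim dist_triangle[of y x "contract n x"] by linarith
          then show "\<bar>c y - c x\<bar> \<le> e / 2" using d(2) by (fastforce simp: dist_real_def)
        qed
        then show ?case using e by simp
      qed
      then show "\<exists>N. \<forall>n\<ge>N. norm (smoothen n c x - c x) < e" by (simp add: eventually_sequentially)
    qed
  qed
qed

text \<open>Convergence holds for bounded continuous functions, and the bound of
  \<open>smoothen_norm\<close>, uniform in \<open>n\<close>, carries it over to the L2
  closure.\<close>

theorem smoothen_tendsto:
  assumes g: "g \<in> L2 X" shows "(\<lambda>n. L2_norm_on X (\<lambda>x. smoothen n g x - g x)) \<longlonglongrightarrow> 0"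
proof (rule LIMSEQ_I)
  fix e :: real assume e: "e > 0"
  \<comment> \<open>A quarter of \<open>e\<close>, because smoothing may double the approximation
    error: the three parts add up to two, one and one quarters.\<close>
  obtain c B where c: "continuous_on UNIV c" "\<And>x. \<bar>c x\<bar> \<le> B" "L2_norm_on X (\<lambda>x. g x - c x) < e / 4"
    using L2_continuous_dense[OF g bounded_X X_lebesgue, of "e / 4"] e by auto
  have cL: "c \<in> L2 X" by (rule continuous_L2[OF c(1) bounded_X X_lebesgue])
  obtain N where N: "\<And>n. n \<ge> N \<Longrightarrow> L2_norm_on X (\<lambda>x. smoothen n c x - c x) < e / 4"
    using order_tendstoD(2)[OF smoothen_continuous[OF c(1,2)], of "e / 4"] e by (auto simp: eventually_sequentially)
  have "L2_norm_on X (\<lambda>x. smoothen n g x - g x) < e" if "n \<ge> N" for n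
  proof -
    have "L2_norm_on X (\<lambda>x. smoothen n g x - smoothen n c x) \<le> 2 * L2_norm_on X (\<lambda>x. g x - c x)"
      using smoothen_norm[OF L2_diff[OF g cL], of n] by (simp add: smoothen_diff[OF g cL])
    then show ?thesis
      using L2_norm_triangle3[OF smoothen_L2[OF g] smoothen_L2[OF cL] g, of n n]
        L2_norm_triangle3[OF smoothen_L2[OF cL] cL g, of n] N[OF that] c(3) L2_norm_diff_commute[of X g c]
      by linarith
  qed
  then show "\<exists>N. \<forall>n\<ge>N. norm (L2_norm_on X (\<lambda>x. smoothen n g x - g x) - 0) < e" by auto
qed

text \<open>For fixed \<open>x\<close> the kernel is a test function of the integration variable
  \<open>y\<close>, so it may be inserted into the definition of weak derivatives; the reflection in
  \<open>contract n x - y\<close> produces the sign of the gradient.\<close>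

lemma kernel_test_function:
  assumes x: "x \<in> X"
  shows "(\<lambda>y. moll (eps n) (contract n x - y)) \<in> test_functions X"
    and "grad (\<lambda>y. moll (eps n) (contract n x - y)) y = - grad (moll (eps n)) (contract n x - y)"
proof -
  let ?k = "\<lambda>y. moll (eps n) (contract n x - y)"
  have l: "linear (\<lambda>y::point. (-1) *\<^sub>R y)" by (rule linearI) auto
  have k: "?k = (\<lambda>y. moll (eps n) ((-1) *\<^sub>R y + contract n x))" by (auto simp: algebra_simps)
  have "closure {y. ?k y \<noteq> 0} \<subseteq> cball (contract n x) (eps n)"
  proof (rule closure_minimal)
    show "{y. ?k y \<noteq> 0} \<subseteq> cball (contract n x) (eps n)"
      using moll_nonzero[OF eps] by (auto simp: dist_norm less_imp_le)
  qed simp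
  moreover from this have "compact (closure {y. ?k y \<noteq> 0})"
    using bounded_subset[OF bounded_cball] by (simp only: compact_eq_bounded_closed closed_closure simp_thms)
  moreover have "smooth ?k" unfolding k by (rule smooth_affine[OF l smooth_moll])
  ultimately show "?k \<in> test_functions X"
    unfolding test_functions_def using cball_contract[OF x] by blast
  have "grad ?k y $ i = - grad (moll (eps n)) (contract n x - y) $ i" for i
    using grad_compose_affine(2)[OF l, of "moll (eps n)" y "contract n x" i] smooth_differentiable[OF smooth_moll]
    unfolding k by (simp add: inner_axis)
  then show "grad ?k y = - grad (moll (eps n)) (contract n x - y)" by (simp add: vec_eq_iff)
qed

text \<open>Inserting the kernel as a test function moves the derivative onto \<open>v\<close>, with
  two signs that cancel; the factor \<open>lam n\<close> is the chain rule for the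
  contraction.\<close>

lemma smoothen_weak_grad:
  assumes v: "v \<in> L2 X" "is_weak_grad X v G" and x: "x \<in> X"
  shows "grad (smoothen n v) x $ i = lam n * smoothen n (\<lambda>y. G y $ i) x"
proof -
  have G: "G \<in> L2 X" using v(2) by (simp add: is_weak_grad_def)
  let ?k = "\<lambda>y. moll (eps n) (contract n x - y)"
  note t = kernel_test_function[OF x, of n]
  have eq: "(LINT y|lebesgue_on X. v y *\<^sub>R grad ?k y) = - (LINT y|lebesgue_on X. ?k y *\<^sub>R G y)"
    using v(2) t(1) by (simp add: is_weak_grad_def)
  have sg: "smooth (\<lambda>z. grad (moll (eps n)) z $ i)" for i by (rule smooth_grad[OF smooth_moll])
  have i1: "integrable (lebesgue_on X) (\<lambda>y. v y *\<^sub>R grad (moll (eps n)) (contract n x - y))"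
  proof -
    have "continuous_on UNIV (\<lambda>y. grad (moll (eps n)) (contract n x - y))"
      by (rule continuous_on_compose2[OF smooth_continuous_grad[OF smooth_moll, of UNIV]]) (auto intro!: continuous_intros)
    then have "(\<lambda>y. grad (moll (eps n)) (contract n x - y)) \<in> L2 X" by (rule continuous_L2[OF _ bounded_X X_lebesgue])
    then have i0: "integrable (lebesgue_on X) (\<lambda>y. \<Sum>i\<in>UNIV. (v y * (grad (moll (eps n)) (contract n x - y) $ i)) *\<^sub>R (axis i 1 :: point))"
      using ip_integrable[OF v(1) L2_nth[of "\<lambda>y. grad (moll (eps n)) (contract n x - y)" X]] 
      by (intro Bochner_Integration.integrable_sum integrable_scaleR_left) auto
    have s: "(\<Sum>i\<in>UNIV. (a * (w $ i)) *\<^sub>R axis i 1) = a *\<^sub>R w" for a and w :: point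
      by (simp add: vec_eq_iff axis_def if_distrib cong: if_cong)
    show ?thesis using i0 by (simp only: s)
  qed
  have i2: "integrable (lebesgue_on X) (\<lambda>y. ?k y *\<^sub>R G y)"
    by (rule L2_bounded_integrable[OF G _ moll_bounded[OF eps] bounded_X X_lebesgue])
      (auto intro!: continuous_measurable_lebesgue_on continuous_on_compose2[OF smooth_continuous[OF smooth_moll, of UNIV]] continuous_intros)
  have "(LINT y|lebesgue_on X. v y *\<^sub>R grad (moll (eps n)) (contract n x - y)) = (LINT y|lebesgue_on X. ?k y *\<^sub>R G y)"
    using eq by (simp add: t(2))
  then have "axis i 1 \<bullet> (LINT y|lebesgue_on X. v y *\<^sub>R grad (moll (eps n)) (contract n x - y)) = axis i 1 \<bullet> (LINT y|lebesgue_on X. ?k y *\<^sub>R G y)" by simp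
  then have "(LINT y|lebesgue_on X. v y * grad (moll (eps n)) (contract n x - y) $ i) = (LINT y|lebesgue_on X. ?k y * G y $ i)"
    unfolding integral_inner_right[OF i1, symmetric] integral_inner_right[OF i2, symmetric] by (simp add: inner_axis')
  then show ?thesis
    using smoothen_smooth(2)[OF v(1), of n x i] by (simp add: smoothen_def conv_def mult.commute)
qed

text \<open>A field with weak divergence need not have weak partial derivatives, so only the sum of
  the diagonal derivatives is identified.\<close>

lemma smoothen_weak_div:
  assumes q: "q \<in> L2 X" "is_weak_div X q d" and x: "x \<in> X"
  shows "(\<Sum>i\<in>UNIV. grad (smoothen n (\<lambda>y. q y $ i)) x $ i) = lam n * smoothen n d x"
proof -
  let ?k = "\<lambda>y. moll (eps n) (contract n x - y)"
  note t = kernel_test_function[OF x, of n]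
  have eq: "(LINT y|lebesgue_on X. q y \<bullet> grad ?k y) = - (LINT y|lebesgue_on X. ?k y * d y)"
    using q(2) t(1) by (simp add: is_weak_div_def)
  have "(LINT y|lebesgue_on X. (\<Sum>i\<in>UNIV. grad (moll (eps n)) (contract n x - y) $ i * q y $ i))
      = (\<Sum>i\<in>UNIV. conv X (\<lambda>z. grad (moll (eps n)) z $ i) (\<lambda>y. q y $ i) (contract n x))"
    unfolding conv_def using conv_integrable[OF smooth_continuous[OF smooth_grad[OF smooth_moll]] bounded_X X_lebesgue L2_nth[OF q(1)]]
    by (intro Bochner_Integration.integral_sum) auto
  moreover have "(LINT y|lebesgue_on X. q y \<bullet> grad ?k y) = - (LINT y|lebesgue_on X. (\<Sum>i\<in>UNIV. grad (moll (eps n)) (contract n x - y) $ i * q y $ i))"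
    by (simp add: t(2) inner_vec_def mult.commute sum_negf)
  ultimately have "(\<Sum>i\<in>UNIV. conv X (\<lambda>z. grad (moll (eps n)) z $ i) (\<lambda>y. q y $ i) (contract n x)) = smoothen n d x"
    using eq by (simp add: smoothen_def conv_def)
  then show ?thesis
    using smoothen_smooth(2)[OF L2_nth[OF q(1)], of n _ x] by (simp add: sum_distrib_left[symmetric])
qed

lemma smoothen_zero:
  assumes "\<And>\<phi>. \<phi> \<in> test_functions X \<Longrightarrow> (LINT x|lebesgue_on X. \<phi> x * g x) = 0" "x \<in> X"
  shows "smoothen n g x = 0"
  using assms(1)[OF kernel_test_function(1)[OF assms(2)]] by (simp add: smoothen_def conv_def)

text \<open>Removes the chain rule factor: \<open>lam n\<close> tends to 1 and the smoothed
  functions are bounded in L2.\<close>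

lemma smoothen_scaled_tendsto:
  assumes g: "g \<in> L2 X" shows "(\<lambda>n. L2_norm_on X (\<lambda>x. lam n * smoothen n g x - g x)) \<longlonglongrightarrow> 0"
proof (rule null_sequence_comparison)
  show "(\<lambda>n. L2_norm_on X (\<lambda>x. smoothen n g x - g x) + \<bar>lam n - 1\<bar> * (2 * L2_norm_on X g)) \<longlonglongrightarrow> 0"
  proof -
    have "(\<lambda>n. L2_norm_on X (\<lambda>x. smoothen n g x - g x) + \<bar>lam n - 1\<bar> * (2 * L2_norm_on X g)) \<longlonglongrightarrow> 0 + \<bar>1 - 1\<bar> * (2 * L2_norm_on X g)"
      by (intro tendsto_intros smoothen_tendsto g lam_tendsto)
    then show ?thesis by simp
  qed
  fix n
  have "L2_norm_on X (\<lambda>x. lam n * smoothen n g x - g x) = L2_norm_on X (\<lambda>x. (lam n - 1) * smoothen n g x + (smoothen n g x - g x))"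
    by (simp add: algebra_simps)
  also have "\<dots> \<le> L2_norm_on X (\<lambda>x. (lam n - 1) * smoothen n g x) + L2_norm_on X (\<lambda>x. smoothen n g x - g x)"
    by (intro L2_norm_triangle L2_mult L2_diff smoothen_L2 g)
  also have "L2_norm_on X (\<lambda>x. (lam n - 1) * smoothen n g x) \<le> \<bar>lam n - 1\<bar> * (2 * L2_norm_on X g)"
    unfolding L2_norm_mult by (intro mult_left_mono smoothen_norm g) simp
  finally show "\<bar>L2_norm_on X (\<lambda>x. lam n * smoothen n g x - g x)\<bar> \<le> L2_norm_on X (\<lambda>x. smoothen n g x - g x) + \<bar>lam n - 1\<bar> * (2 * L2_norm_on X g)"
    by simp
qed

end

section \<open>Weak derivatives\<close>

text \<open>The common framework for \<Omega> and for the elements, to which the smoothing by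
  contraction applies.\<close>

definition convex_domain :: "point set \<Rightarrow> bool" where
  "convex_domain X \<longleftrightarrow> open X \<and> convex X \<and> bounded X \<and> X \<noteq> {}"

lemma convex_domain_smoothing:
  assumes "convex_domain X" obtains x0 r where "smoothing X x0 r"
proof -
  obtain x0 where "x0 \<in> X" using assms by (auto simp: convex_domain_def)
  then obtain r where "r > 0" "ball x0 r \<subseteq> X"
    using assms open_contains_ball[of X] by (auto simp: convex_domain_def)
  then have "smoothing X x0 r" using assms by (simp add: smoothing_def convex_domain_def)
  then show ?thesis by (rule that)
qed

lemma convex_domain_lebesgue: "convex_domain X \<Longrightarrow> X \<in> sets lebesgue"
  by (simp add: convex_domain_def lborelD)

lemma convex_domain_bounded: "convex_domain X \<Longrightarrow> bounded X"
  by (simp add: convex_domain_def)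

lemma convex_domain_cell: "convex_quad K \<Longrightarrow> convex_domain (cell K)"
  by (simp add: convex_domain_def open_cell convex_cell bounded_cell cell_nonempty)

lemma smooth_L2:
  assumes "convex_domain X" "smooth f" shows "f \<in> L2 X" "grad f \<in> L2 X"
  using continuous_L2[OF smooth_continuous[OF assms(2)] convex_domain_bounded[OF assms(1)] convex_domain_lebesgue[OF assms(1)]]
    continuous_L2[OF smooth_continuous_grad[OF assms(2)] convex_domain_bounded[OF assms(1)] convex_domain_lebesgue[OF assms(1)]] .

lemma test_function_smooth: "f \<in> test_functions X \<Longrightarrow> smooth f"
  by (simp add: test_functions_def)

lemma test_L2:
  assumes "convex_domain X" "f \<in> test_functions X" shows "f \<in> L2 X" "grad f \<in> L2 X"
  using smooth_L2[OF assms(1) test_function_smooth[OF assms(2)]] .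

text \<open>The values of the smoothed function on \<open>X\<close> are integrals of
  \<open>g\<close> against test functions and hence vanish, while the smoothed functions converge to
  \<open>g\<close>.\<close>

theorem fundamental_lemma:
  assumes X: "convex_domain X" and g: "g \<in> L2 X"
    and z: "\<And>\<phi>. \<phi> \<in> test_functions X \<Longrightarrow> ip X \<phi> g = 0"
  shows "AE x in lebesgue_on X. g x = 0"
proof -
  obtain x0 r where "smoothing X x0 r" using convex_domain_smoothing[OF X] .
  then interpret smoothing X x0 r .
  have s: "smoothen n g x = 0" if "x \<in> X" for n x
    using z that by (intro smoothen_zero) (auto simp: ip_def)
  have "L2_norm_on X (\<lambda>x. smoothen n g x - g x) = L2_norm_on X g" for n
    unfolding L2_norm_on_def using s by (intro arg_cong[of _ _ sqrt] Bochner_Integration.integral_cong) auto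
  then have "L2_norm_on X g = 0" using smoothen_tendsto[OF g] by (simp add: LIMSEQ_const_iff)
  then show ?thesis using L2_norm_zero_AE[OF g] by simp
qed

text \<open>Replaces the vector-valued integrals of the definition by scalar inner products, for
  which the calculus of \<open>ip\<close> is available.\<close>

lemma is_weak_grad_iff:
  assumes X: "convex_domain X" and f: "f \<in> L2 X"
  shows "is_weak_grad X f g \<longleftrightarrow> g \<in> L2 X \<and>
    (\<forall>\<phi>\<in>test_functions X. \<forall>i. ip X f (\<lambda>x. grad \<phi> x $ i) = - ip X \<phi> (\<lambda>x. g x $ i))"
proof -
  have "(LINT x|lebesgue_on X. f x *\<^sub>R grad \<phi> x) = - (LINT x|lebesgue_on X. \<phi> x *\<^sub>R g x) \<longleftrightarrow>
    (\<forall>i. ip X f (\<lambda>x. grad \<phi> x $ i) = - ip X \<phi> (\<lambda>x. g x $ i))" if g: "g \<in> L2 X" and \<phi>: "\<phi> \<in> test_functions X" for \<phi>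
  proof -
    have int: "integrable (lebesgue_on X) (\<lambda>x. a x *\<^sub>R b x) \<and> (\<forall>i. (LINT x|lebesgue_on X. a x *\<^sub>R b x) $ i = ip X a (\<lambda>x. b x $ i))"
      if a: "a \<in> L2 X" and b: "b \<in> L2 X" for a and b :: "point \<Rightarrow> point"
    proof -
      have s: "(\<Sum>i\<in>UNIV. (c * (w $ i)) *\<^sub>R (axis i 1 :: point)) = c *\<^sub>R w" for c w
        by (simp add: vec_eq_iff axis_def if_distrib cong: if_cong)
      have "integrable (lebesgue_on X) (\<lambda>x. \<Sum>i\<in>UNIV. (a x * (b x $ i)) *\<^sub>R (axis i 1 :: point))"
        using ip_integrable[OF a L2_nth[OF b]] by (intro Bochner_Integration.integrable_sum integrable_scaleR_left) auto
      then have i: "integrable (lebesgue_on X) (\<lambda>x. a x *\<^sub>R b x)" by (simp only: s)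
      have "(LINT x|lebesgue_on X. a x *\<^sub>R b x) $ i = ip X a (\<lambda>x. b x $ i)" for i
        using integral_bounded_linear[OF bounded_linear_vec_nth i, of i] by (simp add: ip_def)
      with i show ?thesis by blast
    qed
    show ?thesis using int[OF f test_L2(2)[OF X \<phi>]] int[OF test_L2(1)[OF X \<phi>] g] by (simp add: vec_eq_iff)
  qed
  then show ?thesis unfolding is_weak_grad_def by blast
qed

lemma is_weak_div_iff:
  "is_weak_div X q d \<longleftrightarrow> d \<in> L2 X \<and> (\<forall>\<phi>\<in>test_functions X. ip X q (grad \<phi>) = - ip X \<phi> d)"
  by (simp add: is_weak_div_def ip_def)

lemma is_weak_grad_L2: "is_weak_grad X f g \<Longrightarrow> g \<in> L2 X"
  by (simp add: is_weak_grad_def)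

lemma is_weak_div_L2: "is_weak_div X f g \<Longrightarrow> g \<in> L2 X"
  by (simp add: is_weak_div_def)

lemma is_weak_grad_unique:
  assumes X: "convex_domain X" and f: "f \<in> L2 X" and g: "is_weak_grad X f g" "is_weak_grad X f g'"
  shows "AE x in lebesgue_on X. g x = g' x"
proof -
  have L: "(\<lambda>x. g x $ i) \<in> L2 X" "(\<lambda>x. g' x $ i) \<in> L2 X" for i
    using is_weak_grad_L2[OF g(1)] is_weak_grad_L2[OF g(2)] by auto
  have "AE x in lebesgue_on X. g x $ i - g' x $ i = 0" for i
  proof (rule fundamental_lemma[OF X L2_diff[OF L]])
    fix \<phi> assume \<phi>: "\<phi> \<in> test_functions X"
    then have "ip X \<phi> (\<lambda>x. g x $ i) = ip X \<phi> (\<lambda>x. g' x $ i)"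
      using g unfolding is_weak_grad_iff[OF X f] by (metis minus_equation_iff)
    then show "ip X \<phi> (\<lambda>x. g x $ i - g' x $ i) = 0"
      using L test_L2(1)[OF X \<phi>] by (simp add: ip_linear)
  qed
  from this[of 1] this[of 2] show ?thesis
    by eventually_elim (simp add: point_eq_iff)
qed

lemma is_weak_div_unique:
  assumes X: "convex_domain X" and g: "is_weak_div X q d" "is_weak_div X q d'"
  shows "AE x in lebesgue_on X. d x = d' x"
proof -
  have L: "d \<in> L2 X" "d' \<in> L2 X" using g is_weak_div_L2 by auto
  have "AE x in lebesgue_on X. d x - d' x = 0"
  proof (rule fundamental_lemma[OF X L2_diff[OF L]])
    fix \<phi> assume \<phi>: "\<phi> \<in> test_functions X"
    then have "ip X \<phi> d = ip X \<phi> d'"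
      using g unfolding is_weak_div_iff by (metis minus_equation_iff)
    then show "ip X \<phi> (\<lambda>x. d x - d' x) = 0"
      using L test_L2(1)[OF X \<phi>] by (simp add: ip_linear)
  qed
  then show ?thesis by simp
qed

lemma H1_L2: "f \<in> H1 X \<Longrightarrow> f \<in> L2 X" and Hdiv_L2: "q \<in> Hdiv X \<Longrightarrow> q \<in> L2 X"
  by (auto simp: H1_def Hdiv_def)

lemma H1I: "f \<in> L2 X \<Longrightarrow> is_weak_grad X f g \<Longrightarrow> f \<in> H1 X" and HdivI: "q \<in> L2 X \<Longrightarrow> is_weak_div X q d \<Longrightarrow> q \<in> Hdiv X"
  by (auto simp: H1_def Hdiv_def)

lemma wgrad: "f \<in> H1 X \<Longrightarrow> is_weak_grad X f (wgrad X f)"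
  unfolding wgrad_def H1_def by (rule someI_ex[of "is_weak_grad X f"]) simp

lemma wdiv: "q \<in> Hdiv X \<Longrightarrow> is_weak_div X q (wdiv X q)"
  unfolding wdiv_def Hdiv_def by (rule someI_ex[of "is_weak_div X q"]) simp

lemma wgrad_L2: "f \<in> H1 X \<Longrightarrow> wgrad X f \<in> L2 X"
  by (rule is_weak_grad_L2[OF wgrad])

lemma wdiv_L2: "q \<in> Hdiv X \<Longrightarrow> wdiv X q \<in> L2 X"
  by (rule is_weak_div_L2[OF wdiv])

lemma wgrad_AE:
  assumes "convex_domain X" "f \<in> L2 X" "is_weak_grad X f g"
  shows "AE x in lebesgue_on X. wgrad X f x = g x"
  by (rule is_weak_grad_unique[OF assms(1,2) wgrad[OF H1I[OF assms(2,3)]] assms(3)])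

lemma wdiv_AE:
  assumes "convex_domain X" "q \<in> L2 X" "is_weak_div X q d"
  shows "AE x in lebesgue_on X. wdiv X q x = d x"
  by (rule is_weak_div_unique[OF assms(1) wdiv[OF HdivI[OF assms(2,3)]] assms(3)])

lemma wgrad_norm:
  assumes "convex_domain X" "f \<in> L2 X" "is_weak_grad X f g"
  shows "L2_norm_on X (wgrad X f) = L2_norm_on X g"
  using wgrad_AE[OF assms] wgrad_L2[OF H1I[OF assms(2,3)]] is_weak_grad_L2[OF assms(3)] by (intro L2_norm_cong_AE L2_measurable)

lemma wdiv_norm:
  assumes "convex_domain X" "f \<in> L2 X" "is_weak_div X f g"
  shows "L2_norm_on X (wdiv X f) = L2_norm_on X g"
  using wdiv_AE[OF assms] wdiv_L2[OF HdivI[OF assms(2,3)]] is_weak_div_L2[OF assms(3)] by (intro L2_norm_cong_AE L2_measurable)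

lemma wgrad_ip:
  assumes "convex_domain X" "f \<in> L2 X" "is_weak_grad X f g" "h \<in> L2 X"
  shows "ip X (wgrad X f) h = ip X g h"
  using wgrad_AE[OF assms(1-3)] wgrad_L2[OF H1I[OF assms(2,3)]] is_weak_grad_L2[OF assms(3)] assms(4)
  by (intro ip_cong_AE L2_measurable) auto

lemma wdiv_ip:
  assumes "convex_domain X" "f \<in> L2 X" "is_weak_div X f g" "h \<in> L2 X"
  shows "ip X h (wdiv X f) = ip X h g"
  using wdiv_AE[OF assms(1-3)] wdiv_L2[OF HdivI[OF assms(2,3)]] is_weak_div_L2[OF assms(3)] assms(4)
  by (intro ip_cong_AE L2_measurable) auto

lemma is_weak_grad_lincomb:
  assumes X: "convex_domain X" and f: "f \<in> L2 X" "f' \<in> L2 X" and g: "is_weak_grad X f g" "is_weak_grad X f' g'"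
  shows "is_weak_grad X (\<lambda>x. a * f x + b * f' x) (\<lambda>x. a *\<^sub>R g x + b *\<^sub>R g' x)"
proof -
  note L = is_weak_grad_L2[OF g(1)] is_weak_grad_L2[OF g(2)]
  have "ip X (\<lambda>x. a * f x + b * f' x) (\<lambda>x. grad \<phi> x $ i) = - ip X \<phi> (\<lambda>x. a * g x $ i + b * g' x $ i)"
    if \<phi>: "\<phi> \<in> test_functions X" for \<phi> i
    using test_L2[OF X \<phi>] f L g[unfolded is_weak_grad_iff[OF X f(1)] is_weak_grad_iff[OF X f(2)]] \<phi>
      ip_scaleR_left[of X a f] ip_scaleR_left[of X b f']
      ip_scaleR_right[of X _ a "\<lambda>x. g x $ i"] ip_scaleR_right[of X _ b "\<lambda>x. g' x $ i"]
    by (simp add: ip_add_left ip_add_right L2_mult L2_nth)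
  then show ?thesis
    using L f by (subst is_weak_grad_iff[OF X]) (auto intro!: L2_add L2_mult L2_scaleR)
qed

lemma is_weak_div_lincomb:
  assumes X: "convex_domain X" and f: "f \<in> L2 X" "f' \<in> L2 X" and g: "is_weak_div X f g" "is_weak_div X f' g'"
  shows "is_weak_div X (\<lambda>x. a *\<^sub>R f x + b *\<^sub>R f' x) (\<lambda>x. a * g x + b * g' x)"
proof -
  note L = is_weak_div_L2[OF g(1)] is_weak_div_L2[OF g(2)]
  have "ip X (\<lambda>x. a *\<^sub>R f x + b *\<^sub>R f' x) (grad \<phi>) = - ip X \<phi> (\<lambda>x. a * g x + b * g' x)"
    if \<phi>: "\<phi> \<in> test_functions X" for \<phi>
    using test_L2[OF X \<phi>] f L g[unfolded is_weak_div_iff] \<phi>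
      ip_scaleR_right[of X _ a g] ip_scaleR_right[of X _ b g']
    by (simp add: ip_add_left ip_add_right L2_mult L2_scaleR ip_scaleR_left)
  then show ?thesis
    using L f by (subst is_weak_div_iff) (auto intro!: L2_add L2_mult L2_scaleR)
qed

lemma is_weak_grad_zero: "is_weak_grad X (\<lambda>x. 0) (\<lambda>x. 0)" and is_weak_div_zero: "is_weak_div X (\<lambda>x. 0) (\<lambda>x. 0)"
  by (auto simp: is_weak_grad_def is_weak_div_def)

lemma is_weak_grad_diff:
  assumes "convex_domain X" "f \<in> L2 X" "f' \<in> L2 X" "is_weak_grad X f g" "is_weak_grad X f' g'"
  shows "is_weak_grad X (\<lambda>x. f x - f' x) (\<lambda>x. g x - g' x)"
  using is_weak_grad_lincomb[OF assms, of 1 "-1"] by simp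

lemma is_weak_div_diff:
  assumes "convex_domain X" "f \<in> L2 X" "f' \<in> L2 X" "is_weak_div X f g" "is_weak_div X f' g'"
  shows "is_weak_div X (\<lambda>x. f x - f' x) (\<lambda>x. g x - g' x)"
  using is_weak_div_lincomb[OF assms, of 1 "-1"] by simp

lemma test_functions_mono: "Y \<subseteq> X \<Longrightarrow> test_functions Y \<subseteq> test_functions X"
  by (auto simp: test_functions_def)

lemma lebesgue_on_integral_subset:
  fixes f :: "'a::euclidean_space \<Rightarrow> 'b::euclidean_space"
  assumes "Y \<subseteq> X" "Y \<in> sets lebesgue" "X \<in> sets lebesgue" "\<And>x. x \<in> X \<Longrightarrow> x \<notin> Y \<Longrightarrow> f x = 0"
  shows "(LINT x|lebesgue_on X. f x) = (LINT x|lebesgue_on Y. f x)"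
  unfolding lebesgue_on_integral_eq_set_integral[OF assms(2)] lebesgue_on_integral_eq_set_integral[OF assms(3)]
    set_lebesgue_integral_def using assms(1,4)
  by (intro Bochner_Integration.integral_cong) (auto simp: indicator_def)

lemma test_functions_outside:
  assumes "\<phi> \<in> test_functions Y" "x \<notin> Y" shows "\<phi> x = 0" "grad \<phi> x = 0"
proof -
  have "x \<notin> closure {x. \<phi> x \<noteq> 0}" using assms unfolding test_functions_def by blast
  from test_functions_grad_zero[OF assms(1) this] show "\<phi> x = 0" "grad \<phi> x = 0" .
qed

text \<open>Test functions of the smaller set are test functions of the larger one and vanish, with
  their gradients, in between.\<close>

lemma is_weak_grad_subset:
  assumes "is_weak_grad X f g" "Y \<subseteq> X" "Y \<in> sets lebesgue" "X \<in> sets lebesgue"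
  shows "is_weak_grad Y f g"
  unfolding is_weak_grad_def
proof (intro conjI ballI)
  show "g \<in> L2 Y" by (rule L2_restrict[OF is_weak_grad_L2[OF assms(1)] assms(2-4)])
  fix \<phi> assume \<phi>: "\<phi> \<in> test_functions Y"
  then have "(LINT x|lebesgue_on X. f x *\<^sub>R grad \<phi> x) = - (LINT x|lebesgue_on X. \<phi> x *\<^sub>R g x)"
    using assms(1) test_functions_mono[OF assms(2)] by (auto simp: is_weak_grad_def)
  then show "(LINT x|lebesgue_on Y. f x *\<^sub>R grad \<phi> x) = - (LINT x|lebesgue_on Y. \<phi> x *\<^sub>R g x)"
    using lebesgue_on_integral_subset[OF assms(2-4), of "\<lambda>x. f x *\<^sub>R grad \<phi> x"]
      lebesgue_on_integral_subset[OF assms(2-4), of "\<lambda>x. \<phi> x *\<^sub>R g x"] test_functions_outside[OF \<phi>] by simp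
qed

lemma is_weak_div_subset:
  assumes "is_weak_div X q d" "Y \<subseteq> X" "Y \<in> sets lebesgue" "X \<in> sets lebesgue"
  shows "is_weak_div Y q d"
  unfolding is_weak_div_def
proof (intro conjI ballI)
  show "d \<in> L2 Y" by (rule L2_restrict[OF is_weak_div_L2[OF assms(1)] assms(2-4)])
  fix \<phi> assume \<phi>: "\<phi> \<in> test_functions Y"
  then have "(LINT x|lebesgue_on X. q x \<bullet> grad \<phi> x) = - (LINT x|lebesgue_on X. \<phi> x * d x)"
    using assms(1) test_functions_mono[OF assms(2)] by (auto simp: is_weak_div_def)
  then show "(LINT x|lebesgue_on Y. q x \<bullet> grad \<phi> x) = - (LINT x|lebesgue_on Y. \<phi> x * d x)"
    using lebesgue_on_integral_subset[OF assms(2-4), of "\<lambda>x. q x \<bullet> grad \<phi> x"]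
      lebesgue_on_integral_subset[OF assms(2-4), of "\<lambda>x. \<phi> x * d x"] test_functions_outside[OF \<phi>] by simp
qed

lemma test_functions_mult:
  assumes f: "smooth f" and \<phi>: "\<phi> \<in> test_functions X"
  shows "(\<lambda>x. f x * \<phi> x) \<in> test_functions X"
proof -
  have sub: "closure {x. f x * \<phi> x \<noteq> 0} \<subseteq> closure {x. \<phi> x \<noteq> 0}" by (rule closure_mono) auto
  have "compact (closure {x. \<phi> x \<noteq> 0})" "closure {x. \<phi> x \<noteq> 0} \<subseteq> X" using \<phi> by (simp_all add: test_functions_def)
  then have "compact (closure {x. f x * \<phi> x \<noteq> 0})" "closure {x. f x * \<phi> x \<noteq> 0} \<subseteq> X"
    using bounded_subset[OF compact_imp_bounded sub] order_trans[OF sub] unfolding compact_eq_bounded_closed[of "closure {x. f x * \<phi> x \<noteq> 0}"]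
    by (simp_all only: closed_closure simp_thms)
  then show ?thesis
    unfolding test_functions_def mem_Collect_eq by (intro conjI smooth_mult f test_function_smooth[OF \<phi>])
qed

text \<open>The product with a test function is a test function, and the integral of its gradient
  vanishes.\<close>

lemma smooth_integration_by_parts:
  assumes X: "convex_domain X" and f: "smooth f" and \<phi>: "\<phi> \<in> test_functions X"
  shows "ip X f (\<lambda>x. grad \<phi> x $ i) = - ip X \<phi> (\<lambda>x. grad f x $ i)"
proof -
  note sd = smooth_differentiable[OF f] smooth_differentiable[OF test_function_smooth[OF \<phi>]]
  note L = smooth_L2[OF X f] test_L2[OF X \<phi>]
  have g: "grad (\<lambda>x. f x * \<phi> x) x = f x *\<^sub>R grad \<phi> x + \<phi> x *\<^sub>R grad f x" for x by (rule grad_mult[OF sd])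
  have tf: "(\<lambda>x. f x * \<phi> x) \<in> test_functions X" by (rule test_functions_mult[OF f \<phi>])
  have "integrable (lebesgue_on X) (grad (\<lambda>x. f x * \<phi> x))"
    using X by (intro continuous_integrable_bounded smooth_continuous_grad test_function_smooth[OF tf])
      (auto simp: convex_domain_bounded convex_domain_lebesgue)
  from integral_bounded_linear[OF bounded_linear_vec_nth this, of i]
  have "0 = (LINT x|lebesgue_on X. f x * (grad \<phi> x $ i) + \<phi> x * (grad f x $ i))"
    using test_functions_integral_grad[OF tf convex_domain_lebesgue[OF X]] by (simp add: g)
  also have "\<dots> = ip X f (\<lambda>x. grad \<phi> x $ i) + ip X \<phi> (\<lambda>x. grad f x $ i)"
    using ip_integrable[OF L(1) L2_nth[OF L(4)], of i] ip_integrable[OF L(3) L2_nth[OF L(2)], of i]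
    by (simp add: ip_def Bochner_Integration.integral_add)
  finally show ?thesis by simp
qed

lemma smooth_weak_grad: "convex_domain X \<Longrightarrow> smooth f \<Longrightarrow> is_weak_grad X f (grad f)"
  by (simp add: is_weak_grad_iff smooth_L2 smooth_integration_by_parts)

definition smooth_vec :: "(point \<Rightarrow> point) \<Rightarrow> bool" where
  "smooth_vec q \<longleftrightarrow> (\<forall>i. smooth (\<lambda>x. q x $ i))"

definition sdiv :: "(point \<Rightarrow> point) \<Rightarrow> point \<Rightarrow> real" where
  "sdiv q x = (\<Sum>i\<in>UNIV. grad (\<lambda>y. q y $ i) x $ i)"

lemma smooth_vec_L2:
  assumes "convex_domain X" "smooth_vec q" shows "q \<in> L2 X" "sdiv q \<in> L2 X"
proof -
  show "q \<in> L2 X" using smooth_L2[OF assms(1)] assms(2) by (intro L2_vecI) (auto simp: smooth_vec_def)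
  have "(\<lambda>x. \<Sum>i\<in>UNIV. grad (\<lambda>y. q y $ i) x $ i) \<in> L2 X"
    using smooth_L2[OF assms(1)] assms(2) by (intro L2_sum L2_nth) (auto simp: smooth_vec_def)
  then show "sdiv q \<in> L2 X" by (simp add: sdiv_def[abs_def])
qed

lemma smooth_weak_div:
  assumes X: "convex_domain X" and q: "smooth_vec q" shows "is_weak_div X q (sdiv q)"
  unfolding is_weak_div_iff
proof (intro conjI ballI)
  show "sdiv q \<in> L2 X" by (rule smooth_vec_L2[OF X q])
  fix \<phi> assume \<phi>: "\<phi> \<in> test_functions X"
  have s: "smooth (\<lambda>x. q x $ i)" for i using q by (simp add: smooth_vec_def)
  have "ip X q (grad \<phi>) = (\<Sum>i\<in>UNIV. ip X (\<lambda>x. q x $ i) (\<lambda>x. grad \<phi> x $ i))"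
    by (rule ip_vec[OF smooth_vec_L2(1)[OF X q] test_L2(2)[OF X \<phi>]])
  also have "\<dots> = - (\<Sum>i\<in>UNIV. ip X \<phi> (\<lambda>x. grad (\<lambda>y. q y $ i) x $ i))"
    by (simp add: smooth_integration_by_parts[OF X s \<phi>] sum_negf)
  also have "(\<Sum>i\<in>UNIV. ip X \<phi> (\<lambda>x. grad (\<lambda>y. q y $ i) x $ i)) = ip X \<phi> (sdiv q)"
    unfolding sum_2_pt sdiv_def[abs_def]
    by (intro ip_add_right[symmetric] L2_nth smooth_L2[OF X s] test_L2[OF X \<phi>])
  finally show "ip X q (grad \<phi>) = - ip X \<phi> (sdiv q)" .
qed

lemma is_weak_grad_limit:
  assumes X: "convex_domain X" and f: "\<And>n. f n \<in> L2 X" "f' \<in> L2 X" and w: "\<And>n. is_weak_grad X (f n) (g n)"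
    and g: "g' \<in> L2 X" and lf: "(\<lambda>n. L2_norm_on X (\<lambda>x. f n x - f' x)) \<longlonglongrightarrow> 0"
    and lg: "(\<lambda>n. L2_norm_on X (\<lambda>x. g n x - g' x)) \<longlonglongrightarrow> 0"
  shows "is_weak_grad X f' g'"
  unfolding is_weak_grad_iff[OF X f(2)]
proof (intro conjI ballI allI g)
  fix \<phi> i assume \<phi>: "\<phi> \<in> test_functions X"
  note gL = is_weak_grad_L2[OF w]
  have "(\<lambda>n. ip X (f n) (\<lambda>x. grad \<phi> x $ i)) \<longlonglongrightarrow> ip X f' (\<lambda>x. grad \<phi> x $ i)"
    by (rule ip_tendsto[OF f lf L2_nth[OF test_L2(2)[OF X \<phi>]]])
  moreover have "(\<lambda>n. - ip X (\<lambda>x. g n x $ i) \<phi>) \<longlonglongrightarrow> - ip X (\<lambda>x. g' x $ i) \<phi>"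
  proof (intro tendsto_minus ip_tendsto[OF L2_nth[OF gL] L2_nth[OF g] _ test_L2(1)[OF X \<phi>]])
    show "(\<lambda>n. L2_norm_on X (\<lambda>x. g n x $ i - g' x $ i)) \<longlonglongrightarrow> 0"
      by (rule null_sequence_comparison[OF _ lg]) (use L2_norm_nth_le[OF L2_diff[OF gL g], of _ i] in simp)
  qed
  moreover have "ip X (f n) (\<lambda>x. grad \<phi> x $ i) = - ip X (\<lambda>x. g n x $ i) \<phi>" for n
    using w[of n] \<phi> f unfolding is_weak_grad_iff[OF X f(1)] by (simp add: ip_commute)
  ultimately show "ip X f' (\<lambda>x. grad \<phi> x $ i) = - ip X \<phi> (\<lambda>x. g' x $ i)"
    using LIMSEQ_unique by (simp add: ip_commute[of X \<phi>]) blast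
qed

lemma L2_norm_vec_tendsto:
  fixes f :: "nat \<Rightarrow> 'd::euclidean_space \<Rightarrow> ('a::euclidean_space)^'n"
  assumes "\<And>n. f n \<in> L2 X" "g \<in> L2 X" "\<And>i. (\<lambda>n. L2_norm_on X (\<lambda>x. f n x $ i - g x $ i)) \<longlonglongrightarrow> 0"
  shows "(\<lambda>n. L2_norm_on X (\<lambda>x. f n x - g x)) \<longlonglongrightarrow> 0"
proof -
  have "(\<lambda>n. sqrt (\<Sum>i\<in>UNIV. (L2_norm_on X (\<lambda>x. f n x $ i - g x $ i))\<^sup>2)) \<longlonglongrightarrow> sqrt (\<Sum>i\<in>(UNIV::'n set). 0\<^sup>2)"
    by (intro tendsto_intros assms(3))
  moreover have "L2_norm_on X (\<lambda>x. f n x - g x) = sqrt (\<Sum>i\<in>UNIV. (L2_norm_on X (\<lambda>x. f n x $ i - g x $ i))\<^sup>2)" for n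
    by (rule real_sqrt_unique[symmetric]) (simp_all add: L2_norm_vec[OF L2_diff[OF assms(1,2)]])
  ultimately show ?thesis by simp
qed

section \<open>Density of smooth functions, and the space with zero boundary values\<close>

theorem H1_smooth_dense:
  assumes X: "convex_domain X" and v: "v \<in> H1 X"
  obtains \<phi> where "\<And>n::nat. smooth (\<phi> n)" "(\<lambda>n. L2_norm_on X (\<lambda>x. \<phi> n x - v x)) \<longlonglongrightarrow> 0"
    "(\<lambda>n. L2_norm_on X (\<lambda>x. grad (\<phi> n) x - wgrad X v x)) \<longlonglongrightarrow> 0"
proof -
  obtain x0 r where "smoothing X x0 r" using convex_domain_smoothing[OF X] .
  then interpret smoothing X x0 r .
  note vL = H1_L2[OF v] and gL = wgrad_L2[OF v]
  have "(\<lambda>n. L2_norm_on X (\<lambda>x. grad (smoothen n v) x - wgrad X v x)) \<longlonglongrightarrow> 0"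
  proof (rule L2_norm_vec_tendsto[OF smooth_L2(2)[OF X smoothen_smooth(1)[OF vL]] gL])
    fix i
    have "L2_norm_on X (\<lambda>x. grad (smoothen n v) x $ i - wgrad X v x $ i) = L2_norm_on X (\<lambda>x. lam n * smoothen n (\<lambda>y. wgrad X v y $ i) x - wgrad X v x $ i)" for n
      unfolding L2_norm_on_def using smoothen_weak_grad[OF vL wgrad[OF v]]
      by (intro arg_cong[of _ _ sqrt] Bochner_Integration.integral_cong) auto
    then show "(\<lambda>n. L2_norm_on X (\<lambda>x. grad (smoothen n v) x $ i - wgrad X v x $ i)) \<longlonglongrightarrow> 0"
      using smoothen_scaled_tendsto[OF L2_nth[OF gL]] by simp
  qed
  with smoothen_smooth(1)[OF vL] smoothen_tendsto[OF vL] show ?thesis by (intro that)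
qed

text \<open>Componentwise smoothing respects the divergence because the same kernel acts on all
  components.\<close>

theorem Hdiv_smooth_dense:
  assumes X: "convex_domain X" and q: "q \<in> Hdiv X"
  obtains \<phi> where "\<And>n::nat. smooth_vec (\<phi> n)" "(\<lambda>n. L2_norm_on X (\<lambda>x. \<phi> n x - q x)) \<longlonglongrightarrow> 0"
    "(\<lambda>n. L2_norm_on X (\<lambda>x. sdiv (\<phi> n) x - wdiv X q x)) \<longlonglongrightarrow> 0"
proof -
  obtain x0 r where "smoothing X x0 r" using convex_domain_smoothing[OF X] .
  then interpret smoothing X x0 r .
  note qL = Hdiv_L2[OF q] and dL = wdiv_L2[OF q]
  define \<phi> where "\<phi> n x = (\<chi> i. smoothen n (\<lambda>y. q y $ i) x)" for n x
  have s: "smooth_vec (\<phi> n)" for n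
    using smoothen_smooth(1)[OF L2_nth[OF qL]] by (simp add: smooth_vec_def \<phi>_def)
  have 1: "(\<lambda>n. L2_norm_on X (\<lambda>x. \<phi> n x - q x)) \<longlonglongrightarrow> 0"
    using smoothen_tendsto[OF L2_nth[OF qL]]
    by (intro L2_norm_vec_tendsto[OF smooth_vec_L2(1)[OF X s] qL]) (simp add: \<phi>_def)
  have "L2_norm_on X (\<lambda>x. sdiv (\<phi> n) x - wdiv X q x) = L2_norm_on X (\<lambda>x. lam n * smoothen n (wdiv X q) x - wdiv X q x)" for n
    unfolding L2_norm_on_def using smoothen_weak_div[OF qL wdiv[OF q]]
    by (intro arg_cong[of _ _ sqrt] Bochner_Integration.integral_cong) (auto simp: sdiv_def \<phi>_def)
  then have 2: "(\<lambda>n. L2_norm_on X (\<lambda>x. sdiv (\<phi> n) x - wdiv X q x)) \<longlonglongrightarrow> 0"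
    using smoothen_scaled_tendsto[OF dL] by simp
  from s 1 2 show ?thesis by (rule that)
qed

lemma H1_norm_eq:
  assumes "convex_domain X" "f \<in> L2 X" "is_weak_grad X f g"
  shows "H1_norm X f = sqrt ((L2_norm_on X f)\<^sup>2 + (L2_norm_on X g)\<^sup>2)"
  by (simp add: H1_norm_def wgrad_norm[OF assms])

lemma H1_norm_smooth_diff:
  assumes X: "convex_domain X" and v: "v \<in> H1 X" and \<phi>: "smooth \<phi>"
  shows "H1_norm X (\<lambda>x. \<phi> x - v x) = sqrt ((L2_norm_on X (\<lambda>x. \<phi> x - v x))\<^sup>2 + (L2_norm_on X (\<lambda>x. grad \<phi> x - wgrad X v x))\<^sup>2)"
  by (rule H1_norm_eq[OF X L2_diff[OF smooth_L2(1)[OF X \<phi>] H1_L2[OF v]]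
      is_weak_grad_diff[OF X smooth_L2(1)[OF X \<phi>] H1_L2[OF v] smooth_weak_grad[OF X \<phi>] wgrad[OF v]]])

lemma sqrt_sum_sq_tendsto_0:
  fixes a b :: "nat \<Rightarrow> real"
  assumes "\<And>n. 0 \<le> a n" "\<And>n. 0 \<le> b n"
  shows "(\<lambda>n. sqrt ((a n)\<^sup>2 + (b n)\<^sup>2)) \<longlonglongrightarrow> 0 \<longleftrightarrow> a \<longlonglongrightarrow> 0 \<and> b \<longlonglongrightarrow> 0"
proof
  assume l: "(\<lambda>n. sqrt ((a n)\<^sup>2 + (b n)\<^sup>2)) \<longlonglongrightarrow> 0"
  have "\<bar>a n\<bar> \<le> sqrt ((a n)\<^sup>2 + (b n)\<^sup>2)" "\<bar>b n\<bar> \<le> sqrt ((a n)\<^sup>2 + (b n)\<^sup>2)" for n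
    by (auto intro: real_le_rsqrt)
  then show "a \<longlonglongrightarrow> 0 \<and> b \<longlonglongrightarrow> 0" using null_sequence_comparison[OF _ l] by blast
next
  assume "a \<longlonglongrightarrow> 0 \<and> b \<longlonglongrightarrow> 0"
  then have "(\<lambda>n. sqrt ((a n)\<^sup>2 + (b n)\<^sup>2)) \<longlonglongrightarrow> sqrt (0\<^sup>2 + 0\<^sup>2)" by (intro tendsto_intros) auto
  then show "(\<lambda>n. sqrt ((a n)\<^sup>2 + (b n)\<^sup>2)) \<longlonglongrightarrow> 0" by simp
qed

lemma H1_norm_tendsto_iff:
  assumes "convex_domain X" "v \<in> H1 X" "\<And>n. smooth (\<phi> n)"
  shows "(\<lambda>n. H1_norm X (\<lambda>x. \<phi> n x - v x)) \<longlonglongrightarrow> 0 \<longleftrightarrow>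
    (\<lambda>n. L2_norm_on X (\<lambda>x. \<phi> n x - v x)) \<longlonglongrightarrow> 0 \<and> (\<lambda>n. L2_norm_on X (\<lambda>x. grad (\<phi> n) x - wgrad X v x)) \<longlonglongrightarrow> 0"
  using sqrt_sum_sq_tendsto_0[of "\<lambda>n. L2_norm_on X (\<lambda>x. \<phi> n x - v x)" "\<lambda>n. L2_norm_on X (\<lambda>x. grad (\<phi> n) x - wgrad X v x)"]
  by (simp add: H1_norm_smooth_diff[OF assms(1,2) assms(3)])

lemma H10_H1: "v \<in> H10 X \<Longrightarrow> v \<in> H1 X"
  by (simp add: H10_def)

lemma H10_obtain:
  assumes X: "convex_domain X" and v: "v \<in> H10 X"
  obtains \<phi> where "\<And>n::nat. \<phi> n \<in> test_functions X" "(\<lambda>n. L2_norm_on X (\<lambda>x. \<phi> n x - v x)) \<longlonglongrightarrow> 0"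
    "(\<lambda>n. L2_norm_on X (\<lambda>x. grad (\<phi> n) x - wgrad X v x)) \<longlonglongrightarrow> 0"
proof -
  obtain \<phi> where \<phi>: "\<And>n. \<phi> n \<in> test_functions X" "(\<lambda>n. H1_norm X (\<lambda>x. \<phi> n x - v x)) \<longlonglongrightarrow> 0"
    using v by (auto simp: H10_def)
  have s: "smooth (\<phi> n)" for n by (rule test_function_smooth[OF \<phi>(1)])
  show ?thesis
    using \<phi> H1_norm_tendsto_iff[OF X H10_H1[OF v] s] by (intro that[of \<phi>]) auto
qed

text \<open>The limit \<open>g\<close> of the gradients is not assumed to be the weak gradient of
  \<open>v\<close>; this is part of the conclusion, as needed for limits of minimizing
  sequences.\<close>

lemma H10_limit:
  assumes X: "convex_domain X" and \<phi>: "\<And>n::nat. \<phi> n \<in> test_functions X" and L: "v \<in> L2 X" "g \<in> L2 X"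
    and lim: "(\<lambda>n. L2_norm_on X (\<lambda>x. \<phi> n x - v x)) \<longlonglongrightarrow> 0" "(\<lambda>n. L2_norm_on X (\<lambda>x. grad (\<phi> n) x - g x)) \<longlonglongrightarrow> 0"
  shows "v \<in> H10 X" "is_weak_grad X v g"
proof -
  have s: "smooth (\<phi> n)" for n by (rule test_function_smooth[OF \<phi>])
  show w: "is_weak_grad X v g"
    by (rule is_weak_grad_limit[OF X smooth_L2(1)[OF X s] L(1) smooth_weak_grad[OF X s] L(2) lim])
  have v: "v \<in> H1 X" by (rule H1I[OF L(1) w])
  have "L2_norm_on X (\<lambda>x. grad (\<phi> n) x - wgrad X v x) = L2_norm_on X (\<lambda>x. grad (\<phi> n) x - g x)" for n
  proof (rule L2_norm_cong_AE)
    show "AE x in lebesgue_on X. grad (\<phi> n) x - wgrad X v x = grad (\<phi> n) x - g x"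
      using wgrad_AE[OF X L(1) w] by eventually_elim simp
  qed (intro L2_measurable L2_diff smooth_L2[OF X s] wgrad_L2[OF v] L)+
  then show "v \<in> H10 X"
    unfolding H10_def using v \<phi> H1_norm_tendsto_iff[of X v \<phi>, OF X v s] lim by auto
qed

text \<open>For test functions this is the definition of the weak divergence, and both sides are
  continuous in the H1 norm.\<close>

lemma H10_integration_by_parts:
  assumes X: "convex_domain X" and w: "w \<in> H10 X" and q: "q \<in> Hdiv X"
  shows "ip X (wgrad X w) q + ip X w (wdiv X q) = 0"
proof -
  obtain \<phi> where \<phi>: "\<And>n::nat. \<phi> n \<in> test_functions X" "(\<lambda>n. L2_norm_on X (\<lambda>x. \<phi> n x - w x)) \<longlonglongrightarrow> 0"
    "(\<lambda>n. L2_norm_on X (\<lambda>x. grad (\<phi> n) x - wgrad X w x)) \<longlonglongrightarrow> 0"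
    by (rule H10_obtain[OF X w]) blast
  note L = test_L2[OF X \<phi>(1)] H1_L2[OF H10_H1[OF w]] wgrad_L2[OF H10_H1[OF w]] Hdiv_L2[OF q] wdiv_L2[OF q]
  have "(\<lambda>n. ip X (grad (\<phi> n)) q + ip X (\<phi> n) (wdiv X q)) \<longlonglongrightarrow> ip X (wgrad X w) q + ip X w (wdiv X q)"
    using L \<phi> by (intro tendsto_add ip_tendsto)
  moreover have "ip X (grad (\<phi> n)) q + ip X (\<phi> n) (wdiv X q) = 0" for n
    using wdiv[OF q] \<phi>(1)[of n] by (simp add: is_weak_div_iff ip_commute[of X _ q])
  ultimately show ?thesis using LIMSEQ_unique[OF _ tendsto_const] by simp
qed

section \<open>Traces on the boundary of an element\<close>

lemma grad_diff:
  assumes "f differentiable (at x)" "g differentiable (at x)"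
  shows "grad (\<lambda>x. f x - g x) x = grad f x - grad g x"
  by (rule grad_eqI_inner)
    (use has_derivative_diff[OF assms[THEN has_derivative_grad]] in \<open>simp add: inner_diff_left\<close>)

definition edge_vec :: "point \<times> point \<Rightarrow> point" where "edge_vec e = snd e - fst e"

text \<open>The integral of \<open>g\<close> times the outward normal component of \<open>q\<close>
  over the boundary of \<open>K\<close>: for a counterclockwise edge
  \<open>cross2 q (edge_vec e)\<close> is the normal component times the edge length, which is the
  density of the parametrization over the unit interval.\<close>

definition boundary_form :: "quad \<Rightarrow> (point \<Rightarrow> real) \<Rightarrow> (point \<Rightarrow> point) \<Rightarrow> real" where
  "boundary_form K g q = (\<Sum>e\<in>edges K. ip {0..1} (\<lambda>s. g (edge_pt e s)) (\<lambda>s. cross2 (q (edge_pt e s)) (edge_vec e)))"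

lemma L2_interval:
  fixes f :: "real \<Rightarrow> 'b::euclidean_space"
  shows "continuous_on UNIV f \<Longrightarrow> f \<in> L2 {0..1}"
  by (rule continuous_L2) auto

lemma smooth_edge_L2: "smooth \<phi> \<Longrightarrow> (\<lambda>s. \<phi> (edge_pt e s)) \<in> L2 {0..1}"
  using continuous_on_edge[OF smooth_continuous] by (rule L2_interval)

lemma continuous_cross2_edge: "smooth_vec q \<Longrightarrow> continuous_on UNIV (\<lambda>s. cross2 (q (edge_pt e s)) v)"
proof -
  assume q: "smooth_vec q"
  have c: "continuous_on UNIV (\<lambda>s. q (edge_pt e s) $ i)" for i
    using continuous_on_edge[OF smooth_continuous, of "\<lambda>x. q x $ i"] q by (simp add: smooth_vec_def)
  show ?thesis
    unfolding cross2_def by (intro continuous_on_diff continuous_on_mult c continuous_on_const)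
qed

text \<open>The Gauss formula applied to \<open>\<phi> x * q x $ i\<close> in the
  \<open>i\<close>-th coordinate direction, summed over \<open>i\<close>.\<close>

theorem green_smooth:
  assumes K: "convex_quad K" and \<phi>: "smooth \<phi>" and q: "smooth_vec q"
  shows "ip (cell K) (grad \<phi>) q + ip (cell K) \<phi> (sdiv q) = boundary_form K \<phi> q"
proof -
  let ?X = "cell K"
  have X: "convex_domain ?X" using convex_domain_cell[OF K] .
  have s: "smooth (\<lambda>x. q x $ i)" for i using q by (simp add: smooth_vec_def)
  note L = smooth_L2[OF X \<phi>] smooth_L2[OF X s] smooth_vec_L2[OF X q]
  have comp: "ip ?X (\<lambda>x. grad \<phi> x $ i) (\<lambda>x. q x $ i) + ip ?X \<phi> (\<lambda>x. grad (\<lambda>y. q y $ i) x $ i)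
      = (\<Sum>e\<in>edges K. cross2 (axis i 1) (edge_vec e) * ip {0..1} (\<lambda>s. \<phi> (edge_pt e s)) (\<lambda>s. q (edge_pt e s) $ i))" for i
  proof -
    have sm: "smooth (\<lambda>x. \<phi> x * q x $ i)" by (intro smooth_mult \<phi> s)
    have g: "grad (\<lambda>x. \<phi> x * q x $ i) x = \<phi> x *\<^sub>R grad (\<lambda>x. q x $ i) x + q x $ i *\<^sub>R grad \<phi> x" for x
      by (rule grad_mult[OF smooth_differentiable[OF \<phi>] smooth_differentiable[OF s]])
    have "integrable (lebesgue_on ?X) (grad (\<lambda>x. \<phi> x * q x $ i))"
      by (intro continuous_integrable_bounded smooth_continuous_grad sm bounded_cell cell_lebesgue)
    from integral_bounded_linear[OF bounded_linear_vec_nth this, of i]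
    have "axis i 1 \<bullet> (LINT x|lebesgue_on ?X. grad (\<lambda>x. \<phi> x * q x $ i) x) = (LINT x|lebesgue_on ?X. grad (\<lambda>x. \<phi> x * q x $ i) x $ i)"
      by (simp add: inner_axis')
    also have "\<dots> = (LINT x|lebesgue_on ?X. \<phi> x * (grad (\<lambda>x. q x $ i) x $ i) + q x $ i * (grad \<phi> x $ i))"
      by (simp add: g)
    also have "\<dots> = ip ?X \<phi> (\<lambda>x. grad (\<lambda>y. q y $ i) x $ i) + ip ?X (\<lambda>x. grad \<phi> x $ i) (\<lambda>x. q x $ i)"
      using ip_integrable[OF L(1) L2_nth[OF L(4)], of i i] ip_integrable[OF L2_nth[OF L(2)] L(3), of i i]
      by (simp add: ip_def Bochner_Integration.integral_add mult.commute)
    finally show ?thesis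
      using gauss_quad[OF K smooth_Ck[OF sm], of "axis i 1"] by (simp add: edge_integral_def ip_def edge_vec_def)
  qed
  have "ip ?X (grad \<phi>) q + ip ?X \<phi> (sdiv q) = (\<Sum>i\<in>UNIV. ip ?X (\<lambda>x. grad \<phi> x $ i) (\<lambda>x. q x $ i) + ip ?X \<phi> (\<lambda>x. grad (\<lambda>y. q y $ i) x $ i))"
    using ip_vec[OF L(2) L(5)] ip_add_right[OF L2_nth[OF L(4)] L2_nth[OF L(4)] L(1), of 1 1 2 2]
    by (simp add: sum_2 sdiv_def[abs_def])
  also have "\<dots> = (\<Sum>e\<in>edges K. \<Sum>i\<in>UNIV. cross2 (axis i 1) (edge_vec e) * ip {0..1} (\<lambda>s. \<phi> (edge_pt e s)) (\<lambda>s. q (edge_pt e s) $ i))"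
    unfolding comp by (rule sum.swap)
  also have "\<dots> = boundary_form K \<phi> q"
    unfolding boundary_form_def
  proof (rule sum.cong)
    fix e
    have c: "cross2 (q (edge_pt e s)) (edge_vec e) = cross2 (axis 1 1) (edge_vec e) *\<^sub>R q (edge_pt e s) $ 1 + cross2 (axis 2 1) (edge_vec e) *\<^sub>R q (edge_pt e s) $ 2" for s
      by (simp add: cross2_def axis_def)
    show "(\<Sum>i\<in>UNIV. cross2 (axis i 1) (edge_vec e) * ip {0..1} (\<lambda>s. \<phi> (edge_pt e s)) (\<lambda>s. q (edge_pt e s) $ i)) =
         ip {0..1} (\<lambda>s. \<phi> (edge_pt e s)) (\<lambda>s. cross2 (q (edge_pt e s)) (edge_vec e))"
      unfolding c sum_2
      by (subst ip_add_right) (auto simp only: ip_scaleR_right intro!: L2_scaleR smooth_edge_L2[OF s] smooth_edge_L2[OF \<phi>])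
  qed simp
  finally show ?thesis .
qed

text \<open>
  With respect to a point of the cell the quadrilateral is strictly star-shaped. Green's formula
  for the field \<open>\<phi> x (x - x\<^sub>0)\<close> then controls the boundary values.
\<close>

lemma trace_inequality:
  assumes K: "convex_quad K"
  obtains C where "C \<ge> 0" "\<And>\<phi> e. smooth \<phi> \<Longrightarrow> e \<in> edges K \<Longrightarrow>
    (L2_norm_on {0..1} (\<lambda>s. \<phi> (edge_pt e s)))\<^sup>2 \<le> C * ((L2_norm_on (cell K) \<phi>)\<^sup>2 + (L2_norm_on (cell K) (grad \<phi>))\<^sup>2)"
proof -
  let ?X = "cell K"
  have X: "convex_domain ?X" using convex_domain_cell[OF K] .
  obtain x0 where x0: "x0 \<in> ?X" using cell_nonempty[OF K] by blast
  \<comment> \<open>On the edge \<open>e\<close> the normal component of \<open>x - x0\<close> times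
    the edge length is the constant \<open>\<delta> e\<close>; it is positive because
    \<open>x0\<close> lies strictly inside.\<close>
  define \<delta> where "\<delta> e = cross2 (edge_vec e) (x0 - fst e)" for e
  have \<delta>: "\<delta> e > 0" if "e \<in> edges K" for e using quad_hull_edge(2)[OF K that x0] by (simp add: \<delta>_def edge_vec_def)
  obtain R where R: "R > 0" "\<And>x. x \<in> ?X \<Longrightarrow> norm (x - x0) \<le> R"
  proof -
    obtain B where B: "B > 0" "\<And>x. x \<in> ?X \<Longrightarrow> norm x \<le> B" using bounded_cell[of K] by (auto simp: bounded_pos)
    have "norm (x - x0) \<le> B + B" if "x \<in> ?X" for x
      using norm_triangle_ineq4[of x x0] B(2)[OF that] B(2)[OF x0] by linarith
    with B(1) that[of "B + B"] show ?thesis by simp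
  qed
  define C where "C = (R + 2) * (\<Sum>e\<in>edges K. 1 / \<delta> e)"
  have C0: "C \<ge> 0" unfolding C_def using R \<delta> by (intro mult_nonneg_nonneg sum_nonneg) (auto simp: less_imp_le)
  have "(L2_norm_on {0..1} (\<lambda>s. \<phi> (edge_pt e s)))\<^sup>2 \<le> C * ((L2_norm_on ?X \<phi>)\<^sup>2 + (L2_norm_on ?X (grad \<phi>))\<^sup>2)"
    if \<phi>: "smooth \<phi>" and e: "e \<in> edges K" for \<phi> e
  proof -
    define a where "a = L2_norm_on ?X \<phi>"
    define b where "b = L2_norm_on ?X (grad \<phi>)"
    define E where "E e = (L2_norm_on {0..1} (\<lambda>s. \<phi> (edge_pt e s)))\<^sup>2" for e
    define q where "q x = \<phi> x *\<^sub>R (x - x0)" for x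
    have qs: "smooth_vec q" unfolding smooth_vec_def q_def
      by (auto intro!: smooth_mult \<phi> smooth_diff smooth_nth)
    note L = smooth_L2[OF X \<phi>] smooth_vec_L2[OF X qs]
    \<comment> \<open>The coefficient 2 is the divergence of \<open>x - x0\<close> in the
      plane.\<close>
    have sd: "sdiv q x = grad \<phi> x \<bullet> (x - x0) + 2 * \<phi> x" for x
    proof -
      have d: "(\<lambda>y. y $ i - x0 $ i) differentiable (at x)" for i
        by (rule smooth_differentiable) (intro smooth_diff smooth_nth smooth_const)
      have "grad (\<lambda>y. y $ i - x0 $ i) x = axis i 1" for i
        using grad_diff[OF smooth_differentiable[OF smooth_nth] smooth_differentiable[OF smooth_const]] by simp
      then have "grad (\<lambda>y. \<phi> y * (y $ i - x0 $ i)) x = \<phi> x *\<^sub>R axis i 1 + (x $ i - x0 $ i) *\<^sub>R grad \<phi> x" for i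
        using grad_mult[OF smooth_differentiable[OF \<phi>] d] by simp
      then show ?thesis
        by (simp add: sdiv_def q_def sum_2 inner_2 axis_def)
    qed
    have gd: "(\<lambda>x. grad \<phi> x \<bullet> (x - x0)) \<in> L2 ?X"
    proof -
      have "(\<lambda>x. sdiv q x - 2 * \<phi> x) \<in> L2 ?X" by (intro L2_diff L2_mult L)
      then show ?thesis by (simp add: sd)
    qed
    have "boundary_form K \<phi> q = (\<Sum>e\<in>edges K. \<delta> e * E e)"
      unfolding boundary_form_def
    proof (rule sum.cong)
      fix e assume "e \<in> edges K"
      have "cross2 (q (edge_pt e s)) (edge_vec e) = \<delta> e *\<^sub>R \<phi> (edge_pt e s)" for s
        by (simp add: q_def edge_pt_def edge_vec_def[symmetric] \<delta>_def cross2_simps) (simp add: cross2_def algebra_simps)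
      then show "ip {0..1} (\<lambda>s. \<phi> (edge_pt e s)) (\<lambda>s. cross2 (q (edge_pt e s)) (edge_vec e)) = \<delta> e * E e"
        by (simp add: ip_scaleR_right E_def L2_norm_sq del: real_scaleR_def)
    qed simp
    then have eq: "(\<Sum>e\<in>edges K. \<delta> e * E e) = ip ?X (grad \<phi>) q + ip ?X \<phi> (sdiv q)"
      using green_smooth[OF K \<phi> qs] by simp
    have i1: "ip ?X (grad \<phi>) q \<le> b * (R * a)"
    proof -
      have "norm (q x) \<le> R * norm (\<phi> x)" if "x \<in> ?X" for x
        using mult_left_mono[OF R(2)[OF that], of "\<bar>\<phi> x\<bar>"] by (simp add: q_def mult.commute)
      then have "L2_norm_on ?X q \<le> R * a" unfolding a_def
        using R(1) by (intro L2_norm_mono[OF L2_measurable[OF L(3)] L(1)] AE_I2) auto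
      then have "L2_norm_on ?X (grad \<phi>) * L2_norm_on ?X q \<le> b * (R * a)"
        unfolding b_def by (intro mult_left_mono) auto
      then show ?thesis using ip_Cauchy_Schwarz[OF L(2) L(3)] by linarith
    qed
    have i2: "ip ?X \<phi> (sdiv q) \<le> a * (R * b) + 2 * a\<^sup>2"
    proof -
      have "L2_norm_on ?X (\<lambda>x. grad \<phi> x \<bullet> (x - x0)) \<le> R * b" unfolding b_def
      proof (rule L2_norm_mono[OF L2_measurable[OF gd] L(2)])
        have "\<bar>grad \<phi> x \<bullet> (x - x0)\<bar> \<le> R * norm (grad \<phi> x)" if "x \<in> ?X" for x
          using Cauchy_Schwarz_ineq2[of "grad \<phi> x" "x - x0"] mult_left_mono[OF R(2)[OF that], of "norm (grad \<phi> x)"]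
          by (simp add: mult.commute)
        then show "AE x in lebesgue_on ?X. norm (grad \<phi> x \<bullet> (x - x0)) \<le> R * norm (grad \<phi> x)" by (intro AE_I2) simp
      qed (use R in simp)
      then have "a * L2_norm_on ?X (\<lambda>x. grad \<phi> x \<bullet> (x - x0)) \<le> a * (R * b)"
        unfolding a_def by (intro mult_left_mono) auto
      moreover have "ip ?X \<phi> (sdiv q) = ip ?X \<phi> (\<lambda>x. grad \<phi> x \<bullet> (x - x0)) + 2 * a\<^sup>2"
        using ip_add_right[OF gd L2_scaleR[OF L(1), of 2] L(1)] ip_scaleR_right[of ?X \<phi> 2 \<phi>]
        by (simp add: sd[abs_def] a_def L2_norm_sq)
      ultimately show ?thesis using ip_Cauchy_Schwarz[OF L(1) gd] by (simp add: a_def)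
    qed
    have le: "(\<Sum>e\<in>edges K. \<delta> e * E e) \<le> (R + 2) * (a\<^sup>2 + b\<^sup>2)"
    proof -
      \<comment> \<open>The mixed product of the two norms is absorbed into the sum of their
        squares.\<close>
      have "R * a\<^sup>2 + R * b\<^sup>2 - 2 * (R * (a * b)) = R * (a - b)\<^sup>2"
        by (simp add: power2_diff algebra_simps)
      moreover have "0 \<le> R * (a - b)\<^sup>2" using R(1) by simp
      ultimately have h: "2 * (R * (a * b)) \<le> R * a\<^sup>2 + R * b\<^sup>2" by linarith
      have "(\<Sum>e\<in>edges K. \<delta> e * E e) \<le> b * (R * a) + (a * (R * b) + 2 * a\<^sup>2)"
        unfolding eq using i1 i2 by (rule add_mono)
      also have "\<dots> = 2 * (R * (a * b)) + 2 * a\<^sup>2" by (simp add: algebra_simps)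
      also have "\<dots> \<le> R * a\<^sup>2 + R * b\<^sup>2 + 2 * a\<^sup>2 + 2 * b\<^sup>2" using h zero_le_power2[of b] by linarith
      also have "\<dots> = (R + 2) * (a\<^sup>2 + b\<^sup>2)" by (simp add: algebra_simps)
      finally show ?thesis .
    qed
    have E0: "0 \<le> E e" for e by (simp add: E_def)
    have "\<delta> e * E e \<le> (\<Sum>e\<in>edges K. \<delta> e * E e)"
      using e \<delta> E0 by (intro member_le_sum) (auto simp: less_imp_le)
    then have "E e \<le> (1 / \<delta> e) * ((R + 2) * (a\<^sup>2 + b\<^sup>2))"
      using le \<delta>[OF e] by (simp add: field_simps)
    also have "\<dots> \<le> (\<Sum>e\<in>edges K. 1 / \<delta> e) * ((R + 2) * (a\<^sup>2 + b\<^sup>2))"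
      using e \<delta> R(1) by (intro mult_right_mono member_le_sum) (auto simp: less_imp_le)
    finally show ?thesis by (simp add: C_def E_def a_def b_def mult.commute mult.left_commute)
  qed
  with C0 show ?thesis by (rule that)
qed

section \<open>Existence of traces\<close>

text \<open>Further subsequences are extracted one index at a time; convergence for the earlier
  indices is inherited.\<close>

lemma common_AE_subsequence:
  fixes f :: "'i \<Rightarrow> nat \<Rightarrow> 'd::euclidean_space \<Rightarrow> 'a::euclidean_space"
  assumes "finite E" "\<And>e n. e \<in> E \<Longrightarrow> f e n \<in> L2 X" "\<And>e. e \<in> E \<Longrightarrow> g e \<in> L2 X"
    "\<And>e. e \<in> E \<Longrightarrow> (\<lambda>n. L2_norm_on X (\<lambda>x. f e n x - g e x)) \<longlonglongrightarrow> 0"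
  shows "\<exists>r::nat \<Rightarrow> nat. strict_mono r \<and> (\<forall>e\<in>E. AE x in lebesgue_on X. (\<lambda>n. f e (r n) x) \<longlonglongrightarrow> g e x)"
  using assms
proof (induction E rule: finite_induct)
  case empty
  then show ?case using strict_mono_id by auto
next
  case (insert e E)
  then obtain r :: "nat \<Rightarrow> nat" where r: "strict_mono r" "\<And>e. e \<in> E \<Longrightarrow> AE x in lebesgue_on X. (\<lambda>n. f e (r n) x) \<longlonglongrightarrow> g e x"
    by auto
  have "(\<lambda>n. L2_norm_on X (\<lambda>x. f e (r n) x - g e x)) \<longlonglongrightarrow> 0"
    using LIMSEQ_subseq_LIMSEQ[OF insert.prems(3)[of e] r(1)] by (simp add: o_def)
  then obtain r' :: "nat \<Rightarrow> nat" where r': "strict_mono r'" "AE x in lebesgue_on X. (\<lambda>n. f e (r (r' n)) x) \<longlonglongrightarrow> g e x"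
    using L2_AE_subseq[of "\<lambda>n. f e (r n)" X "g e"] insert.prems by auto
  have "AE x in lebesgue_on X. (\<lambda>n. f e' (r (r' n)) x) \<longlonglongrightarrow> g e' x" if "e' \<in> E" for e'
    using r(2)[OF that]
  proof eventually_elim
    case (elim x) from LIMSEQ_subseq_LIMSEQ[OF this r'(1)] show ?case by (simp add: o_def)
  qed
  with r'(2) have "\<forall>e'\<in>insert e E. AE x in lebesgue_on X. (\<lambda>n. f e' ((r \<circ> r') n) x) \<longlonglongrightarrow> g e' x" by simp
  moreover have "strict_mono (r \<circ> r')" using r(1) r'(1) by (rule strict_mono_o)
  ultimately show ?case by blast
qed

text \<open>
  The trace is obtained as a pointwise limit along a subsequence, so that the limits on different
  (possibly overlapping) edges are given by one and the same function.
\<close>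

lemma edge_limit:
  assumes E: "finite E" and \<phi>: "\<And>n::nat. smooth (\<phi> n)"
    and Cauchy: "\<And>e \<epsilon>. e \<in> E \<Longrightarrow> \<epsilon> > 0 \<Longrightarrow>
      \<exists>N. \<forall>m\<ge>N. \<forall>n\<ge>N. L2_norm_on {0..1} (\<lambda>s. \<phi> m (edge_pt e s) - \<phi> n (edge_pt e s)) < \<epsilon>"
  obtains g where "\<And>e. e \<in> E \<Longrightarrow> (\<lambda>s. g (edge_pt e s)) \<in> L2 {0..1}"
    "\<And>e. e \<in> E \<Longrightarrow> (\<lambda>n. L2_norm_on {0..1} (\<lambda>s. \<phi> n (edge_pt e s) - g (edge_pt e s))) \<longlonglongrightarrow> 0"
proof -
  note L = smooth_edge_L2[OF \<phi>]
  have "\<forall>e\<in>E. \<exists>\<gamma>. \<gamma> \<in> L2 {0..1} \<and> (\<lambda>n. L2_norm_on {0..1} (\<lambda>s. \<phi> n (edge_pt e s) - \<gamma> s)) \<longlonglongrightarrow> 0"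
  proof
    fix e assume e: "e \<in> E"
    show "\<exists>\<gamma>. \<gamma> \<in> L2 {0..1} \<and> (\<lambda>n. L2_norm_on {0..1} (\<lambda>s. \<phi> n (edge_pt e s) - \<gamma> s)) \<longlonglongrightarrow> 0"
      by (rule L2_complete[OF L Cauchy[OF e]]) auto
  qed
  from bchoice[OF this] obtain \<gamma> where \<gamma>': "\<forall>e\<in>E. \<gamma> e \<in> L2 {0..1} \<and>
    (\<lambda>n. L2_norm_on {0..1} (\<lambda>s. \<phi> n (edge_pt e s) - \<gamma> e s)) \<longlonglongrightarrow> 0" by blast
  then have \<gamma>: "\<And>e. e \<in> E \<Longrightarrow> \<gamma> e \<in> L2 {0..1}"
    "\<And>e. e \<in> E \<Longrightarrow> (\<lambda>n. L2_norm_on {0..1} (\<lambda>s. \<phi> n (edge_pt e s) - \<gamma> e s)) \<longlonglongrightarrow> 0"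
    by auto
  obtain r :: "nat \<Rightarrow> nat" where r: "\<And>e. e \<in> E \<Longrightarrow> AE s in lebesgue_on {0..1}. (\<lambda>n. \<phi> (r n) (edge_pt e s)) \<longlonglongrightarrow> \<gamma> e s"
    using common_AE_subsequence[where f = "\<lambda>e n s. \<phi> n (edge_pt e s)", OF E L \<gamma>] by auto
  define g where "g x = lim (\<lambda>n. \<phi> (r n) x)" for x
  have m: "(\<lambda>s. g (edge_pt e s)) \<in> borel_measurable (lebesgue_on {0..1})" for e
    unfolding g_def by (intro borel_measurable_lim_metric L2_measurable[OF L])
  have ae: "AE s in lebesgue_on {0..1}. g (edge_pt e s) = \<gamma> e s" if "e \<in> E" for e
    using r[OF that] unfolding g_def by eventually_elim (rule limI)
  have gL: "(\<lambda>s. g (edge_pt e s)) \<in> L2 {0..1}" if "e \<in> E" for e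
    by (rule L2_bound[OF m \<gamma>(1)[OF that], where c = 1]) (use ae[OF that] in \<open>eventually_elim, simp\<close>)
  have "(\<lambda>n. L2_norm_on {0..1} (\<lambda>s. \<phi> n (edge_pt e s) - g (edge_pt e s))) \<longlonglongrightarrow> 0" if "e \<in> E" for e
  proof -
    have "L2_norm_on {0..1} (\<lambda>s. \<phi> n (edge_pt e s) - g (edge_pt e s)) = L2_norm_on {0..1} (\<lambda>s. \<phi> n (edge_pt e s) - \<gamma> e s)" for n
    proof (rule L2_norm_cong_AE)
      show "AE s in lebesgue_on {0..1}. \<phi> n (edge_pt e s) - g (edge_pt e s) = \<phi> n (edge_pt e s) - \<gamma> e s"
        using ae[OF that] by eventually_elim simp
    qed (intro L2_measurable L2_diff L gL[OF that] \<gamma>(1)[OF that])+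
    then show ?thesis using \<gamma>(2)[OF that] by simp
  qed
  with gL show ?thesis by (rule that)
qed

lemma edge_length_pos:
  assumes "convex_quad K" "e \<in> edges K" shows "dist (fst e) (snd e) > 0"
proof -
  obtain x0 where "x0 \<in> cell K" using cell_nonempty[OF assms(1)] by blast
  then have "cross2 (snd e - fst e) (x0 - fst e) > 0" using quad_hull_edge(2)[OF assms] by blast
  then have "fst e \<noteq> snd e" by (auto simp: cross2_simps)
  then show ?thesis by simp
qed

text \<open>Edge lengths are positive, so convergence in the weighted boundary norm is convergence
  on each edge separately; likewise the H1 norm splits into function and gradient.\<close>

lemma has_trace_iff:
  assumes K: "convex_quad K"
  shows "has_trace K v g \<longleftrightarrow> v \<in> H1 (cell K) \<and> (\<forall>e\<in>edges K. (\<lambda>s. g (edge_pt e s)) \<in> L2 {0..1}) \<and>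
    (\<exists>\<phi>. (\<forall>n::nat. smooth (\<phi> n)) \<and> (\<lambda>n. L2_norm_on (cell K) (\<lambda>x. \<phi> n x - v x)) \<longlonglongrightarrow> 0 \<and>
      (\<lambda>n. L2_norm_on (cell K) (\<lambda>x. grad (\<phi> n) x - wgrad (cell K) v x)) \<longlonglongrightarrow> 0 \<and>
      (\<forall>e\<in>edges K. (\<lambda>n. L2_norm_on {0..1} (\<lambda>s. \<phi> n (edge_pt e s) - g (edge_pt e s))) \<longlonglongrightarrow> 0))"
proof -
  have b: "(\<lambda>n. bdry_L2_norm K (\<lambda>x. \<phi> n x - g x)) \<longlonglongrightarrow> 0 \<longleftrightarrow>
    (\<forall>e\<in>edges K. (\<lambda>n. L2_norm_on {0..1} (\<lambda>s. \<phi> n (edge_pt e s) - g (edge_pt e s))) \<longlonglongrightarrow> 0)" for \<phi> :: "nat \<Rightarrow> point \<Rightarrow> real"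
  proof (intro iffI ballI)
    fix e assume l: "(\<lambda>n. bdry_L2_norm K (\<lambda>x. \<phi> n x - g x)) \<longlonglongrightarrow> 0" and e: "e \<in> edges K"
    let ?d = "dist (fst e) (snd e)" and ?N = "\<lambda>n. L2_norm_on {0..1} (\<lambda>s. \<phi> n (edge_pt e s) - g (edge_pt e s))"
    have d: "?d > 0" using edge_length_pos[OF K e] .
    have "?N n \<le> bdry_L2_norm K (\<lambda>x. \<phi> n x - g x) / sqrt ?d" for n
    proof -
      have "?d * (?N n)\<^sup>2 \<le> (\<Sum>e\<in>edges K. dist (fst e) (snd e) * (L2_norm_on {0..1} (\<lambda>s. \<phi> n (edge_pt e s) - g (edge_pt e s)))\<^sup>2)"
        using e by (intro member_le_sum) auto
      then have "sqrt (?d * (?N n)\<^sup>2) \<le> bdry_L2_norm K (\<lambda>x. \<phi> n x - g x)"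
        unfolding bdry_L2_norm_def by (rule real_sqrt_le_mono)
      then show ?thesis using d by (simp add: real_sqrt_mult field_simps)
    qed
    then have "\<bar>?N n\<bar> \<le> bdry_L2_norm K (\<lambda>x. \<phi> n x - g x) / sqrt ?d" for n by simp
    moreover have "(\<lambda>n. bdry_L2_norm K (\<lambda>x. \<phi> n x - g x) / sqrt ?d) \<longlonglongrightarrow> 0" using tendsto_divide_zero[OF l] .
    ultimately show "?N \<longlonglongrightarrow> 0" by (rule null_sequence_comparison)
  next
    assume l: "\<forall>e\<in>edges K. (\<lambda>n. L2_norm_on {0..1} (\<lambda>s. \<phi> n (edge_pt e s) - g (edge_pt e s))) \<longlonglongrightarrow> 0"
    have "(\<lambda>n. bdry_L2_norm K (\<lambda>x. \<phi> n x - g x)) \<longlonglongrightarrow> sqrt (\<Sum>e\<in>edges K. dist (fst e) (snd e) * 0\<^sup>2)"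
      unfolding bdry_L2_norm_def using l by (intro tendsto_intros) auto
    then show "(\<lambda>n. bdry_L2_norm K (\<lambda>x. \<phi> n x - g x)) \<longlonglongrightarrow> 0" by simp
  qed
  show ?thesis
  proof (cases "v \<in> H1 (cell K)")
    case True
    show ?thesis
      unfolding has_trace_def bdry_L2_def b
      using True H1_norm_tendsto_iff[OF convex_domain_cell[OF K] True] by auto
  qed (simp add: has_trace_def)
qed

lemma has_trace_H1: "has_trace K v g \<Longrightarrow> v \<in> H1 (cell K)"
  by (simp add: has_trace_def)

text \<open>The trace inequality makes the boundary values Cauchy on each edge. One approximating
  sequence is used for all elements of \<open>T\<close>, so that a single function is the trace from
  every side; a singleton \<open>T\<close> gives the trace on one element.\<close>

lemma common_trace:
  assumes T: "finite T" "\<And>K. K \<in> T \<Longrightarrow> convex_quad K" and \<phi>: "\<And>n::nat. smooth (\<phi> n)"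
    and v: "\<And>K. K \<in> T \<Longrightarrow> v \<in> H1 (cell K)"
    and l: "\<And>K. K \<in> T \<Longrightarrow> (\<lambda>n. L2_norm_on (cell K) (\<lambda>x. \<phi> n x - v x)) \<longlonglongrightarrow> 0"
      "\<And>K. K \<in> T \<Longrightarrow> (\<lambda>n. L2_norm_on (cell K) (\<lambda>x. grad (\<phi> n) x - wgrad (cell K) v x)) \<longlonglongrightarrow> 0"
  obtains g where "\<And>K. K \<in> T \<Longrightarrow> has_trace K v g"
proof -
  have Cauchy: "\<exists>N. \<forall>m\<ge>N. \<forall>n\<ge>N. L2_norm_on {0..1} (\<lambda>s. \<phi> m (edge_pt e s) - \<phi> n (edge_pt e s)) < \<epsilon>"
    if e: "e \<in> (\<Union>K\<in>T. edges K)" and \<epsilon>: "\<epsilon> > 0" for e \<epsilon>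
  proof -
    obtain K where K: "K \<in> T" "e \<in> edges K" using e by blast
    let ?X = "cell K"
    have X: "convex_domain ?X" using convex_domain_cell[OF T(2)[OF K(1)]] .
    obtain C where C: "C \<ge> 0" "\<And>\<phi> e. smooth \<phi> \<Longrightarrow> e \<in> edges K \<Longrightarrow>
      (L2_norm_on {0..1} (\<lambda>s. \<phi> (edge_pt e s)))\<^sup>2 \<le> C * ((L2_norm_on ?X \<phi>)\<^sup>2 + (L2_norm_on ?X (grad \<phi>))\<^sup>2)"
      using trace_inequality[OF T(2)[OF K(1)]] by blast
    \<comment> \<open>Two approximation errors of size \<eta> for the function and two for its
      gradient give the bound \<open>8 * C * \<eta>\<^sup>2\<close>; the numbers 9 and
      \<open>C + 1\<close> make the comparison with \<open>\<epsilon>\<^sup>2\<close>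
      strict.\<close>
    define \<eta> where "\<eta> = \<epsilon> / (3 * sqrt (C + 1))"
    have \<eta>: "\<eta> > 0" "9 * (C + 1) * \<eta>\<^sup>2 = \<epsilon>\<^sup>2" using \<epsilon> C(1) by (auto simp: \<eta>_def power_divide power_mult_distrib)
    have "\<forall>\<^sub>F n in sequentially. L2_norm_on ?X (\<lambda>x. \<phi> n x - v x) < \<eta> \<and> L2_norm_on ?X (\<lambda>x. grad (\<phi> n) x - wgrad ?X v x) < \<eta>"
      using order_tendstoD(2)[OF l(1)[OF K(1)] \<eta>(1)] order_tendstoD(2)[OF l(2)[OF K(1)] \<eta>(1)] by (rule eventually_conj)
    then obtain N where N: "\<And>n. n \<ge> N \<Longrightarrow> L2_norm_on ?X (\<lambda>x. \<phi> n x - v x) < \<eta>"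
      "\<And>n. n \<ge> N \<Longrightarrow> L2_norm_on ?X (\<lambda>x. grad (\<phi> n) x - wgrad ?X v x) < \<eta>"
      by (auto simp: eventually_sequentially)
    have "L2_norm_on {0..1} (\<lambda>s. \<phi> m (edge_pt e s) - \<phi> n (edge_pt e s)) < \<epsilon>" if "m \<ge> N" "n \<ge> N" for m n
    proof -
      note L = smooth_L2[OF X \<phi>] and vL = H1_L2[OF v[OF K(1)]] wgrad_L2[OF v[OF K(1)]]
      have g: "grad (\<lambda>x. \<phi> m x - \<phi> n x) = (\<lambda>x. grad (\<phi> m) x - grad (\<phi> n) x)"
        by (rule ext) (rule grad_diff[OF smooth_differentiable[OF \<phi>] smooth_differentiable[OF \<phi>]])
      have 1: "L2_norm_on ?X (\<lambda>x. \<phi> m x - \<phi> n x) \<le> 2 * \<eta>"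
        using L2_norm_triangle3[OF L(1) vL(1) L(1), of m n] N(1)[OF that(1)] N(1)[OF that(2)]
          L2_norm_diff_commute[of ?X v "\<phi> n"] by simp
      have 2: "L2_norm_on ?X (\<lambda>x. grad (\<phi> m) x - grad (\<phi> n) x) \<le> 2 * \<eta>"
        using L2_norm_triangle3[OF L(2) vL(2) L(2), of m n] N(2)[OF that(1)] N(2)[OF that(2)]
          L2_norm_diff_commute[of ?X "wgrad ?X v" "grad (\<phi> n)"] by simp
      have "(L2_norm_on {0..1} (\<lambda>s. \<phi> m (edge_pt e s) - \<phi> n (edge_pt e s)))\<^sup>2
          \<le> C * ((L2_norm_on ?X (\<lambda>x. \<phi> m x - \<phi> n x))\<^sup>2 + (L2_norm_on ?X (\<lambda>x. grad (\<phi> m) x - grad (\<phi> n) x))\<^sup>2)"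
        using C(2)[OF smooth_diff[OF \<phi> \<phi>] K(2), of m n] by (simp add: g)
      also have "\<dots> \<le> C * ((2 * \<eta>)\<^sup>2 + (2 * \<eta>)\<^sup>2)"
        using C(1) by (intro mult_left_mono add_mono power_mono 1 2) auto
      also have "\<dots> = 8 * C * \<eta>\<^sup>2" by (simp add: power_mult_distrib)
      also have "\<dots> < 9 * (C + 1) * \<eta>\<^sup>2" using C(1) \<eta>(1) by (intro mult_strict_right_mono) auto
      also have "\<dots> = \<epsilon>\<^sup>2" by (rule \<eta>(2))
      finally show ?thesis using \<epsilon> by (simp add: power2_less_imp_less)
    qed
    then show ?thesis by blast
  qed
  have fin: "finite (\<Union>K\<in>T. edges K)" using T(1) by simp
  obtain g where g: "\<And>e. e \<in> (\<Union>K\<in>T. edges K) \<Longrightarrow> (\<lambda>s. g (edge_pt e s)) \<in> L2 {0..1}"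
    "\<And>e. e \<in> (\<Union>K\<in>T. edges K) \<Longrightarrow> (\<lambda>n. L2_norm_on {0..1} (\<lambda>s. \<phi> n (edge_pt e s) - g (edge_pt e s))) \<longlonglongrightarrow> 0"
    using edge_limit[OF fin \<phi> Cauchy] by blast
  have "has_trace K v g" if "K \<in> T" for K
    unfolding has_trace_iff[OF T(2)[OF that]] using v[OF that] g l[OF that] \<phi> that by blast
  then show ?thesis by (rule that)
qed

theorem trace_exists:
  assumes K: "convex_quad K" and v: "v \<in> H1 (cell K)"
  shows "\<exists>g. has_trace K v g"
proof (rule H1_smooth_dense[OF convex_domain_cell[OF K] v])
  fix \<phi> assume \<phi>: "\<And>n::nat. smooth (\<phi> n)" "(\<lambda>n. L2_norm_on (cell K) (\<lambda>x. \<phi> n x - v x)) \<longlonglongrightarrow> 0"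
    "(\<lambda>n. L2_norm_on (cell K) (\<lambda>x. grad (\<phi> n) x - wgrad (cell K) v x)) \<longlonglongrightarrow> 0"
  show ?thesis
  proof (rule common_trace[of "{K}" \<phi> v])
    fix g assume "\<And>K'. K' \<in> {K} \<Longrightarrow> has_trace K' v g"
    then show ?thesis by auto
  qed (use K v \<phi> in auto)
qed

lemma has_trace_on: "convex_quad K \<Longrightarrow> v \<in> H1 (cell K) \<Longrightarrow> has_trace K v (trace_on K v)"
  unfolding trace_on_def using trace_exists someI_ex[of "has_trace K v"] by blast

section \<open>Green's formula for traces and its consequences\<close>

lemma has_trace_diff:
  assumes K: "convex_quad K" and t: "has_trace K v g" "has_trace K v' g'"
  shows "has_trace K (\<lambda>x. v x - v' x) (\<lambda>x. g x - g' x)"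
proof -
  let ?X = "cell K"
  have X: "convex_domain ?X" using convex_domain_cell[OF K] .
  note tt = t[unfolded has_trace_iff[OF K]]
  obtain \<phi> where \<phi>: "\<And>n::nat. smooth (\<phi> n)" "(\<lambda>n. L2_norm_on ?X (\<lambda>x. \<phi> n x - v x)) \<longlonglongrightarrow> 0"
      "(\<lambda>n. L2_norm_on ?X (\<lambda>x. grad (\<phi> n) x - wgrad ?X v x)) \<longlonglongrightarrow> 0"
      "\<And>e. e \<in> edges K \<Longrightarrow> (\<lambda>n. L2_norm_on {0..1} (\<lambda>s. \<phi> n (edge_pt e s) - g (edge_pt e s))) \<longlonglongrightarrow> 0"
    using tt(1) by auto
  obtain \<phi>' where \<phi>': "\<And>n::nat. smooth (\<phi>' n)" "(\<lambda>n. L2_norm_on ?X (\<lambda>x. \<phi>' n x - v' x)) \<longlonglongrightarrow> 0"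
      "(\<lambda>n. L2_norm_on ?X (\<lambda>x. grad (\<phi>' n) x - wgrad ?X v' x)) \<longlonglongrightarrow> 0"
      "\<And>e. e \<in> edges K \<Longrightarrow> (\<lambda>n. L2_norm_on {0..1} (\<lambda>s. \<phi>' n (edge_pt e s) - g' (edge_pt e s))) \<longlonglongrightarrow> 0"
    using tt(2) by auto
  have v: "v \<in> H1 ?X" "v' \<in> H1 ?X" using tt by auto
  note L = H1_L2[OF v(1)] H1_L2[OF v(2)] wgrad_L2[OF v(1)] wgrad_L2[OF v(2)]
  have dc: "(\<lambda>n. L2_norm_on Y (\<lambda>x. (a n x - b n x) - (c x - d x))) \<longlonglongrightarrow> 0"
    if "\<And>n. a n \<in> L2 Y" "\<And>n. b n \<in> L2 Y" "c \<in> L2 Y" "d \<in> L2 Y"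
      "(\<lambda>n. L2_norm_on Y (\<lambda>x. a n x - c x)) \<longlonglongrightarrow> 0" "(\<lambda>n. L2_norm_on Y (\<lambda>x. b n x - d x)) \<longlonglongrightarrow> 0"
    for a b :: "nat \<Rightarrow> 'x::euclidean_space \<Rightarrow> 'y::euclidean_space" and c d Y
  proof (rule null_sequence_comparison)
    show "(\<lambda>n. L2_norm_on Y (\<lambda>x. a n x - c x) + L2_norm_on Y (\<lambda>x. b n x - d x)) \<longlonglongrightarrow> 0"
      using tendsto_add[OF that(5,6)] by simp
    have "(\<lambda>x. (a n x - b n x) - (c x - d x)) = (\<lambda>x. (a n x - c x) - (b n x - d x))" for n
      by (auto simp: algebra_simps)
    then show "\<bar>L2_norm_on Y (\<lambda>x. (a n x - b n x) - (c x - d x))\<bar> \<le> L2_norm_on Y (\<lambda>x. a n x - c x) + L2_norm_on Y (\<lambda>x. b n x - d x)" for n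
      using L2_norm_triangle_diff[OF L2_diff[OF that(1,3)] L2_diff[OF that(2,4)], of n n] by simp
  qed
  have w: "is_weak_grad ?X (\<lambda>x. v x - v' x) (\<lambda>x. wgrad ?X v x - wgrad ?X v' x)"
    by (rule is_weak_grad_diff[OF X L(1,2) wgrad[OF v(1)] wgrad[OF v(2)]])
  have vv: "(\<lambda>x. v x - v' x) \<in> H1 ?X" by (rule H1I[OF L2_diff[OF L(1,2)] w])
  let ?\<psi> = "\<lambda>n x. \<phi> n x - \<phi>' n x"
  have gr: "grad (?\<psi> n) = (\<lambda>x. grad (\<phi> n) x - grad (\<phi>' n) x)" for n
    by (rule ext) (rule grad_diff[OF smooth_differentiable[OF \<phi>(1)] smooth_differentiable[OF \<phi>'(1)]])
  have 3: "(\<lambda>n. L2_norm_on ?X (\<lambda>x. grad (?\<psi> n) x - wgrad ?X (\<lambda>x. v x - v' x) x)) \<longlonglongrightarrow> 0"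
  proof -
    have "L2_norm_on ?X (\<lambda>x. grad (?\<psi> n) x - wgrad ?X (\<lambda>x. v x - v' x) x) =
        L2_norm_on ?X (\<lambda>x. (grad (\<phi> n) x - grad (\<phi>' n) x) - (wgrad ?X v x - wgrad ?X v' x))" for n
    proof (rule L2_norm_cong_AE)
      show "AE x in lebesgue_on ?X. grad (?\<psi> n) x - wgrad ?X (\<lambda>x. v x - v' x) x = (grad (\<phi> n) x - grad (\<phi>' n) x) - (wgrad ?X v x - wgrad ?X v' x)"
        using wgrad_AE[OF X L2_diff[OF L(1,2)] w] by eventually_elim (simp add: gr)
    qed (intro L2_measurable L2_diff smooth_L2[OF X smooth_diff[OF \<phi>(1) \<phi>'(1)]] wgrad_L2[OF vv] smooth_L2[OF X \<phi>(1)] smooth_L2[OF X \<phi>'(1)] L)+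
    then show ?thesis
      using dc[OF smooth_L2(2)[OF X \<phi>(1)] smooth_L2(2)[OF X \<phi>'(1)] L(3,4) \<phi>(3) \<phi>'(3)] by simp
  qed
  show ?thesis
    unfolding has_trace_iff[OF K]
  proof (intro conjI vv exI[of _ ?\<psi>] allI ballI 3)
    show "smooth (?\<psi> n)" for n by (rule smooth_diff[OF \<phi>(1) \<phi>'(1)])
    show "(\<lambda>n. L2_norm_on ?X (\<lambda>x. ?\<psi> n x - (v x - v' x))) \<longlonglongrightarrow> 0"
      by (rule dc[OF smooth_L2(1)[OF X \<phi>(1)] smooth_L2(1)[OF X \<phi>'(1)] L(1,2) \<phi>(2) \<phi>'(2)])
    fix e assume e: "e \<in> edges K"
    have gL: "(\<lambda>s. g (edge_pt e s)) \<in> L2 {0..1}" "(\<lambda>s. g' (edge_pt e s)) \<in> L2 {0..1}" using tt e by auto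
    then show "(\<lambda>s. g (edge_pt e s) - g' (edge_pt e s)) \<in> L2 {0..1}" by (rule L2_diff)
    show "(\<lambda>n. L2_norm_on {0..1} (\<lambda>s. ?\<psi> n (edge_pt e s) - (g (edge_pt e s) - g' (edge_pt e s)))) \<longlonglongrightarrow> 0"
      by (rule dc[OF smooth_edge_L2[OF \<phi>(1)] smooth_edge_L2[OF \<phi>'(1)] gL \<phi>(4)[OF e] \<phi>'(4)[OF e]])
  qed
qed

text \<open>For a smooth field both sides are continuous along the sequence that defines the
  trace.\<close>

lemma green_trace:
  assumes K: "convex_quad K" and t: "has_trace K v g" and q: "smooth_vec q"
  shows "ip (cell K) (wgrad (cell K) v) q + ip (cell K) v (sdiv q) = boundary_form K g q"
proof -
  let ?X = "cell K"
  have X: "convex_domain ?X" using convex_domain_cell[OF K] .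
  note tt = t[unfolded has_trace_iff[OF K]]
  obtain \<phi> where \<phi>: "\<And>n::nat. smooth (\<phi> n)" "(\<lambda>n. L2_norm_on ?X (\<lambda>x. \<phi> n x - v x)) \<longlonglongrightarrow> 0"
      "(\<lambda>n. L2_norm_on ?X (\<lambda>x. grad (\<phi> n) x - wgrad ?X v x)) \<longlonglongrightarrow> 0"
      "\<And>e. e \<in> edges K \<Longrightarrow> (\<lambda>n. L2_norm_on {0..1} (\<lambda>s. \<phi> n (edge_pt e s) - g (edge_pt e s))) \<longlonglongrightarrow> 0"
    using tt by auto
  have v: "v \<in> H1 ?X" using tt by auto
  have "(\<lambda>n. boundary_form K (\<phi> n) q) \<longlonglongrightarrow> boundary_form K g q"
    unfolding boundary_form_def
  proof (rule tendsto_sum)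
    fix e assume e: "e \<in> edges K"
    have gL: "(\<lambda>s. g (edge_pt e s)) \<in> L2 {0..1}" using tt e by auto
    show "(\<lambda>n. ip {0..1} (\<lambda>s. \<phi> n (edge_pt e s)) (\<lambda>s. cross2 (q (edge_pt e s)) (edge_vec e)))
        \<longlonglongrightarrow> ip {0..1} (\<lambda>s. g (edge_pt e s)) (\<lambda>s. cross2 (q (edge_pt e s)) (edge_vec e))"
      by (rule ip_tendsto[OF smooth_edge_L2[OF \<phi>(1)] gL \<phi>(4)[OF e] L2_interval[OF continuous_cross2_edge[OF q]]])
  qed
  moreover have "(\<lambda>n. ip ?X (grad (\<phi> n)) q + ip ?X (\<phi> n) (sdiv q)) \<longlonglongrightarrow> ip ?X (wgrad ?X v) q + ip ?X v (sdiv q)"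
    by (intro tendsto_add ip_tendsto smooth_L2[OF X \<phi>(1)] smooth_vec_L2[OF X q] H1_L2[OF v] wgrad_L2[OF v] \<phi>)
  ultimately show ?thesis
    using LIMSEQ_unique by (simp add: green_smooth[OF K \<phi>(1) q]) blast
qed

text \<open>For smooth fields both sides equal \<open>boundary_form K g q\<close>, which sees only
  the trace \<open>g\<close>; smooth fields are dense in H(div).\<close>

theorem green_extension_independent:
  assumes K: "convex_quad K" and t: "has_trace K v g" "has_trace K v' g" and q: "q \<in> Hdiv (cell K)"
  shows "ip (cell K) (wgrad (cell K) v) q + ip (cell K) v (wdiv (cell K) q)
    = ip (cell K) (wgrad (cell K) v') q + ip (cell K) v' (wdiv (cell K) q)"
proof (rule Hdiv_smooth_dense[OF convex_domain_cell[OF K] q])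
  let ?X = "cell K"
  have X: "convex_domain ?X" using convex_domain_cell[OF K] .
  fix p assume p: "\<And>n::nat. smooth_vec (p n)" "(\<lambda>n. L2_norm_on ?X (\<lambda>x. p n x - q x)) \<longlonglongrightarrow> 0"
    "(\<lambda>n. L2_norm_on ?X (\<lambda>x. sdiv (p n) x - wdiv ?X q x)) \<longlonglongrightarrow> 0"
  have lim: "(\<lambda>n. ip ?X (wgrad ?X v) (p n) + ip ?X v (sdiv (p n))) \<longlonglongrightarrow> ip ?X (wgrad ?X v) q + ip ?X v (wdiv ?X q)"
    if "v \<in> H1 ?X" for v
    unfolding ip_commute[of ?X "wgrad ?X v"] ip_commute[of ?X v]
    by (intro tendsto_add ip_tendsto smooth_vec_L2[OF X p(1)] H1_L2[OF that] wgrad_L2[OF that] p Hdiv_L2[OF q] wdiv_L2[OF q])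
  show ?thesis
    using LIMSEQ_unique[OF lim[OF has_trace_H1[OF t(1)]]] lim[OF has_trace_H1[OF t(2)]]
    by (simp add: green_trace[OF K t(1) p(1)] green_trace[OF K t(2) p(1)])
qed

text \<open>Frees \<open>normal_trace\<close> from the extension chosen in its definition: any
  function with trace \<open>g\<close> may be used.\<close>

corollary normal_trace_green:
  assumes K: "convex_quad K" and t: "has_trace K v g" and q: "q \<in> Hdiv (cell K)"
  shows "normal_trace K q g = ip (cell K) (wgrad (cell K) v) q + ip (cell K) v (wdiv (cell K) q)"
proof -
  have "g \<in> H_half K" using t by (auto simp: H_half_def)
  moreover have "has_trace K (SOME v. has_trace K v g) g" using someI[of "\<lambda>v. has_trace K v g", OF t] .
  ultimately show ?thesis
    using green_extension_independent[OF K _ t q] by (simp add: normal_trace_def Let_def)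
qed

text \<open>On the edge \<open>e0\<close> the linear function belonging to another edge is a convex
  combination of its two end point values, which are nonnegative and not both zero.\<close>

lemma edge_interior_positive:
  assumes K: "convex_quad K" and e: "e0 \<in> edges K" "e \<in> edges K" "e \<noteq> e0" and s: "0 < s" "s < 1"
  shows "cross2 (edge_vec e) (edge_pt e0 s - fst e) > 0"
proof -
  have lin: "cross2 (edge_vec e) (edge_pt e0 s - fst e) =
      (1 - s) * cross2 (edge_vec e) (fst e0 - fst e) + s * cross2 (edge_vec e) (snd e0 - fst e)" for e e0
    by (simp add: edge_pt_def cross2_def algebra_simps)
  have pos: "0 < (1 - s) * x + s * y" if "0 \<le> x" "0 \<le> y" "0 < x \<or> 0 < y" for x y :: real
    using that s by (auto intro: add_pos_nonneg add_nonneg_pos)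
  have pos': "0 < (1 - s) * x" "0 < s * x" if "0 < x" for x using that s by auto
  \<comment> \<open>It suffices to treat the edge from \<open>a\<close> to \<open>b\<close>, since
    the vertices may be rotated.\<close>
  have first: "\<forall>e\<in>edges (a, b, c, d). e \<noteq> (a, b) \<longrightarrow> 0 < cross2 (edge_vec e) (edge_pt (a, b) s - fst e)"
    if q: "convex_quad (a, b, c, d)" for a b c d
  proof -
    note q2 = convex_quad_rotate[OF q] note q3 = convex_quad_rotate[OF q2] note q4 = convex_quad_rotate[OF q3]
    note side = quad_vertex_side[OF q2] quad_vertex_side[OF q3] quad_vertex_side[OF q4]
    show ?thesis unfolding lin using side s by (auto simp: edge_vec_def cross2_simps(7-9) intro!: pos pos')
  qed
  obtain a b c d where Ke: "K = (a, b, c, d)" by (cases K) auto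
  note q = K[unfolded Ke] note q2 = convex_quad_rotate[OF q] note q3 = convex_quad_rotate[OF q2] note q4 = convex_quad_rotate[OF q3]
  have r: "edges (b, c, d, a) = edges K" "edges (c, d, a, b) = edges K" "edges (d, a, b, c) = edges K" "edges (a, b, c, d) = edges K"
    by (auto simp: Ke)
  have "e0 = (a, b) \<or> e0 = (b, c) \<or> e0 = (c, d) \<or> e0 = (d, a)" using e(1) by (auto simp: Ke)
  then show ?thesis
    using first[OF q] first[OF q2] first[OF q3] first[OF q4] e(2,3) unfolding r by blast
qed

text \<open>
  The product of the linear functions vanishing on the other edges localizes the test fields to a
  single edge.
\<close>

theorem trace_unique_of_green:
  assumes K: "convex_quad K" and t: "has_trace K v g"
    and z: "\<And>q. smooth_vec q \<Longrightarrow> ip (cell K) (wgrad (cell K) v) q + ip (cell K) v (sdiv q) = 0" and e0: "e0 \<in> edges K"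
  shows "AE s in lebesgue_on {0..1}. g (edge_pt e0 s) = 0"
proof -
  define b where "b x = (\<Prod>e\<in>edges K - {e0}. cross2 (edge_vec e) (x - fst e))" for x
  have lin: "smooth (\<lambda>x. cross2 (edge_vec e) (x - fst e))" for e
    unfolding cross2_def by (auto intro!: smooth_diff smooth_mult smooth_nth smooth_const)
  have "smooth (\<lambda>x. \<Prod>e\<in>E. cross2 (edge_vec e) (x - fst e))" for E
    by (induction E rule: infinite_finite_induct) (auto intro: smooth_mult lin)
  then have bs: "smooth b" by (simp add: b_def[abs_def])
  have b0: "b (edge_pt e s) = 0" if "e \<in> edges K" "e \<noteq> e0" for e s
  proof -
    have "cross2 (edge_vec e) (edge_pt e s - fst e) = 0" by (simp add: edge_pt_def edge_vec_def cross2_simps)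
    then show ?thesis unfolding b_def using that by (intro prod_zero) auto
  qed
  have bp: "b (edge_pt e0 s) > 0" if "0 < s" "s < 1" for s
    unfolding b_def by (rule prod_pos) (use edge_interior_positive[OF K e0] that in auto)
  \<comment> \<open>The edge vector turned to the outward normal; its flux through the edge is the
    squared edge length.\<close>
  define N where "N = pt (edge_vec e0 $ 2, - edge_vec e0 $ 1)"
  have N: "cross2 N (edge_vec e0) > 0"
  proof -
    have "edge_vec e0 \<noteq> 0" using edge_length_pos[OF K e0] by (auto simp: edge_vec_def)
    then have "0 < edge_vec e0 \<bullet> edge_vec e0" by simp
    then show ?thesis by (simp add: N_def cross2_def inner_2)
  qed
  have gL: "(\<lambda>s. g (edge_pt e s)) \<in> L2 {0..1}" if "e \<in> edges K" for e using t that by (auto simp: has_trace_iff[OF K])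
  obtain \<phi> where \<phi>: "\<And>n::nat. smooth (\<phi> n)"
      "\<And>e. e \<in> edges K \<Longrightarrow> (\<lambda>n. L2_norm_on {0..1} (\<lambda>s. \<phi> n (edge_pt e s) - g (edge_pt e s))) \<longlonglongrightarrow> 0"
    using t unfolding has_trace_iff[OF K] by auto
  have cb: "continuous_on UNIV (\<lambda>s. b (edge_pt e0 s))" by (rule continuous_on_edge[OF smooth_continuous[OF bs]])
  have gb: "(\<lambda>s. b (edge_pt e0 s) * g (edge_pt e0 s)) \<in> L2 {0..1}"
  proof -
    obtain B where "\<And>s. s \<in> {0..1} \<Longrightarrow> norm (b (edge_pt e0 s)) \<le> B"
      using continuous_bounded_on_bounded[OF cb, of "{0..1}"] by auto
    then show ?thesis
      using L2_mult_bounded[OF gL[OF e0] continuous_measurable_lebesgue_on[OF cb], of B] by simp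
  qed
  \<comment> \<open>The trace \<open>g\<close> itself is not smooth and cannot enter a test field.
    Its smooth approximants do, and the limit \<open>n \<rightarrow> \<infinity>\<close> then yields
    the weighted square of \<open>g\<close>.\<close>
  have 0: "ip {0..1} (\<lambda>s. \<phi> n (edge_pt e0 s)) (\<lambda>s. b (edge_pt e0 s) * g (edge_pt e0 s)) = 0" for n
  proof -
    define q where "q x = (b x * \<phi> n x) *\<^sub>R N" for x
    have qs: "smooth_vec q" unfolding smooth_vec_def q_def by (auto intro!: smooth_mult bs \<phi> smooth_const)
    have "0 = boundary_form K g q" using z[OF qs] green_trace[OF K t qs] by simp
    also have "\<dots> = (\<Sum>e\<in>edges K. if e = e0 then ip {0..1} (\<lambda>s. g (edge_pt e0 s)) (\<lambda>s. cross2 (q (edge_pt e0 s)) (edge_vec e0)) else 0)"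
      unfolding boundary_form_def by (rule sum.cong) (auto simp: q_def b0 cross2_simps)
    also have "\<dots> = ip {0..1} (\<lambda>s. g (edge_pt e0 s)) (\<lambda>s. cross2 (q (edge_pt e0 s)) (edge_vec e0))"
      using e0 by simp
    also have "\<dots> = cross2 N (edge_vec e0) * ip {0..1} (\<lambda>s. \<phi> n (edge_pt e0 s)) (\<lambda>s. b (edge_pt e0 s) * g (edge_pt e0 s))"
      by (simp add: q_def cross2_simps ip_def mult.assoc mult.left_commute mult.commute flip: integral_mult_right_zero)
    finally show ?thesis using N by simp
  qed
  have "(\<lambda>n. ip {0..1} (\<lambda>s. \<phi> n (edge_pt e0 s)) (\<lambda>s. b (edge_pt e0 s) * g (edge_pt e0 s)))
      \<longlonglongrightarrow> ip {0..1} (\<lambda>s. g (edge_pt e0 s)) (\<lambda>s. b (edge_pt e0 s) * g (edge_pt e0 s))"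
    by (rule ip_tendsto[OF smooth_edge_L2[OF \<phi>(1)] gL[OF e0] \<phi>(2)[OF e0] gb])
  then have int0: "(LINT s|lebesgue_on {0..1}. g (edge_pt e0 s) * (b (edge_pt e0 s) * g (edge_pt e0 s))) = 0"
    unfolding 0 LIMSEQ_const_iff by (simp add: ip_def)
  \<comment> \<open>The end points are discarded because the weight is positive only in the open
    edge.\<close>
  have 1: "AE s in lebesgue_on {0..1::real}. 0 < s \<and> s < 1"
  proof -
    have "negligible {0, 1::real}" by simp
    then have "AE s in lebesgue. s \<notin> {0, 1::real}" unfolding negligible_iff_null_sets by (rule AE_not_in)
    then have "AE s in lebesgue. s \<in> {0..1} \<longrightarrow> 0 < s \<and> s < (1::real)"
      by eventually_elim auto
    then show ?thesis by (rule iffD2[OF AE_restrict_space_iff, rotated]) simp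
  qed
  have nn: "AE s in lebesgue_on {0..1}. 0 \<le> g (edge_pt e0 s) * (b (edge_pt e0 s) * g (edge_pt e0 s))"
    using 1 by eventually_elim (use bp in \<open>simp add: mult.left_commute mult_nonneg_nonneg less_imp_le\<close>)
  have "integrable (lebesgue_on {0..1}) (\<lambda>s. g (edge_pt e0 s) * (b (edge_pt e0 s) * g (edge_pt e0 s)))"
    using ip_integrable[OF gL[OF e0] gb] by simp
  then have "AE s in lebesgue_on {0..1}. g (edge_pt e0 s) * (b (edge_pt e0 s) * g (edge_pt e0 s)) = 0"
    using integral_nonneg_eq_0_iff_AE[OF _ nn] int0 by simp
  with 1 show ?thesis by eventually_elim (use bp in force)
qed

section \<open>The coercive plate energy\<close>

text \<open>The mean value theorem is applied twice, once in each coordinate direction.\<close>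

lemma double_difference:
  assumes f: "smooth f" and h: "h > 0"
  obtains \<xi> \<eta> where "0 < \<xi>" "\<xi> < h" "0 < \<eta>" "\<eta> < h"
    "f (x + h *\<^sub>R axis i 1 + h *\<^sub>R axis j 1) - f (x + h *\<^sub>R axis i 1) - f (x + h *\<^sub>R axis j 1) + f x
      = h * h * (grad (\<lambda>x. grad f x $ i) (x + \<xi> *\<^sub>R axis i 1 + \<eta> *\<^sub>R axis j 1) $ j)"
proof -
  have der: "((\<lambda>s. g (y + s *\<^sub>R axis k 1)) has_real_derivative grad g (y + s *\<^sub>R axis k 1) $ k) (at s)"
    if "smooth g" for g y k and s :: real
  proof -
    have "((\<lambda>s. y + s *\<^sub>R axis k 1) has_derivative (\<lambda>h. h *\<^sub>R axis k 1)) (at s)"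
      by (auto intro!: derivative_eq_intros)
    from has_derivative_compose[OF this has_derivative_grad[OF smooth_differentiable[OF that]]]
    show ?thesis by (simp add: has_field_derivative_def inner_axis mult.commute[of _ "grad _ _ $ _"])
  qed
  let ?\<phi> = "\<lambda>s. f ((x + h *\<^sub>R axis j 1) + s *\<^sub>R axis i 1) - f (x + s *\<^sub>R axis i 1)"
  have d: "(?\<phi> has_real_derivative grad f ((x + h *\<^sub>R axis j 1) + s *\<^sub>R axis i 1) $ i - grad f (x + s *\<^sub>R axis i 1) $ i) (at s)" for s
    by (intro DERIV_diff der f)
  from MVT2[OF h d] obtain \<xi> where \<xi>: "0 < \<xi>" "\<xi> < h"
    "?\<phi> h - ?\<phi> 0 = (h - 0) * (grad f ((x + h *\<^sub>R axis j 1) + \<xi> *\<^sub>R axis i 1) $ i - grad f (x + \<xi> *\<^sub>R axis i 1) $ i)"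
    by blast
  let ?p = "\<lambda>x. grad f x $ i"
  have d': "((\<lambda>s. ?p ((x + \<xi> *\<^sub>R axis i 1) + s *\<^sub>R axis j 1)) has_real_derivative grad ?p ((x + \<xi> *\<^sub>R axis i 1) + s *\<^sub>R axis j 1) $ j) (at s)" for s
    by (rule der[OF smooth_grad[OF f]])
  from MVT2[OF h d'] obtain \<eta> where \<eta>: "0 < \<eta>" "\<eta> < h"
    "?p ((x + \<xi> *\<^sub>R axis i 1) + h *\<^sub>R axis j 1) - ?p ((x + \<xi> *\<^sub>R axis i 1) + 0 *\<^sub>R axis j 1) = (h - 0) * grad ?p ((x + \<xi> *\<^sub>R axis i 1) + \<eta> *\<^sub>R axis j 1) $ j"
    by blast
  have c: "(x + h *\<^sub>R axis j 1) + s *\<^sub>R axis i 1 = (x + s *\<^sub>R axis i 1) + h *\<^sub>R axis j 1" for s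
    by (simp add: algebra_simps)
  have "f (x + h *\<^sub>R axis i 1 + h *\<^sub>R axis j 1) - f (x + h *\<^sub>R axis i 1) - f (x + h *\<^sub>R axis j 1) + f x = ?\<phi> h - ?\<phi> 0"
    unfolding c by simp
  also have "\<dots> = h * (h * grad ?p ((x + \<xi> *\<^sub>R axis i 1) + \<eta> *\<^sub>R axis j 1) $ j)"
    using \<xi>(3) \<eta>(3) unfolding c by simp
  finally show ?thesis using \<xi> \<eta> by (intro that[of \<xi> \<eta>]) (simp_all add: mult.assoc)
qed

text \<open>The second difference is symmetric in the two directions, so both mixed derivatives
  agree at intermediate points, which tend to \<open>x\<close> as the step \<open>h n\<close>
  shrinks.\<close>

lemma mixed_partials:
  assumes f: "smooth f"
  shows "grad (\<lambda>x. grad f x $ i) x $ j = grad (\<lambda>x. grad f x $ j) x $ i"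
proof -
  let ?P = "\<lambda>i j x. grad (\<lambda>x. grad f x $ i) x $ j"
  define h where "h n = 1 / real (Suc n)" for n
  have h: "h n > 0" for n by (simp add: h_def)
  have h0: "h \<longlonglongrightarrow> 0" unfolding h_def using LIMSEQ_Suc[OF lim_1_over_n] by simp
  have "\<exists>\<xi> \<eta>. 0 < \<xi> \<and> \<xi> < h n \<and> 0 < \<eta> \<and> \<eta> < h n \<and>
    f (x + h n *\<^sub>R axis i 1 + h n *\<^sub>R axis j 1) - f (x + h n *\<^sub>R axis i 1) - f (x + h n *\<^sub>R axis j 1) + f x
      = h n * h n * ?P i j (x + \<xi> *\<^sub>R axis i 1 + \<eta> *\<^sub>R axis j 1)" for n i j
    by (rule double_difference[OF f h[of n], of x i j]) blast
  then obtain \<xi> \<eta> where \<xi>\<eta>: "\<And>n i j. 0 < \<xi> n i j \<and> \<xi> n i j < h n \<and> 0 < \<eta> n i j \<and> \<eta> n i j < h n \<and>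
    f (x + h n *\<^sub>R axis i 1 + h n *\<^sub>R axis j 1) - f (x + h n *\<^sub>R axis i 1) - f (x + h n *\<^sub>R axis j 1) + f x
      = h n * h n * ?P i j (x + \<xi> n i j *\<^sub>R axis i 1 + \<eta> n i j *\<^sub>R axis j 1)"
    by metis
  have lim: "(\<lambda>n. ?P i j (x + \<xi> n i j *\<^sub>R axis i 1 + \<eta> n i j *\<^sub>R axis j 1)) \<longlonglongrightarrow> ?P i j x" for i j
  proof -
    have "(\<lambda>n. \<xi> n i j) \<longlonglongrightarrow> 0" "(\<lambda>n. \<eta> n i j) \<longlonglongrightarrow> 0"
      by (rule null_sequence_comparison[OF _ h0]; use \<xi>\<eta> in \<open>simp add: less_imp_le\<close>)+
    then have "(\<lambda>n. x + \<xi> n i j *\<^sub>R axis i 1 + \<eta> n i j *\<^sub>R axis j 1) \<longlonglongrightarrow> x + 0 *\<^sub>R axis i 1 + 0 *\<^sub>R axis j 1"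
      by (intro tendsto_intros)
    moreover have "isCont (?P i j) x"
      using smooth_continuous[OF smooth_grad[OF smooth_grad[OF f]], of UNIV] by (simp add: continuous_on_eq_continuous_at)
    ultimately show ?thesis using isCont_tendsto_compose by fastforce
  qed
  have "?P i j (x + \<xi> n i j *\<^sub>R axis i 1 + \<eta> n i j *\<^sub>R axis j 1) = ?P j i (x + \<xi> n j i *\<^sub>R axis j 1 + \<eta> n j i *\<^sub>R axis i 1)" for n
  proof -
    have "x + h n *\<^sub>R axis i 1 + h n *\<^sub>R axis j 1 = x + h n *\<^sub>R axis j 1 + h n *\<^sub>R axis i 1" by (simp add: algebra_simps)
    then have "h n * h n * ?P i j (x + \<xi> n i j *\<^sub>R axis i 1 + \<eta> n i j *\<^sub>R axis j 1) = h n * h n * ?P j i (x + \<xi> n j i *\<^sub>R axis j 1 + \<eta> n j i *\<^sub>R axis i 1)"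
      using \<xi>\<eta>[of n i j] \<xi>\<eta>[of n j i] by (simp only:) linarith
    then show ?thesis using h[of n] by simp
  qed
  then show ?thesis using LIMSEQ_unique[OF lim[of i j]] lim[of j i] by simp
qed

text \<open>Integrating by parts with \<open>x $ 1 * \<phi> x\<close> gives the squared norm of
  \<phi> as -2 times the inner product of \<open>x $ 1 * \<phi> x\<close> with the first partial
  derivative. With \<open>R\<close> a bound for the points of \<open>X\<close> this yields the
  constant \<open>2 * R\<close>.\<close>

lemma poincare_test:
  assumes X: "convex_domain X"
  obtains P where "P \<ge> 0" "\<And>\<phi>. \<phi> \<in> test_functions X \<Longrightarrow> L2_norm_on X \<phi> \<le> P * L2_norm_on X (grad \<phi>)"
proof -
  obtain R where R: "R > 0" "\<And>x. x \<in> X \<Longrightarrow> norm x \<le> R"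
    using convex_domain_bounded[OF X] by (auto simp: bounded_pos)
  have "L2_norm_on X \<phi> \<le> (2 * R) * L2_norm_on X (grad \<phi>)" if \<phi>: "\<phi> \<in> test_functions X" for \<phi>
  proof -
    note s = test_function_smooth[OF \<phi>]
    note L = test_L2[OF X \<phi>]
    let ?f = "\<lambda>x. x $ 1 * \<phi> x"
    have fs: "smooth ?f" by (intro smooth_mult smooth_nth s)
    have fL: "?f \<in> L2 X" by (rule smooth_L2[OF X fs])
    have g: "grad ?f x $ 1 = \<phi> x + x $ 1 * grad \<phi> x $ 1" for x
      by (simp add: grad_mult[OF smooth_differentiable[OF smooth_nth] smooth_differentiable[OF s]])
    have gL: "(\<lambda>x. x $ 1 * grad \<phi> x $ 1) \<in> L2 X"
    proof -
      have "(\<lambda>x. grad ?f x $ 1 - \<phi> x) \<in> L2 X" by (intro L2_diff L2_nth smooth_L2[OF X fs] L)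
      then show ?thesis by (simp add: g)
    qed
    have "ip X ?f (\<lambda>x. grad \<phi> x $ 1) = - (ip X \<phi> \<phi> + ip X \<phi> (\<lambda>x. x $ 1 * grad \<phi> x $ 1))"
      using smooth_integration_by_parts[OF X fs \<phi>, of 1] by (simp add: g ip_add_right[OF L(1) gL L(1)])
    moreover have "ip X \<phi> (\<lambda>x. x $ 1 * grad \<phi> x $ 1) = ip X ?f (\<lambda>x. grad \<phi> x $ 1)"
      by (simp add: ip_def mult.assoc mult.left_commute)
    ultimately have "(L2_norm_on X \<phi>)\<^sup>2 = - 2 * ip X ?f (\<lambda>x. grad \<phi> x $ 1)" by (simp add: L2_norm_sq)
    also have "\<dots> \<le> 2 * (L2_norm_on X ?f * L2_norm_on X (\<lambda>x. grad \<phi> x $ 1))"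
      using abs_le_D2[OF ip_Cauchy_Schwarz[OF fL L2_nth[OF L(2), of 1]]] by linarith
    also have "\<dots> \<le> 2 * ((R * L2_norm_on X \<phi>) * L2_norm_on X (grad \<phi>))"
    proof -
      have "norm (?f x) \<le> R * norm (\<phi> x)" if "x \<in> X" for x
        using R(2)[OF that] component_le_norm_cart[of x 1] by (auto simp: abs_mult intro!: mult_right_mono)
      then have "L2_norm_on X ?f \<le> R * L2_norm_on X \<phi>"
        using R(1) by (intro L2_norm_mono[OF L2_measurable[OF fL] L(1)] AE_I2) auto
      then show ?thesis using L2_norm_nth_le[OF L(2), of 1] R(1) by (intro mult_left_mono mult_mono) auto
    qed
    finally have "L2_norm_on X \<phi> * L2_norm_on X \<phi> \<le> L2_norm_on X \<phi> * ((2 * R) * L2_norm_on X (grad \<phi>))"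
      by (simp add: power2_eq_square mult.assoc mult.left_commute)
    then show ?thesis
      using R(1) by (cases "L2_norm_on X \<phi> = 0") (auto simp: mult_le_cancel_left less_le)
  qed
  with R(1) show ?thesis by (intro that[of "2 * R"]) auto
qed

section \<open>Isotropic tensor maps and Korn's inequality\<close>

lemma inner_tensor: "\<sigma> \<bullet> \<rho> = \<sigma> $ 1 $ 1 * \<rho> $ 1 $ 1 + \<sigma> $ 1 $ 2 * \<rho> $ 1 $ 2 + \<sigma> $ 2 $ 1 * \<rho> $ 2 $ 1 + \<sigma> $ 2 $ 2 * \<rho> $ 2 $ 2"
  for \<sigma> \<rho> :: tensor
  by (simp add: inner_vec_def sum_2)

lemma tensor_eq_iff: "\<sigma> = \<rho> \<longleftrightarrow> \<sigma> $ 1 $ 1 = \<rho> $ 1 $ 1 \<and> \<sigma> $ 1 $ 2 = \<rho> $ 1 $ 2 \<and> \<sigma> $ 2 $ 1 = \<rho> $ 2 $ 1 \<and> \<sigma> $ 2 $ 2 = \<rho> $ 2 $ 2"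
  for \<sigma> \<rho> :: tensor
  by (simp add: vec_eq_iff forall_2)

lemma trace_2: "trace \<sigma> = \<sigma> $ 1 $ 1 + \<sigma> $ 2 $ 2" for \<sigma> :: tensor
  by (simp add: trace_def sum_2)

lemma mat_1_nth: "(mat 1 :: tensor) $ 1 $ 1 = 1" "(mat 1 :: tensor) $ 1 $ 2 = 0" "(mat 1 :: tensor) $ 2 $ 1 = 0" "(mat 1 :: tensor) $ 2 $ 2 = 1"
  by (simp_all add: mat_def)

lemma Jmat_nth: "Jmat $ 1 $ 1 = 0" "Jmat $ 1 $ 2 = 1" "Jmat $ 2 $ 1 = -1" "Jmat $ 2 $ 2 = 0"
  by (simp_all add: Jmat_def)

definition symm :: "tensor \<Rightarrow> tensor" where "symm G = (1 / 2) *\<^sub>R (G + transpose G)"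

lemma symm_nth: "symm G $ i $ j = (G $ i $ j + G $ j $ i) / 2"
  by (simp add: symm_def transpose_def)

text \<open>The bending stiffness tensor, inverse to \<open>Cinv\<close>: trace-free tensors are
  scaled by \<open>1 / 6\<close>, multiples of the identity by
  \<open>(1 + \<nu>) / (6 * (1 - \<nu>))\<close>.\<close>

definition Cten :: "real \<Rightarrow> tensor \<Rightarrow> tensor" where
  "Cten \<nu> \<sigma> = (1 / 6) *\<^sub>R (\<sigma> + (\<nu> / (1 - \<nu>) * trace \<sigma>) *\<^sub>R mat 1)"

text \<open>The symmetric square root of \<open>Cten\<close>: the scale factors on trace-free
  tensors and on multiples of the identity are the roots of those of \<open>Cten\<close>. It turns
  the bending energy into the square of an L2 norm.\<close>

definition Croot :: "real \<Rightarrow> tensor \<Rightarrow> tensor" where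
  "Croot \<nu> \<sigma> = sqrt (1 / 6) *\<^sub>R (\<sigma> + ((sqrt ((1 + \<nu>) / (1 - \<nu>)) - 1) / 2 * trace \<sigma>) *\<^sub>R mat 1)"

lemmas tensor_nth = symm_nth trace_2 mat_1_nth Jmat_nth

lemma Croot_inner:
  assumes "-1 < \<nu>" "\<nu> < 1" shows "Croot \<nu> \<sigma> \<bullet> Croot \<nu> \<rho> = Cten \<nu> \<sigma> \<bullet> \<rho>"
proof -
  let ?s = "sqrt ((1 + \<nu>) / (1 - \<nu>))"
  let ?b = "(?s - 1) / 2"
  have s2: "?s * ?s = (1 + \<nu>) / (1 - \<nu>)" using assms by simp
  have 6: "sqrt (1 / 6) * sqrt (1 / 6) = (1 / 6 :: real)" by simp
  \<comment> \<open>In the product of two roots with trace coefficient \<open>?b\<close> the product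
    of traces has the coefficient \<open>2 * ?b + 2 * (?b * ?b)\<close>, the second 2 being the
    squared norm of the identity.\<close>
  have b: "2 * ?b + 2 * (?b * ?b) = \<nu> / (1 - \<nu>)"
  proof -
    have "2 * ?b + 2 * (?b * ?b) = (?s * ?s - 1) / 2" by (simp add: field_simps)
    also have "\<dots> = \<nu> / (1 - \<nu>)" unfolding s2 using assms by (simp add: field_simps)
    finally show ?thesis .
  qed
  have "Croot \<nu> \<sigma> \<bullet> Croot \<nu> \<rho> = (sqrt (1 / 6) * sqrt (1 / 6)) * (\<sigma> \<bullet> \<rho> + (2 * ?b + 2 * (?b * ?b)) * (trace \<sigma> * trace \<rho>))"
    by (simp only: Croot_def inner_tensor tensor_nth vector_add_component vector_scaleR_component real_scaleR_def) (simp only: algebra_simps)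
  also have "\<dots> = Cten \<nu> \<sigma> \<bullet> \<rho>"
    unfolding 6 b by (simp add: Cten_def inner_tensor tensor_nth algebra_simps)
  finally show ?thesis .
qed

lemma linear_isotropic: "linear (\<lambda>\<sigma> :: tensor. a *\<^sub>R (\<sigma> + (b * trace \<sigma>) *\<^sub>R mat 1))"
  by (rule linearI) (simp_all add: trace_2 algebra_simps)

lemma linear_tensor_maps: "linear symm" "linear (Croot \<nu>)" "linear (Cten \<nu>)" "linear (Cinv \<nu>)"
proof -
  show "linear symm" by (rule linearI) (simp_all add: tensor_eq_iff tensor_nth add_divide_distrib algebra_simps)
  show "linear (Croot \<nu>)" "linear (Cten \<nu>)" unfolding Croot_def[abs_def] Cten_def[abs_def] by (rule linear_isotropic)+
  show "linear (Cinv \<nu>)" using linear_isotropic[of 6 "- (\<nu> / (1 + \<nu>))"] by (simp add: Cinv_def[abs_def])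
qed

text \<open>Injectivity suffices, since a linear left inverse in finite dimension is bounded. Taking
  traces in \<open>Croot \<nu> \<sigma> = 0\<close> shows that the trace of \<sigma> vanishes, and
  then \<sigma> itself.\<close>

lemma Croot_bounded_below:
  assumes "-1 < \<nu>" "\<nu> < 1"
  obtains c where "c \<ge> 0" "\<And>\<sigma>. norm \<sigma> \<le> c * norm (Croot \<nu> \<sigma>)"
proof -
  define s where "s = sqrt ((1 + \<nu>) / (1 - \<nu>))"
  have s: "s > 0" using assms by (simp add: s_def)
  have inj: "\<sigma> = 0" if "Croot \<nu> \<sigma> = 0" for \<sigma>
  proof -
    have z: "\<sigma> + ((s - 1) / 2 * trace \<sigma>) *\<^sub>R mat 1 = 0"
      using that unfolding Croot_def s_def[symmetric] by simp
    then have "trace (\<sigma> + ((s - 1) / 2 * trace \<sigma>) *\<^sub>R mat 1) = trace (0 :: tensor)" by (rule arg_cong)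
    moreover have "trace (\<sigma> + ((s - 1) / 2 * trace \<sigma>) *\<^sub>R mat 1) = s * trace \<sigma>"
      by (simp add: trace_2 mat_1_nth field_simps)
    ultimately have "trace \<sigma> = 0" using s by (simp add: trace_2)
    then show ?thesis using z by simp
  qed
  have "inj (Croot \<nu>)"
    using inj linear_injective_0[OF linear_tensor_maps(2)] by blast
  then obtain g where g: "linear g" "g \<circ> Croot \<nu> = id"
    using linear_injective_left_inverse[OF linear_tensor_maps(2)] by blast
  obtain B where B: "B > 0" "\<And>x. norm (g x) \<le> B * norm x" using linear_bounded_pos[OF g(1)] by blast
  have "norm \<sigma> \<le> B * norm (Croot \<nu> \<sigma>)" for \<sigma>
    using B(2)[of "Croot \<nu> \<sigma>"] g(2) by (simp add: fun_eq_iff)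
  with B(1) show ?thesis by (intro that[of B]) auto
qed

definition gradv :: "(point \<Rightarrow> point) \<Rightarrow> point \<Rightarrow> tensor" where
  "gradv \<psi> x = (\<chi> i. grad (\<lambda>y. \<psi> y $ i) x)"

definition test_vec :: "point set \<Rightarrow> (point \<Rightarrow> point) set" where
  "test_vec X = {\<psi>. \<forall>i. (\<lambda>x. \<psi> x $ i) \<in> test_functions X}"

lemma test_vec_L2:
  assumes "convex_domain X" "\<psi> \<in> test_vec X" shows "\<psi> \<in> L2 X" "gradv \<psi> \<in> L2 X"
proof -
  have t: "(\<lambda>x. \<psi> x $ i) \<in> test_functions X" for i using assms(2) by (simp add: test_vec_def)
  show "\<psi> \<in> L2 X" by (rule L2_vecI) (rule test_L2(1)[OF assms(1) t])
  show "gradv \<psi> \<in> L2 X" by (rule L2_vecI) (use test_L2(2)[OF assms(1) t] in \<open>simp add: gradv_def\<close>)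
qed

text \<open>
  Korn's first inequality: integrating by parts twice, the integrals of \<open>\<partial>\<^sub>2\<psi>\<^sub>1 \<partial>\<^sub>1\<psi>\<^sub>2\<close> and
  \<open>\<partial>\<^sub>1\<psi>\<^sub>1 \<partial>\<^sub>2\<psi>\<^sub>2\<close> agree, and the defect is the square of the divergence.
\<close>

lemma korn_test:
  assumes X: "convex_domain X" and \<psi>: "\<psi> \<in> test_vec X"
  shows "L2_norm_on X (gradv \<psi>) \<le> 2 * L2_norm_on X (\<lambda>x. symm (gradv \<psi> x))"
proof -
  have t: "(\<lambda>x. \<psi> x $ i) \<in> test_functions X" for i using \<psi> by (simp add: test_vec_def)
  note s = test_function_smooth[OF t]
  define G where "G = gradv \<psi>"
  have G: "G x $ i $ j = grad (\<lambda>y. \<psi> y $ i) x $ j" for x i j by (simp add: G_def gradv_def)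
  have GL: "G \<in> L2 X" using test_vec_L2[OF X \<psi>] by (simp add: G_def)
  have gL: "(\<lambda>x. G x $ i $ j) \<in> L2 X" for i j using GL by (intro L2_nth)
  have SL: "(\<lambda>x. symm (G x)) \<in> L2 X"
    using GL linear_tensor_maps(1) by (intro L2_bounded_linear[of symm]) (simp_all add: linear_conv_bounded_linear)
  have bc: "ip X (\<lambda>x. G x $ 2 $ 1) (\<lambda>x. G x $ 1 $ 2) = ip X (\<lambda>x. G x $ 2 $ 2) (\<lambda>x. G x $ 1 $ 1)"
    using smooth_integration_by_parts[OF X smooth_grad[OF s[of 2], of 1] t[of 1], of 2]
      smooth_integration_by_parts[OF X smooth_grad[OF s[of 2], of 2] t[of 1], of 1]
    by (simp add: G mixed_partials[OF s[of 2], of 1 _ 2])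
  have dL: "(\<lambda>x. G x $ 1 $ 1 + G x $ 2 $ 2) \<in> L2 X" by (intro L2_add gL)
  have "2 * ip X (\<lambda>x. symm (G x)) (\<lambda>x. symm (G x)) = ip X G G + ip X (\<lambda>x. G x $ 1 $ 1 + G x $ 2 $ 2) (\<lambda>x. G x $ 1 $ 1 + G x $ 2 $ 2)
     + 2 * ip X (\<lambda>x. G x $ 2 $ 1) (\<lambda>x. G x $ 1 $ 2) - 2 * ip X (\<lambda>x. G x $ 2 $ 2) (\<lambda>x. G x $ 1 $ 1)"
  proof -
    have p: "2 * (symm H \<bullet> symm H) = H \<bullet> H + (H $ 1 $ 1 + H $ 2 $ 2) * (H $ 1 $ 1 + H $ 2 $ 2) + 2 * (H $ 2 $ 1 * H $ 1 $ 2) - 2 * (H $ 2 $ 2 * H $ 1 $ 1)" for H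
      by (simp add: inner_tensor tensor_nth field_simps)
    have "2 * ip X (\<lambda>x. symm (G x)) (\<lambda>x. symm (G x)) = (LINT x|lebesgue_on X. 2 * (symm (G x) \<bullet> symm (G x)))"
      by (simp add: ip_def)
    also have "\<dots> = (LINT x|lebesgue_on X. G x \<bullet> G x + (G x $ 1 $ 1 + G x $ 2 $ 2) \<bullet> (G x $ 1 $ 1 + G x $ 2 $ 2) + 2 * (G x $ 2 $ 1 \<bullet> G x $ 1 $ 2) - 2 * (G x $ 2 $ 2 \<bullet> G x $ 1 $ 1))"
      unfolding p by simp
    also have "\<dots> = ip X G G + ip X (\<lambda>x. G x $ 1 $ 1 + G x $ 2 $ 2) (\<lambda>x. G x $ 1 $ 1 + G x $ 2 $ 2)
     + 2 * ip X (\<lambda>x. G x $ 2 $ 1) (\<lambda>x. G x $ 1 $ 2) - 2 * ip X (\<lambda>x. G x $ 2 $ 2) (\<lambda>x. G x $ 1 $ 1)"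
      using ip_integrable[OF GL GL] ip_integrable[OF dL dL] ip_integrable[OF gL gL, of 2 1 1 2] ip_integrable[OF gL gL, of 2 2 1 1]
      unfolding ip_def by simp
    finally show ?thesis .
  qed
  then have "(L2_norm_on X G)\<^sup>2 \<le> 2 * (L2_norm_on X (\<lambda>x. symm (G x)))\<^sup>2"
    using zero_le_power2[of "L2_norm_on X (\<lambda>x. G x $ 1 $ 1 + G x $ 2 $ 2)"] unfolding L2_norm_sq bc by linarith
  \<comment> \<open>The argument yields the square root of 2; rounding up keeps the later constants
    free of roots.\<close>
  also have "\<dots> \<le> (2 * L2_norm_on X (\<lambda>x. symm (G x)))\<^sup>2" by (simp add: power_mult_distrib)
  finally show ?thesis unfolding G_def by (rule power2_le_imp_le) simp
qed

section \<open>Coercivity and energy minimization\<close>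

type_synonym jet = "real \<times> point \<times> point \<times> tensor"

text \<open>The L2 norm of the jet is the H1 norm of the pair, so that questions on Sobolev spaces
  become questions on L2 functions.\<close>

definition jet :: "(point \<Rightarrow> real) \<Rightarrow> (point \<Rightarrow> point) \<Rightarrow> point \<Rightarrow> jet" where
  "jet w \<psi> x = (w x, grad w x, \<psi> x, gradv \<psi> x)"

text \<open>The energy of the plate is \<open>\<parallel>Lam k \<nu> (jet w \<psi>)\<parallel>\<^sup>2 / 2\<close> with \<open>k\<^sup>2 = \<kappa> / t\<^sup>2\<close>.\<close>

definition Lam :: "real \<Rightarrow> real \<Rightarrow> jet \<Rightarrow> point \<times> tensor" where
  "Lam k \<nu> u = (k *\<^sub>R (fst (snd u) - fst (snd (snd u))), Croot \<nu> (symm (snd (snd (snd u)))))"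

lemma bounded_linear_Lam: "bounded_linear (Lam k \<nu>)"
  unfolding linear_conv_bounded_linear[symmetric]
  by (rule linearI) (auto simp: Lam_def linear_add[OF linear_tensor_maps(1)] linear_add[OF linear_tensor_maps(2)]
      linear_scale[OF linear_tensor_maps(1)] linear_scale[OF linear_tensor_maps(2)] algebra_simps)

lemma jet_L2: "convex_domain X \<Longrightarrow> w \<in> test_functions X \<Longrightarrow> \<psi> \<in> test_vec X \<Longrightarrow> jet w \<psi> \<in> L2 X"
  unfolding jet_def[abs_def] by (intro L2_Pair test_L2 test_vec_L2)

lemma Lam_L2: "u \<in> L2 X \<Longrightarrow> (\<lambda>x. Lam k \<nu> (u x)) \<in> L2 X"
  by (rule L2_bounded_linear[OF bounded_linear_Lam])

lemma L2_norm_Pair_le: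
  assumes "f \<in> L2 X" "g \<in> L2 X"
  shows "L2_norm_on X (\<lambda>x. (f x, g x)) \<le> L2_norm_on X f + L2_norm_on X g"
proof (rule power2_le_imp_le)
  show "(L2_norm_on X (\<lambda>x. (f x, g x)))\<^sup>2 \<le> (L2_norm_on X f + L2_norm_on X g)\<^sup>2"
    unfolding L2_norm_Pair[OF assms] by (simp add: power2_sum)
qed (simp add: add_nonneg_nonneg)

lemma L2_norm_bounded_linear_le:
  fixes h :: "'a::euclidean_space \<Rightarrow> 'b::euclidean_space"
  assumes "bounded_linear h" "f \<in> L2 X" "0 \<le> c" "\<And>x. norm (h x) \<le> c * norm x"
  shows "L2_norm_on X (\<lambda>x. h (f x)) \<le> c * L2_norm_on X f"
  using L2_bounded_linear[OF assms(1,2)] assms by (intro L2_norm_mono L2_measurable) auto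

lemma L2_norm_fst_le: "f \<in> L2 X \<Longrightarrow> L2_norm_on X (\<lambda>x. fst (f x)) \<le> L2_norm_on X f"
  and L2_norm_snd_le: "f \<in> L2 X \<Longrightarrow> L2_norm_on X (\<lambda>x. snd (f x)) \<le> L2_norm_on X f"
  using L2_norm_bounded_linear_le[OF bounded_linear_fst, of f X 1] L2_norm_bounded_linear_le[OF bounded_linear_snd, of f X 1]
  by (auto simp: norm_fst_le norm_snd_le)

lemma L2_tendsto_bounded_linear:
  fixes h :: "'a::euclidean_space \<Rightarrow> 'b::euclidean_space"
  assumes h: "bounded_linear h" and f: "\<And>n. f n \<in> L2 X" "g \<in> L2 X" "(\<lambda>n. L2_norm_on X (\<lambda>x. f n x - g x)) \<longlonglongrightarrow> 0"
  shows "(\<lambda>n. L2_norm_on X (\<lambda>x. h (f n x) - h (g x))) \<longlonglongrightarrow> 0"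
proof -
  obtain c where c: "\<And>x. norm (h x) \<le> norm x * c" "c > 0"
    using bounded_linear.pos_bounded[OF h] by blast
  have "L2_norm_on X (\<lambda>x. h (f n x) - h (g x)) \<le> c * L2_norm_on X (\<lambda>x. f n x - g x)" for n
    using L2_norm_bounded_linear_le[OF h L2_diff[OF f(1,2)], of c n] c
    by (simp add: mult.commute linear_diff[OF bounded_linear.linear[OF h]])
  then have "\<bar>L2_norm_on X (\<lambda>x. h (f n x) - h (g x))\<bar> \<le> c * L2_norm_on X (\<lambda>x. f n x - g x)" for n by simp
  then show ?thesis by (rule null_sequence_comparison) (use tendsto_mult_right_zero[OF f(3)] in simp)
qed

text \<open>Korn's inequality bounds the gradient of \<psi> by the bending part, Poincare's bounds
  \<psi> itself; the shear part then bounds the gradient of \<open>w\<close>, and Poincare's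
  inequality once more \<open>w\<close>.\<close>

lemma jet_coercive:
  assumes X: "convex_domain X" and k: "k > 0" and \<nu>: "-1 < \<nu>" "\<nu> < 1"
  obtains C where "C \<ge> 0" "\<And>w \<psi>. w \<in> test_functions X \<Longrightarrow> \<psi> \<in> test_vec X \<Longrightarrow>
    L2_norm_on X (jet w \<psi>) \<le> C * L2_norm_on X (\<lambda>x. Lam k \<nu> (jet w \<psi> x))"
proof -
  obtain P where P: "P \<ge> 0" "\<And>\<phi>. \<phi> \<in> test_functions X \<Longrightarrow> L2_norm_on X \<phi> \<le> P * L2_norm_on X (grad \<phi>)"
    using poincare_test[OF X] by blast
  obtain c where c: "c \<ge> 0" "\<And>\<sigma>. norm \<sigma> \<le> c * norm (Croot \<nu> \<sigma>)" using Croot_bounded_below[OF \<nu>] by blast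
  define a where "a = 2 * c"
  \<comment> \<open>Each of the two components of \<psi> is bounded by \<open>P * a\<close>; the
    factor 2 is an upper bound for the square root of 2. Adding \<open>1 / k\<close> from the shear
    term gives \<open>d\<close>.\<close>
  define b where "b = 2 * P * a"
  define d where "d = 1 / k + b"
  have nn: "a \<ge> 0" "b \<ge> 0" "d \<ge> 0" using c(1) P(1) k by (auto simp: a_def b_def d_def)
  have "L2_norm_on X (jet w \<psi>) \<le> (P * d + d + b + a) * L2_norm_on X (\<lambda>x. Lam k \<nu> (jet w \<psi> x))"
    if w: "w \<in> test_functions X" and \<psi>: "\<psi> \<in> test_vec X" for w \<psi>
  proof -
    define e where "e = L2_norm_on X (\<lambda>x. Lam k \<nu> (jet w \<psi> x))"
    have e0: "e \<ge> 0" by (simp add: e_def)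
    note LL = Lam_L2[OF jet_L2[OF X w \<psi>], of k \<nu>]
    note L = test_L2[OF X w] test_vec_L2[OF X \<psi>]
    have 1: "L2_norm_on X (\<lambda>x. grad w x - \<psi> x) \<le> e / k"
    proof -
      have "L2_norm_on X (\<lambda>x. k *\<^sub>R (grad w x - \<psi> x)) \<le> e"
        using L2_norm_fst_le[OF LL] by (simp add: e_def Lam_def jet_def)
      then show ?thesis using k unfolding L2_norm_scaleR by (simp add: field_simps)
    qed
    have 2: "L2_norm_on X (gradv \<psi>) \<le> a * e"
    proof -
      have SL: "(\<lambda>x. symm (gradv \<psi> x)) \<in> L2 X"
        using L(4) linear_tensor_maps(1) by (intro L2_bounded_linear[of symm]) (simp_all add: linear_conv_bounded_linear)
      have CL: "(\<lambda>x. Croot \<nu> (symm (gradv \<psi> x))) \<in> L2 X" using L2_snd[OF LL] by (simp add: Lam_def jet_def)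
      have "L2_norm_on X (\<lambda>x. symm (gradv \<psi> x)) \<le> c * L2_norm_on X (\<lambda>x. Croot \<nu> (symm (gradv \<psi> x)))"
        using c by (intro L2_norm_mono[OF L2_measurable[OF SL] CL] AE_I2) auto
      also have "\<dots> \<le> c * e" using L2_norm_snd_le[OF LL] c(1) by (intro mult_left_mono) (simp_all add: e_def Lam_def jet_def)
      finally show ?thesis using korn_test[OF X \<psi>] by (simp add: a_def)
    qed
    have 3: "L2_norm_on X \<psi> \<le> b * e"
    proof -
      have i: "L2_norm_on X (\<lambda>x. \<psi> x $ i) \<le> P * (a * e)" for i
      proof -
        have "(\<lambda>x. \<psi> x $ i) \<in> test_functions X" using \<psi> by (simp add: test_vec_def)
        then have "L2_norm_on X (\<lambda>x. \<psi> x $ i) \<le> P * L2_norm_on X (\<lambda>x. gradv \<psi> x $ i)" using P(2) by (simp add: gradv_def)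
        also have "\<dots> \<le> P * (a * e)" using L2_norm_nth_le[OF L(4), of i] 2 P(1) by (intro mult_left_mono) auto
        finally show ?thesis .
      qed
      have "(L2_norm_on X \<psi>)\<^sup>2 = (L2_norm_on X (\<lambda>x. \<psi> x $ 1))\<^sup>2 + (L2_norm_on X (\<lambda>x. \<psi> x $ 2))\<^sup>2"
        by (simp add: L2_norm_vec[OF L(3)] sum_2)
      also have "\<dots> \<le> (P * (a * e))\<^sup>2 + (P * (a * e))\<^sup>2" by (intro add_mono power_mono i) auto
      also have "\<dots> \<le> (b * e)\<^sup>2" by (simp add: b_def power_mult_distrib)
      finally show ?thesis by (rule power2_le_imp_le) (use nn e0 in simp)
    qed
    have 4: "L2_norm_on X (grad w) \<le> d * e"
      using L2_norm_triangle[OF L2_diff[OF L(2) L(3)] L(3)] 1 3 by (simp add: d_def algebra_simps)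
    have 5: "L2_norm_on X w \<le> P * d * e"
      using P(2)[OF w] mult_left_mono[OF 4 P(1)] by (simp add: mult.assoc)
    have "L2_norm_on X (jet w \<psi>) \<le> L2_norm_on X w + (L2_norm_on X (grad w) + (L2_norm_on X \<psi> + L2_norm_on X (gradv \<psi>)))"
      unfolding jet_def[abs_def] using L
      by (intro order_trans[OF L2_norm_Pair_le] add_left_mono L2_Pair) auto
    also have "\<dots> \<le> P * d * e + (d * e + (b * e + a * e))" by (intro add_mono 2 3 4 5)
    finally show ?thesis by (simp add: e_def[symmetric] algebra_simps)
  qed
  moreover have "P * d + d + b + a \<ge> 0" using P(1) nn by simp
  ultimately show ?thesis using that by blast
qed

lemma test_functions_lincomb:
  assumes "f \<in> test_functions X" "g \<in> test_functions X"
  shows "(\<lambda>x. a * f x + b * g x) \<in> test_functions X"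
    and "grad (\<lambda>x. a * f x + b * g x) x = a *\<^sub>R grad f x + b *\<^sub>R grad g x"
proof -
  note s = test_function_smooth[OF assms(1)] test_function_smooth[OF assms(2)]
  let ?h = "\<lambda>x. a * f x + b * g x"
  have "closure {x. ?h x \<noteq> 0} \<subseteq> closure ({x. f x \<noteq> 0} \<union> {x. g x \<noteq> 0})" by (rule closure_mono) auto
  then have sub: "closure {x. ?h x \<noteq> 0} \<subseteq> closure {x. f x \<noteq> 0} \<union> closure {x. g x \<noteq> 0}" by (simp only: closure_Un)
  have c: "compact (closure {x. f x \<noteq> 0} \<union> closure {x. g x \<noteq> 0})" "closure {x. f x \<noteq> 0} \<union> closure {x. g x \<noteq> 0} \<subseteq> X"
    using assms unfolding test_functions_def by (simp_all add: compact_Un)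
  have "compact (closure {x. ?h x \<noteq> 0})"
    unfolding compact_eq_bounded_closed using bounded_subset[OF compact_imp_bounded[OF c(1)] sub] by (simp only: closed_closure simp_thms)
  then show "?h \<in> test_functions X"
    unfolding test_functions_def mem_Collect_eq by (intro conjI smooth_add smooth_mult smooth_const s order_trans[OF sub c(2)])
  note d = smooth_differentiable[OF s(1)] smooth_differentiable[OF s(2)]
  show "grad ?h x = a *\<^sub>R grad f x + b *\<^sub>R grad g x"
    using grad_add[of "\<lambda>x. a * f x" x "\<lambda>x. b * g x"] d by (simp add: grad_cmult)
qed

lemma jet_lincomb:
  assumes w: "w \<in> test_functions X" "w' \<in> test_functions X" and \<psi>: "\<psi> \<in> test_vec X" "\<psi>' \<in> test_vec X"
  shows "(\<lambda>x. a * w x + b * w' x) \<in> test_functions X" "(\<lambda>x. a *\<^sub>R \<psi> x + b *\<^sub>R \<psi>' x) \<in> test_vec X"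
    "jet (\<lambda>x. a * w x + b * w' x) (\<lambda>x. a *\<^sub>R \<psi> x + b *\<^sub>R \<psi>' x) x = a *\<^sub>R jet w \<psi> x + b *\<^sub>R jet w' \<psi>' x"
proof -
  have t: "(\<lambda>x. \<psi> x $ i) \<in> test_functions X" "(\<lambda>x. \<psi>' x $ i) \<in> test_functions X" for i using \<psi> by (simp_all add: test_vec_def)
  show "(\<lambda>x. a * w x + b * w' x) \<in> test_functions X" by (rule test_functions_lincomb[OF w])
  show "(\<lambda>x. a *\<^sub>R \<psi> x + b *\<^sub>R \<psi>' x) \<in> test_vec X"
    using test_functions_lincomb(1)[OF t] by (simp add: test_vec_def)
  have "gradv (\<lambda>x. a *\<^sub>R \<psi> x + b *\<^sub>R \<psi>' x) x = a *\<^sub>R gradv \<psi> x + b *\<^sub>R gradv \<psi>' x"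
    using test_functions_lincomb(2)[OF t] by (simp add: gradv_def vec_eq_iff)
  then show "jet (\<lambda>x. a * w x + b * w' x) (\<lambda>x. a *\<^sub>R \<psi> x + b *\<^sub>R \<psi>' x) x = a *\<^sub>R jet w \<psi> x + b *\<^sub>R jet w' \<psi>' x"
    by (simp add: jet_def test_functions_lincomb(2)[OF w])
qed

text \<open>The Riesz theorem for the map from test functions to
  \<open>Lam k \<nu> (jet w \<psi>)\<close> yields a sequence whose images converge; by coercivity
  the jets converge too, and their limit is the jet of the solution. Coercivity enters the constant
  twice: in the bound of the load functional and in the passage from the energy back to the
  jet.\<close>

theorem energy_problem:
  assumes X: "convex_domain X" and k: "k > 0" and \<nu>: "-1 < \<nu>" "\<nu> < 1"
  obtains C where "C \<ge> 0" "\<And>b :: point \<Rightarrow> jet. b \<in> L2 X \<Longrightarrow> \<exists>w gw \<psi> g\<psi>.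
      w \<in> H10 X \<and> is_weak_grad X w gw \<and> (\<forall>i. (\<lambda>x. \<psi> x $ i) \<in> H10 X \<and> is_weak_grad X (\<lambda>x. \<psi> x $ i) (\<lambda>x. g\<psi> x $ i)) \<and>
      \<psi> \<in> L2 X \<and> g\<psi> \<in> L2 X \<and>
      (\<forall>\<delta>\<in>test_functions X. \<forall>\<eta>\<in>test_vec X.
        ip X (\<lambda>x. Lam k \<nu> (w x, gw x, \<psi> x, g\<psi> x)) (\<lambda>x. Lam k \<nu> (jet \<delta> \<eta> x)) = ip X b (jet \<delta> \<eta>)) \<and>
      L2_norm_on X (\<lambda>x. (w x, gw x, \<psi> x, g\<psi> x)) \<le> C * L2_norm_on X b"
proof -
  obtain C where C: "C \<ge> 0" "\<And>w \<psi>. w \<in> test_functions X \<Longrightarrow> \<psi> \<in> test_vec X \<Longrightarrow>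
    L2_norm_on X (jet w \<psi>) \<le> C * L2_norm_on X (\<lambda>x. Lam k \<nu> (jet w \<psi> x))"
    using jet_coercive[OF X k \<nu>] by blast
  define S where "S = test_functions X \<times> test_vec X"
  define U where "U v = jet (fst v) (snd v)" for v
  define D where "D v x = Lam k \<nu> (U v x)" for v x
  have UL: "U v \<in> L2 X" if "v \<in> S" for v using that jet_L2[OF X] by (auto simp: S_def U_def)
  have DL: "D v \<in> L2 X" if "v \<in> S" for v using Lam_L2[OF UL[OF that]] by (simp add: D_def[abs_def])
  have UD: "L2_norm_on X (U v) \<le> C * L2_norm_on X (D v)" if "v \<in> S" for v
    using C(2) that by (auto simp: S_def U_def D_def[abs_def])
  have linL: "linear (Lam k \<nu>)" using bounded_linear_Lam linear_conv_bounded_linear by blast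
  have comb: "\<exists>w\<in>S. \<forall>x. U w x = a *\<^sub>R U u x + b *\<^sub>R U v x" if "u \<in> S" "v \<in> S" for u v a b
  proof (intro bexI allI)
    let ?w = "(\<lambda>x. a * fst u x + b * fst v x, \<lambda>x. a *\<^sub>R snd u x + b *\<^sub>R snd v x)"
    show "?w \<in> S" "U ?w x = a *\<^sub>R U u x + b *\<^sub>R U v x" for x
      using that jet_lincomb[of "fst u" X "fst v" "snd u" "snd v"] by (auto simp: S_def U_def)
  qed
  have S0: "S \<noteq> {}"
  proof -
    have "(\<lambda>x. 0) \<in> test_functions X" by (auto simp: test_functions_def)
    then show ?thesis by (auto simp: S_def test_vec_def intro!: exI[of _ "\<lambda>x. 0"])
  qed
  have "\<exists>w gw \<psi> g\<psi>.
      w \<in> H10 X \<and> is_weak_grad X w gw \<and> (\<forall>i. (\<lambda>x. \<psi> x $ i) \<in> H10 X \<and> is_weak_grad X (\<lambda>x. \<psi> x $ i) (\<lambda>x. g\<psi> x $ i)) \<and>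
      \<psi> \<in> L2 X \<and> g\<psi> \<in> L2 X \<and>
      (\<forall>\<delta>\<in>test_functions X. \<forall>\<eta>\<in>test_vec X.
        ip X (\<lambda>x. Lam k \<nu> (w x, gw x, \<psi> x, g\<psi> x)) (\<lambda>x. Lam k \<nu> (jet \<delta> \<eta> x)) = ip X b (jet \<delta> \<eta>)) \<and>
      L2_norm_on X (\<lambda>x. (w x, gw x, \<psi> x, g\<psi> x)) \<le> (C * C) * L2_norm_on X b"
    if b: "b \<in> L2 X" for b :: "point \<Rightarrow> jet"
  proof -
    let ?l = "\<lambda>v. ip X b (U v)"
    have "\<exists>w\<in>S. (AE x in lebesgue_on X. D w x = a *\<^sub>R D u x + c *\<^sub>R D v x) \<and> ?l w = a * ?l u + c * ?l v"
      if uv: "u \<in> S" "v \<in> S" for u v a c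
    proof -
      obtain w where w: "w \<in> S" "\<And>x. U w x = a *\<^sub>R U u x + c *\<^sub>R U v x" using comb[OF uv] by blast
      have "?l w = a * ?l u + c * ?l v"
        using b UL uv by (simp add: w(2)[abs_def] ip_add_right L2_scaleR ip_scaleR_right)
      moreover have "D w x = a *\<^sub>R D u x + c *\<^sub>R D v x" for x
        by (simp add: D_def w(2) linear_add[OF linL] linear_scale[OF linL])
      ultimately show ?thesis using w(1) by auto
    qed
    moreover have "\<bar>?l v\<bar> \<le> (L2_norm_on X b * C) * L2_norm_on X (D v)" if "v \<in> S" for v
      using ip_Cauchy_Schwarz[OF b UL[OF that]] mult_left_mono[OF UD[OF that], of "L2_norm_on X b"] by (simp add: mult.assoc)
    moreover have "0 \<le> L2_norm_on X b * C" using C(1) by simp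
    ultimately obtain f v where f: "f \<in> L2 X" and v: "\<And>n::nat. v n \<in> S"
      and lim: "(\<lambda>n. L2_norm_on X (\<lambda>x. D (v n) x - f x)) \<longlonglongrightarrow> 0"
      and rep: "\<And>v. v \<in> S \<Longrightarrow> ?l v = ip X f (D v)" and fn: "L2_norm_on X f \<le> L2_norm_on X b * C"
      using riesz_L2[of S D X ?l "L2_norm_on X b * C"] DL S0 by blast
    have "\<exists>N. \<forall>m\<ge>N. \<forall>n\<ge>N. L2_norm_on X (\<lambda>x. U (v m) x - U (v n) x) < e" if e: "e > 0" for e
    proof -
      \<comment> \<open>Two distances to \<open>f\<close> are added and multiplied by
        \<open>C\<close>; replacing \<open>C\<close> by \<open>C + 1\<close> makes the estimate
        strict.\<close>
      define e' where "e' = e / (2 * (C + 1))"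
      have e': "e' > 0" using e C(1) by (simp add: e'_def)
      then obtain N where N: "\<And>n. n \<ge> N \<Longrightarrow> L2_norm_on X (\<lambda>x. D (v n) x - f x) < e'"
        using order_tendstoD(2)[OF lim] unfolding eventually_sequentially by blast
      have "L2_norm_on X (\<lambda>x. U (v m) x - U (v n) x) < e" if "m \<ge> N" "n \<ge> N" for m n
      proof -
        obtain w where w: "w \<in> S" "\<And>x. U w x = 1 *\<^sub>R U (v m) x + (-1) *\<^sub>R U (v n) x" using comb[OF v v] by blast
        have Dw: "D w x = D (v m) x - D (v n) x" for x
          unfolding D_def w(2) by (simp add: linear_diff[OF linL])
        have "L2_norm_on X (\<lambda>x. D (v m) x - D (v n) x) \<le> e' + e'"
          using L2_norm_triangle3[OF DL[OF v] f DL[OF v], of m n] N[OF that(1)] N[OF that(2)]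
            L2_norm_diff_commute[of X f "D (v n)"] by simp
        then have "C * L2_norm_on X (D w) \<le> C * (e' + e')" using C(1) by (simp add: Dw[abs_def] mult_left_mono)
        also have "\<dots> < (C + 1) * (e' + e')" using e' by (simp add: distrib_right)
        also have "\<dots> = e"
        proof -
          have half: "c * (e / (2 * c) + e / (2 * c)) = e" if "c \<noteq> 0" for c
            using that by (simp add: field_simps)
          show ?thesis unfolding e'_def by (rule half) (use C(1) in simp)
        qed
        finally show ?thesis using UD[OF w(1)] by (simp add: w(2)[abs_def])
      qed
      then show ?thesis by blast
    qed
    then obtain u where u: "u \<in> L2 X" "(\<lambda>n. L2_norm_on X (\<lambda>x. U (v n) x - u x)) \<longlonglongrightarrow> 0"
      using L2_complete[of "\<lambda>n. U (v n)" X] UL[OF v] by blast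
    define w where "w x = fst (u x)" for x
    define gw where "gw x = fst (snd (u x))" for x
    define \<psi> where "\<psi> x = fst (snd (snd (u x)))" for x
    define g\<psi> where "g\<psi> x = snd (snd (snd (u x)))" for x
    have uc: "u x = (w x, gw x, \<psi> x, g\<psi> x)" for x by (simp add: w_def gw_def \<psi>_def g\<psi>_def)
    have L: "w \<in> L2 X" "gw \<in> L2 X" "\<psi> \<in> L2 X" "g\<psi> \<in> L2 X"
      unfolding w_def[abs_def] gw_def[abs_def] \<psi>_def[abs_def] g\<psi>_def[abs_def]
      using L2_fst[OF u(1)] L2_fst[OF L2_snd[OF u(1)]] L2_fst[OF L2_snd[OF L2_snd[OF u(1)]]]
        L2_snd[OF L2_snd[OF L2_snd[OF u(1)]]] .
    note bl = bounded_linear_fst bounded_linear_compose[OF bounded_linear_fst bounded_linear_snd]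
      bounded_linear_compose[OF bounded_linear_fst bounded_linear_compose[OF bounded_linear_snd bounded_linear_snd]]
      bounded_linear_compose[OF bounded_linear_snd bounded_linear_compose[OF bounded_linear_snd bounded_linear_snd]]
    note tl = L2_tendsto_bounded_linear[OF _ UL[OF v] u]
    have tests: "fst (v n) \<in> test_functions X" "(\<lambda>x. snd (v n) x $ i) \<in> test_functions X" for n i
      using v[of n] by (auto simp: S_def test_vec_def)
    have 1: "w \<in> H10 X" "is_weak_grad X w gw"
    proof -
      have "(\<lambda>n. L2_norm_on X (\<lambda>x. fst (v n) x - w x)) \<longlonglongrightarrow> 0" "(\<lambda>n. L2_norm_on X (\<lambda>x. grad (fst (v n)) x - gw x)) \<longlonglongrightarrow> 0"
        using tl[OF bl(1)] tl[OF bl(2)] by (simp_all add: U_def jet_def w_def gw_def)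
      from H10_limit[OF X tests(1) L(1,2) this] show "w \<in> H10 X" "is_weak_grad X w gw" .
    qed
    have 2: "(\<lambda>x. \<psi> x $ i) \<in> H10 X \<and> is_weak_grad X (\<lambda>x. \<psi> x $ i) (\<lambda>x. g\<psi> x $ i)" for i
    proof -
      have "(\<lambda>n. L2_norm_on X (\<lambda>x. snd (v n) x $ i - \<psi> x $ i)) \<longlonglongrightarrow> 0" "(\<lambda>n. L2_norm_on X (\<lambda>x. grad (\<lambda>x. snd (v n) x $ i) x - g\<psi> x $ i)) \<longlonglongrightarrow> 0"
        using tl[OF bounded_linear_compose[OF bounded_linear_vec_nth bl(3)], of i] tl[OF bounded_linear_compose[OF bounded_linear_vec_nth bl(4)], of i]
        by (simp_all add: U_def jet_def gradv_def \<psi>_def g\<psi>_def)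
      from H10_limit[OF X tests(2) L2_nth[OF L(3)] L2_nth[OF L(4)] this] show ?thesis by blast
    qed
    \<comment> \<open>Both sides are L2 limits of the same sequence, the right one because
      \<open>Lam k \<nu>\<close> is bounded.\<close>
    have fu: "AE x in lebesgue_on X. f x = Lam k \<nu> (u x)"
      by (rule L2_limit_unique[OF DL[OF v] f Lam_L2[OF u(1)] lim]) (use tl[OF bounded_linear_Lam] in \<open>simp add: D_def\<close>)
    have 3: "ip X (\<lambda>x. Lam k \<nu> (u x)) (\<lambda>x. Lam k \<nu> (jet \<delta> \<eta> x)) = ip X b (jet \<delta> \<eta>)"
      if "\<delta> \<in> test_functions X" "\<eta> \<in> test_vec X" for \<delta> \<eta>
    proof -
      have s: "(\<delta>, \<eta>) \<in> S" using that by (simp add: S_def)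
      have "ip X b (jet \<delta> \<eta>) = ip X f (D (\<delta>, \<eta>))" using rep[OF s] by (simp add: U_def)
      also have "\<dots> = ip X (\<lambda>x. Lam k \<nu> (u x)) (D (\<delta>, \<eta>))"
        using fu f Lam_L2[OF u(1)] DL[OF s] by (intro ip_cong_AE L2_measurable) auto
      finally show ?thesis by (simp add: D_def[abs_def] U_def)
    qed
    have 4: "L2_norm_on X u \<le> (C * C) * L2_norm_on X b"
    proof (rule order_trans)
      show "L2_norm_on X u \<le> C * L2_norm_on X f"
      proof (rule LIMSEQ_le)
        show "(\<lambda>n. L2_norm_on X (U (v n))) \<longlonglongrightarrow> L2_norm_on X u" by (rule L2_norm_tendsto[OF UL[OF v] u])
        show "(\<lambda>n. C * L2_norm_on X (D (v n))) \<longlonglongrightarrow> C * L2_norm_on X f"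
          by (intro tendsto_mult tendsto_const L2_norm_tendsto[OF DL[OF v] f lim])
        show "\<exists>N. \<forall>n\<ge>N. L2_norm_on X (U (v n)) \<le> C * L2_norm_on X (D (v n))" using UD[OF v] by blast
      qed
      show "C * L2_norm_on X f \<le> (C * C) * L2_norm_on X b"
        using mult_left_mono[OF fn C(1)] by (simp only: ac_simps)
    qed
    show ?thesis
      using 1 2 L 3 4 unfolding uc[abs_def] by blast
  qed
  moreover have "C * C \<ge> 0" using C(1) by simp
  ultimately show ?thesis using that by blast
qed

section \<open>The plate problem on the whole domain\<close>

definition is_weak_grad_vec :: "point set \<Rightarrow> (point \<Rightarrow> point) \<Rightarrow> (point \<Rightarrow> tensor) \<Rightarrow> bool" where
  "is_weak_grad_vec X \<psi> G \<longleftrightarrow> (\<forall>i. is_weak_grad X (\<lambda>x. \<psi> x $ i) (\<lambda>x. G x $ i))"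

definition is_weak_div_ten :: "point set \<Rightarrow> (point \<Rightarrow> tensor) \<Rightarrow> (point \<Rightarrow> point) \<Rightarrow> bool" where
  "is_weak_div_ten X M d \<longleftrightarrow> (\<forall>i. is_weak_div X (\<lambda>x. M x $ i) (\<lambda>x. d x $ i))"

lemma is_weak_grad_vec_L2: "is_weak_grad_vec X \<psi> G \<Longrightarrow> G \<in> L2 X"
  by (rule L2_vecI) (use is_weak_grad_L2 in \<open>auto simp: is_weak_grad_vec_def\<close>)

lemma is_weak_div_ten_L2: "is_weak_div_ten X M d \<Longrightarrow> d \<in> L2 X"
  by (rule L2_vecI) (use is_weak_div_L2 in \<open>auto simp: is_weak_div_ten_def\<close>)

lemma Cinv_Cten:
  assumes "-1 < \<nu>" "\<nu> < 1" shows "Cinv \<nu> (Cten \<nu> \<sigma>) = \<sigma>"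
proof -
  define a where "a = \<nu> / (1 - \<nu>)"
  define b where "b = \<nu> / (1 + \<nu>)"
  have ab: "b * (1 + 2 * a) = a"
  proof -
    have "1 - \<nu> \<noteq> 0" "1 + \<nu> \<noteq> 0" using assms by auto
    then show ?thesis unfolding a_def b_def by (simp add: divide_simps)
  qed
  have tr: "trace (Cten \<nu> \<sigma>) = (1 + 2 * a) * trace \<sigma> / 6"
    unfolding Cten_def a_def[symmetric] by (simp add: trace_2 mat_1_nth field_simps)
  have "b * ((1 + 2 * a) * trace \<sigma> / 6) = a * trace \<sigma> / 6"
    using ab by (simp flip: mult.assoc)
  then have "Cinv \<nu> (Cten \<nu> \<sigma>) = 6 *\<^sub>R (Cten \<nu> \<sigma> - (a * trace \<sigma> / 6) *\<^sub>R mat 1)"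
    by (simp add: Cinv_def b_def[symmetric] tr)
  also have "\<dots> = \<sigma>" unfolding Cten_def a_def[symmetric] by (simp add: algebra_simps)
  finally show ?thesis .
qed

lemma Cinv_sym: "Cinv \<nu> \<sigma> \<bullet> \<rho> = \<sigma> \<bullet> Cinv \<nu> \<rho>"
  by (simp add: Cinv_def inner_tensor tensor_nth algebra_simps)

lemma Cten_symm_inner: "Cten \<nu> (symm \<sigma>) \<bullet> symm \<rho> = Cten \<nu> (symm \<sigma>) \<bullet> \<rho>"
  by (simp add: Cten_def inner_tensor tensor_nth field_simps)

text \<open>In the plane the skew tensors are the multiples of \<open>Jmat\<close>, and the squared
  norm of \<open>Jmat\<close> is 2.\<close>

lemma symm_decomposition: "symm G + ((G \<bullet> Jmat) / 2) *\<^sub>R Jmat = G"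
  by (simp add: tensor_eq_iff inner_tensor tensor_nth field_simps)

lemma Cinv_Jmat: "Cinv \<nu> (c *\<^sub>R Jmat) = (6 * c) *\<^sub>R Jmat"
  by (simp add: tensor_eq_iff Cinv_def tensor_nth)

lemma Cten_symm_Jmat: "Cten \<nu> (symm G) \<bullet> Jmat = 0"
  by (simp add: Cten_def inner_tensor tensor_nth field_simps)

lemma Jmat_Jmat: "Jmat \<bullet> Jmat = 2"
  by (simp add: inner_tensor Jmat_nth)

text \<open>\<open>Cinv\<close> undoes \<open>Cten\<close> on the symmetric part and sends
  \<open>(s / 2) *\<^sub>R Jmat\<close> to \<open>(3 * s) *\<^sub>R Jmat\<close>; the multiplier in
  front of the last \<open>Jmat\<close> supplies the difference to the skew part of
  \<open>G\<close>. The value \<open>s\<close> is the prescribed pairing of the moments with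
  \<open>Jmat\<close>.\<close>

lemma constitutive_law:
  assumes "-1 < \<nu>" "\<nu> < 1"
  shows "Cinv \<nu> (Cten \<nu> (symm G) + (s / 2) *\<^sub>R Jmat) + ((G \<bullet> Jmat - 6 * s) / 2) *\<^sub>R Jmat = G"
proof -
  have "Cinv \<nu> (Cten \<nu> (symm G) + (s / 2) *\<^sub>R Jmat) = symm G + (3 * s) *\<^sub>R Jmat"
    by (simp add: linear_add[OF linear_tensor_maps(4)] Cinv_Cten[OF assms] Cinv_Jmat)
  then have "Cinv \<nu> (Cten \<nu> (symm G) + (s / 2) *\<^sub>R Jmat) + ((G \<bullet> Jmat - 6 * s) / 2) *\<^sub>R Jmat
      = symm G + ((G \<bullet> Jmat) / 2) *\<^sub>R Jmat"
    by (simp add: tensor_eq_iff Jmat_nth field_simps)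
  then show ?thesis by (simp only: symm_decomposition)
qed

text \<open>The numbering \<open>f1, f3, f5, ...\<close> is that of the residual components. The
  second and the fourth are absent since they are matched by shifting the fields \<open>w\<close>
  and \<psi>.\<close>

type_synonym plate_data = "point \<times> tensor \<times> real \<times> point \<times> point \<times> tensor \<times> real"

text \<open>The right-hand side of the energy problem that remains when \<open>V\<close> and
  \<open>M\<close> are eliminated by the constitutive equations; \<open>K\<close> stands for
  \<kappa> / t^2.\<close>

definition plate_load :: "real \<Rightarrow> real \<Rightarrow> plate_data \<Rightarrow> jet" where
  "plate_load K \<nu> = (\<lambda>(f1, f3, f5, f6, f7, f8, f9).
     (f5, f6 - K *\<^sub>R f1, f7 + K *\<^sub>R f1, f8 - Cten \<nu> (symm f3) - (f9 / 2) *\<^sub>R Jmat))"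

text \<open>Recovers shear force, moments and rotation from the jet of the solution and the data.
  Being a linear map on tuples, it needs no separate L2 estimate for each of them.\<close>

definition plate_stress :: "real \<Rightarrow> real \<Rightarrow> jet \<times> plate_data \<Rightarrow> point \<times> tensor \<times> real" where
  "plate_stress K \<nu> = (\<lambda>((w, g, p, G), (f1, f3, f5, f6, f7, f8, f9)).
     (K *\<^sub>R (g - p + f1), Cten \<nu> (symm (G + f3)) + (f9 / 2) *\<^sub>R Jmat, ((G + f3) \<bullet> Jmat - 6 * f9) / 2))"

lemmas linear_tensor_simps = linear_add[OF linear_tensor_maps(1)] linear_add[OF linear_tensor_maps(3)]
  linear_scale[OF linear_tensor_maps(1)] linear_scale[OF linear_tensor_maps(3)]

lemma linear_plate_load: "linear (plate_load K \<nu>)"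
  by (rule linearI) (auto simp: plate_load_def linear_tensor_simps algebra_simps add_divide_distrib scaleR_add_left)

lemma linear_plate_stress: "linear (plate_stress K \<nu>)"
proof (rule linearI)
  fix x y :: "jet \<times> plate_data" and c :: real
  show "plate_stress K \<nu> (x + y) = plate_stress K \<nu> x + plate_stress K \<nu> y"
    by (cases x; cases y) (auto simp: plate_stress_def linear_tensor_simps algebra_simps inner_add_left add_divide_distrib diff_divide_distrib scaleR_add_left)
  show "plate_stress K \<nu> (c *\<^sub>R x) = c *\<^sub>R plate_stress K \<nu> x"
    by (cases x) (auto simp: plate_stress_def linear_tensor_simps algebra_simps inner_add_left diff_divide_distrib add_divide_distrib)
qed

lemma L2_norm_linear_bound:
  fixes h :: "'a::euclidean_space \<Rightarrow> 'b::euclidean_space"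
  assumes "linear h"
  obtains c where "c \<ge> 0" "\<And>f X :: 'd::euclidean_space set. f \<in> L2 X \<Longrightarrow> (\<lambda>x. h (f x)) \<in> L2 X \<and> L2_norm_on X (\<lambda>x. h (f x)) \<le> c * L2_norm_on X f"
proof -
  obtain c where c: "c > 0" "\<And>x. norm (h x) \<le> c * norm x" using linear_bounded_pos[OF assms] by blast
  have b: "bounded_linear h" using assms linear_conv_bounded_linear by blast
  show ?thesis
    using c L2_bounded_linear[OF b] L2_norm_bounded_linear_le[OF b _ _ c(2)] by (intro that[of c]) auto
qed

text \<open>The algebraic equations hold pointwise by the definition of \<open>V\<close>,
  \<open>M\<close> and \<open>r\<close>; the two equilibrium equations are the variational equation
  tested with a deflection alone and with a rotation alone.\<close>

theorem plate_system:
  assumes X: "convex_domain X" and \<kappa>: "\<kappa> > 0" and t: "t > 0" and \<nu>: "-1 < \<nu>" "\<nu> < 1"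
  obtains C where "C \<ge> 0" "\<And>f1 f3 f5 f6 f7 f8 f9. (\<lambda>x. (f1 x, f3 x, f5 x, f6 x, f7 x, f8 x, f9 x) :: plate_data) \<in> L2 X \<Longrightarrow>
    \<exists>w gw \<psi> g\<psi> V M r.
      w \<in> H10 X \<and> is_weak_grad X w gw \<and> \<psi> \<in> H10_vec X \<and> is_weak_grad_vec X \<psi> g\<psi> \<and>
      (\<lambda>x. ((w x, gw x, \<psi> x, g\<psi> x), (V x, M x, r x))) \<in> L2 X \<and>
      (\<forall>x. (inverse \<kappa> * t\<^sup>2) *\<^sub>R V x + \<psi> x - gw x = f1 x) \<and>
      (\<forall>x. Cinv \<nu> (M x) + r x *\<^sub>R Jmat - g\<psi> x = f3 x) \<and>
      is_weak_div X (\<lambda>x. V x - f6 x) (\<lambda>x. - f5 x) \<and>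
      is_weak_div_ten X (\<lambda>x. M x - f8 x) (\<lambda>x. - V x - f7 x) \<and>
      (\<forall>x. M x \<bullet> Jmat = f9 x) \<and>
      L2_norm_on X (\<lambda>x. ((w x, gw x, \<psi> x, g\<psi> x), (V x, M x, r x)))
        \<le> C * L2_norm_on X (\<lambda>x. (f1 x, f3 x, f5 x, f6 x, f7 x, f8 x, f9 x))"
proof -
  define k where "k = sqrt \<kappa> / t"
  define K where "K = \<kappa> / t\<^sup>2"
  have k: "k > 0" "k * k = K" using \<kappa> t by (auto simp: k_def K_def power2_eq_square)
  have Kinv: "(inverse \<kappa> * t\<^sup>2) * K = 1" using \<kappa> t by (simp add: K_def field_simps)
  obtain C where C: "C \<ge> 0" "\<And>b :: point \<Rightarrow> jet. b \<in> L2 X \<Longrightarrow> \<exists>w gw \<psi> g\<psi>.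
      w \<in> H10 X \<and> is_weak_grad X w gw \<and> (\<forall>i. (\<lambda>x. \<psi> x $ i) \<in> H10 X \<and> is_weak_grad X (\<lambda>x. \<psi> x $ i) (\<lambda>x. g\<psi> x $ i)) \<and>
      \<psi> \<in> L2 X \<and> g\<psi> \<in> L2 X \<and>
      (\<forall>\<delta>\<in>test_functions X. \<forall>\<eta>\<in>test_vec X.
        ip X (\<lambda>x. Lam k \<nu> (w x, gw x, \<psi> x, g\<psi> x)) (\<lambda>x. Lam k \<nu> (jet \<delta> \<eta> x)) = ip X b (jet \<delta> \<eta>)) \<and>
      L2_norm_on X (\<lambda>x. (w x, gw x, \<psi> x, g\<psi> x)) \<le> C * L2_norm_on X b"
    using energy_problem[OF X k(1) \<nu>] by blast
  obtain cb where cb: "cb \<ge> 0" "\<And>f X :: point set. f \<in> L2 X \<Longrightarrow> (\<lambda>x. plate_load K \<nu> (f x)) \<in> L2 X \<and> L2_norm_on X (\<lambda>x. plate_load K \<nu> (f x)) \<le> cb * L2_norm_on X f"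
    using L2_norm_linear_bound[OF linear_plate_load] by blast
  obtain cs where cs: "cs \<ge> 0" "\<And>f X :: point set. f \<in> L2 X \<Longrightarrow> (\<lambda>x. plate_stress K \<nu> (f x)) \<in> L2 X \<and> L2_norm_on X (\<lambda>x. plate_stress K \<nu> (f x)) \<le> cs * L2_norm_on X f"
    using L2_norm_linear_bound[OF linear_plate_stress] by blast
  define C' where "C' = C * cb + cs * (C * cb + 1)"
  have "\<exists>w gw \<psi> g\<psi> V M r.
      w \<in> H10 X \<and> is_weak_grad X w gw \<and> \<psi> \<in> H10_vec X \<and> is_weak_grad_vec X \<psi> g\<psi> \<and>
      (\<lambda>x. ((w x, gw x, \<psi> x, g\<psi> x), (V x, M x, r x))) \<in> L2 X \<and>
      (\<forall>x. (inverse \<kappa> * t\<^sup>2) *\<^sub>R V x + \<psi> x - gw x = f1 x) \<and>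
      (\<forall>x. Cinv \<nu> (M x) + r x *\<^sub>R Jmat - g\<psi> x = f3 x) \<and>
      is_weak_div X (\<lambda>x. V x - f6 x) (\<lambda>x. - f5 x) \<and>
      is_weak_div_ten X (\<lambda>x. M x - f8 x) (\<lambda>x. - V x - f7 x) \<and>
      (\<forall>x. M x \<bullet> Jmat = f9 x) \<and>
      L2_norm_on X (\<lambda>x. ((w x, gw x, \<psi> x, g\<psi> x), (V x, M x, r x)))
        \<le> C' * L2_norm_on X (\<lambda>x. (f1 x, f3 x, f5 x, f6 x, f7 x, f8 x, f9 x))"
    if FL: "(\<lambda>x. (f1 x, f3 x, f5 x, f6 x, f7 x, f8 x, f9 x) :: plate_data) \<in> L2 X" for f1 f3 f5 f6 f7 f8 f9
  proof -
    define F where "F x = (f1 x, f3 x, f5 x, f6 x, f7 x, f8 x, f9 x)" for x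
    have FL': "F \<in> L2 X" using FL by (simp add: F_def[abs_def])
    note S1 = L2_snd[OF FL] note S2 = L2_snd[OF S1] note S3 = L2_snd[OF S2] note S4 = L2_snd[OF S3] note S5 = L2_snd[OF S4] note S6 = L2_snd[OF S5]
    have fL: "f5 \<in> L2 X" "f6 \<in> L2 X" "f7 \<in> L2 X" "f8 \<in> L2 X"
      using L2_fst[OF S2] L2_fst[OF S3] L2_fst[OF S4] L2_fst[OF S5] by simp_all
    obtain w gw \<psi> g\<psi> where s: "w \<in> H10 X" "is_weak_grad X w gw" "\<And>i. (\<lambda>x. \<psi> x $ i) \<in> H10 X" "\<And>i. is_weak_grad X (\<lambda>x. \<psi> x $ i) (\<lambda>x. g\<psi> x $ i)"
      "\<psi> \<in> L2 X" "g\<psi> \<in> L2 X"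
      and eq: "\<And>\<delta> \<eta>. \<delta> \<in> test_functions X \<Longrightarrow> \<eta> \<in> test_vec X \<Longrightarrow>
        ip X (\<lambda>x. Lam k \<nu> (w x, gw x, \<psi> x, g\<psi> x)) (\<lambda>x. Lam k \<nu> (jet \<delta> \<eta> x)) = ip X (\<lambda>x. plate_load K \<nu> (F x)) (jet \<delta> \<eta>)"
      and nb: "L2_norm_on X (\<lambda>x. (w x, gw x, \<psi> x, g\<psi> x)) \<le> C * L2_norm_on X (\<lambda>x. plate_load K \<nu> (F x))"
      using C(2)[OF conjunct1[OF cb(2)[OF FL']]] by blast
    define U where "U x = (w x, gw x, \<psi> x, g\<psi> x)" for x
    have UL: "U \<in> L2 X"
      unfolding U_def[abs_def] using s H1_L2[OF H10_H1[OF s(1)]] is_weak_grad_L2[OF s(2)] by (intro L2_Pair)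
    define V where "V x = K *\<^sub>R (gw x - \<psi> x + f1 x)" for x
    define M where "M x = Cten \<nu> (symm (g\<psi> x + f3 x)) + (f9 x / 2) *\<^sub>R Jmat" for x
    define r where "r x = ((g\<psi> x + f3 x) \<bullet> Jmat - 6 * f9 x) / 2" for x
    have st: "plate_stress K \<nu> (U x, F x) = (V x, M x, r x)" for x
      by (simp add: plate_stress_def U_def F_def V_def M_def r_def)
    have UF: "(\<lambda>x. (U x, F x)) \<in> L2 X" using UL FL' by (rule L2_Pair)
    have sL: "(\<lambda>x. (V x, M x, r x)) \<in> L2 X" and sn: "L2_norm_on X (\<lambda>x. (V x, M x, r x)) \<le> cs * L2_norm_on X (\<lambda>x. (U x, F x))"
      using cs(2)[OF UF] by (simp_all add: st)
    have vL: "V \<in> L2 X" and mL: "M \<in> L2 X" using L2_fst[OF sL] L2_fst[OF L2_snd[OF sL]] by simp_all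
    have jz: "(\<lambda>x. 0) \<in> test_functions X" "(\<lambda>x. 0) \<in> test_vec X" by (auto simp: test_vec_def test_functions_def)
    have g0: "gradv (\<lambda>x. 0) x = 0" for x by (simp add: gradv_def vec_eq_iff)
    have bL: "(\<lambda>x. plate_load K \<nu> (F x)) \<in> L2 X" using cb(2)[OF FL'] by blast
    have Leq: "(LINT x|lebesgue_on X. Lam k \<nu> (U x) \<bullet> Lam k \<nu> (jet \<delta> \<eta> x) - plate_load K \<nu> (F x) \<bullet> jet \<delta> \<eta> x) = 0"
      if "\<delta> \<in> test_functions X" "\<eta> \<in> test_vec X" for \<delta> \<eta>
      using eq[OF that] ip_integrable[OF Lam_L2[OF UL] Lam_L2[OF jet_L2[OF X that]]] ip_integrable[OF bL jet_L2[OF X that]]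
      by (simp add: ip_def U_def)
    have VmL: "(\<lambda>x. V x - f6 x) \<in> L2 X" and MmL: "(\<lambda>x. M x - f8 x) \<in> L2 X" and Vp: "(\<lambda>x. - V x - f7 x) \<in> L2 X"
      using vL mL fL by (auto intro!: L2_diff L2_minus)
    have 1: "is_weak_div X (\<lambda>x. V x - f6 x) (\<lambda>x. - f5 x)"
      unfolding is_weak_div_iff
    proof (intro conjI ballI L2_minus fL)
      fix \<delta> assume \<delta>: "\<delta> \<in> test_functions X"
      \<comment> \<open>The zero rotation leaves the shear term, in which \<open>K\<close> times the
        difference of gradient and rotation combines with the load to \<open>V\<close>.\<close>
      have p: "Lam k \<nu> (U x) \<bullet> Lam k \<nu> (jet \<delta> (\<lambda>x. 0) x) - plate_load K \<nu> (F x) \<bullet> jet \<delta> (\<lambda>x. 0) x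
          = (V x - f6 x) \<bullet> grad \<delta> x - f5 x \<bullet> \<delta> x" for x
        using linear_0[OF linear_tensor_maps(1)] linear_0[OF linear_tensor_maps(2)]
        by (simp add: Lam_def U_def jet_def g0 plate_load_def F_def V_def k(2)[symmetric] algebra_simps inner_prod_def inner_diff_left inner_add_left)
      have "(LINT x|lebesgue_on X. (V x - f6 x) \<bullet> grad \<delta> x - f5 x \<bullet> \<delta> x) = 0"
        using Leq[OF \<delta> jz(2)] by (simp only: p)
      then have "ip X (\<lambda>x. V x - f6 x) (grad \<delta>) = ip X f5 \<delta>"
        using ip_integrable[OF VmL test_L2(2)[OF X \<delta>]] ip_integrable[OF fL(1) test_L2(1)[OF X \<delta>]] by (simp add: ip_def)
      then show "ip X (\<lambda>x. V x - f6 x) (grad \<delta>) = - ip X \<delta> (\<lambda>x. - f5 x)" by (simp add: ip_minus_right ip_commute)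
    qed
    have 2: "is_weak_div_ten X (\<lambda>x. M x - f8 x) (\<lambda>x. - V x - f7 x)"
      unfolding is_weak_div_ten_def is_weak_div_iff
    proof (intro allI conjI ballI)
      fix i show "(\<lambda>x. (- V x - f7 x) $ i) \<in> L2 X" by (rule L2_nth[OF Vp])
      fix \<phi> assume \<phi>: "\<phi> \<in> test_functions X"
      \<comment> \<open>A test rotation with a single nonzero component isolates the
        \<open>i\<close>-th row of the moments.\<close>
      let ?\<eta> = "\<lambda>x. axis i (\<phi> x) :: point"
      have nth: "?\<eta> x $ j = (if j = i then \<phi> x else 0)" for x j by (simp add: axis_def)
      have "(\<lambda>x. ?\<eta> x $ j) \<in> test_functions X" for j
        using \<phi> jz(1) by (cases "j = i") (simp_all add: nth)
      then have \<eta>: "?\<eta> \<in> test_vec X" by (simp add: test_vec_def)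
      have gv: "gradv ?\<eta> x = axis i (grad \<phi> x)" for x
        by (simp add: gradv_def vec_eq_iff nth axis_def)
      have p: "Lam k \<nu> (U x) \<bullet> Lam k \<nu> (jet (\<lambda>x. 0) ?\<eta> x) - plate_load K \<nu> (F x) \<bullet> jet (\<lambda>x. 0) ?\<eta> x
          = (M x - f8 x) $ i \<bullet> grad \<phi> x + ((- V x - f7 x) $ i) \<bullet> \<phi> x" for x
      proof -
        have "Lam k \<nu> (U x) \<bullet> Lam k \<nu> (jet (\<lambda>x. 0) ?\<eta> x) = - K * ((gw x - \<psi> x) \<bullet> ?\<eta> x) + Cten \<nu> (symm (g\<psi> x)) \<bullet> gradv ?\<eta> x"
          by (simp add: Lam_def U_def jet_def inner_prod_def Croot_inner[OF \<nu>] Cten_symm_inner k(2)[symmetric])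
        moreover have "plate_load K \<nu> (F x) \<bullet> jet (\<lambda>x. 0) ?\<eta> x = (f7 x + K *\<^sub>R f1 x) \<bullet> ?\<eta> x + (f8 x - Cten \<nu> (symm (f3 x)) - (f9 x / 2) *\<^sub>R Jmat) \<bullet> gradv ?\<eta> x"
          by (simp add: plate_load_def F_def jet_def inner_prod_def)
        moreover have "M x = Cten \<nu> (symm (g\<psi> x)) + Cten \<nu> (symm (f3 x)) + (f9 x / 2) *\<^sub>R Jmat"
          by (simp add: M_def linear_tensor_simps)
        ultimately have "Lam k \<nu> (U x) \<bullet> Lam k \<nu> (jet (\<lambda>x. 0) ?\<eta> x) - plate_load K \<nu> (F x) \<bullet> jet (\<lambda>x. 0) ?\<eta> x
          = (M x - f8 x) \<bullet> gradv ?\<eta> x + (- V x - f7 x) \<bullet> ?\<eta> x"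
          by (simp add: V_def inner_add_left inner_diff_left algebra_simps)
        then show ?thesis by (simp only: gv inner_axis)
      qed
      have "(LINT x|lebesgue_on X. (M x - f8 x) $ i \<bullet> grad \<phi> x + ((- V x - f7 x) $ i) \<bullet> \<phi> x) = 0"
        using Leq[OF jz(1) \<eta>] by (simp only: p)
      then have "ip X (\<lambda>x. (M x - f8 x) $ i) (grad \<phi>) + ip X (\<lambda>x. (- V x - f7 x) $ i) \<phi> = 0"
        using ip_integrable[OF L2_nth[OF MmL] test_L2(2)[OF X \<phi>], of i] ip_integrable[OF L2_nth[OF Vp] test_L2(1)[OF X \<phi>], of i]
        unfolding ip_def by (subst (asm) Bochner_Integration.integral_add)
      then show "ip X (\<lambda>x. (M x - f8 x) $ i) (grad \<phi>) = - ip X \<phi> (\<lambda>x. (- V x - f7 x) $ i)"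
        by (simp only: ip_commute[of X \<phi>])
    qed
    have 3: "(inverse \<kappa> * t\<^sup>2) *\<^sub>R V x + \<psi> x - gw x = f1 x" for x
      by (simp only: V_def scaleR_scaleR Kinv) simp
    have 4: "Cinv \<nu> (M x) + r x *\<^sub>R Jmat - g\<psi> x = f3 x" for x
      unfolding M_def r_def constitutive_law[OF \<nu>] by simp
    have 5: "M x \<bullet> Jmat = f9 x" for x
      by (simp add: M_def inner_add_left Cten_symm_Jmat Jmat_Jmat)
    have 6: "L2_norm_on X (\<lambda>x. (U x, (V x, M x, r x))) \<le> C' * L2_norm_on X F"
    proof -
      have u: "L2_norm_on X U \<le> C * cb * L2_norm_on X F"
        using nb mult_left_mono[OF conjunct2[OF cb(2)[OF FL']] C(1)] by (simp add: U_def[abs_def] mult.assoc)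
      have "L2_norm_on X (\<lambda>x. (V x, M x, r x)) \<le> cs * (L2_norm_on X U + L2_norm_on X F)"
        using sn mult_left_mono[OF L2_norm_Pair_le[OF UL FL'] cs(1)] by linarith
      also have "\<dots> \<le> cs * (C * cb * L2_norm_on X F + L2_norm_on X F)"
        using u cs(1) by (intro mult_left_mono) auto
      finally show ?thesis
        using L2_norm_Pair_le[OF UL sL] u by (simp add: C'_def algebra_simps)
    qed
    show ?thesis
      using s(1,2) H10_vec_def[of X] s(3,4) L2_Pair[OF UL sL] 1 2 3 4 5 6
      unfolding is_weak_grad_vec_def U_def[abs_def] F_def[abs_def]
      by (intro exI[of _ w] exI[of _ gw] exI[of _ \<psi>] exI[of _ g\<psi>] exI[of _ V] exI[of _ M] exI[of _ r]) simp
  qed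
  moreover have "C' \<ge> 0" using C(1) cb(1) cs(1) by (simp add: C'_def)
  ultimately show ?thesis using that by blast
qed

section \<open>Integration over the mesh\<close>

lemma polygonal_convex_domain:
  assumes "convex_polygonal_domain \<Omega>" shows "convex_domain \<Omega>"
proof -
  obtain S where S: "finite S" "\<Omega> = interior (convex hull S)" "\<Omega> \<noteq> {}" using assms by (auto simp: convex_polygonal_domain_def)
  have "bounded (convex hull S)" using S(1) by (intro bounded_convex_hull finite_imp_bounded)
  then have "bounded \<Omega>" unfolding S(2) using bounded_subset interior_subset by blast
  then show ?thesis using S by (simp add: convex_domain_def convex_interior)
qed

locale mesh =
  fixes \<Omega> :: "point set" and T :: "quad set"
  assumes dom: "convex_domain \<Omega>" and quad_mesh: "quad_mesh \<Omega> T"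
begin

lemma finite_T: "finite T" and convex_T: "K \<in> T \<Longrightarrow> convex_quad K"
  and disjoint_T: "K \<in> T \<Longrightarrow> K' \<in> T \<Longrightarrow> K \<noteq> K' \<Longrightarrow> cell K \<inter> cell K' = {}"
  and closure_T: "closure \<Omega> = (\<Union>K\<in>T. closure (cell K))"
  using quad_mesh by (auto simp: quad_mesh_def)

lemma \<Omega>_lebesgue: "\<Omega> \<in> sets lebesgue" using dom by (rule convex_domain_lebesgue)

lemma cell_domain: "K \<in> T \<Longrightarrow> convex_domain (cell K)"
  by (rule convex_domain_cell[OF convex_T])

text \<open>The mesh condition places the cell in the closure of \<Omega> only; being open, it lies
  in the interior of this closure, which is \<Omega> by convexity.\<close>

lemma cell_subset: assumes "K \<in> T" shows "cell K \<subseteq> \<Omega>"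
proof -
  have "cell K \<subseteq> closure \<Omega>" using closure_T closure_subset[of "cell K"] assms by blast
  then have "cell K \<subseteq> interior (closure \<Omega>)" using open_cell by (rule interior_maximal)
  then show ?thesis using convex_interior_closure[of \<Omega>] dom by (simp add: convex_domain_def interior_open)
qed

text \<open>What the open cells miss lies on their frontiers, and frontiers of convex sets are null
  sets.\<close>

lemma negligible_skeleton: "negligible (\<Omega> - (\<Union>K\<in>T. cell K))"
proof (rule negligible_subset)
  show "negligible (\<Union>K\<in>T. frontier (cell K))"
    using finite_T negligible_convex_frontier[OF convex_cell] by (intro negligible_Union) auto
  show "\<Omega> - (\<Union>K\<in>T. cell K) \<subseteq> (\<Union>K\<in>T. frontier (cell K))"
  proof
    fix x assume x: "x \<in> \<Omega> - (\<Union>K\<in>T. cell K)"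
    then have "x \<in> closure \<Omega>" using closure_subset[of \<Omega>] by blast
    then obtain K where "K \<in> T" "x \<in> closure (cell K)" using closure_T by blast
    then show "x \<in> (\<Union>K\<in>T. frontier (cell K))" using x open_cell by (auto simp: frontier_def interior_open)
  qed
qed

lemma AE_mesh:
  assumes "\<And>K. K \<in> T \<Longrightarrow> AE x in lebesgue_on (cell K). P x"
  shows "AE x in lebesgue_on \<Omega>. P x"
proof -
  have "AE x in lebesgue. \<forall>K\<in>T. x \<in> cell K \<longrightarrow> P x"
  proof (rule AE_ball_countable'[OF _ countable_finite[OF finite_T]])
    fix K assume "K \<in> T"
    from assms[OF this] show "AE x in lebesgue. x \<in> cell K \<longrightarrow> P x"
      by (subst (asm) AE_restrict_space_iff) auto
  qed
  moreover have "AE x in lebesgue. x \<notin> \<Omega> - (\<Union>K\<in>T. cell K)"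
    using negligible_skeleton unfolding negligible_iff_null_sets by (rule AE_not_in)
  ultimately have "AE x in lebesgue. x \<in> \<Omega> \<longrightarrow> P x" by eventually_elim auto
  then show ?thesis by (rule iffD2[OF AE_restrict_space_iff, rotated]) (simp add: \<Omega>_lebesgue)
qed

lemma integral_mesh:
  fixes f :: "point \<Rightarrow> real"
  assumes f: "integrable (lebesgue_on \<Omega>) f"
  shows "(LINT x|lebesgue_on \<Omega>. f x) = (\<Sum>K\<in>T. LINT x|lebesgue_on (cell K). f x)"
proof -
  have si: "set_integrable lebesgue \<Omega> f" using f \<Omega>_lebesgue by (simp add: lebesgue_on_integrable_iff_set_integrable)
  have U: "(\<Union>K\<in>T. cell K) \<in> sets lebesgue" using finite_T by (intro sets.finite_UN) auto
  have sub: "(\<Union>K\<in>T. cell K) \<subseteq> \<Omega>" using cell_subset by blast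
  have fU: "integrable (lebesgue_on (\<Union>K\<in>T. cell K)) f"
    using set_integrable_subset[OF si U sub] U by (simp add: lebesgue_on_integrable_iff_set_integrable)
  have "(LINT x|lebesgue_on \<Omega>. f x) = (LINT x|lebesgue_on (\<Union>K\<in>T. cell K). f x)"
    by (rule lebesgue_on_integral_spike_set[OF \<Omega>_lebesgue U f fU negligible_skeleton])
      (use sub in \<open>simp add: Diff_eq_empty_iff[THEN iffD2]\<close>)
  also have "\<dots> = (LINT x:(\<Union>K\<in>T. cell K)|lebesgue. f x)" using U by (rule lebesgue_on_integral_eq_set_integral)
  also have "\<dots> = (\<Sum>K\<in>T. LINT x:cell K|lebesgue. f x)"
  proof (rule set_integral_finite_Union[OF finite_T])
    show "disjoint_family_on cell T" using disjoint_T by (auto simp: disjoint_family_on_def)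
    show "set_integrable lebesgue (cell K) f" if "K \<in> T" for K
      by (rule set_integrable_subset[OF si cell_lebesgue cell_subset[OF that]])
  qed simp
  finally show ?thesis by (simp add: lebesgue_on_integral_eq_set_integral)
qed

lemma L2_cell: "f \<in> L2 \<Omega> \<Longrightarrow> K \<in> T \<Longrightarrow> f \<in> L2 (cell K)"
  by (rule L2_restrict[OF _ cell_subset cell_lebesgue \<Omega>_lebesgue])

lemma ip_mesh: "f \<in> L2 \<Omega> \<Longrightarrow> g \<in> L2 \<Omega> \<Longrightarrow> ip \<Omega> f g = (\<Sum>K\<in>T. ip (cell K) f g)"
  unfolding ip_def by (rule integral_mesh[OF ip_integrable])

lemma weak_grad_cell: "is_weak_grad \<Omega> f g \<Longrightarrow> K \<in> T \<Longrightarrow> is_weak_grad (cell K) f g"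
  by (rule is_weak_grad_subset[OF _ cell_subset cell_lebesgue \<Omega>_lebesgue])

lemma weak_div_cell: "is_weak_div \<Omega> f g \<Longrightarrow> K \<in> T \<Longrightarrow> is_weak_div (cell K) f g"
  by (rule is_weak_div_subset[OF _ cell_subset cell_lebesgue \<Omega>_lebesgue])

text \<open>The cells are disjoint, so at most one summand is nonzero; on the skeleton, a null set,
  the value is zero.\<close>

definition glue :: "(quad \<Rightarrow> point \<Rightarrow> 'a::euclidean_space) \<Rightarrow> point \<Rightarrow> 'a" where
  "glue f x = (\<Sum>K\<in>T. indicator (cell K) x *\<^sub>R f K x)"

lemma glue_cell: assumes "K \<in> T" "x \<in> cell K" shows "glue f x = f K x"
proof -
  have "glue f x = (\<Sum>K'\<in>T. if K' = K then f K x else 0)"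
    unfolding glue_def
  proof (rule sum.cong)
    fix K' assume "K' \<in> T"
    then show "indicator (cell K') x *\<^sub>R f K' x = (if K' = K then f K x else 0)"
      using disjoint_T[OF assms(1), of K'] assms(2) by (cases "K' = K") (auto simp: indicator_def)
  qed simp
  then show ?thesis using assms(1) finite_T by simp
qed

lemma L2_extend:
  fixes f :: "point \<Rightarrow> 'a::euclidean_space"
  assumes K: "K \<in> T" and f: "f \<in> L2 (cell K)" shows "(\<lambda>x. indicator (cell K) x *\<^sub>R f x) \<in> L2 \<Omega>"
proof -
  let ?g = "\<lambda>x. indicator (cell K) x *\<^sub>R f x"
  have g: "?g = (\<lambda>x. if x \<in> cell K then f x else 0)" by (auto simp: indicator_def)
  have "?g \<in> borel_measurable lebesgue"
    unfolding g by (rule borel_measurable_if_I[OF L2_measurable[OF f] cell_lebesgue])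
  then have m: "?g \<in> borel_measurable (lebesgue_on \<Omega>)" by (rule measurable_restrict_space1)
  have "integrable lebesgue (\<lambda>x. indicator (cell K) x *\<^sub>R (norm (f x))\<^sup>2)"
    using L2_integrable_sq[OF f] by (simp add: integrable_restrict_space)
  then have "integrable lebesgue (\<lambda>x. indicator \<Omega> x *\<^sub>R (norm (?g x))\<^sup>2)"
  proof (rule Bochner_Integration.integrable_cong[OF refl, THEN iffD1, rotated])
    fix x show "indicator (cell K) x *\<^sub>R (norm (f x))\<^sup>2 = indicator \<Omega> x *\<^sub>R (norm (?g x))\<^sup>2"
      using cell_subset[OF K] by (auto simp: indicator_def)
  qed
  then have "integrable (lebesgue_on \<Omega>) (\<lambda>x. (norm (?g x))\<^sup>2)"
    using \<Omega>_lebesgue by (simp add: integrable_restrict_space)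
  with m show ?thesis by (simp add: L2_def)
qed

lemma glue_L2: "(\<And>K. K \<in> T \<Longrightarrow> f K \<in> L2 (cell K)) \<Longrightarrow> glue f \<in> L2 \<Omega>"
  unfolding glue_def[abs_def] by (intro L2_sum L2_extend)

end

section \<open>The residual of the ultra-weak form\<close>

lemma Cinv_L2: "M \<in> L2 X \<Longrightarrow> (\<lambda>x. Cinv \<nu> (M x)) \<in> L2 X"
  by (rule L2_bounded_linear[OF linear_conv_bounded_linear[THEN iffD1, OF linear_tensor_maps(4)]])

lemma ip_tuple:
  assumes "a1 \<in> L2 X" "a2 \<in> L2 X" "a3 \<in> L2 X" "a4 \<in> L2 X" "a5 \<in> L2 X" "a6 \<in> L2 X" "a7 \<in> L2 X" "a8 \<in> L2 X" "a9 \<in> L2 X"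
    "b1 \<in> L2 X" "b2 \<in> L2 X" "b3 \<in> L2 X" "b4 \<in> L2 X" "b5 \<in> L2 X" "b6 \<in> L2 X" "b7 \<in> L2 X" "b8 \<in> L2 X" "b9 \<in> L2 X"
  shows "ip X (\<lambda>x. (a1 x, a2 x, a3 x, a4 x, a5 x, a6 x, a7 x, a8 x, a9 x)) (\<lambda>x. (b1 x, b2 x, b3 x, b4 x, b5 x, b6 x, b7 x, b8 x, b9 x))
    = ip X a1 b1 + ip X a2 b2 + ip X a3 b3 + ip X a4 b4 + ip X a5 b5 + ip X a6 b6 + ip X a7 b7 + ip X a8 b8 + ip X a9 b9"
  using assms by (simp add: ip_Pair L2_Pair)

text \<open>The form is regrouped by test components instead of trial components, with the symmetry
  of \<open>Cinv\<close> moving it from \<tau> to \<open>M\<close>. The set \<open>X\<close> is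
  arbitrary, since the identity is used on single elements as well as on all of \<Omega>.\<close>

lemma residual_identity:
  fixes V q gz \<phi> gw lV \<psi> d\<tau> l\<psi> dM :: "point \<Rightarrow> point" and M \<tau> g\<phi> g\<psi> lM :: "point \<Rightarrow> tensor"
    and w r s dq lw z dV :: "point \<Rightarrow> real"
  assumes u: "V \<in> L2 X" "M \<in> L2 X" "w \<in> L2 X" "\<psi> \<in> L2 X" "r \<in> L2 X"
    and l: "lw \<in> L2 X" "gw \<in> L2 X" "l\<psi> \<in> L2 X" "g\<psi> \<in> L2 X" "lV \<in> L2 X" "dV \<in> L2 X" "lM \<in> L2 X" "dM \<in> L2 X"
    and v: "q \<in> L2 X" "dq \<in> L2 X" "\<tau> \<in> L2 X" "d\<tau> \<in> L2 X" "z \<in> L2 X" "gz \<in> L2 X" "\<phi> \<in> L2 X" "g\<phi> \<in> L2 X" "s \<in> L2 X"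
  shows "ip X (\<lambda>x. (c *\<^sub>R V x + \<psi> x - gw x, w x - lw x, Cinv \<nu> (M x) + r x *\<^sub>R Jmat - g\<psi> x, \<psi> x - l\<psi> x, - dV x, V x - lV x,
        - V x - dM x, M x - lM x, M x \<bullet> Jmat)) (\<lambda>x. (q x, dq x, \<tau> x, d\<tau> x, z x, gz x, \<phi> x, g\<phi> x, s x))
    = ip X V (\<lambda>x. c *\<^sub>R q x + gz x - \<phi> x) + ip X M (\<lambda>x. Cinv \<nu> (\<tau> x) + g\<phi> x + s x *\<^sub>R Jmat) + ip X w dq
      + ip X \<psi> (\<lambda>x. q x + d\<tau> x) + ip X (\<lambda>x. r x *\<^sub>R Jmat) \<tau>
      - (ip X gw q + ip X lw dq) - (ip X g\<psi> \<tau> + ip X l\<psi> d\<tau>) - (ip X gz lV + ip X z dV) - (ip X g\<phi> lM + ip X \<phi> dM)"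
proof -
  note CM = Cinv_L2[OF u(2), of \<nu>] and C\<tau> = Cinv_L2[OF v(3), of \<nu>]
  have rJ: "(\<lambda>x. r x *\<^sub>R Jmat) \<in> L2 X" and sJ: "(\<lambda>x. s x *\<^sub>R Jmat) \<in> L2 X" by (rule L2_scaleR_const u v)+
  have MJ: "(\<lambda>x. M x \<bullet> Jmat) \<in> L2 X" by (rule L2_inner_const[OF u(2)])
  have "ip X (\<lambda>x. (c *\<^sub>R V x + \<psi> x - gw x, w x - lw x, Cinv \<nu> (M x) + r x *\<^sub>R Jmat - g\<psi> x, \<psi> x - l\<psi> x, - dV x, V x - lV x,
        - V x - dM x, M x - lM x, M x \<bullet> Jmat)) (\<lambda>x. (q x, dq x, \<tau> x, d\<tau> x, z x, gz x, \<phi> x, g\<phi> x, s x))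
    = ip X (\<lambda>x. c *\<^sub>R V x + \<psi> x - gw x) q + ip X (\<lambda>x. w x - lw x) dq + ip X (\<lambda>x. Cinv \<nu> (M x) + r x *\<^sub>R Jmat - g\<psi> x) \<tau>
      + ip X (\<lambda>x. \<psi> x - l\<psi> x) d\<tau> + ip X (\<lambda>x. - dV x) z + ip X (\<lambda>x. V x - lV x) gz + ip X (\<lambda>x. - V x - dM x) \<phi>
      + ip X (\<lambda>x. M x - lM x) g\<phi> + ip X (\<lambda>x. M x \<bullet> Jmat) s"
    by (rule ip_tuple) (intro L2_diff L2_add L2_scaleR L2_minus CM rJ MJ u l v)+
  moreover have "ip X (\<lambda>x. c *\<^sub>R V x + \<psi> x - gw x) q = c * ip X V q + ip X \<psi> q - ip X gw q"
    using u l v by (simp add: ip_diff_left ip_add_left L2_add L2_scaleR ip_scaleR_left)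
  moreover have "ip X (\<lambda>x. w x - lw x) dq = ip X w dq - ip X lw dq" by (rule ip_diff_left[OF u(3) l(1) v(2)])
  moreover have "ip X (\<lambda>x. Cinv \<nu> (M x) + r x *\<^sub>R Jmat - g\<psi> x) \<tau> = ip X (\<lambda>x. Cinv \<nu> (M x)) \<tau> + ip X (\<lambda>x. r x *\<^sub>R Jmat) \<tau> - ip X g\<psi> \<tau>"
    using ip_diff_left[OF L2_add[OF CM rJ] l(4) v(3)] ip_add_left[OF CM rJ v(3)] by simp
  moreover have "ip X (\<lambda>x. \<psi> x - l\<psi> x) d\<tau> = ip X \<psi> d\<tau> - ip X l\<psi> d\<tau>" by (rule ip_diff_left[OF u(4) l(3) v(4)])
  moreover have "ip X (\<lambda>x. - dV x) z = - ip X z dV" by (simp add: ip_minus_left ip_commute)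
  moreover have "ip X (\<lambda>x. V x - lV x) gz = ip X V gz - ip X gz lV" using ip_diff_left[OF u(1) l(5) v(6)] by (simp add: ip_commute)
  moreover have "ip X (\<lambda>x. - V x - dM x) \<phi> = - ip X V \<phi> - ip X \<phi> dM"
    using ip_diff_left[OF L2_minus[OF u(1)] l(8) v(7)] by (simp add: ip_minus_left ip_commute[of X dM])
  moreover have "ip X (\<lambda>x. M x - lM x) g\<phi> = ip X M g\<phi> - ip X g\<phi> lM" using ip_diff_left[OF u(2) l(7) v(8)] by (simp add: ip_commute)
  moreover have "ip X V (\<lambda>x. c *\<^sub>R q x + gz x - \<phi> x) = c * ip X V q + ip X V gz - ip X V \<phi>"
    using u v by (simp add: ip_diff_right ip_add_right L2_add L2_scaleR ip_scaleR_right)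
  moreover have "ip X M (\<lambda>x. Cinv \<nu> (\<tau> x) + g\<phi> x + s x *\<^sub>R Jmat) = ip X M (\<lambda>x. Cinv \<nu> (\<tau> x)) + ip X M g\<phi> + ip X M (\<lambda>x. s x *\<^sub>R Jmat)"
    using ip_add_right[OF L2_add[OF C\<tau> v(8)] sJ u(2)] ip_add_right[OF C\<tau> v(8) u(2)] by simp
  moreover have "ip X M (\<lambda>x. Cinv \<nu> (\<tau> x)) = ip X (\<lambda>x. Cinv \<nu> (M x)) \<tau>" by (simp add: ip_def Cinv_sym)
  moreover have "ip X M (\<lambda>x. s x *\<^sub>R Jmat) = ip X (\<lambda>x. M x \<bullet> Jmat) s" by (simp add: ip_def mult.commute)
  moreover have "ip X \<psi> (\<lambda>x. q x + d\<tau> x) = ip X \<psi> q + ip X \<psi> d\<tau>" by (rule ip_add_right[OF v(1) v(4) u(4)])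
  ultimately show ?thesis by linarith
qed

type_synonym testjet = "point \<times> real \<times> tensor \<times> point \<times> real \<times> point \<times> point \<times> tensor \<times> real"

definition cell_jet :: "quad \<Rightarrow> testv \<Rightarrow> point \<Rightarrow> testjet" where
  "cell_jet K v x = (vq v x, wdiv (cell K) (vq v) x, vtau v x, wdiv_ten (cell K) (vtau v) x, vz v x, wgrad (cell K) (vz v) x,
     vphi v x, wgrad_vec (cell K) (vphi v) x, vs v x)"

text \<open>Extensions of the four skeleton unknowns together with their weak derivatives as
  explicit data, so that the solution of the plate system can be inserted without passing through
  the choice operators of \<open>wgrad\<close> and \<open>wdiv\<close>.\<close>

record lift =
  lw :: "point \<Rightarrow> real"
  lgw :: "point \<Rightarrow> point"
  lpsi :: "point \<Rightarrow> point"
  lgpsi :: "point \<Rightarrow> tensor"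
  lV :: "point \<Rightarrow> point"
  ldV :: "point \<Rightarrow> real"
  lM :: "point \<Rightarrow> tensor"
  ldM :: "point \<Rightarrow> point"

definition residual :: "real \<Rightarrow> real \<Rightarrow> trial \<Rightarrow> lift \<Rightarrow> point \<Rightarrow> testjet" where
  "residual c \<nu> u l x = (c *\<^sub>R uV u x + upsi u x - lgw l x, uw u x - lw l x, Cinv \<nu> (uM u x) + ur u x *\<^sub>R Jmat - lgpsi l x,
     upsi u x - lpsi l x, - ldV l x, uV u x - lV l x, - uV u x - ldM l x, uM u x - lM l x, uM u x \<bullet> Jmat)"

lemma wdiv_ten_weak: "\<tau> \<in> Hdiv_ten X \<Longrightarrow> is_weak_div_ten X \<tau> (wdiv_ten X \<tau>)"
  using wdiv by (simp add: is_weak_div_ten_def wdiv_ten_def Hdiv_ten_def)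

lemma wgrad_vec_weak: "\<phi> \<in> H1_vec X \<Longrightarrow> is_weak_grad_vec X \<phi> (wgrad_vec X \<phi>)"
  using wgrad by (simp add: is_weak_grad_vec_def wgrad_vec_def H1_vec_def)

lemma H1_vecI: "f \<in> L2 X \<Longrightarrow> is_weak_grad_vec X f g \<Longrightarrow> f \<in> H1_vec X"
  and Hdiv_tenI: "\<tau> \<in> L2 X \<Longrightarrow> is_weak_div_ten X \<tau> d \<Longrightarrow> \<tau> \<in> Hdiv_ten X"
  unfolding H1_vec_def Hdiv_ten_def is_weak_grad_vec_def is_weak_div_ten_def
  using H1I HdivI L2_nth by blast+

lemma vec_AE_eq:
  fixes f g :: "point \<Rightarrow> ('a::euclidean_space)^2"
  assumes "\<And>i. AE x in M. f x $ i = g x $ i" shows "AE x in M. f x = g x"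
  using assms[of 1] assms[of 2] by eventually_elim (simp add: vec_eq_iff forall_2)

lemma wdiv_ten_AE:
  assumes X: "convex_domain X" and t: "\<tau> \<in> L2 X" "is_weak_div_ten X \<tau> d"
  shows "AE x in lebesgue_on X. wdiv_ten X \<tau> x = d x"
proof (rule vec_AE_eq)
  fix i show "AE x in lebesgue_on X. wdiv_ten X \<tau> x $ i = d x $ i"
    using wdiv_AE[OF X L2_nth[OF t(1), of i]] t(2) by (simp add: wdiv_ten_def is_weak_div_ten_def)
qed

lemma wgrad_vec_AE:
  assumes X: "convex_domain X" and t: "\<phi> \<in> L2 X" "is_weak_grad_vec X \<phi> g"
  shows "AE x in lebesgue_on X. wgrad_vec X \<phi> x = g x"
proof (rule vec_AE_eq)
  fix i show "AE x in lebesgue_on X. wgrad_vec X \<phi> x $ i = g x $ i"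
    using wgrad_AE[OF X L2_nth[OF t(1), of i]] t(2) by (simp add: wgrad_vec_def is_weak_grad_vec_def)
qed

context mesh begin

definition test_jet :: "testv \<Rightarrow> point \<Rightarrow> testjet" where
  "test_jet v = glue (\<lambda>K. cell_jet K v)"

lemma test_spaceD:
  assumes "v \<in> test_space \<Omega> T" "K \<in> T"
  shows "vq v \<in> Hdiv (cell K)" "vtau v \<in> Hdiv_ten (cell K)" "vz v \<in> H1 (cell K)" "vphi v \<in> H1_vec (cell K)"
    "vq v \<in> L2 (cell K)" "vtau v \<in> L2 (cell K)" "vz v \<in> L2 (cell K)" "vphi v \<in> L2 (cell K)" "vs v \<in> L2 (cell K)"
  using assms L2_cell[OF _ assms(2)] by (auto simp: test_space_def)

lemma cell_jet_components_L2:
  assumes "v \<in> test_space \<Omega> T" "K \<in> T"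
  shows "wdiv (cell K) (vq v) \<in> L2 (cell K)" "wdiv_ten (cell K) (vtau v) \<in> L2 (cell K)"
    "wgrad (cell K) (vz v) \<in> L2 (cell K)" "wgrad_vec (cell K) (vphi v) \<in> L2 (cell K)"
  using test_spaceD[OF assms] wdiv_L2 wgrad_L2 is_weak_div_ten_L2[OF wdiv_ten_weak] is_weak_grad_vec_L2[OF wgrad_vec_weak] by auto

lemma cell_jet_L2: "v \<in> test_space \<Omega> T \<Longrightarrow> K \<in> T \<Longrightarrow> cell_jet K v \<in> L2 (cell K)"
  unfolding cell_jet_def[abs_def] by (intro L2_Pair test_spaceD cell_jet_components_L2)

lemma test_jet_L2: "v \<in> test_space \<Omega> T \<Longrightarrow> test_jet v \<in> L2 \<Omega>"
  unfolding test_jet_def by (intro glue_L2 cell_jet_L2)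

lemma test_jet_cell: "K \<in> T \<Longrightarrow> x \<in> cell K \<Longrightarrow> test_jet v x = cell_jet K v x"
  by (simp add: test_jet_def glue_cell)

lemma ip_test_jet:
  assumes "f \<in> L2 \<Omega>" "v \<in> test_space \<Omega> T"
  shows "ip \<Omega> f (test_jet v) = (\<Sum>K\<in>T. ip (cell K) f (cell_jet K v))"
proof -
  have "ip \<Omega> f (test_jet v) = (\<Sum>K\<in>T. ip (cell K) f (test_jet v))"
    by (rule ip_mesh[OF assms(1) test_jet_L2[OF assms(2)]])
  also have "\<dots> = (\<Sum>K\<in>T. ip (cell K) f (cell_jet K v))"
    unfolding ip_def by (intro sum.cong Bochner_Integration.integral_cong refl) (auto simp: test_jet_cell)
  finally show ?thesis .
qed

lemma L2_norm_mesh: "f \<in> L2 \<Omega> \<Longrightarrow> (L2_norm_on \<Omega> f)\<^sup>2 = (\<Sum>K\<in>T. (L2_norm_on (cell K) f)\<^sup>2)"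
  by (simp add: L2_norm_sq ip_mesh)

text \<open>The test space is thereby isometric to a space of L2 functions, and the Riesz theorem
  for L2 can be used in place of a Hilbert space structure on records.\<close>

lemma test_norm_jet:
  assumes v: "v \<in> test_space \<Omega> T" shows "test_norm \<Omega> T v = L2_norm_on \<Omega> (test_jet v)"
proof -
  have cellwise: "(L2_norm_on (cell K) (test_jet v))\<^sup>2 = (Hdiv_norm (cell K) (vq v))\<^sup>2 + (Hdiv_ten_norm (cell K) (vtau v))\<^sup>2
      + (H1_norm (cell K) (vz v))\<^sup>2 + (H1_vec_norm (cell K) (vphi v))\<^sup>2 + (L2_norm_on (cell K) (vs v))\<^sup>2" if K: "K \<in> T" for K
  proof -
    note L = test_spaceD(5-9)[OF v K] cell_jet_components_L2[OF v K]
    have "(L2_norm_on (cell K) (test_jet v))\<^sup>2 = (L2_norm_on (cell K) (cell_jet K v))\<^sup>2"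
      unfolding L2_norm_on_def
      by (intro arg_cong[of _ _ "\<lambda>t. (sqrt t)\<^sup>2"] Bochner_Integration.integral_cong) (auto simp: test_jet_cell[OF K])
    also have "\<dots> = (Hdiv_norm (cell K) (vq v))\<^sup>2 + (Hdiv_ten_norm (cell K) (vtau v))\<^sup>2
      + (H1_norm (cell K) (vz v))\<^sup>2 + (H1_vec_norm (cell K) (vphi v))\<^sup>2 + (L2_norm_on (cell K) (vs v))\<^sup>2"
      unfolding cell_jet_def[abs_def] using L
      by (simp add: L2_norm_Pair L2_Pair Hdiv_norm_def Hdiv_ten_norm_def H1_norm_def H1_vec_norm_def)
    finally show ?thesis .
  qed
  have "vs v \<in> L2 \<Omega>" using v by (simp add: test_space_def)
  then have "(L2_norm_on \<Omega> (test_jet v))\<^sup>2 = (\<Sum>K\<in>T. (Hdiv_norm (cell K) (vq v))\<^sup>2) + (\<Sum>K\<in>T. (Hdiv_ten_norm (cell K) (vtau v))\<^sup>2) +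
           (\<Sum>K\<in>T. (H1_norm (cell K) (vz v))\<^sup>2) + (\<Sum>K\<in>T. (H1_vec_norm (cell K) (vphi v))\<^sup>2) + (L2_norm_on \<Omega> (vs v))\<^sup>2"
    unfolding L2_norm_mesh[OF test_jet_L2[OF v]] by (simp add: cellwise sum.distrib L2_norm_mesh)
  then show ?thesis unfolding test_norm_def by (metis L2_norm_nonneg real_sqrt_unique)
qed

lemma cell_jet_AE:
  assumes v: "v \<in> test_space \<Omega> T" and K: "K \<in> T"
    and d: "is_weak_div (cell K) (vq v) dq" "is_weak_div_ten (cell K) (vtau v) d\<tau>"
      "is_weak_grad (cell K) (vz v) gz" "is_weak_grad_vec (cell K) (vphi v) g\<phi>"
  shows "AE x in lebesgue_on (cell K). cell_jet K v x = (vq v x, dq x, vtau v x, d\<tau> x, vz v x, gz x, vphi v x, g\<phi> x, vs v x)"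
  using wdiv_AE[OF cell_domain[OF K] test_spaceD(5)[OF v K] d(1)] wdiv_ten_AE[OF cell_domain[OF K] test_spaceD(6)[OF v K] d(2)]
    wgrad_AE[OF cell_domain[OF K] test_spaceD(7)[OF v K] d(3)] wgrad_vec_AE[OF cell_domain[OF K] test_spaceD(8)[OF v K] d(4)]
  by eventually_elim (simp add: cell_jet_def)

text \<open>Membership and jet of an explicitly given test function can be read off from any weak
  derivatives on the elements, since these agree almost everywhere with the chosen ones.\<close>

lemma test_jet_AE:
  assumes L: "vq v \<in> L2 \<Omega>" "vtau v \<in> L2 \<Omega>" "vz v \<in> L2 \<Omega>" "vphi v \<in> L2 \<Omega>" "vs v \<in> L2 \<Omega>"
    and d: "\<And>K. K \<in> T \<Longrightarrow> is_weak_div (cell K) (vq v) (dq K)" "\<And>K. K \<in> T \<Longrightarrow> is_weak_div_ten (cell K) (vtau v) (d\<tau> K)"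
      "\<And>K. K \<in> T \<Longrightarrow> is_weak_grad (cell K) (vz v) (gz K)" "\<And>K. K \<in> T \<Longrightarrow> is_weak_grad_vec (cell K) (vphi v) (g\<phi> K)"
    and j: "\<And>K x. K \<in> T \<Longrightarrow> x \<in> cell K \<Longrightarrow> j x = (vq v x, dq K x, vtau v x, d\<tau> K x, vz v x, gz K x, vphi v x, g\<phi> K x, vs v x)"
  shows "v \<in> test_space \<Omega> T" and "AE x in lebesgue_on \<Omega>. test_jet v x = j x"
proof -
  show v: "v \<in> test_space \<Omega> T"
    unfolding test_space_def mem_Collect_eq
  proof (intro conjI ballI L)
    fix K assume K: "K \<in> T"
    show "vq v \<in> Hdiv (cell K)" by (rule HdivI[OF L2_cell[OF L(1) K] d(1)[OF K]])
    show "vtau v \<in> Hdiv_ten (cell K)" by (rule Hdiv_tenI[OF L2_cell[OF L(2) K] d(2)[OF K]])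
    show "vz v \<in> H1 (cell K)" by (rule H1I[OF L2_cell[OF L(3) K] d(3)[OF K]])
    show "vphi v \<in> H1_vec (cell K)" by (rule H1_vecI[OF L2_cell[OF L(4) K] d(4)[OF K]])
  qed
  show "AE x in lebesgue_on \<Omega>. test_jet v x = j x"
  proof (rule AE_mesh)
    fix K assume K: "K \<in> T"
    have "AE x in lebesgue_on (cell K). x \<in> cell K" by (rule AE_I2) simp
    with cell_jet_AE[OF v K d(1)[OF K] d(2)[OF K] d(3)[OF K] d(4)[OF K]]
    show "AE x in lebesgue_on (cell K). test_jet v x = j x"
      by eventually_elim (simp add: test_jet_cell[OF K] j[OF K])
  qed
qed

lemma test_lincomb_jet:
  assumes v: "v \<in> test_space \<Omega> T" and v': "v' \<in> test_space \<Omega> T"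
  shows "test_lincomb a v b v' \<in> test_space \<Omega> T"
    and "AE x in lebesgue_on \<Omega>. test_jet (test_lincomb a v b v') x = a *\<^sub>R test_jet v x + b *\<^sub>R test_jet v' x"
proof -
  let ?u = "test_lincomb a v b v'"
  have d: "is_weak_div (cell K) (vq ?u) (\<lambda>x. a * wdiv (cell K) (vq v) x + b * wdiv (cell K) (vq v') x)"
    "is_weak_div_ten (cell K) (vtau ?u) (\<lambda>x. a *\<^sub>R wdiv_ten (cell K) (vtau v) x + b *\<^sub>R wdiv_ten (cell K) (vtau v') x)"
    "is_weak_grad (cell K) (vz ?u) (\<lambda>x. a *\<^sub>R wgrad (cell K) (vz v) x + b *\<^sub>R wgrad (cell K) (vz v') x)"
    "is_weak_grad_vec (cell K) (vphi ?u) (\<lambda>x. a *\<^sub>R wgrad_vec (cell K) (vphi v) x + b *\<^sub>R wgrad_vec (cell K) (vphi v') x)"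
    if K: "K \<in> T" for K
  proof -
    note X = cell_domain[OF K] note s = test_spaceD[OF v K] note s' = test_spaceD[OF v' K]
    show "is_weak_div (cell K) (vq ?u) (\<lambda>x. a * wdiv (cell K) (vq v) x + b * wdiv (cell K) (vq v') x)"
      using is_weak_div_lincomb[OF X s(5) s'(5) wdiv[OF s(1)] wdiv[OF s'(1)]] by (simp add: test_lincomb_def)
    show "is_weak_grad (cell K) (vz ?u) (\<lambda>x. a *\<^sub>R wgrad (cell K) (vz v) x + b *\<^sub>R wgrad (cell K) (vz v') x)"
      using is_weak_grad_lincomb[OF X s(7) s'(7) wgrad[OF s(3)] wgrad[OF s'(3)]] by (simp add: test_lincomb_def)
    have "is_weak_div (cell K) (\<lambda>x. vtau v x $ i) (\<lambda>x. wdiv_ten (cell K) (vtau v) x $ i)"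
      "is_weak_div (cell K) (\<lambda>x. vtau v' x $ i) (\<lambda>x. wdiv_ten (cell K) (vtau v') x $ i)"
      "is_weak_grad (cell K) (\<lambda>x. vphi v x $ i) (\<lambda>x. wgrad_vec (cell K) (vphi v) x $ i)"
      "is_weak_grad (cell K) (\<lambda>x. vphi v' x $ i) (\<lambda>x. wgrad_vec (cell K) (vphi v') x $ i)" for i
      using wdiv_ten_weak[OF s(2)] wdiv_ten_weak[OF s'(2)] wgrad_vec_weak[OF s(4)] wgrad_vec_weak[OF s'(4)]
      by (simp_all add: is_weak_div_ten_def is_weak_grad_vec_def)
    note c = this
    show "is_weak_div_ten (cell K) (vtau ?u) (\<lambda>x. a *\<^sub>R wdiv_ten (cell K) (vtau v) x + b *\<^sub>R wdiv_ten (cell K) (vtau v') x)"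
      using is_weak_div_lincomb[OF X L2_nth[OF s(6)] L2_nth[OF s'(6)] c(1,2)] by (simp add: test_lincomb_def is_weak_div_ten_def)
    show "is_weak_grad_vec (cell K) (vphi ?u) (\<lambda>x. a *\<^sub>R wgrad_vec (cell K) (vphi v) x + b *\<^sub>R wgrad_vec (cell K) (vphi v') x)"
      using is_weak_grad_lincomb[OF X L2_nth[OF s(8)] L2_nth[OF s'(8)] c(3,4)] by (simp add: test_lincomb_def is_weak_grad_vec_def)
  qed
  have L: "vq ?u \<in> L2 \<Omega>" "vtau ?u \<in> L2 \<Omega>" "vz ?u \<in> L2 \<Omega>" "vphi ?u \<in> L2 \<Omega>" "vs ?u \<in> L2 \<Omega>"
    using v v' by (auto simp: test_space_def test_lincomb_def intro!: L2_add L2_scaleR L2_mult)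
  show "?u \<in> test_space \<Omega> T" and "AE x in lebesgue_on \<Omega>. test_jet ?u x = a *\<^sub>R test_jet v x + b *\<^sub>R test_jet v' x"
    by (rule test_jet_AE[OF L, where j="\<lambda>x. a *\<^sub>R test_jet v x + b *\<^sub>R test_jet v' x"], (rule d, assumption)+,
        simp add: test_jet_cell, simp add: cell_jet_def test_lincomb_def)+
qed

section \<open>The form as an inner product with the residual\<close>

text \<open>The boundary condition on \<Omega> is kept apart, as membership of \<open>lw l\<close>
  and \<open>lpsi l\<close> in the spaces with zero boundary values.\<close>

definition is_lift :: "trial \<Rightarrow> lift \<Rightarrow> bool" where
  "is_lift u l \<longleftrightarrow> lw l \<in> L2 \<Omega> \<and> is_weak_grad \<Omega> (lw l) (lgw l) \<and> (\<forall>K\<in>T. has_trace K (lw l) (uwh u)) \<and>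
     lpsi l \<in> L2 \<Omega> \<and> is_weak_grad_vec \<Omega> (lpsi l) (lgpsi l) \<and> (\<forall>K\<in>T. \<forall>i. has_trace K (\<lambda>x. lpsi l x $ i) (\<lambda>x. upsih u x $ i)) \<and>
     lV l \<in> L2 \<Omega> \<and> is_weak_div \<Omega> (lV l) (ldV l) \<and> uVnh u = skel_normal_trace T (lV l) \<and>
     lM l \<in> L2 \<Omega> \<and> is_weak_div_ten \<Omega> (lM l) (ldM l) \<and> uMnh u = skel_normal_trace_ten T (lM l)"

definition L2_fields :: "trial \<Rightarrow> bool" where
  "L2_fields u \<longleftrightarrow> uV u \<in> L2 \<Omega> \<and> uM u \<in> L2 \<Omega> \<and> uw u \<in> L2 \<Omega> \<and> upsi u \<in> L2 \<Omega> \<and> ur u \<in> L2 \<Omega>"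

lemma lift_L2:
  assumes "is_lift u l"
  shows "lw l \<in> L2 \<Omega>" "lgw l \<in> L2 \<Omega>" "lpsi l \<in> L2 \<Omega>" "lgpsi l \<in> L2 \<Omega>" "lV l \<in> L2 \<Omega>" "ldV l \<in> L2 \<Omega>" "lM l \<in> L2 \<Omega>" "ldM l \<in> L2 \<Omega>"
  using assms is_weak_grad_L2 is_weak_div_L2 is_weak_grad_vec_L2 is_weak_div_ten_L2 unfolding is_lift_def by blast+

lemma residual_L2:
  assumes u: "L2_fields u" and l: "is_lift u l" shows "residual c \<nu> u l \<in> L2 \<Omega>"
  unfolding residual_def[abs_def] using u lift_L2[OF l]
  by (auto simp: L2_fields_def intro!: L2_Pair L2_diff L2_add L2_scaleR L2_minus Cinv_L2 L2_scaleR_const L2_inner_const)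

text \<open>Green's formula on each element. For the traces of deflection and rotation the lift is
  the extension in \<open>normal_trace_green\<close>; for the normal traces it is the test function,
  as an extension of its own trace.\<close>

theorem RM_form_residual:
  assumes u: "L2_fields u" and l: "is_lift u l" and v: "v \<in> test_space \<Omega> T"
  shows "RM_form \<kappa> t \<nu> T u v = ip \<Omega> (residual (inverse \<kappa> * t\<^sup>2) \<nu> u l) (test_jet v)"
proof -
  let ?c = "inverse \<kappa> * t\<^sup>2"
  have cellwise: "ip (cell K) (uV u) (\<lambda>x. ?c *\<^sub>R vq v x + wgrad (cell K) (vz v) x - vphi v x)
      + ip (cell K) (uM u) (\<lambda>x. Cinv \<nu> (vtau v x) + wgrad_vec (cell K) (vphi v) x + vs v x *\<^sub>R Jmat)
      + ip (cell K) (uw u) (wdiv (cell K) (vq v)) + ip (cell K) (upsi u) (\<lambda>x. vq v x + wdiv_ten (cell K) (vtau v) x)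
      + ip (cell K) (\<lambda>x. ur u x *\<^sub>R Jmat) (vtau v)
      - normal_trace K (vq v) (uwh u)
      - (\<Sum>i\<in>UNIV. normal_trace_ten K (vtau v) (\<lambda>x. upsih u x $ i) $ i)
      - uVnh u K (trace_on K (vz v))
      - (\<Sum>i\<in>UNIV. uMnh u K (trace_on K (\<lambda>x. vphi v x $ i)) $ i)
      = ip (cell K) (residual ?c \<nu> u l) (cell_jet K v)" if K: "K \<in> T" for K
  proof -
    let ?X = "cell K"
    note X = cell_domain[OF K] and cK = convex_T[OF K]
    note ll = l[unfolded is_lift_def]
    note s = test_spaceD[OF v K] and dL = cell_jet_components_L2[OF v K]
    note lL = lift_L2[OF l, THEN L2_cell[OF _ K]]
    have uL: "uV u \<in> L2 ?X" "uM u \<in> L2 ?X" "uw u \<in> L2 ?X" "upsi u \<in> L2 ?X" "ur u \<in> L2 ?X"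
      using u L2_cell[OF _ K] by (auto simp: L2_fields_def)
    have wg: "is_weak_grad ?X (lw l) (lgw l)" "is_weak_grad ?X (\<lambda>x. lpsi l x $ i) (\<lambda>x. lgpsi l x $ i)"
      "is_weak_div ?X (lV l) (ldV l)" "is_weak_div ?X (\<lambda>x. lM l x $ i) (\<lambda>x. ldM l x $ i)" for i
      using ll weak_grad_cell[OF _ K] weak_div_cell[OF _ K] by (auto simp: is_weak_grad_vec_def is_weak_div_ten_def)
    have \<tau>i: "(\<lambda>x. vtau v x $ i) \<in> Hdiv ?X" and \<phi>i: "(\<lambda>x. vphi v x $ i) \<in> H1 ?X" for i
      using s by (auto simp: Hdiv_ten_def H1_vec_def)
    have 1: "normal_trace K (vq v) (uwh u) = ip ?X (lgw l) (vq v) + ip ?X (lw l) (wdiv ?X (vq v))"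
      using normal_trace_green[OF cK _ s(1), of "lw l" "uwh u"] ll K wgrad_ip[OF X lL(1) wg(1) s(5)] by simp
    have "normal_trace_ten K (vtau v) (\<lambda>x. upsih u x $ i) $ i =
        ip ?X (\<lambda>x. lgpsi l x $ i) (\<lambda>x. vtau v x $ i) + ip ?X (\<lambda>x. lpsi l x $ i) (\<lambda>x. wdiv_ten ?X (vtau v) x $ i)" for i
      using normal_trace_green[OF cK _ \<tau>i, of "\<lambda>x. lpsi l x $ i" "\<lambda>x. upsih u x $ i" i] ll K
        wgrad_ip[OF X L2_nth[OF lL(3)] wg(2) L2_nth[OF s(6)], of i i]
      by (simp add: normal_trace_ten_def wdiv_ten_def)
    then have 2: "(\<Sum>i\<in>UNIV. normal_trace_ten K (vtau v) (\<lambda>x. upsih u x $ i) $ i) = ip ?X (lgpsi l) (vtau v) + ip ?X (lpsi l) (wdiv_ten ?X (vtau v))"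
      by (simp add: sum.distrib ip_vec[OF lL(4) s(6)] ip_vec[OF lL(3) dL(2)])
    have 3: "uVnh u K (trace_on K (vz v)) = ip ?X (wgrad ?X (vz v)) (lV l) + ip ?X (vz v) (ldV l)"
      using normal_trace_green[OF cK has_trace_on[OF cK s(3)] HdivI[OF lL(5) wg(3)]] ll K wdiv_ip[OF X lL(5) wg(3) s(7)]
      by (simp add: skel_normal_trace_def)
    have "uMnh u K (trace_on K (\<lambda>x. vphi v x $ i)) $ i =
        ip ?X (\<lambda>x. wgrad_vec ?X (vphi v) x $ i) (\<lambda>x. lM l x $ i) + ip ?X (\<lambda>x. vphi v x $ i) (\<lambda>x. ldM l x $ i)" for i
      using normal_trace_green[OF cK has_trace_on[OF cK \<phi>i] HdivI[OF L2_nth[OF lL(7)] wg(4)], of i i] ll K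
        wdiv_ip[OF X L2_nth[OF lL(7)] wg(4) L2_nth[OF s(8)], of i i]
      by (simp add: skel_normal_trace_ten_def normal_trace_ten_def wgrad_vec_def)
    then have 4: "(\<Sum>i\<in>UNIV. uMnh u K (trace_on K (\<lambda>x. vphi v x $ i)) $ i) = ip ?X (wgrad_vec ?X (vphi v)) (lM l) + ip ?X (vphi v) (ldM l)"
      by (simp add: sum.distrib ip_vec[OF dL(4) lL(7)] ip_vec[OF s(8) lL(8)])
    show ?thesis
      unfolding 1 2 3 4 residual_def[abs_def] cell_jet_def[abs_def]
      by (rule residual_identity[symmetric]) (fact uL lL s dL)+
  qed
  have "RM_form \<kappa> t \<nu> T u v = (\<Sum>K\<in>T. ip (cell K) (residual ?c \<nu> u l) (cell_jet K v))"
    unfolding RM_form_def sum.distrib[symmetric] sum_subtractf[symmetric] by (rule sum.cong[OF refl cellwise])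
  then show ?thesis by (simp only: ip_test_jet[OF residual_L2[OF u l] v])
qed

text \<open>A supremum of reals means something only for a bounded set, which the definition of the
  dual space provides. Test functions of norm zero are covered by the same bound, all others by
  scaling.\<close>

lemma dual_norm_bound:
  assumes L: "L \<in> test_dual \<Omega> T"
  shows "0 \<le> dual_norm \<Omega> T L" "v \<in> test_space \<Omega> T \<Longrightarrow> \<bar>L v\<bar> \<le> dual_norm \<Omega> T L * test_norm \<Omega> T v"
proof -
  obtain C where C: "\<And>v. v \<in> test_space \<Omega> T \<Longrightarrow> \<bar>L v\<bar> \<le> C * test_norm \<Omega> T v" using L unfolding test_dual_def by blast
  have lin: "L (test_lincomb a v b v') = a * L v + b * L v'" if "v \<in> test_space \<Omega> T" "v' \<in> test_space \<Omega> T" for a b v v'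
    using L that by (auto simp: test_dual_def)
  let ?S = "{\<bar>L v\<bar> | v. v \<in> test_space \<Omega> T \<and> test_norm \<Omega> T v \<le> 1}"
  have tn0: "test_norm \<Omega> T v \<ge> 0" if "v \<in> test_space \<Omega> T" for v using test_norm_jet[OF that] by simp
  have bdd: "bdd_above ?S"
  proof (rule bdd_aboveI[of _ "\<bar>C\<bar>"])
    fix y assume "y \<in> ?S"
    then obtain v where v: "y = \<bar>L v\<bar>" "v \<in> test_space \<Omega> T" "test_norm \<Omega> T v \<le> 1" by auto
    have "C * test_norm \<Omega> T v \<le> \<bar>C\<bar> * test_norm \<Omega> T v" using tn0[OF v(2)] by (intro mult_right_mono) auto
    also have "\<dots> \<le> \<bar>C\<bar> * 1" using v(3) by (intro mult_left_mono) auto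
    finally show "y \<le> \<bar>C\<bar>" using C[OF v(2)] v(1) by simp
  qed
  \<comment> \<open>Scaling is written as a linear combination with coefficient zero, the form in
    which linearity of \<open>L\<close> is available.\<close>
  have nrm: "test_norm \<Omega> T (test_lincomb a v 0 v) = \<bar>a\<bar> * test_norm \<Omega> T v" if v: "v \<in> test_space \<Omega> T" for a v
  proof -
    note l = test_lincomb_jet[OF v v, of a 0]
    have "L2_norm_on \<Omega> (test_jet (test_lincomb a v 0 v)) = L2_norm_on \<Omega> (\<lambda>x. a *\<^sub>R test_jet v x)"
      using l(2) L2_measurable[OF test_jet_L2[OF l(1)]] L2_measurable[OF L2_scaleR[OF test_jet_L2[OF v]]]
      by (intro L2_norm_cong_AE) auto
    then show ?thesis by (simp add: test_norm_jet[OF v] test_norm_jet[OF l(1)] L2_norm_scaleR)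
  qed
  have up: "\<bar>L v\<bar> \<le> dual_norm \<Omega> T L" if "v \<in> test_space \<Omega> T" "test_norm \<Omega> T v \<le> 1" for v
    unfolding dual_norm_def using that bdd by (intro cSup_upper) auto
  have z: "\<lparr>vq = \<lambda>x. 0, vtau = \<lambda>x. 0, vz = \<lambda>x. 0, vphi = \<lambda>x. 0, vs = \<lambda>x. 0\<rparr> \<in> test_space \<Omega> T"
    using H1I[OF L2_zero is_weak_grad_zero] HdivI[OF L2_zero is_weak_div_zero] by (simp add: test_space_def Hdiv_ten_def H1_vec_def)
  have "\<bar>L (test_lincomb 0 \<lparr>vq = \<lambda>x. 0, vtau = \<lambda>x. 0, vz = \<lambda>x. 0, vphi = \<lambda>x. 0, vs = \<lambda>x. 0\<rparr> 0 \<lparr>vq = \<lambda>x. 0, vtau = \<lambda>x. 0, vz = \<lambda>x. 0, vphi = \<lambda>x. 0, vs = \<lambda>x. 0\<rparr>)\<bar> \<le> dual_norm \<Omega> T L"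
    by (rule up[OF test_lincomb_jet(1)[OF z z]]) (simp add: nrm[OF z])
  then show "0 \<le> dual_norm \<Omega> T L" by (simp add: lin[OF z z])
  show "\<bar>L v\<bar> \<le> dual_norm \<Omega> T L * test_norm \<Omega> T v" if v: "v \<in> test_space \<Omega> T"
  proof (cases "test_norm \<Omega> T v = 0")
    case True then show ?thesis using C[OF v] by simp
  next
    case False
    let ?n = "test_norm \<Omega> T v"
    have n: "?n > 0" using False tn0[OF v] by simp
    have "\<bar>L (test_lincomb (1 / ?n) v 0 v)\<bar> \<le> dual_norm \<Omega> T L"
      using n by (intro up test_lincomb_jet(1)[OF v v]) (simp add: nrm[OF v])
    then have "\<bar>L v\<bar> / ?n \<le> dual_norm \<Omega> T L" using n by (simp add: lin[OF v v] abs_mult)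
    then show ?thesis using n by (simp add: field_simps)
  qed
qed

lemma dual_representation:
  assumes L: "L \<in> test_dual \<Omega> T"
  obtains f where "f \<in> L2 \<Omega>" "\<And>v. v \<in> test_space \<Omega> T \<Longrightarrow> L v = ip \<Omega> f (test_jet v)" "L2_norm_on \<Omega> f \<le> dual_norm \<Omega> T L"
proof -
  have comb: "\<exists>w\<in>test_space \<Omega> T. (AE x in lebesgue_on \<Omega>. test_jet w x = a *\<^sub>R test_jet u x + b *\<^sub>R test_jet v x) \<and> L w = a * L u + b * L v"
    if uv: "u \<in> test_space \<Omega> T" "v \<in> test_space \<Omega> T" for u v a b
    using test_lincomb_jet[OF uv, of a b] L uv by (intro bexI[of _ "test_lincomb a u b v"]) (auto simp: test_dual_def)
  have ne: "test_space \<Omega> T \<noteq> {}"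
    using H1I[OF L2_zero is_weak_grad_zero] HdivI[OF L2_zero is_weak_div_zero]
    by (auto simp: test_space_def Hdiv_ten_def H1_vec_def
        intro!: exI[of _ "\<lparr>vq = \<lambda>x. 0, vtau = \<lambda>x. 0, vz = \<lambda>x. 0, vphi = \<lambda>x. 0, vs = \<lambda>x. 0\<rparr>"])
  have b: "\<bar>L v\<bar> \<le> dual_norm \<Omega> T L * L2_norm_on \<Omega> (test_jet v)" if "v \<in> test_space \<Omega> T" for v
    using dual_norm_bound(2)[OF L that] by (simp add: test_norm_jet[OF that])
  show ?thesis
  proof (rule riesz_L2[where S="test_space \<Omega> T" and D=test_jet and l=L and X=\<Omega> and C="dual_norm \<Omega> T L"])
    fix f :: "point \<Rightarrow> testjet" and u
    assume f: "f \<in> L2 \<Omega>" "\<And>v. v \<in> test_space \<Omega> T \<Longrightarrow> L v = ip \<Omega> f (test_jet v)" "L2_norm_on \<Omega> f \<le> dual_norm \<Omega> T L"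
    show ?thesis by (rule that[OF f])
  next
    show "test_space \<Omega> T \<noteq> {}" by (fact ne)
    show "0 \<le> dual_norm \<Omega> T L" by (rule dual_norm_bound(1)[OF L])
  qed (rule test_jet_L2 b comb, assumption+)+
qed

lemma L2_norm_cell_le: "f \<in> L2 \<Omega> \<Longrightarrow> K \<in> T \<Longrightarrow> L2_norm_on (cell K) f \<le> L2_norm_on \<Omega> f"
proof (rule power2_le_imp_le)
  assume "f \<in> L2 \<Omega>" "K \<in> T"
  then show "(L2_norm_on (cell K) f)\<^sup>2 \<le> (L2_norm_on \<Omega> f)\<^sup>2"
    unfolding L2_norm_mesh[OF \<open>f \<in> L2 \<Omega>\<close>] using finite_T by (intro member_le_sum) auto
qed simp

text \<open>One sequence of test functions on \<Omega> approximates the function on every element,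
  as \<open>common_trace\<close> requires.\<close>

lemma H10_skeleton_trace:
  assumes w: "w \<in> H10 \<Omega>" obtains g where "\<And>K. K \<in> T \<Longrightarrow> has_trace K w g"
proof -
  obtain \<phi> where \<phi>: "\<And>n::nat. \<phi> n \<in> test_functions \<Omega>" "(\<lambda>n. L2_norm_on \<Omega> (\<lambda>x. \<phi> n x - w x)) \<longlonglongrightarrow> 0"
    "(\<lambda>n. L2_norm_on \<Omega> (\<lambda>x. grad (\<phi> n) x - wgrad \<Omega> w x)) \<longlonglongrightarrow> 0"
    by (rule H10_obtain[OF dom w]) blast
  note wH = H10_H1[OF w]
  note L = test_L2[OF dom \<phi>(1)] H1_L2[OF wH] wgrad_L2[OF wH]
  note g = weak_grad_cell[OF wgrad[OF wH]]
  have 1: "(\<lambda>n. L2_norm_on (cell K) (\<lambda>x. \<phi> n x - w x)) \<longlonglongrightarrow> 0" if K: "K \<in> T" for K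
    by (rule null_sequence_comparison[OF _ \<phi>(2)]) (simp add: L2_norm_cell_le[OF L2_diff[OF L(1) L(3)] K])
  have 2: "(\<lambda>n. L2_norm_on (cell K) (\<lambda>x. grad (\<phi> n) x - wgrad (cell K) w x)) \<longlonglongrightarrow> 0" if K: "K \<in> T" for K
  proof (rule null_sequence_comparison[OF _ \<phi>(3)])
    fix n
    have "L2_norm_on (cell K) (\<lambda>x. grad (\<phi> n) x - wgrad (cell K) w x) = L2_norm_on (cell K) (\<lambda>x. grad (\<phi> n) x - wgrad \<Omega> w x)"
    proof (rule L2_norm_cong_AE)
      show "AE x in lebesgue_on (cell K). grad (\<phi> n) x - wgrad (cell K) w x = grad (\<phi> n) x - wgrad \<Omega> w x"
        using wgrad_AE[OF cell_domain[OF K] L2_cell[OF L(3) K] g[OF K]] by eventually_elim simp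
    qed (intro L2_measurable L2_diff L2_cell[OF L(2) K] L2_cell[OF L(4) K] wgrad_L2[OF H1I[OF L2_cell[OF L(3) K] g[OF K]]])+
    then show "\<bar>L2_norm_on (cell K) (\<lambda>x. grad (\<phi> n) x - wgrad (cell K) w x)\<bar> \<le> L2_norm_on \<Omega> (\<lambda>x. grad (\<phi> n) x - wgrad \<Omega> w x)"
      using L2_norm_cell_le[OF L2_diff[OF L(2) L(4)] K] by simp
  qed
  show ?thesis
  proof (rule common_trace[of T \<phi> w])
    fix g assume "\<And>K. K \<in> T \<Longrightarrow> has_trace K w g"
    then show ?thesis by (rule that)
  next
    fix K n assume K: "K \<in> T"
    show "convex_quad K" by (rule convex_T[OF K])
    show "w \<in> H1 (cell K)" by (rule H1I[OF L2_cell[OF L(3) K] g[OF K]])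
    show "(\<lambda>n. L2_norm_on (cell K) (\<lambda>x. \<phi> n x - w x)) \<longlonglongrightarrow> 0" by (rule 1[OF K])
    show "(\<lambda>n. L2_norm_on (cell K) (\<lambda>x. grad (\<phi> n) x - wgrad (cell K) w x)) \<longlonglongrightarrow> 0" by (rule 2[OF K])
  qed (fact finite_T | rule test_function_smooth[OF \<phi>(1)])+
qed

end

section \<open>Existence\<close>

lemma abs_Inf_le:
  fixes a :: real
  assumes "a \<in> S" "\<And>x. x \<in> S \<Longrightarrow> 0 \<le> x" shows "\<bar>Inf S\<bar> \<le> a"
proof -
  have "Inf S \<le> a" by (rule cInf_lower[OF assms(1) bdd_belowI[of S 0]]) (rule assms(2))
  moreover have "0 \<le> Inf S" using assms by (intro cInf_greatest) auto
  ultimately show ?thesis by simp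
qed

lemma sqrt_sum_nine_le:
  fixes a1 a2 a3 a4 a5 a6 a7 a8 a9 B :: real
  assumes "\<bar>a1\<bar> \<le> B" "\<bar>a2\<bar> \<le> B" "\<bar>a3\<bar> \<le> B" "\<bar>a4\<bar> \<le> B" "\<bar>a5\<bar> \<le> B" "\<bar>a6\<bar> \<le> B" "\<bar>a7\<bar> \<le> B" "\<bar>a8\<bar> \<le> B" "\<bar>a9\<bar> \<le> B"
  shows "sqrt (a1\<^sup>2 + a2\<^sup>2 + a3\<^sup>2 + a4\<^sup>2 + a5\<^sup>2 + a6\<^sup>2 + a7\<^sup>2 + a8\<^sup>2 + a9\<^sup>2) \<le> 3 * B"
proof (rule real_le_lsqrt)
  have sq: "a\<^sup>2 \<le> B\<^sup>2" if "\<bar>a\<bar> \<le> B" for a using power_mono[OF that, of 2] by simp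
  have "a1\<^sup>2 + a2\<^sup>2 + a3\<^sup>2 + a4\<^sup>2 + a5\<^sup>2 + a6\<^sup>2 + a7\<^sup>2 + a8\<^sup>2 + a9\<^sup>2 \<le> 9 * B\<^sup>2"
    using assms[THEN sq] by linarith
  then show "a1\<^sup>2 + a2\<^sup>2 + a3\<^sup>2 + a4\<^sup>2 + a5\<^sup>2 + a6\<^sup>2 + a7\<^sup>2 + a8\<^sup>2 + a9\<^sup>2 \<le> (3 * B)\<^sup>2"
    by (simp add: power_mult_distrib)
  show "0 \<le> 3 * B" using assms(1) by simp
qed

lemma L2_norm_le_pointwise:
  fixes f :: "'d::euclidean_space \<Rightarrow> 'a::euclidean_space" and g :: "'d \<Rightarrow> 'b::euclidean_space"
  assumes "f \<in> L2 X" "g \<in> L2 X" "\<And>x. norm (f x) \<le> norm (g x)"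
  shows "L2_norm_on X f \<le> L2_norm_on X g"
  using L2_norm_mono[OF L2_measurable[OF assms(1)] assms(2), of 1] assms(3) by simp

lemma norm_proj_le:
  "norm (fst y) \<le> norm y" "norm (snd y) \<le> norm y"
  by (cases y; simp add: norm_fst_le norm_snd_le)+

lemmas norm_proj_trans = order_refl order_trans[OF norm_proj_le(1)] order_trans[OF norm_proj_le(2)]

lemma H1_norm_le:
  assumes X: "convex_domain X" and "f \<in> L2 X" "is_weak_grad X f g" "L2_norm_on X f \<le> B" "L2_norm_on X g \<le> B"
  shows "H1_norm X f \<le> 2 * B"
  using sqrt_sum_squares_le_sum[of "L2_norm_on X f" "L2_norm_on X g"] assms by (simp add: H1_norm_def wgrad_norm[OF assms(1-3)])

lemma Hdiv_norm_le:
  assumes X: "convex_domain X" and "f \<in> L2 X" "is_weak_div X f g" "L2_norm_on X f \<le> B" "L2_norm_on X g \<le> B"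
  shows "Hdiv_norm X f \<le> 2 * B"
  using sqrt_sum_squares_le_sum[of "L2_norm_on X f" "L2_norm_on X g"] assms by (simp add: Hdiv_norm_def wdiv_norm[OF assms(1-3)])

lemma H1_vec_norm_le:
  assumes X: "convex_domain X" and f: "f \<in> L2 X" "is_weak_grad_vec X f g" and "L2_norm_on X f \<le> B" "L2_norm_on X g \<le> B"
  shows "H1_vec_norm X f \<le> 2 * B"
proof -
  have "L2_norm_on X (wgrad_vec X f) = L2_norm_on X g"
    by (rule L2_norm_cong_AE[OF L2_measurable L2_measurable wgrad_vec_AE[OF X f]])
      (rule is_weak_grad_vec_L2[OF wgrad_vec_weak[OF H1_vecI[OF f]]] is_weak_grad_vec_L2[OF f(2)])+
  then show ?thesis
    using sqrt_sum_squares_le_sum[of "L2_norm_on X f" "L2_norm_on X g"] assms by (simp add: H1_vec_norm_def)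
qed

lemma Hdiv_ten_norm_le:
  assumes X: "convex_domain X" and f: "f \<in> L2 X" "is_weak_div_ten X f g" and "L2_norm_on X f \<le> B" "L2_norm_on X g \<le> B"
  shows "Hdiv_ten_norm X f \<le> 2 * B"
proof -
  have "L2_norm_on X (wdiv_ten X f) = L2_norm_on X g"
    by (rule L2_norm_cong_AE[OF L2_measurable L2_measurable wdiv_ten_AE[OF X f]])
      (rule is_weak_div_ten_L2[OF wdiv_ten_weak[OF Hdiv_tenI[OF f]]] is_weak_div_ten_L2[OF f(2)])+
  then show ?thesis
    using sqrt_sum_squares_le_sum[of "L2_norm_on X f" "L2_norm_on X g"] assms by (simp add: Hdiv_ten_norm_def)
qed

text \<open>The difference in the first component compensates the shift of the rotation field by
  \<open>g4\<close>, which also occurs in the shear equation.\<close>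

definition jet_load :: "testjet \<Rightarrow> plate_data" where
  "jet_load = (\<lambda>(g1, g2, g3, g4, g5, g6, g7, g8, g9). (g1 - g4, g3, g5, g6, g7, g8, g9))"

lemma linear_jet_load: "linear jet_load"
  by (rule linearI) (auto simp: jet_load_def algebra_simps split: prod.splits)

context mesh begin

lemma H10_vec_L2: "\<psi> \<in> H10_vec \<Omega> \<Longrightarrow> \<psi> \<in> L2 \<Omega>"
  by (rule L2_vecI) (auto simp: H10_vec_def intro: H1_L2 H10_H1)

lemma trial_lift:
  assumes "u \<in> trial_space \<Omega> T"
  obtains l where "L2_fields u" "is_lift u l" "lw l \<in> H10 \<Omega>" "lpsi l \<in> H10_vec \<Omega>"
proof -
  have f: "L2_fields u" using assms by (simp add: trial_space_def L2_fields_def)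
  obtain w where w: "w \<in> H10 \<Omega>" "is_skel_trace T w (uwh u)" using assms by (auto simp: trial_space_def H_half0_skel_def)
  obtain \<psi> where \<psi>: "\<psi> \<in> H10_vec \<Omega>" "is_skel_trace_vec T \<psi> (upsih u)" using assms by (auto simp: trial_space_def H_half0_skel_vec_def)
  obtain V where V: "V \<in> Hdiv \<Omega>" "uVnh u = skel_normal_trace T V" using assms by (auto simp: trial_space_def H_mhalf_skel_def)
  obtain M where M: "M \<in> Hdiv_ten \<Omega>" "uMnh u = skel_normal_trace_ten T M" using assms by (auto simp: trial_space_def H_mhalf_skel_ten_def)
  have \<psi>1: "\<psi> \<in> H1_vec \<Omega>" using \<psi>(1) H10_H1 by (auto simp: H10_vec_def H1_vec_def)
  have ML2: "M \<in> L2 \<Omega>" using M(1) by - (rule L2_vecI, auto simp: Hdiv_ten_def intro: Hdiv_L2)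
  let ?l = "\<lparr>lw = w, lgw = wgrad \<Omega> w, lpsi = \<psi>, lgpsi = wgrad_vec \<Omega> \<psi>, lV = V, ldV = wdiv \<Omega> V, lM = M, ldM = wdiv_ten \<Omega> M\<rparr>"
  have "is_lift u ?l"
    unfolding is_lift_def
    using H1_L2[OF H10_H1[OF w(1)]] wgrad[OF H10_H1[OF w(1)]] w(2) H10_vec_L2[OF \<psi>(1)] wgrad_vec_weak[OF \<psi>1] \<psi>(2)
      Hdiv_L2[OF V(1)] wdiv[OF V(1)] V(2) ML2 wdiv_ten_weak[OF M(1)] M(2)
    by (simp add: is_skel_trace_def is_skel_trace_vec_def)
  then show ?thesis using f w(1) \<psi>(1) by (intro that[of ?l]) simp_all
qed

text \<open>Each trace norm is an infimum over extensions and so is at most the graph norm of the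
  given one. The 6 is the product of 2, for a graph norm with two parts, and 3, the root of the
  number of components.\<close>

lemma trial_of_lift:
  assumes f: "L2_fields u" and l: "is_lift u l" and w: "lw l \<in> H10 \<Omega>" and \<psi>: "lpsi l \<in> H10_vec \<Omega>"
  shows "u \<in> trial_space \<Omega> T"
    and "L2_norm_on \<Omega> (uV u) \<le> B \<Longrightarrow> L2_norm_on \<Omega> (uM u) \<le> B \<Longrightarrow> L2_norm_on \<Omega> (uw u) \<le> B \<Longrightarrow>
      L2_norm_on \<Omega> (upsi u) \<le> B \<Longrightarrow> L2_norm_on \<Omega> (ur u) \<le> B \<Longrightarrow>
      L2_norm_on \<Omega> (lw l) \<le> B \<Longrightarrow> L2_norm_on \<Omega> (lgw l) \<le> B \<Longrightarrow> L2_norm_on \<Omega> (lpsi l) \<le> B \<Longrightarrow> L2_norm_on \<Omega> (lgpsi l) \<le> B \<Longrightarrow>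
      L2_norm_on \<Omega> (lV l) \<le> B \<Longrightarrow> L2_norm_on \<Omega> (ldV l) \<le> B \<Longrightarrow> L2_norm_on \<Omega> (lM l) \<le> B \<Longrightarrow> L2_norm_on \<Omega> (ldM l) \<le> B \<Longrightarrow>
      trial_norm \<Omega> T u \<le> 6 * B"
proof -
  note ll = l[unfolded is_lift_def]
  have tw: "is_skel_trace T (lw l) (uwh u)" and t\<psi>: "is_skel_trace_vec T (lpsi l) (upsih u)"
    using ll by (auto simp: is_skel_trace_def is_skel_trace_vec_def)
  have V: "lV l \<in> Hdiv \<Omega>" and M: "lM l \<in> Hdiv_ten \<Omega>" using ll HdivI Hdiv_tenI by blast+
  show "u \<in> trial_space \<Omega> T"
    using f ll w \<psi> tw t\<psi> V M
    by (auto simp: trial_space_def L2_fields_def H_half0_skel_def H_half0_skel_vec_def H_mhalf_skel_def H_mhalf_skel_ten_def)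
  have "\<bar>half_norm \<Omega> T (uwh u)\<bar> \<le> H1_norm \<Omega> (lw l)"
    unfolding half_norm_def by (rule abs_Inf_le) (use w tw in \<open>auto simp: H1_norm_def\<close>)
  moreover have "\<bar>half_norm_vec \<Omega> T (upsih u)\<bar> \<le> H1_vec_norm \<Omega> (lpsi l)"
    unfolding half_norm_vec_def by (rule abs_Inf_le) (use \<psi> t\<psi> in \<open>auto simp: H1_vec_norm_def\<close>)
  moreover have "\<bar>mhalf_norm \<Omega> T (uVnh u)\<bar> \<le> Hdiv_norm \<Omega> (lV l)"
    unfolding mhalf_norm_def by (rule abs_Inf_le) (use V ll in \<open>auto simp: Hdiv_norm_def\<close>)
  moreover have "\<bar>mhalf_norm_ten \<Omega> T (uMnh u)\<bar> \<le> Hdiv_ten_norm \<Omega> (lM l)"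
    unfolding mhalf_norm_ten_def by (rule abs_Inf_le) (use M ll in \<open>auto simp: Hdiv_ten_norm_def\<close>)
  moreover assume B: "L2_norm_on \<Omega> (uV u) \<le> B" "L2_norm_on \<Omega> (uM u) \<le> B" "L2_norm_on \<Omega> (uw u) \<le> B"
      "L2_norm_on \<Omega> (upsi u) \<le> B" "L2_norm_on \<Omega> (ur u) \<le> B"
      "L2_norm_on \<Omega> (lw l) \<le> B" "L2_norm_on \<Omega> (lgw l) \<le> B" "L2_norm_on \<Omega> (lpsi l) \<le> B" "L2_norm_on \<Omega> (lgpsi l) \<le> B"
      "L2_norm_on \<Omega> (lV l) \<le> B" "L2_norm_on \<Omega> (ldV l) \<le> B" "L2_norm_on \<Omega> (lM l) \<le> B" "L2_norm_on \<Omega> (ldM l) \<le> B"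
  moreover have "H1_norm \<Omega> (lw l) \<le> 2 * B" "H1_vec_norm \<Omega> (lpsi l) \<le> 2 * B"
    "Hdiv_norm \<Omega> (lV l) \<le> 2 * B" "Hdiv_ten_norm \<Omega> (lM l) \<le> 2 * B"
    using ll B by (auto intro!: H1_norm_le[OF dom] H1_vec_norm_le[OF dom] Hdiv_norm_le[OF dom] Hdiv_ten_norm_le[OF dom])
  ultimately have "\<bar>half_norm \<Omega> T (uwh u)\<bar> \<le> 2 * B" "\<bar>half_norm_vec \<Omega> T (upsih u)\<bar> \<le> 2 * B"
     "\<bar>mhalf_norm \<Omega> T (uVnh u)\<bar> \<le> 2 * B" "\<bar>mhalf_norm_ten \<Omega> T (uMnh u)\<bar> \<le> 2 * B" by linarith+
  moreover have "0 \<le> B" using B(1) L2_norm_nonneg[of \<Omega> "uV u"] by linarith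
  ultimately have "trial_norm \<Omega> T u \<le> 3 * (2 * B)"
    unfolding trial_norm_def using B(1-5) by (intro sqrt_sum_nine_le) auto
  then show "trial_norm \<Omega> T u \<le> 6 * B" by simp
qed

lemma H10_vec_skeleton_trace:
  assumes "\<psi> \<in> H10_vec \<Omega>" obtains g where "is_skel_trace_vec T \<psi> g"
proof -
  have "\<exists>g. \<forall>K\<in>T. has_trace K (\<lambda>x. \<psi> x $ i) g" for i
  proof -
    have "(\<lambda>x. \<psi> x $ i) \<in> H10 \<Omega>" using assms by (simp add: H10_vec_def)
    then show ?thesis by (rule H10_skeleton_trace) blast
  qed
  then obtain G where "\<And>i K. K \<in> T \<Longrightarrow> has_trace K (\<lambda>x. \<psi> x $ i) (G i)" by metis
  then have "is_skel_trace_vec T \<psi> (\<lambda>x. \<chi> i. G i x)"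
    by (simp add: is_skel_trace_vec_def is_skel_trace_def)
  then show ?thesis by (rule that)
qed

theorem existence:
  assumes \<kappa>: "\<kappa> > 0" and t: "t > 0" and \<nu>: "-1 < \<nu>" "\<nu> < 1"
  obtains A where "A > 0" "\<And>L. L \<in> test_dual \<Omega> T \<Longrightarrow>
    \<exists>u\<in>trial_space \<Omega> T. (\<forall>v\<in>test_space \<Omega> T. RM_form \<kappa> t \<nu> T u v = L v) \<and> trial_norm \<Omega> T u \<le> A * dual_norm \<Omega> T L"
proof -
  obtain C where C: "C \<ge> 0" "\<And>f1 f3 f5 f6 f7 f8 f9. (\<lambda>x. (f1 x, f3 x, f5 x, f6 x, f7 x, f8 x, f9 x) :: plate_data) \<in> L2 \<Omega> \<Longrightarrow>
    \<exists>w gw \<psi> g\<psi> V M r.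
      w \<in> H10 \<Omega> \<and> is_weak_grad \<Omega> w gw \<and> \<psi> \<in> H10_vec \<Omega> \<and> is_weak_grad_vec \<Omega> \<psi> g\<psi> \<and>
      (\<lambda>x. ((w x, gw x, \<psi> x, g\<psi> x), (V x, M x, r x))) \<in> L2 \<Omega> \<and>
      (\<forall>x. (inverse \<kappa> * t\<^sup>2) *\<^sub>R V x + \<psi> x - gw x = f1 x) \<and>
      (\<forall>x. Cinv \<nu> (M x) + r x *\<^sub>R Jmat - g\<psi> x = f3 x) \<and>
      is_weak_div \<Omega> (\<lambda>x. V x - f6 x) (\<lambda>x. - f5 x) \<and>
      is_weak_div_ten \<Omega> (\<lambda>x. M x - f8 x) (\<lambda>x. - V x - f7 x) \<and>
      (\<forall>x. M x \<bullet> Jmat = f9 x) \<and>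
      L2_norm_on \<Omega> (\<lambda>x. ((w x, gw x, \<psi> x, g\<psi> x), (V x, M x, r x)))
        \<le> C * L2_norm_on \<Omega> (\<lambda>x. (f1 x, f3 x, f5 x, f6 x, f7 x, f8 x, f9 x))"
    by (rule plate_system[OF dom \<kappa> t \<nu>]) blast
  obtain c where c: "c \<ge> 0" "\<And>f X :: point set. f \<in> L2 X \<Longrightarrow> (\<lambda>x. jet_load (f x)) \<in> L2 X \<and> L2_norm_on X (\<lambda>x. jet_load (f x)) \<le> c * L2_norm_on X f"
    using L2_norm_linear_bound[OF linear_jet_load] by blast
  show ?thesis
  proof (rule that[of "6 * (C * c + 1)"])
    show "0 < 6 * (C * c + 1)" using C(1) c(1) by (simp add: add_nonneg_pos)
    fix L assume L: "L \<in> test_dual \<Omega> T"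
    obtain f where f: "f \<in> L2 \<Omega>" "\<And>v. v \<in> test_space \<Omega> T \<Longrightarrow> L v = ip \<Omega> f (test_jet v)" "L2_norm_on \<Omega> f \<le> dual_norm \<Omega> T L"
      by (rule dual_representation[OF L]) blast
    define g1 where "g1 x = fst (f x)" for x
    define g2 where "g2 x = fst (snd (f x))" for x
    define g3 where "g3 x = fst (snd (snd (f x)))" for x
    define g4 where "g4 x = fst (snd (snd (snd (f x))))" for x
    define g5 where "g5 x = fst (snd (snd (snd (snd (f x)))))" for x
    define g6 where "g6 x = fst (snd (snd (snd (snd (snd (f x))))))" for x
    define g7 where "g7 x = fst (snd (snd (snd (snd (snd (snd (f x)))))))" for x
    define g8 where "g8 x = fst (snd (snd (snd (snd (snd (snd (snd (f x))))))))" for x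
    define g9 where "g9 x = snd (snd (snd (snd (snd (snd (snd (snd (f x))))))))" for x
    note g_defs = g1_def g2_def g3_def g4_def g5_def g6_def g7_def g8_def g9_def
    have fg: "f x = (g1 x, g2 x, g3 x, g4 x, g5 x, g6 x, g7 x, g8 x, g9 x)" for x by (simp add: g_defs)
    have gL: "g1 \<in> L2 \<Omega>" "g2 \<in> L2 \<Omega>" "g3 \<in> L2 \<Omega>" "g4 \<in> L2 \<Omega>" "g5 \<in> L2 \<Omega>" "g6 \<in> L2 \<Omega>" "g7 \<in> L2 \<Omega>" "g8 \<in> L2 \<Omega>" "g9 \<in> L2 \<Omega>"
      unfolding g_defs[abs_def] by (intro L2_fst L2_snd f)+
    have ng: "norm (g2 x) \<le> norm (f x)" "norm (g4 x) \<le> norm (f x)" "norm (g5 x) \<le> norm (f x)"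
      "norm (g6 x) \<le> norm (f x)" "norm (g7 x) \<le> norm (f x)" "norm (g8 x) \<le> norm (f x)" for x
      unfolding g_defs by (intro norm_proj_trans)+
    have gb: "L2_norm_on \<Omega> g2 \<le> dual_norm \<Omega> T L" "L2_norm_on \<Omega> g4 \<le> dual_norm \<Omega> T L" "L2_norm_on \<Omega> g5 \<le> dual_norm \<Omega> T L"
      "L2_norm_on \<Omega> g6 \<le> dual_norm \<Omega> T L" "L2_norm_on \<Omega> g7 \<le> dual_norm \<Omega> T L" "L2_norm_on \<Omega> g8 \<le> dual_norm \<Omega> T L"
      using L2_norm_le_pointwise[OF gL(2) f(1) ng(1)] L2_norm_le_pointwise[OF gL(4) f(1) ng(2)] L2_norm_le_pointwise[OF gL(5) f(1) ng(3)]
        L2_norm_le_pointwise[OF gL(6) f(1) ng(4)] L2_norm_le_pointwise[OF gL(7) f(1) ng(5)] L2_norm_le_pointwise[OF gL(8) f(1) ng(6)] f(3)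
      by linarith+
    let ?F = "\<lambda>x. (g1 x - g4 x, g3 x, g5 x, g6 x, g7 x, g8 x, g9 x) :: plate_data"
    have Fj: "jet_load (f x) = ?F x" for x by (simp add: fg jet_load_def)
    have F: "?F \<in> L2 \<Omega>" "L2_norm_on \<Omega> ?F \<le> c * L2_norm_on \<Omega> f" using c(2)[OF f(1)] unfolding Fj by auto
    obtain w gw \<psi> g\<psi> V M r where sol: "w \<in> H10 \<Omega>" "is_weak_grad \<Omega> w gw" "\<psi> \<in> H10_vec \<Omega>" "is_weak_grad_vec \<Omega> \<psi> g\<psi>"
      "(\<lambda>x. ((w x, gw x, \<psi> x, g\<psi> x), (V x, M x, r x))) \<in> L2 \<Omega>"
      "\<And>x. (inverse \<kappa> * t\<^sup>2) *\<^sub>R V x + \<psi> x - gw x = g1 x - g4 x"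
      "\<And>x. Cinv \<nu> (M x) + r x *\<^sub>R Jmat - g\<psi> x = g3 x"
      "is_weak_div \<Omega> (\<lambda>x. V x - g6 x) (\<lambda>x. - g5 x)"
      "is_weak_div_ten \<Omega> (\<lambda>x. M x - g8 x) (\<lambda>x. - V x - g7 x)"
      "\<And>x. M x \<bullet> Jmat = g9 x"
      "L2_norm_on \<Omega> (\<lambda>x. ((w x, gw x, \<psi> x, g\<psi> x), (V x, M x, r x))) \<le> C * L2_norm_on \<Omega> ?F"
      using C(2)[OF F(1)] by (elim exE conjE) blast
    define U where "U x = ((w x, gw x, \<psi> x, g\<psi> x), (V x, M x, r x))" for x
    have U: "U \<in> L2 \<Omega>" using sol(5) unfolding U_def[abs_def] .
    have UL: "w \<in> L2 \<Omega>" "gw \<in> L2 \<Omega>" "\<psi> \<in> L2 \<Omega>" "g\<psi> \<in> L2 \<Omega>" "V \<in> L2 \<Omega>" "M \<in> L2 \<Omega>" "r \<in> L2 \<Omega>"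
      using L2_fst[OF L2_fst[OF U]] L2_fst[OF L2_snd[OF L2_fst[OF U]]] L2_fst[OF L2_snd[OF L2_snd[OF L2_fst[OF U]]]]
        L2_snd[OF L2_snd[OF L2_snd[OF L2_fst[OF U]]]] L2_fst[OF L2_snd[OF U]] L2_fst[OF L2_snd[OF L2_snd[OF U]]]
        L2_snd[OF L2_snd[OF L2_snd[OF U]]]
      by (simp_all add: U_def)
    have "L2_norm_on \<Omega> U \<le> C * L2_norm_on \<Omega> ?F" using sol(11) unfolding U_def[abs_def] .
    also have "\<dots> \<le> C * (c * dual_norm \<Omega> T L)"
      using order_trans[OF F(2) mult_left_mono[OF f(3) c(1)]] C(1) by (rule mult_left_mono)
    finally have Ub: "L2_norm_on \<Omega> U \<le> C * c * dual_norm \<Omega> T L" by (simp add: mult.assoc)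
    have nU: "norm (w x) \<le> norm (U x)" "norm (gw x) \<le> norm (U x)" "norm (\<psi> x) \<le> norm (U x)" "norm (g\<psi> x) \<le> norm (U x)"
      "norm (V x) \<le> norm (U x)" "norm (M x) \<le> norm (U x)" "norm (r x) \<le> norm (U x)" for x
    proof -
      have "norm (fst (fst (U x))) \<le> norm (U x)" "norm (fst (snd (fst (U x)))) \<le> norm (U x)"
        "norm (fst (snd (snd (fst (U x))))) \<le> norm (U x)" "norm (snd (snd (snd (fst (U x))))) \<le> norm (U x)"
        "norm (fst (snd (U x))) \<le> norm (U x)" "norm (fst (snd (snd (U x)))) \<le> norm (U x)" "norm (snd (snd (snd (U x)))) \<le> norm (U x)"
        by (intro norm_proj_trans)+
      then show "norm (w x) \<le> norm (U x)" "norm (gw x) \<le> norm (U x)" "norm (\<psi> x) \<le> norm (U x)" "norm (g\<psi> x) \<le> norm (U x)"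
        "norm (V x) \<le> norm (U x)" "norm (M x) \<le> norm (U x)" "norm (r x) \<le> norm (U x)"
        by (simp_all only: U_def fst_conv snd_conv)
    qed
    define N where "N = dual_norm \<Omega> T L"
    have N: "0 \<le> N" using dual_norm_bound(1)[OF L] by (simp add: N_def)
    \<comment> \<open>One bound for all components: the plate solution contributes
      \<open>C * c * N\<close>, and each shift by a component of \<open>f\<close> at most
      \<open>N\<close>.\<close>
    define B where "B = C * c * N + N"
    have CcN: "0 \<le> C * c * N" using C(1) c(1) N by simp
    have sb: "L2_norm_on \<Omega> h \<le> C * c * N" if "h \<in> L2 \<Omega>" "\<And>x. norm (h x) \<le> norm (U x)" for h :: "point \<Rightarrow> 'z::euclidean_space"
      using L2_norm_le_pointwise[OF that(1) U that(2)] Ub by (simp add: N_def)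
    note UB = sb[OF UL(1) nU(1)] sb[OF UL(2) nU(2)] sb[OF UL(3) nU(3)] sb[OF UL(4) nU(4)] sb[OF UL(5) nU(5)] sb[OF UL(6) nU(6)] sb[OF UL(7) nU(7)]
    note gb' = gb[folded N_def]
    obtain wh where wh: "\<And>K. K \<in> T \<Longrightarrow> has_trace K w wh" by (rule H10_skeleton_trace[OF sol(1)]) blast
    obtain \<psi>h where \<psi>h: "is_skel_trace_vec T \<psi> \<psi>h" by (rule H10_vec_skeleton_trace[OF sol(3)])
    \<comment> \<open>The fields \<open>w\<close> and \<psi> are shifted by \<open>g2\<close> and
      \<open>g4\<close> while their extensions are not; conversely \<open>V\<close> and
      \<open>M\<close> are kept and their extensions are shifted by \<open>g6\<close> and
      \<open>g8\<close>. This sets the four comparison components of the residual.\<close>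
    let ?u = "\<lparr>uV = V, uM = M, uw = \<lambda>x. w x + g2 x, upsi = \<lambda>x. \<psi> x + g4 x, ur = r, uwh = wh, upsih = \<psi>h,
      uVnh = skel_normal_trace T (\<lambda>x. V x - g6 x), uMnh = skel_normal_trace_ten T (\<lambda>x. M x - g8 x)\<rparr>"
    let ?l = "\<lparr>lw = w, lgw = gw, lpsi = \<psi>, lgpsi = g\<psi>, lV = \<lambda>x. V x - g6 x, ldV = \<lambda>x. - g5 x,
      lM = \<lambda>x. M x - g8 x, ldM = \<lambda>x. - V x - g7 x\<rparr>"
    have fu: "L2_fields ?u" unfolding L2_fields_def using UL gL by (simp add: L2_add)
    have lu: "is_lift ?u ?l"
      unfolding is_lift_def using UL gL sol(2,4,8,9) wh \<psi>h by (simp add: L2_diff is_skel_trace_vec_def is_skel_trace_def)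
    have H: "lw ?l \<in> H10 \<Omega>" "lpsi ?l \<in> H10_vec \<Omega>" using sol(1,3) by simp_all
    have res: "residual (inverse \<kappa> * t\<^sup>2) \<nu> ?u ?l = f"
    proof
      fix x
      have "(inverse \<kappa> * t\<^sup>2) *\<^sub>R V x + (\<psi> x + g4 x) - gw x = ((inverse \<kappa> * t\<^sup>2) *\<^sub>R V x + \<psi> x - gw x) + g4 x" by (simp add: algebra_simps)
      also have "\<dots> = g1 x" by (simp only: sol(6)) simp
      finally show "residual (inverse \<kappa> * t\<^sup>2) \<nu> ?u ?l x = f x" unfolding residual_def fg by (simp add: sol(7,10))
    qed
    have "trial_norm \<Omega> T ?u \<le> 6 * B"
    proof (rule trial_of_lift(2)[OF fu lu H]; simp)
      show "L2_norm_on \<Omega> V \<le> B" "L2_norm_on \<Omega> M \<le> B" "L2_norm_on \<Omega> r \<le> B" "L2_norm_on \<Omega> w \<le> B" "L2_norm_on \<Omega> gw \<le> B"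
        "L2_norm_on \<Omega> \<psi> \<le> B" "L2_norm_on \<Omega> g\<psi> \<le> B" using UB N unfolding B_def by linarith+
      show "L2_norm_on \<Omega> (\<lambda>x. w x + g2 x) \<le> B" using L2_norm_triangle[OF UL(1) gL(2)] UB gb' unfolding B_def by linarith
      show "L2_norm_on \<Omega> (\<lambda>x. \<psi> x + g4 x) \<le> B" using L2_norm_triangle[OF UL(3) gL(4)] UB gb' unfolding B_def by linarith
      show "L2_norm_on \<Omega> (\<lambda>x. V x - g6 x) \<le> B" using L2_norm_triangle_diff[OF UL(5) gL(6)] UB gb' unfolding B_def by linarith
      show "L2_norm_on \<Omega> (\<lambda>x. M x - g8 x) \<le> B" using L2_norm_triangle_diff[OF UL(6) gL(8)] UB gb' unfolding B_def by linarith
      show "L2_norm_on \<Omega> (\<lambda>x. - g5 x) \<le> B" using gb' CcN unfolding B_def L2_norm_minus by linarith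
      show "L2_norm_on \<Omega> (\<lambda>x. - V x - g7 x) \<le> B"
        using L2_norm_triangle_diff[OF L2_minus[OF UL(5)] gL(7)] UB gb' unfolding B_def L2_norm_minus by linarith
    qed
    then have "trial_norm \<Omega> T ?u \<le> 6 * (C * c + 1) * dual_norm \<Omega> T L" by (simp add: B_def N_def algebra_simps)
    moreover have "\<forall>v\<in>test_space \<Omega> T. RM_form \<kappa> t \<nu> T ?u v = L v"
    proof
      fix v assume v: "v \<in> test_space \<Omega> T"
      show "RM_form \<kappa> t \<nu> T ?u v = L v" unfolding RM_form_residual[OF fu lu v] res by (rule f(2)[OF v, symmetric])
    qed
    ultimately show "\<exists>u\<in>trial_space \<Omega> T. (\<forall>v\<in>test_space \<Omega> T. RM_form \<kappa> t \<nu> T u v = L v) \<and>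
        trial_norm \<Omega> T u \<le> 6 * (C * c + 1) * dual_norm \<Omega> T L"
      using trial_of_lift(1)[OF fu lu H] by blast
  qed
qed

end

section \<open>Uniqueness\<close>

lemma H10_green:
  assumes X: "convex_domain X" and w: "w \<in> H10 X" "is_weak_grad X w gw" and q: "q \<in> L2 X" "is_weak_div X q dq"
  shows "ip X gw q + ip X w dq = 0"
proof -
  note wL = H1_L2[OF H10_H1[OF w(1)]]
  show ?thesis
    using H10_integration_by_parts[OF X w(1) HdivI[OF q]] wgrad_ip[OF X wL w(2) q(1)] wdiv_ip[OF X q wL] by simp
qed

lemma H10_vec_green:
  assumes X: "convex_domain X" and \<psi>: "\<psi> \<in> H10_vec X" "\<psi> \<in> L2 X" "is_weak_grad_vec X \<psi> g" and M: "M \<in> L2 X" "is_weak_div_ten X M d"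
  shows "ip X g M + ip X \<psi> d = 0"
proof -
  have "ip X (\<lambda>x. g x $ i) (\<lambda>x. M x $ i) + ip X (\<lambda>x. \<psi> x $ i) (\<lambda>x. d x $ i) = 0" for i
    using \<psi>(1,3) M(2) by (intro H10_green[OF X _ _ L2_nth[OF M(1)]]) (auto simp: H10_vec_def is_weak_grad_vec_def is_weak_div_ten_def)
  then have "(\<Sum>i\<in>UNIV. ip X (\<lambda>x. g x $ i) (\<lambda>x. M x $ i) + ip X (\<lambda>x. \<psi> x $ i) (\<lambda>x. d x $ i)) = 0" by simp
  then show ?thesis
    by (simp only: ip_vec[OF is_weak_grad_vec_L2[OF \<psi>(3)] M(1)] ip_vec[OF \<psi>(2) is_weak_div_ten_L2[OF M(2)]] sum.distrib)
qed

lemma L2_cong: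
  assumes "\<And>x. x \<in> X \<Longrightarrow> f x = g x" "f \<in> L2 X" shows "g \<in> L2 X"
proof -
  have "f \<in> borel_measurable (lebesgue_on X) \<longleftrightarrow> g \<in> borel_measurable (lebesgue_on X)"
    by (rule measurable_cong) (simp add: assms(1))
  moreover have "integrable (lebesgue_on X) (\<lambda>x. (norm (f x))\<^sup>2) \<longleftrightarrow> integrable (lebesgue_on X) (\<lambda>x. (norm (g x))\<^sup>2)"
    by (rule Bochner_Integration.integrable_cong[OF refl]) (simp add: assms(1))
  ultimately show ?thesis using assms(2) by (simp add: L2_def)
qed

lemma ip_cong:
  assumes "\<And>x. x \<in> X \<Longrightarrow> f x \<bullet> g x = f' x \<bullet> g' x" shows "ip X f g = ip X f' g'"
  unfolding ip_def by (rule Bochner_Integration.integral_cong[OF refl]) (simp add: assms)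

lemma is_weak_div_cong:
  assumes "is_weak_div X q d" "\<And>x. x \<in> X \<Longrightarrow> q x = q' x" "\<And>x. x \<in> X \<Longrightarrow> d x = d' x"
  shows "is_weak_div X q' d'"
  unfolding is_weak_div_iff
proof (intro conjI ballI)
  show "d' \<in> L2 X" by (rule L2_cong[OF assms(3) is_weak_div_L2[OF assms(1)]])
  fix \<phi> assume "\<phi> \<in> test_functions X"
  then have "ip X q (grad \<phi>) = - ip X \<phi> d" using assms(1) by (simp add: is_weak_div_iff)
  moreover have "ip X q (grad \<phi>) = ip X q' (grad \<phi>)" "ip X \<phi> d = ip X \<phi> d'" by (rule ip_cong; simp add: assms(2,3))+
  ultimately show "ip X q' (grad \<phi>) = - ip X \<phi> d'" by simp
qed

lemma is_weak_grad_cong: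
  assumes "is_weak_grad X f g" "\<And>x. x \<in> X \<Longrightarrow> f x = f' x" "\<And>x. x \<in> X \<Longrightarrow> g x = g' x"
  shows "is_weak_grad X f' g'"
  unfolding is_weak_grad_def
proof (intro conjI ballI)
  show "g' \<in> L2 X" by (rule L2_cong[OF assms(3) is_weak_grad_L2[OF assms(1)]])
  fix \<phi> assume "\<phi> \<in> test_functions X"
  then have "(LINT x|lebesgue_on X. f x *\<^sub>R grad \<phi> x) = - (LINT x|lebesgue_on X. \<phi> x *\<^sub>R g x)"
    using assms(1) by (simp add: is_weak_grad_def)
  moreover have "(LINT x|lebesgue_on X. f x *\<^sub>R grad \<phi> x) = (LINT x|lebesgue_on X. f' x *\<^sub>R grad \<phi> x)"
    "(LINT x|lebesgue_on X. \<phi> x *\<^sub>R g x) = (LINT x|lebesgue_on X. \<phi> x *\<^sub>R g' x)"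
    by (rule Bochner_Integration.integral_cong[OF refl]; simp add: assms(2,3))+
  ultimately show "(LINT x|lebesgue_on X. f' x *\<^sub>R grad \<phi> x) = - (LINT x|lebesgue_on X. \<phi> x *\<^sub>R g' x)" by simp
qed

context mesh begin

definition ext :: "quad \<Rightarrow> (point \<Rightarrow> 'a::euclidean_space) \<Rightarrow> point \<Rightarrow> 'a" where
  "ext K f x = indicator (cell K) x *\<^sub>R f x"

lemma ext_in: "x \<in> cell K \<Longrightarrow> ext K f x = f x"
  by (simp add: ext_def)

lemma ext_out: "K \<in> T \<Longrightarrow> K' \<in> T \<Longrightarrow> K' \<noteq> K \<Longrightarrow> x \<in> cell K' \<Longrightarrow> ext K f x = 0"
  using disjoint_T[of K K'] by (auto simp: ext_def indicator_def)

lemma ext_nth: fixes f :: "point \<Rightarrow> ('a::euclidean_space)^2" shows "ext K f x $ i = ext K (\<lambda>x. f x $ i) x"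
  by (simp add: ext_def)

lemma ext_L2: "K \<in> T \<Longrightarrow> f \<in> L2 (cell K) \<Longrightarrow> ext K f \<in> L2 \<Omega>"
  unfolding ext_def[abs_def] by (rule L2_extend)

lemma ext_weak_div:
  assumes K: "K \<in> T" and q: "is_weak_div (cell K) q d" and K': "K' \<in> T" shows "is_weak_div (cell K') (ext K q) (ext K d)"
proof (cases "K' = K")
  case True
  then show ?thesis using is_weak_div_cong[OF q] by (simp add: ext_in)
next
  case False
  then show ?thesis by (intro is_weak_div_cong[OF is_weak_div_zero]) (simp_all add: ext_out[OF K K'])
qed

lemma ext_weak_grad:
  assumes K: "K \<in> T" and q: "is_weak_grad (cell K) f g" and K': "K' \<in> T" shows "is_weak_grad (cell K') (ext K f) (ext K g)"
proof (cases "K' = K")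
  case True
  then show ?thesis using is_weak_grad_cong[OF q] by (simp add: ext_in)
next
  case False
  then show ?thesis by (intro is_weak_grad_cong[OF is_weak_grad_zero]) (simp_all add: ext_out[OF K K'])
qed

text \<open>Extension by zero is admissible since the test functions are discontinuous across elements.\<close>

lemma test_local:
  assumes f: "f \<in> L2 \<Omega>" "\<And>v. v \<in> test_space \<Omega> T \<Longrightarrow> ip \<Omega> f (test_jet v) = 0" and K0: "K0 \<in> T"
    and L: "q \<in> L2 (cell K0)" "\<tau> \<in> L2 (cell K0)" "z \<in> L2 (cell K0)" "\<phi> \<in> L2 (cell K0)" "s \<in> L2 (cell K0)"
    and d: "is_weak_div (cell K0) q dq" "is_weak_div_ten (cell K0) \<tau> d\<tau>"
      "is_weak_grad (cell K0) z gz" "is_weak_grad_vec (cell K0) \<phi> g\<phi>"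
  shows "ip (cell K0) f (\<lambda>x. (q x, dq x, \<tau> x, d\<tau> x, z x, gz x, \<phi> x, g\<phi> x, s x)) = 0"
proof -
  let ?j = "\<lambda>x. (q x, dq x, \<tau> x, d\<tau> x, z x, gz x, \<phi> x, g\<phi> x, s x)"
  let ?v = "\<lparr>vq = ext K0 q, vtau = ext K0 \<tau>, vz = ext K0 z, vphi = ext K0 \<phi>, vs = ext K0 s\<rparr>"
  have wd: "is_weak_div (cell K) (vq ?v) (ext K0 dq)" "is_weak_div_ten (cell K) (vtau ?v) (ext K0 d\<tau>)"
    "is_weak_grad (cell K) (vz ?v) (ext K0 gz)" "is_weak_grad_vec (cell K) (vphi ?v) (ext K0 g\<phi>)" if "K \<in> T" for K
    using d ext_weak_div[OF K0 _ that] ext_weak_grad[OF K0 _ that] by (simp_all add: is_weak_div_ten_def is_weak_grad_vec_def ext_nth)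
  have L\<Omega>: "vq ?v \<in> L2 \<Omega>" "vtau ?v \<in> L2 \<Omega>" "vz ?v \<in> L2 \<Omega>" "vphi ?v \<in> L2 \<Omega>" "vs ?v \<in> L2 \<Omega>"
    using L by (simp_all add: ext_L2[OF K0])
  have j: "?j \<in> L2 (cell K0)"
    using L is_weak_div_L2[OF d(1)] is_weak_div_ten_L2[OF d(2)] is_weak_grad_L2[OF d(3)] is_weak_grad_vec_L2[OF d(4)]
    by (intro L2_Pair)
  have v: "?v \<in> test_space \<Omega> T" "AE x in lebesgue_on \<Omega>. test_jet ?v x = ext K0 ?j x"
    by (rule test_jet_AE[OF L\<Omega>, where j="ext K0 ?j"], (rule wd, assumption)+, simp add: ext_def)+
  have "ip \<Omega> f (test_jet ?v) = ip \<Omega> f (ext K0 ?j)"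
    by (rule ip_cong_AE[OF L2_measurable[OF f(1)] L2_measurable[OF test_jet_L2[OF v(1)]] L2_measurable[OF f(1)]
          L2_measurable[OF ext_L2[OF K0 j]] _ v(2)]) simp
  also have "\<dots> = (\<Sum>K\<in>T. ip (cell K) f (ext K0 ?j))" by (rule ip_mesh[OF f(1) ext_L2[OF K0 j]])
  also have "\<dots> = (\<Sum>K\<in>T. if K = K0 then ip (cell K0) f ?j else 0)"
  proof (rule sum.cong[OF refl])
    fix K assume K: "K \<in> T"
    show "ip (cell K) f (ext K0 ?j) = (if K = K0 then ip (cell K0) f ?j else 0)"
    proof (cases "K = K0")
      case True
      have "ip (cell K0) f (ext K0 ?j) = ip (cell K0) f ?j" by (rule ip_cong) (simp add: ext_in)
      with True show ?thesis by simp
    next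
      case False
      then have "ip (cell K) f (ext K0 ?j) = ip (cell K) f (\<lambda>x. 0)" by (intro ip_cong) (simp add: ext_out[OF K0 K])
      then show ?thesis using False by simp
    qed
  qed
  also have "\<dots> = ip (cell K0) f ?j" using K0 finite_T by simp
  finally show ?thesis using f(2)[OF v(1)] by simp
qed

text \<open>
  Conforming test functions see only the five fields, since the boundary terms vanish; testing with the
  solution of the plate system driven by the fields shows that these are zero.
\<close>

lemma fields_zero:
  fixes V b p :: "point \<Rightarrow> point" and M gb m :: "point \<Rightarrow> tensor"
  assumes \<kappa>: "\<kappa> > 0" and t: "t > 0" and \<nu>: "-1 < \<nu>" "\<nu> < 1"
    and u: "V \<in> L2 \<Omega>" "M \<in> L2 \<Omega>" "w \<in> L2 \<Omega>" "\<psi> \<in> L2 \<Omega>" "r \<in> L2 \<Omega>"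
    and a: "a \<in> H10 \<Omega>" "is_weak_grad \<Omega> a ga" and b: "b \<in> H10_vec \<Omega>" "is_weak_grad_vec \<Omega> b gb"
    and p: "p \<in> L2 \<Omega>" "is_weak_div \<Omega> p dp" and m: "m \<in> L2 \<Omega>" "is_weak_div_ten \<Omega> m dm"
    and z: "\<And>v. v \<in> test_space \<Omega> T \<Longrightarrow> ip \<Omega> (\<lambda>x. ((inverse \<kappa> * t\<^sup>2) *\<^sub>R V x + \<psi> x - ga x, w x - a x, Cinv \<nu> (M x) + r x *\<^sub>R Jmat - gb x,
       \<psi> x - b x, - dp x, V x - p x, - V x - dm x, M x - m x, M x \<bullet> Jmat)) (test_jet v) = 0"
  shows "AE x in lebesgue_on \<Omega>. V x = 0 \<and> M x = 0 \<and> w x = 0 \<and> \<psi> x = 0 \<and> r x = 0"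
proof -
  let ?c = "inverse \<kappa> * t\<^sup>2"
  let ?\<rho> = "\<lambda>x. (?c *\<^sub>R V x + \<psi> x - ga x, w x - a x, Cinv \<nu> (M x) + r x *\<^sub>R Jmat - gb x,
       \<psi> x - b x, - dp x, V x - p x, - V x - dm x, M x - m x, M x \<bullet> Jmat)"
  note l = H1_L2[OF H10_H1[OF a(1)]] is_weak_grad_L2[OF a(2)] H10_vec_L2[OF b(1)] is_weak_grad_vec_L2[OF b(2)]
    p(1) is_weak_div_L2[OF p(2)] m(1) is_weak_div_ten_L2[OF m(2)]
  have \<rho>L: "?\<rho> \<in> L2 \<Omega>"
    by (intro L2_Pair L2_diff L2_add L2_scaleR L2_minus Cinv_L2 L2_scaleR_const L2_inner_const u l)
  \<comment> \<open>The signs and zeros are chosen so that the test function built below pairs each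
    of the five fields with itself.\<close>
  have F: "(\<lambda>x. (V x, M x, - w x, 0, - \<psi> x, 0, r x) :: plate_data) \<in> L2 \<Omega>"
    by (intro L2_Pair L2_minus L2_zero u)
  obtain C where C: "C \<ge> 0" "\<And>f1 f3 f5 f6 f7 f8 f9. (\<lambda>x. (f1 x, f3 x, f5 x, f6 x, f7 x, f8 x, f9 x) :: plate_data) \<in> L2 \<Omega> \<Longrightarrow>
    \<exists>w gw \<psi> g\<psi> V M r.
      w \<in> H10 \<Omega> \<and> is_weak_grad \<Omega> w gw \<and> \<psi> \<in> H10_vec \<Omega> \<and> is_weak_grad_vec \<Omega> \<psi> g\<psi> \<and>
      (\<lambda>x. ((w x, gw x, \<psi> x, g\<psi> x), (V x, M x, r x))) \<in> L2 \<Omega> \<and>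
      (\<forall>x. (inverse \<kappa> * t\<^sup>2) *\<^sub>R V x + \<psi> x - gw x = f1 x) \<and>
      (\<forall>x. Cinv \<nu> (M x) + r x *\<^sub>R Jmat - g\<psi> x = f3 x) \<and>
      is_weak_div \<Omega> (\<lambda>x. V x - f6 x) (\<lambda>x. - f5 x) \<and>
      is_weak_div_ten \<Omega> (\<lambda>x. M x - f8 x) (\<lambda>x. - V x - f7 x) \<and>
      (\<forall>x. M x \<bullet> Jmat = f9 x) \<and>
      L2_norm_on \<Omega> (\<lambda>x. ((w x, gw x, \<psi> x, g\<psi> x), (V x, M x, r x)))
        \<le> C * L2_norm_on \<Omega> (\<lambda>x. (f1 x, f3 x, f5 x, f6 x, f7 x, f8 x, f9 x))"
    by (rule plate_system[OF dom \<kappa> t \<nu>]) blast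
  obtain y gy \<eta> g\<eta> q \<tau> s where sol: "y \<in> H10 \<Omega>" "is_weak_grad \<Omega> y gy" "\<eta> \<in> H10_vec \<Omega>" "is_weak_grad_vec \<Omega> \<eta> g\<eta>"
      "(\<lambda>x. ((y x, gy x, \<eta> x, g\<eta> x), (q x, \<tau> x, s x))) \<in> L2 \<Omega>"
      "\<And>x. ?c *\<^sub>R q x + \<eta> x - gy x = V x"
      "\<And>x. Cinv \<nu> (\<tau> x) + s x *\<^sub>R Jmat - g\<eta> x = M x"
      "is_weak_div \<Omega> (\<lambda>x. q x - 0) (\<lambda>x. - (- w x))"
      "is_weak_div_ten \<Omega> (\<lambda>x. \<tau> x - 0) (\<lambda>x. - q x - (- \<psi> x))"
      "\<And>x. \<tau> x \<bullet> Jmat = r x"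
    using C(2)[OF F] by (elim exE conjE) blast
  have UL: "q \<in> L2 \<Omega>" "\<tau> \<in> L2 \<Omega>" "s \<in> L2 \<Omega>"
    using L2_fst[OF L2_snd[OF sol(5)]] L2_fst[OF L2_snd[OF L2_snd[OF sol(5)]]] L2_snd[OF L2_snd[OF L2_snd[OF sol(5)]]] by simp_all
  note yL = H1_L2[OF H10_H1[OF sol(1)]] and \<eta>L = H10_vec_L2[OF sol(3)]
  have d: "is_weak_div \<Omega> q w" "is_weak_div_ten \<Omega> \<tau> (\<lambda>x. \<psi> x - q x)" using sol(8,9) by simp_all
  have g: "is_weak_grad \<Omega> (\<lambda>x. - y x) (\<lambda>x. - gy x)"
    using is_weak_grad_diff[OF dom L2_zero yL is_weak_grad_zero sol(2)] by simp
  have g': "is_weak_grad_vec \<Omega> (\<lambda>x. - \<eta> x) (\<lambda>x. - g\<eta> x)"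
    using is_weak_grad_diff[OF dom L2_zero L2_nth[OF \<eta>L] is_weak_grad_zero] sol(4) by (simp add: is_weak_grad_vec_def)
  \<comment> \<open>The adjoint problem differs from the plate system in the signs of deflection and
    rotation.\<close>
  let ?v = "\<lparr>vq = q, vtau = \<tau>, vz = \<lambda>x. - y x, vphi = \<lambda>x. - \<eta> x, vs = s\<rparr>"
  have wd: "is_weak_div (cell K) (vq ?v) w" "is_weak_div_ten (cell K) (vtau ?v) (\<lambda>x. \<psi> x - q x)"
    "is_weak_grad (cell K) (vz ?v) (\<lambda>x. - gy x)" "is_weak_grad_vec (cell K) (vphi ?v) (\<lambda>x. - g\<eta> x)" if K: "K \<in> T" for K
    using d g g' weak_div_cell[OF _ K] weak_grad_cell[OF _ K] by (simp_all add: is_weak_div_ten_def is_weak_grad_vec_def)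
  have L\<Omega>: "vq ?v \<in> L2 \<Omega>" "vtau ?v \<in> L2 \<Omega>" "vz ?v \<in> L2 \<Omega>" "vphi ?v \<in> L2 \<Omega>" "vs ?v \<in> L2 \<Omega>"
    using UL L2_minus[OF yL] L2_minus[OF \<eta>L] by simp_all
  let ?j = "\<lambda>x. (q x, w x, \<tau> x, \<psi> x - q x, - y x, - gy x, - \<eta> x, - g\<eta> x, s x)"
  have v: "?v \<in> test_space \<Omega> T" "AE x in lebesgue_on \<Omega>. test_jet ?v x = ?j x"
    by (rule test_jet_AE[OF L\<Omega>, where j="?j"], (rule wd, assumption)+, simp)+
  note vL = UL(1) u(3) UL(2) L2_diff[OF u(4) UL(1)] L2_minus[OF yL] L2_minus[OF is_weak_grad_L2[OF sol(2)]]
    L2_minus[OF \<eta>L] L2_minus[OF is_weak_grad_vec_L2[OF sol(4)]] UL(3)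
  have jL: "?j \<in> L2 \<Omega>" by (intro L2_Pair vL)
  have "0 = ip \<Omega> ?\<rho> ?j"
    using z[OF v(1)] ip_cong_AE[OF L2_measurable[OF \<rho>L] L2_measurable[OF test_jet_L2[OF v(1)]] L2_measurable[OF \<rho>L] L2_measurable[OF jL] _ v(2)] by simp
  also have "\<dots> = ip \<Omega> V (\<lambda>x. ?c *\<^sub>R q x + - gy x - - \<eta> x) + ip \<Omega> M (\<lambda>x. Cinv \<nu> (\<tau> x) + - g\<eta> x + s x *\<^sub>R Jmat) + ip \<Omega> w w
      + ip \<Omega> \<psi> (\<lambda>x. q x + (\<psi> x - q x)) + ip \<Omega> (\<lambda>x. r x *\<^sub>R Jmat) \<tau>
      - (ip \<Omega> ga q + ip \<Omega> a w) - (ip \<Omega> gb \<tau> + ip \<Omega> b (\<lambda>x. \<psi> x - q x)) - (ip \<Omega> (\<lambda>x. - gy x) p + ip \<Omega> (\<lambda>x. - y x) dp)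
      - (ip \<Omega> (\<lambda>x. - g\<eta> x) m + ip \<Omega> (\<lambda>x. - \<eta> x) dm)"
    by (rule residual_identity) (fact u l vL)+
  also have "(\<lambda>x. ?c *\<^sub>R q x + - gy x - - \<eta> x) = V"
  proof
    fix x show "?c *\<^sub>R q x + - gy x - - \<eta> x = V x" using sol(6)[of x] by (simp add: algebra_simps)
  qed
  also have "(\<lambda>x. Cinv \<nu> (\<tau> x) + - g\<eta> x + s x *\<^sub>R Jmat) = M"
  proof
    fix x show "Cinv \<nu> (\<tau> x) + - g\<eta> x + s x *\<^sub>R Jmat = M x" using sol(7)[of x] by (simp add: algebra_simps)
  qed
  also have "(\<lambda>x. q x + (\<psi> x - q x)) = \<psi>" by simp
  also have "ip \<Omega> (\<lambda>x. r x *\<^sub>R Jmat) \<tau> = ip \<Omega> r r"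
    by (rule ip_cong) (simp add: sol(10)[symmetric] inner_commute)
  \<comment> \<open>In each of the four Green sums one factor has zero boundary values and the other
    is conforming on \<Omega>, so the terms of the extensions drop out.\<close>
  also have "ip \<Omega> ga q + ip \<Omega> a w = 0" by (rule H10_green[OF dom a UL(1) d(1)])
  also have "ip \<Omega> gb \<tau> + ip \<Omega> b (\<lambda>x. \<psi> x - q x) = 0" by (rule H10_vec_green[OF dom b(1) l(3) b(2) UL(2) d(2)])
  also have "ip \<Omega> (\<lambda>x. - gy x) p + ip \<Omega> (\<lambda>x. - y x) dp = 0"
    using H10_green[OF dom sol(1,2) p] by (simp add: ip_minus_left)
  also have "ip \<Omega> (\<lambda>x. - g\<eta> x) m + ip \<Omega> (\<lambda>x. - \<eta> x) dm = 0"
    using H10_vec_green[OF dom sol(3) \<eta>L sol(4) m] by (simp add: ip_minus_left)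
  finally have sum0: "(L2_norm_on \<Omega> V)\<^sup>2 + (L2_norm_on \<Omega> M)\<^sup>2 + (L2_norm_on \<Omega> w)\<^sup>2 + (L2_norm_on \<Omega> \<psi>)\<^sup>2 + (L2_norm_on \<Omega> r)\<^sup>2 = 0"
    by (simp add: L2_norm_sq)
  have "(L2_norm_on \<Omega> V)\<^sup>2 \<ge> 0" "(L2_norm_on \<Omega> M)\<^sup>2 \<ge> 0" "(L2_norm_on \<Omega> w)\<^sup>2 \<ge> 0" "(L2_norm_on \<Omega> \<psi>)\<^sup>2 \<ge> 0" "(L2_norm_on \<Omega> r)\<^sup>2 \<ge> 0"
    by (rule zero_le_power2)+
  with sum0 have "(L2_norm_on \<Omega> V)\<^sup>2 = 0" "(L2_norm_on \<Omega> M)\<^sup>2 = 0" "(L2_norm_on \<Omega> w)\<^sup>2 = 0" "(L2_norm_on \<Omega> \<psi>)\<^sup>2 = 0" "(L2_norm_on \<Omega> r)\<^sup>2 = 0"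
    by linarith+
  then have n: "L2_norm_on \<Omega> V = 0" "L2_norm_on \<Omega> M = 0" "L2_norm_on \<Omega> w = 0" "L2_norm_on \<Omega> \<psi> = 0" "L2_norm_on \<Omega> r = 0"
    by simp_all
  show ?thesis
    using L2_norm_zero_AE[OF u(1) n(1)] L2_norm_zero_AE[OF u(2) n(2)] L2_norm_zero_AE[OF u(3) n(3)] L2_norm_zero_AE[OF u(4) n(4)]
      L2_norm_zero_AE[OF u(5) n(5)]
    by eventually_elim simp
qed

end

section \<open>Uniqueness of the skeleton unknowns\<close>

lemma H10_diff:
  assumes X: "convex_domain X" and w: "w \<in> H10 X" "w' \<in> H10 X" shows "(\<lambda>x. w x - w' x) \<in> H10 X"
proof -
  obtain \<phi> where \<phi>: "\<And>n::nat. \<phi> n \<in> test_functions X" "(\<lambda>n. L2_norm_on X (\<lambda>x. \<phi> n x - w x)) \<longlonglongrightarrow> 0"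
    "(\<lambda>n. L2_norm_on X (\<lambda>x. grad (\<phi> n) x - wgrad X w x)) \<longlonglongrightarrow> 0"
    by (rule H10_obtain[OF X w(1)]) blast
  obtain \<phi>' where \<phi>': "\<And>n::nat. \<phi>' n \<in> test_functions X" "(\<lambda>n. L2_norm_on X (\<lambda>x. \<phi>' n x - w' x)) \<longlonglongrightarrow> 0"
    "(\<lambda>n. L2_norm_on X (\<lambda>x. grad (\<phi>' n) x - wgrad X w' x)) \<longlonglongrightarrow> 0"
    by (rule H10_obtain[OF X w(2)]) blast
  note L = test_L2[OF X \<phi>(1)] test_L2[OF X \<phi>'(1)]
    and Lw = H1_L2[OF H10_H1[OF w(1)]] H1_L2[OF H10_H1[OF w(2)]] wgrad_L2[OF H10_H1[OF w(1)]] wgrad_L2[OF H10_H1[OF w(2)]]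
  have lim: "(\<lambda>n. L2_norm_on X (\<lambda>x. (f n x - f' n x) - (h x - h' x))) \<longlonglongrightarrow> 0"
    if "\<And>n. f n \<in> L2 X" "\<And>n. f' n \<in> L2 X" "h \<in> L2 X" "h' \<in> L2 X"
      "(\<lambda>n. L2_norm_on X (\<lambda>x. f n x - h x)) \<longlonglongrightarrow> 0" "(\<lambda>n. L2_norm_on X (\<lambda>x. f' n x - h' x)) \<longlonglongrightarrow> 0"
    for f f' :: "nat \<Rightarrow> point \<Rightarrow> 'z::euclidean_space" and h h'
  proof (rule null_sequence_comparison)
    show "(\<lambda>n. L2_norm_on X (\<lambda>x. f n x - h x) + L2_norm_on X (\<lambda>x. f' n x - h' x)) \<longlonglongrightarrow> 0"
      using tendsto_add[OF that(5,6)] by simp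
    fix n
    have "(\<lambda>x. (f n x - f' n x) - (h x - h' x)) = (\<lambda>x. (f n x - h x) - (f' n x - h' x))" by (simp add: algebra_simps)
    then show "\<bar>L2_norm_on X (\<lambda>x. (f n x - f' n x) - (h x - h' x))\<bar> \<le> L2_norm_on X (\<lambda>x. f n x - h x) + L2_norm_on X (\<lambda>x. f' n x - h' x)"
      using L2_norm_triangle_diff[OF L2_diff[OF that(1) that(3)] L2_diff[OF that(2) that(4)]] by simp
  qed
  have g: "grad (\<lambda>x. \<phi> n x - \<phi>' n x) x = grad (\<phi> n) x - grad (\<phi>' n) x" for n x
    using test_functions_lincomb(2)[OF \<phi>(1)[of n] \<phi>'(1)[of n], where a=1 and b="-1"] by simp
  show ?thesis
  proof (rule H10_limit(1)[OF X])
    show "(\<lambda>x. \<phi> n x - \<phi>' n x) \<in> test_functions X" for n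
      using test_functions_lincomb(1)[OF \<phi>(1)[of n] \<phi>'(1)[of n], where a=1 and b="-1"] by simp
    show "(\<lambda>n. L2_norm_on X (\<lambda>x. \<phi> n x - \<phi>' n x - (w x - w' x))) \<longlonglongrightarrow> 0"
      by (rule lim[OF L(1,3) Lw(1,2) \<phi>(2) \<phi>'(2)])
    show "(\<lambda>n. L2_norm_on X (\<lambda>x. grad (\<lambda>x. \<phi> n x - \<phi>' n x) x - (wgrad X w x - wgrad X w' x))) \<longlonglongrightarrow> 0"
      unfolding g by (rule lim[OF L(2,4) Lw(3,4) \<phi>(3) \<phi>'(3)])
  qed (intro L2_diff Lw)+
qed

context mesh begin

text \<open>Hypothesis \<open>z\<close> couples the four skeleton unknowns, and taking all test
  components but one equal to zero isolates each of them. Traces are compared through smooth fields,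
  normal traces as functionals on all extensions.\<close>

lemma hats_unique:
  assumes u: "is_lift u l" and u': "is_lift u' l'"
    and z: "\<And>K q dq \<tau> d\<tau> z gz \<phi> g\<phi>. K \<in> T \<Longrightarrow> q \<in> L2 (cell K) \<Longrightarrow> is_weak_div (cell K) q dq \<Longrightarrow>
      \<tau> \<in> L2 (cell K) \<Longrightarrow> is_weak_div_ten (cell K) \<tau> d\<tau> \<Longrightarrow> z \<in> L2 (cell K) \<Longrightarrow> is_weak_grad (cell K) z gz \<Longrightarrow>
      \<phi> \<in> L2 (cell K) \<Longrightarrow> is_weak_grad_vec (cell K) \<phi> g\<phi> \<Longrightarrow>
      ip (cell K) (\<lambda>x. lgw l x - lgw l' x) q + ip (cell K) (\<lambda>x. lw l x - lw l' x) dq +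
      (ip (cell K) (\<lambda>x. lgpsi l x - lgpsi l' x) \<tau> + ip (cell K) (\<lambda>x. lpsi l x - lpsi l' x) d\<tau>) +
      (ip (cell K) gz (\<lambda>x. lV l x - lV l' x) + ip (cell K) z (\<lambda>x. ldV l x - ldV l' x)) +
      (ip (cell K) g\<phi> (\<lambda>x. lM l x - lM l' x) + ip (cell K) \<phi> (\<lambda>x. ldM l x - ldM l' x)) = 0"
  shows "K \<in> T \<Longrightarrow> e \<in> edges K \<Longrightarrow> AE s in lebesgue_on {0..1}. uwh u (edge_pt e s) = uwh u' (edge_pt e s)"
    and "K \<in> T \<Longrightarrow> e \<in> edges K \<Longrightarrow> AE s in lebesgue_on {0..1}. upsih u (edge_pt e s) $ i = upsih u' (edge_pt e s) $ i"
    and "uVnh u = uVnh u'" and "uMnh u = uMnh u'"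
proof -
  note ll = u[unfolded is_lift_def] and ll' = u'[unfolded is_lift_def]
  have 0: "is_weak_div_ten X (\<lambda>x. 0) (\<lambda>x. 0)" "is_weak_grad_vec X (\<lambda>x. 0) (\<lambda>x. 0)" for X
    by (simp_all add: is_weak_div_ten_def is_weak_grad_vec_def is_weak_div_zero is_weak_grad_zero)
  \<comment> \<open>Test objects with a single nonzero row reduce the vector-valued unknowns to the
    scalar case.\<close>
  have axis_L2: "(\<lambda>x. axis i (f x)) \<in> L2 X" if "f \<in> L2 X" for f :: "point \<Rightarrow> 'b::euclidean_space" and X and i :: 2
  proof (rule L2_vecI)
    fix j show "(\<lambda>x. axis i (f x) $ j) \<in> L2 X" using that by (cases "j = i") (auto simp: axis_def)
  qed
  have axis_div: "is_weak_div_ten X (\<lambda>x. axis i (q x)) (\<lambda>x. axis i (dq x))" if "is_weak_div X q dq" for X i q dq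
    unfolding is_weak_div_ten_def
  proof
    fix j show "is_weak_div X (\<lambda>x. axis i (q x) $ j) (\<lambda>x. axis i (dq x) $ j)"
      using that by (cases "j = i") (auto simp: axis_def is_weak_div_zero)
  qed
  have axis_grad: "is_weak_grad_vec X (\<lambda>x. axis i (f x)) (\<lambda>x. axis i (g x))" if "is_weak_grad X f g" for X i f g
    unfolding is_weak_grad_vec_def
  proof
    fix j show "is_weak_grad X (\<lambda>x. axis i (f x) $ j) (\<lambda>x. axis i (g x) $ j)"
      using that by (cases "j = i") (auto simp: axis_def is_weak_grad_zero)
  qed
  have axis_ip: "ip X f (\<lambda>x. axis i (g x)) = ip X (\<lambda>x. f x $ i) g" "ip X (\<lambda>x. axis i (g x)) f = ip X g (\<lambda>x. f x $ i)"
    for X i and f :: "point \<Rightarrow> ('b::euclidean_space)^2" and g by (simp_all add: ip_def inner_axis inner_axis')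
  have zero_on_edge: "AE s in lebesgue_on {0..1}. g (edge_pt e s) = g' (edge_pt e s)"
    if K: "K \<in> T" "e \<in> edges K" and t: "has_trace K v g" "has_trace K v' g'"
      and L: "v \<in> L2 \<Omega>" "v' \<in> L2 \<Omega>" and d: "is_weak_grad \<Omega> v gv" "is_weak_grad \<Omega> v' gv'"
      and eq: "\<And>q. smooth_vec q \<Longrightarrow> ip (cell K) (\<lambda>x. gv x - gv' x) q + ip (cell K) (\<lambda>x. v x - v' x) (sdiv q) = 0" for K e v v' g g' gv gv'
  proof -
    note X = cell_domain[OF K(1)]
    note w = is_weak_grad_diff[OF X L2_cell[OF L(1) K(1)] L2_cell[OF L(2) K(1)] weak_grad_cell[OF d(1) K(1)] weak_grad_cell[OF d(2) K(1)]]
    have "AE s in lebesgue_on {0..1}. g (edge_pt e s) - g' (edge_pt e s) = 0"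
    proof (rule trace_unique_of_green[OF convex_T[OF K(1)] has_trace_diff[OF convex_T[OF K(1)] t] _ K(2)])
      fix q assume q: "smooth_vec q"
      show "ip (cell K) (wgrad (cell K) (\<lambda>x. v x - v' x)) q + ip (cell K) (\<lambda>x. v x - v' x) (sdiv q) = 0"
        using wgrad_ip[OF X L2_diff[OF L2_cell[OF L(1) K(1)] L2_cell[OF L(2) K(1)]] w smooth_vec_L2(1)[OF X q]] eq[OF q] by simp
    qed
    then show ?thesis by eventually_elim simp
  qed
  show "AE s in lebesgue_on {0..1}. uwh u (edge_pt e s) = uwh u' (edge_pt e s)" if K: "K \<in> T" "e \<in> edges K"
  proof (rule zero_on_edge[OF K, of "lw l" "uwh u" "lw l'" "uwh u'" "lgw l" "lgw l'"])
    fix q assume q: "smooth_vec q"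
    note X = cell_domain[OF K(1)]
    show "ip (cell K) (\<lambda>x. lgw l x - lgw l' x) q + ip (cell K) (\<lambda>x. lw l x - lw l' x) (sdiv q) = 0"
      using z[OF K(1) smooth_vec_L2(1)[OF X q] smooth_weak_div[OF X q] L2_zero 0(1) L2_zero is_weak_grad_zero L2_zero 0(2)] by simp
  qed (use ll ll' K in auto)
  show "AE s in lebesgue_on {0..1}. upsih u (edge_pt e s) $ i = upsih u' (edge_pt e s) $ i" if K: "K \<in> T" "e \<in> edges K"
  proof (rule zero_on_edge[OF K, of "\<lambda>x. lpsi l x $ i" "\<lambda>x. upsih u x $ i" "\<lambda>x. lpsi l' x $ i" "\<lambda>x. upsih u' x $ i"
        "\<lambda>x. lgpsi l x $ i" "\<lambda>x. lgpsi l' x $ i"])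
    fix q assume q: "smooth_vec q"
    note X = cell_domain[OF K(1)]
    show "ip (cell K) (\<lambda>x. lgpsi l x $ i - lgpsi l' x $ i) q + ip (cell K) (\<lambda>x. lpsi l x $ i - lpsi l' x $ i) (sdiv q) = 0"
      using z[OF K(1) L2_zero is_weak_div_zero axis_L2[OF smooth_vec_L2(1)[OF X q], of i] axis_div[OF smooth_weak_div[OF X q]]
          L2_zero is_weak_grad_zero L2_zero 0(2)] by (simp add: axis_ip)
  qed (use ll ll' K in \<open>auto simp: is_weak_grad_vec_def\<close>)
  \<comment> \<open>An arbitrary argument \<open>g\<close> of the functionals is the trace of some
    \<open>v\<close>, which serves as the test function.\<close>
  have normal: "normal_trace K p g = normal_trace K p' g"
    if K: "K \<in> T" and L: "p \<in> L2 \<Omega>" "p' \<in> L2 \<Omega>" and d: "is_weak_div \<Omega> p dp" "is_weak_div \<Omega> p' dp'"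
      and eq: "\<And>z gz. z \<in> L2 (cell K) \<Longrightarrow> is_weak_grad (cell K) z gz \<Longrightarrow>
        ip (cell K) gz (\<lambda>x. p x - p' x) + ip (cell K) z (\<lambda>x. dp x - dp' x) = 0" for K p p' dp dp' g
  proof (cases "g \<in> H_half K")
    case True
    then obtain v where v: "has_trace K v g" by (auto simp: H_half_def)
    then have vH: "v \<in> H1 (cell K)" using has_trace_H1 by blast
    note X = cell_domain[OF K] and pL = L2_cell[OF L(1) K] L2_cell[OF L(2) K]
      and pd = weak_div_cell[OF d(1) K] weak_div_cell[OF d(2) K]
    have "normal_trace K p g = ip (cell K) (wgrad (cell K) v) p + ip (cell K) v dp"
      using normal_trace_green[OF convex_T[OF K] v HdivI[OF pL(1) pd(1)]] wdiv_ip[OF X pL(1) pd(1) H1_L2[OF vH]] by simp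
    moreover have "normal_trace K p' g = ip (cell K) (wgrad (cell K) v) p' + ip (cell K) v dp'"
      using normal_trace_green[OF convex_T[OF K] v HdivI[OF pL(2) pd(2)]] wdiv_ip[OF X pL(2) pd(2) H1_L2[OF vH]] by simp
    moreover have "ip (cell K) (wgrad (cell K) v) (\<lambda>x. p x - p' x) = ip (cell K) (wgrad (cell K) v) p - ip (cell K) (wgrad (cell K) v) p'"
      by (rule ip_diff_right[OF pL wgrad_L2[OF vH]])
    moreover have "ip (cell K) v (\<lambda>x. dp x - dp' x) = ip (cell K) v dp - ip (cell K) v dp'"
      by (rule ip_diff_right[OF is_weak_div_L2[OF pd(1)] is_weak_div_L2[OF pd(2)] H1_L2[OF vH]])
    ultimately show ?thesis using eq[OF H1_L2[OF vH] wgrad[OF vH]] by simp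
  next
    case False then show ?thesis by (simp add: normal_trace_def)
  qed
  have "skel_normal_trace T (lV l) K g = skel_normal_trace T (lV l') K g" for K g
  proof (cases "K \<in> T")
    case K: True
    have "normal_trace K (lV l) g = normal_trace K (lV l') g"
    proof (rule normal[OF K, of _ _ "ldV l" "ldV l'"])
      fix z gz assume zL: "z \<in> L2 (cell K)" "is_weak_grad (cell K) z gz"
      show "ip (cell K) gz (\<lambda>x. lV l x - lV l' x) + ip (cell K) z (\<lambda>x. ldV l x - ldV l' x) = 0"
        using z[OF K L2_zero is_weak_div_zero L2_zero 0(1) zL L2_zero 0(2)] by simp
    qed (use ll ll' in auto)
    then show ?thesis using K by (simp add: skel_normal_trace_def)
  qed (simp add: skel_normal_trace_def)
  then show "uVnh u = uVnh u'" using ll ll' by (metis ext)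
  have "skel_normal_trace_ten T (lM l) K g = skel_normal_trace_ten T (lM l') K g" for K g
  proof (cases "K \<in> T")
    case K: True
    have "normal_trace K (\<lambda>x. lM l x $ i) g = normal_trace K (\<lambda>x. lM l' x $ i) g" for i
    proof (rule normal[OF K, of _ _ "\<lambda>x. ldM l x $ i" "\<lambda>x. ldM l' x $ i"])
      fix z gz assume zL: "z \<in> L2 (cell K)" "is_weak_grad (cell K) z gz"
      show "ip (cell K) gz (\<lambda>x. lM l x $ i - lM l' x $ i) + ip (cell K) z (\<lambda>x. ldM l x $ i - ldM l' x $ i) = 0"
        using z[OF K L2_zero is_weak_div_zero L2_zero 0(1) L2_zero is_weak_grad_zero axis_L2[OF zL(1), of i] axis_grad[OF zL(2)]]
        by (simp add: axis_ip)
    qed (use ll ll' in \<open>auto simp: is_weak_div_ten_def\<close>)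
    then show ?thesis using K by (simp add: skel_normal_trace_ten_def normal_trace_ten_def)
  qed (simp add: skel_normal_trace_ten_def)
  then have "skel_normal_trace_ten T (lM l) = skel_normal_trace_ten T (lM l')" by (intro HOL.ext)
  then show "uMnh u = uMnh u'" using ll ll' by simp
qed

text \<open>The difference of the residuals is orthogonal to all test jets but need not vanish
  itself, since a skeleton unknown determines its extension only up to functions with vanishing
  trace. Hence fields and traces are treated separately.\<close>

theorem uniqueness:
  assumes \<kappa>: "\<kappa> > 0" and t: "t > 0" and \<nu>: "-1 < \<nu>" "\<nu> < 1"
    and u: "u \<in> trial_space \<Omega> T" and u': "u' \<in> trial_space \<Omega> T"
    and eq: "\<And>v. v \<in> test_space \<Omega> T \<Longrightarrow> RM_form \<kappa> t \<nu> T u v = RM_form \<kappa> t \<nu> T u' v"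
  shows "trial_eq \<Omega> T u u'"
proof -
  let ?c = "inverse \<kappa> * t\<^sup>2"
  obtain l where l: "L2_fields u" "is_lift u l" "lw l \<in> H10 \<Omega>" "lpsi l \<in> H10_vec \<Omega>" by (rule trial_lift[OF u])
  obtain l' where l': "L2_fields u'" "is_lift u' l'" "lw l' \<in> H10 \<Omega>" "lpsi l' \<in> H10_vec \<Omega>" by (rule trial_lift[OF u'])
  note ll = l(2)[unfolded is_lift_def] and ll' = l'(2)[unfolded is_lift_def]
  define V where "V x = uV u x - uV u' x" for x
  define M where "M x = uM u x - uM u' x" for x
  define w where "w x = uw u x - uw u' x" for x
  define \<psi> where "\<psi> x = upsi u x - upsi u' x" for x
  define r where "r x = ur u x - ur u' x" for x
  define a where "a x = lw l x - lw l' x" for x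
  define ga where "ga x = lgw l x - lgw l' x" for x
  define b where "b x = lpsi l x - lpsi l' x" for x
  define gb where "gb x = lgpsi l x - lgpsi l' x" for x
  define p where "p x = lV l x - lV l' x" for x
  define dp where "dp x = ldV l x - ldV l' x" for x
  define m where "m x = lM l x - lM l' x" for x
  define dm where "dm x = ldM l x - ldM l' x" for x
  note defs = V_def M_def w_def \<psi>_def r_def a_def ga_def b_def gb_def p_def dp_def m_def dm_def
  note uL = l(1)[unfolded L2_fields_def] and uL' = l'(1)[unfolded L2_fields_def]
  have f: "V \<in> L2 \<Omega>" "M \<in> L2 \<Omega>" "w \<in> L2 \<Omega>" "\<psi> \<in> L2 \<Omega>" "r \<in> L2 \<Omega>"
    using uL uL' unfolding defs[abs_def] by (auto intro: L2_diff)
  note lL = lift_L2[OF l(2)] and lL' = lift_L2[OF l'(2)]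
  have g: "a \<in> L2 \<Omega>" "ga \<in> L2 \<Omega>" "b \<in> L2 \<Omega>" "gb \<in> L2 \<Omega>" "p \<in> L2 \<Omega>" "dp \<in> L2 \<Omega>" "m \<in> L2 \<Omega>" "dm \<in> L2 \<Omega>"
    unfolding defs[abs_def] by (intro L2_diff lL lL')+
  have da: "is_weak_grad \<Omega> a ga"
    unfolding a_def[abs_def] ga_def[abs_def] by (rule is_weak_grad_diff[OF dom]) (use ll ll' in auto)
  have db: "is_weak_grad_vec \<Omega> b gb"
    unfolding b_def[abs_def] gb_def[abs_def] is_weak_grad_vec_def vector_minus_component
    by (intro allI is_weak_grad_diff[OF dom] L2_nth lL lL') (use ll ll' in \<open>auto simp: is_weak_grad_vec_def\<close>)
  have dp: "is_weak_div \<Omega> p dp"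
    unfolding p_def[abs_def] dp_def[abs_def] by (rule is_weak_div_diff[OF dom]) (use ll ll' in auto)
  have dm: "is_weak_div_ten \<Omega> m dm"
    unfolding m_def[abs_def] dm_def[abs_def] is_weak_div_ten_def vector_minus_component
    by (intro allI is_weak_div_diff[OF dom] L2_nth lL lL') (use ll ll' in \<open>auto simp: is_weak_div_ten_def\<close>)
  have aH: "a \<in> H10 \<Omega>" unfolding a_def[abs_def] by (rule H10_diff[OF dom l(3) l'(3)])
  have bH: "b \<in> H10_vec \<Omega>"
    using l(4) l'(4) unfolding b_def[abs_def] H10_vec_def by (auto intro: H10_diff[OF dom])
  define \<rho> where "\<rho> x = (?c *\<^sub>R V x + \<psi> x - ga x, w x - a x, Cinv \<nu> (M x) + r x *\<^sub>R Jmat - gb x,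
       \<psi> x - b x, - dp x, V x - p x, - V x - dm x, M x - m x, M x \<bullet> Jmat)" for x
  have \<rho>: "\<rho> x = residual ?c \<nu> u l x - residual ?c \<nu> u' l' x" for x
    unfolding \<rho>_def residual_def defs by (simp add: linear_diff[OF linear_tensor_maps(4)] algebra_simps)
  have \<rho>z: "ip \<Omega> \<rho> (test_jet v) = 0" if v: "v \<in> test_space \<Omega> T" for v
    using eq[OF v] unfolding \<rho>[abs_def] RM_form_residual[OF l(1,2) v] RM_form_residual[OF l'(1,2) v]
    by (simp add: ip_diff_left[OF residual_L2[OF l(1,2)] residual_L2[OF l'(1,2)] test_jet_L2[OF v]])
  have AE0: "AE x in lebesgue_on \<Omega>. V x = 0 \<and> M x = 0 \<and> w x = 0 \<and> \<psi> x = 0 \<and> r x = 0"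
    by (rule fields_zero[OF \<kappa> t \<nu> f aH da bH db g(5) dp g(7) dm]) (rule \<rho>z[unfolded \<rho>_def[abs_def]])
  \<comment> \<open>With the fields gone, only the differences of the extensions are left in the
    residual.\<close>
  let ?\<rho>0 = "\<lambda>x. (- ga x, - a x, - gb x, - b x, - dp x, - p x, - dm x, - m x, 0) :: testjet"
  have \<rho>0: "?\<rho>0 \<in> L2 \<Omega>" by (intro L2_Pair L2_minus L2_zero g)
  have \<rho>L: "\<rho> \<in> L2 \<Omega>" unfolding \<rho>[abs_def] by (rule L2_diff[OF residual_L2[OF l(1,2)] residual_L2[OF l'(1,2)]])
  have \<rho>AE: "AE x in lebesgue_on \<Omega>. \<rho> x = ?\<rho>0 x"
    using AE0 by eventually_elim (simp add: \<rho>_def linear_0[OF linear_tensor_maps(4)])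
  have \<rho>0z: "ip \<Omega> ?\<rho>0 (test_jet v) = 0" if v: "v \<in> test_space \<Omega> T" for v
    using \<rho>z[OF v] ip_cong_AE[OF L2_measurable[OF \<rho>L] L2_measurable[OF test_jet_L2[OF v]] L2_measurable[OF \<rho>0]
      L2_measurable[OF test_jet_L2[OF v]] \<rho>AE] by simp
  \<comment> \<open>On a single element the orthogonality is a sum of four Green terms, the boundary
    pairings with the differences of the skeleton unknowns.\<close>
  have local: "ip (cell K) ga q + ip (cell K) a dq + (ip (cell K) gb \<tau> + ip (cell K) b d\<tau>) +
      (ip (cell K) gz p + ip (cell K) z dp) + (ip (cell K) g\<phi> m + ip (cell K) \<phi> dm) = 0"
    if K: "K \<in> T" and q: "q \<in> L2 (cell K)" "is_weak_div (cell K) q dq" and \<tau>: "\<tau> \<in> L2 (cell K)" "is_weak_div_ten (cell K) \<tau> d\<tau>"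
      and z: "z \<in> L2 (cell K)" "is_weak_grad (cell K) z gz" and \<phi>: "\<phi> \<in> L2 (cell K)" "is_weak_grad_vec (cell K) \<phi> g\<phi>"
    for K q dq \<tau> d\<tau> z gz \<phi> g\<phi>
  proof -
    have gL: "(\<lambda>x. - ga x) \<in> L2 (cell K)" "(\<lambda>x. - a x) \<in> L2 (cell K)" "(\<lambda>x. - gb x) \<in> L2 (cell K)" "(\<lambda>x. - b x) \<in> L2 (cell K)"
      "(\<lambda>x. - dp x) \<in> L2 (cell K)" "(\<lambda>x. - p x) \<in> L2 (cell K)" "(\<lambda>x. - dm x) \<in> L2 (cell K)" "(\<lambda>x. - m x) \<in> L2 (cell K)"
      by (intro L2_minus L2_cell[OF _ K] g)+
    have "ip (cell K) ?\<rho>0 (\<lambda>x. (q x, dq x, \<tau> x, d\<tau> x, z x, gz x, \<phi> x, g\<phi> x, 0)) = 0"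
      by (rule test_local[OF \<rho>0 \<rho>0z K q(1) \<tau>(1) z(1) \<phi>(1) L2_zero q(2) \<tau>(2) z(2) \<phi>(2)])
    moreover have "ip (cell K) ?\<rho>0 (\<lambda>x. (q x, dq x, \<tau> x, d\<tau> x, z x, gz x, \<phi> x, g\<phi> x, 0)) =
      ip (cell K) (\<lambda>x. - ga x) q + ip (cell K) (\<lambda>x. - a x) dq + ip (cell K) (\<lambda>x. - gb x) \<tau> + ip (cell K) (\<lambda>x. - b x) d\<tau> +
      ip (cell K) (\<lambda>x. - dp x) z + ip (cell K) (\<lambda>x. - p x) gz + ip (cell K) (\<lambda>x. - dm x) \<phi> + ip (cell K) (\<lambda>x. - m x) g\<phi> + ip (cell K) (\<lambda>x. 0 :: real) (\<lambda>x. 0)"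
      by (rule ip_tuple) (rule gL L2_zero q(1) \<tau>(1) z(1) \<phi>(1) is_weak_div_L2[OF q(2)] is_weak_div_ten_L2[OF \<tau>(2)] is_weak_grad_L2[OF z(2)]
        is_weak_grad_vec_L2[OF \<phi>(2)])+
    ultimately show ?thesis
      by (simp add: ip_minus_left ip_commute[of "cell K" dp] ip_commute[of "cell K" p] ip_commute[of "cell K" dm] ip_commute[of "cell K" m])
  qed
  note h = hats_unique[OF l(2) l'(2)] and loc = local[unfolded defs[abs_def]]
  have "AE s in lebesgue_on {0..1}. uwh u (edge_pt e s) = uwh u' (edge_pt e s) \<and> upsih u (edge_pt e s) = upsih u' (edge_pt e s)"
    if K: "K \<in> T" "e \<in> edges K" for K e
  proof -
    have "AE s in lebesgue_on {0..1}. uwh u (edge_pt e s) = uwh u' (edge_pt e s)"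
      by (rule h(1)[OF _ K]) (rule loc, assumption+)
    moreover have "AE s in lebesgue_on {0..1}. upsih u (edge_pt e s) $ i = upsih u' (edge_pt e s) $ i" for i
      by (rule h(2)[OF _ K]) (rule loc, assumption+)
    from this[of 1] this[of 2] calculation show ?thesis by eventually_elim (simp add: vec_eq_iff forall_2)
  qed
  moreover have "AE x in lebesgue_on \<Omega>. uV u x = uV u' x \<and> uM u x = uM u' x \<and> uw u x = uw u' x \<and> upsi u x = upsi u' x \<and> ur u x = ur u' x"
    using AE0 by eventually_elim (simp add: defs)
  moreover have "uVnh u = uVnh u'" by (rule h(3)) (rule loc, assumption+)
  moreover have "uMnh u = uMnh u'" by (rule h(4)) (rule loc, assumption+)
  ultimately show ?thesis unfolding trial_eq_def by blast
qed

text \<open>The deflection is one component of the jet, so its L2 norm is at most the test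
  norm.\<close>

lemma load_functional_dual: assumes p: "p \<in> L2 \<Omega>" shows "load_functional T p \<in> test_dual \<Omega> T"
  unfolding test_dual_def mem_Collect_eq
proof (intro conjI ballI allI exI)
  fix v v' a b assume v: "v \<in> test_space \<Omega> T" and v': "v' \<in> test_space \<Omega> T"
  have "ip (cell K) p (vz (test_lincomb a v b v')) = a * ip (cell K) p (vz v) + b * ip (cell K) p (vz v')" if K: "K \<in> T" for K
    using ip_add_right[OF L2_mult[OF test_spaceD(7)[OF v K]] L2_mult[OF test_spaceD(7)[OF v' K]] L2_cell[OF p K], of a b]
      ip_scaleR_right[of "cell K" p a "vz v"] ip_scaleR_right[of "cell K" p b "vz v'"]
    by (simp add: test_lincomb_def)
  then show "load_functional T p (test_lincomb a v b v') = a * load_functional T p v + b * load_functional T p v'"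
    by (simp add: load_functional_def sum.distrib sum_distrib_left)
next
  fix v assume v: "v \<in> test_space \<Omega> T"
  then have z: "vz v \<in> L2 \<Omega>" by (simp add: test_space_def)
  have "L2_norm_on \<Omega> (vz v) \<le> L2_norm_on \<Omega> (test_jet v)"
  proof (rule power2_le_imp_le)
    have "(L2_norm_on (cell K) (vz v))\<^sup>2 \<le> (L2_norm_on (cell K) (test_jet v))\<^sup>2" if K: "K \<in> T" for K
    proof (intro power_mono L2_norm_nonneg)
      have "L2_norm_on (cell K) (vz v) \<le> L2_norm_on (cell K) (cell_jet K v)"
      proof (rule L2_norm_le_pointwise[OF test_spaceD(7)[OF v K] cell_jet_L2[OF v K]])
        fix x
        have "norm (fst (snd (snd (snd (snd (cell_jet K v x)))))) \<le> norm (cell_jet K v x)" by (intro norm_proj_trans)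
        then show "norm (vz v x) \<le> norm (cell_jet K v x)" by (simp only: cell_jet_def fst_conv snd_conv)
      qed
      also have "\<dots> = L2_norm_on (cell K) (test_jet v)"
        unfolding L2_norm_on_def by (intro arg_cong[of _ _ sqrt] Bochner_Integration.integral_cong refl) (simp add: test_jet_cell[OF K])
      finally show "L2_norm_on (cell K) (vz v) \<le> L2_norm_on (cell K) (test_jet v)" .
    qed
    then show "(L2_norm_on \<Omega> (vz v))\<^sup>2 \<le> (L2_norm_on \<Omega> (test_jet v))\<^sup>2"
      by (simp add: L2_norm_mesh[OF z] L2_norm_mesh[OF test_jet_L2[OF v]] sum_mono)
  qed simp
  then have "\<bar>ip \<Omega> p (vz v)\<bar> \<le> L2_norm_on \<Omega> p * test_norm \<Omega> T v"
    using ip_Cauchy_Schwarz[OF p z] by (simp add: test_norm_jet[OF v]) (meson L2_norm_nonneg mult_left_mono order_trans)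
  then show "\<bar>load_functional T p v\<bar> \<le> L2_norm_on \<Omega> p * test_norm \<Omega> T v"
    by (simp add: load_functional_def ip_mesh[OF p z])
qed

end

theorem theorem3p2:
  fixes \<Omega> :: "point set" and F :: "quad set set" and T :: "quad set" and t \<kappa> \<nu> :: real
  assumes "convex_polygonal_domain \<Omega>" and "diameter \<Omega> = 1"
    and "0 < t" and "t \<le> 1" and "\<kappa> > 0" and "-1 < \<nu>" and "\<nu> < 1 / 2"
    and "\<And>T'. T' \<in> F \<Longrightarrow> quad_mesh \<Omega> T'" and "nondegenerate F" and "T \<in> F"
  shows "(\<exists>\<alpha>>0. \<forall>L \<in> test_dual \<Omega> T. \<exists>u \<in> trial_space \<Omega> T.
            (\<forall>v \<in> test_space \<Omega> T. RM_form \<kappa> t \<nu> T u v = L v) \<and>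
            trial_norm \<Omega> T u \<le> inverse \<alpha> * dual_norm \<Omega> T L \<and>
            (\<forall>u' \<in> trial_space \<Omega> T.
               (\<forall>v \<in> test_space \<Omega> T. RM_form \<kappa> t \<nu> T u' v = L v) \<longrightarrow> trial_eq \<Omega> T u' u))
       \<and> (\<forall>p \<in> L2 \<Omega>. load_functional T p \<in> test_dual \<Omega> T)"
proof -
  interpret mesh \<Omega> T
    by (rule mesh.intro[OF polygonal_convex_domain[OF assms(1)] assms(8)[OF assms(10)]])
  have \<nu>: "\<nu> < 1" using assms(7) by simp
  \<comment> \<open>The constant is fixed before any functional is considered; its inverse is the
    required \<alpha>.\<close>
  obtain A where A: "A > 0" "\<And>L. L \<in> test_dual \<Omega> T \<Longrightarrow>
    \<exists>u\<in>trial_space \<Omega> T. (\<forall>v\<in>test_space \<Omega> T. RM_form \<kappa> t \<nu> T u v = L v) \<and> trial_norm \<Omega> T u \<le> A * dual_norm \<Omega> T L"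
    by (rule existence[OF assms(5,3,6) \<nu>]) blast
  have "\<exists>u \<in> trial_space \<Omega> T. (\<forall>v \<in> test_space \<Omega> T. RM_form \<kappa> t \<nu> T u v = L v) \<and>
      trial_norm \<Omega> T u \<le> inverse (inverse A) * dual_norm \<Omega> T L \<and>
      (\<forall>u' \<in> trial_space \<Omega> T. (\<forall>v \<in> test_space \<Omega> T. RM_form \<kappa> t \<nu> T u' v = L v) \<longrightarrow> trial_eq \<Omega> T u' u)"
    if L: "L \<in> test_dual \<Omega> T" for L
  proof -
    obtain u where u: "u \<in> trial_space \<Omega> T" "\<And>v. v \<in> test_space \<Omega> T \<Longrightarrow> RM_form \<kappa> t \<nu> T u v = L v"
      "trial_norm \<Omega> T u \<le> A * dual_norm \<Omega> T L" using A(2)[OF L] by blast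
    have "trial_eq \<Omega> T u' u" if "u' \<in> trial_space \<Omega> T" "\<forall>v \<in> test_space \<Omega> T. RM_form \<kappa> t \<nu> T u' v = L v" for u'
      by (rule uniqueness[OF assms(5,3,6) \<nu> that(1) u(1)]) (simp add: that(2) u(2))
    then show ?thesis using u by (intro bexI[of _ u]) auto
  qed
  then show ?thesis using A(1) load_functional_dual by (intro conjI exI[of _ "inverse A"]) auto
qed

end
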